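(* Let $\Omega=(\alpha,\beta)$ with the Lebesgue measure, $-\infty<\alpha<\beta<\infty$, and let $\varphi$ be an Orlicz function. Then the following conditions are equivalent. (i) $W^{1,\varphi}$ is reflexive. (ii) $W^{1,\varphi}$ is superreflexive. (iii) $W^{1,\varphi}$ is $B$-convex. (iv) Both $\varphi$ and its complementary function $\varphi^*$ satisfy condition $\Delta_2^\infty$.
   Context: An Orlicz function is a convex function $\varphi:[0,\infty)\to[0,\infty)$, not identically $0$, with $\varphi(0)=\lim_{t\to0+}\varphi(t)=0$. Its complementary function is $\varphi^*(t)=\sup_{s\ge0}\{st-\varphi(s)\}\in[0,\infty]$. Condition $\Delta_2^\infty$ is defined for finite-valued functions: $\psi:[0,\infty)\to[0,\infty)$ satisfies $\Delta_2^\infty$ if there exist $k>0$ and $u_0\ge0$ such that $\psi(2u)\le k\psi(u)$ for all $u\ge u_0$; in particular, if $\varphi^*$ takes the value $\infty$, then $\varphi^*$ does not satisfy $\Delta_2^\infty$. The Orlicz space $L^\varphi=L^\varphi(\Omega)$ consists of all (classes of) measurable functions $f:\Omega\to\mathbb C$ with $I_\varphi(\lambda f)=\int_\Omega\varphi(\lambda|f(x)|)\,dx<\infty$ for some $\lambda>0$, with the Luxemburg norm $\|f\|_\varphi=\inf\{\lambda>0: I_\varphi(f/\lambda)\le1\}$. The space $W^{1,\varphi}=W^{1,\varphi}(\Omega)$ consists of all $f\in L^1_{loc}(\Omega)$ whose weak derivative $f'\in L^1_{loc}(\Omega)$ exists and $\|f\|_{1,\varphi}=\|f\|_\varphi+\|f'\|_\varphi<\infty$;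 it is equipped with the norm $\|\cdot\|_{1,\varphi}$. A Banach space $X$ is $B$-convex if there exist $\delta>0$ and an integer $n\ge2$ such that for any $x_1,\dots,x_n\in X$ one can choose signs $\epsilon_k=\pm1$ with $\left\|\frac1n\sum_{k=1}^n\epsilon_kx_k\right\|\le(1-\delta)\max_{1\le k\le n}\|x_k\|$. A Banach space $X$ is superreflexive if every Banach space $Y$ which is finitely representable in $X$ is reflexive. *)

theory Defs
  imports "HOL-Analysis.Analysis" "HOL-Algebra.Module"
begin

section \<open>Complex normed spaces with explicit carriers\<close>

text \<open>
  The space in question depends on the values of \<open>\<phi>\<close>, \<open>\<alpha>\<close>, \<open>\<beta>\<close>, so it cannot be a type and the
  type classes for normed spaces do not apply. A complex normed space is a HOL-Algebra module
  over the field of complex numbers, with a norm. The fields \<open>mult\<close> and \<open>one\<close>, which every module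
  record inherits from the ring record, carry no meaning.
\<close>

definition complex_ring :: "complex ring" where
  "complex_ring = \<lparr>carrier = UNIV, monoid.mult = (*), one = 1, zero = 0, add = (+)\<rparr>"

record 'a cnormed = "(complex, 'a) module" +
  nrm :: "'a \<Rightarrow> real"

locale complex_normed_space = Module.module complex_ring X
  for X :: "'a cnormed" (structure) +
  assumes nrm_eq_0_iff: "x \<in> carrier X \<Longrightarrow> nrm X x = 0 \<longleftrightarrow> x = \<zero>"
    and nrm_smult: "x \<in> carrier X \<Longrightarrow> nrm X (c \<odot> x) = cmod c * nrm X x"
    and nrm_triangle: "x \<in> carrier X \<Longrightarrow> y \<in> carrier X \<Longrightarrow> nrm X (x \<oplus> y) \<le> nrm X x + nrm X y"

text \<open>The locale \<^locale>\<open>Metric_space\<close> asks for a nonnegative symmetric distance also outside the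
  carrier, hence the guard.\<close>

definition nrm_dist :: "'a cnormed \<Rightarrow> 'a \<Rightarrow> 'a \<Rightarrow> real" where
  "nrm_dist X x y =
     (if x \<in> carrier X \<and> y \<in> carrier X then nrm X (x \<ominus>\<^bsub>X\<^esub> y) else 0)"

locale complex_banach_space = complex_normed_space +
  assumes complete: "Metric_space.mcomplete (carrier X) (nrm_dist X)"

definition linear_map_on :: "'a set \<Rightarrow> 'a cnormed \<Rightarrow> 'b cnormed \<Rightarrow> ('a \<Rightarrow> 'b) \<Rightarrow> bool" where
  "linear_map_on E X Y T \<longleftrightarrow>
     T \<in> E \<rightarrow> carrier Y \<and>
     (\<forall>x\<in>E. \<forall>y\<in>E. T (x \<oplus>\<^bsub>X\<^esub> y) = T x \<oplus>\<^bsub>Y\<^esub> T y) \<and>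
     (\<forall>c. \<forall>x\<in>E. T (c \<odot>\<^bsub>X\<^esub> x) = c \<odot>\<^bsub>Y\<^esub> T x)"


section \<open>Dual space and reflexivity\<close>

text \<open>Functionals are made \<^const>\<open>extensional\<close> so that equality of functionals is equality on the
  carrier.\<close>

definition bounded_functionals :: "'a cnormed \<Rightarrow> ('a \<Rightarrow> complex) set" where
  "bounded_functionals X =
     {f \<in> extensional (carrier X).
        (\<forall>x\<in>carrier X. \<forall>y\<in>carrier X. f (x \<oplus>\<^bsub>X\<^esub> y) = f x + f y) \<and>
        (\<forall>c. \<forall>x\<in>carrier X. f (c \<odot>\<^bsub>X\<^esub> x) = c * f x) \<and>
        (\<exists>C. \<forall>x\<in>carrier X. cmod (f x) \<le> C * nrm X x)}"

definition dual :: "'a cnormed \<Rightarrow> ('a \<Rightarrow> complex) cnormed" where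
  "dual X =
     \<lparr>carrier = bounded_functionals X,
      monoid.mult = undefined,
      one = undefined,
      zero = (\<lambda>x\<in>carrier X. 0),
      add = (\<lambda>f g. \<lambda>x\<in>carrier X. f x + g x),
      smult = (\<lambda>c f. \<lambda>x\<in>carrier X. c * f x),
      nrm = (\<lambda>f. Sup {cmod (f x) |x. x \<in> carrier X \<and> nrm X x \<le> 1})\<rparr>"

definition canonical_embedding :: "'a cnormed \<Rightarrow> 'a \<Rightarrow> ('a \<Rightarrow> complex) \<Rightarrow> complex" where
  "canonical_embedding X x = (\<lambda>f\<in>carrier (dual X). f x)"

definition reflexive :: "'a cnormed \<Rightarrow> bool" where
  "reflexive X \<longleftrightarrow> canonical_embedding X ` carrier X = carrier (dual (dual X))"


section \<open>Superreflexivity and B-convexity\<close>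

definition finite_dim_subspace :: "'a cnormed \<Rightarrow> 'a set \<Rightarrow> bool" where
  "finite_dim_subspace X E \<longleftrightarrow>
     (\<exists>S. finite S \<and> S \<subseteq> carrier X \<and> E = {(\<Oplus>\<^bsub>X\<^esub>s\<in>S. a s \<odot>\<^bsub>X\<^esub> s) |a. True})"

definition finitely_representable_in :: "'b cnormed \<Rightarrow> 'a cnormed \<Rightarrow> bool" where
  "finitely_representable_in Y X \<longleftrightarrow>
     (\<forall>E \<epsilon>. finite_dim_subspace Y E \<and> \<epsilon> > 0 \<longrightarrow>
        (\<exists>T. linear_map_on E Y X T \<and>
             (\<forall>y\<in>E. nrm Y y / (1 + \<epsilon>) \<le> nrm X (T y) \<and> nrm X (T y) \<le> (1 + \<epsilon>) * nrm Y y)))"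

text \<open>
  HOL cannot quantify over types inside a formula, so the space \<open>Y\<close> ranges over the Banach spaces
  whose carrier lies in the type given by the first argument. This is all of superreflexivity only
  if that type is large enough: over a finite type, for instance, the condition is void.
  Cardinality of the continuum suffices, since a non-reflexive Banach space has a separable
  non-reflexive closed subspace.
\<close>

definition superreflexive :: "'b itself \<Rightarrow> 'a cnormed \<Rightarrow> bool" where
  "superreflexive _ X \<longleftrightarrow>
     (\<forall>Y :: 'b cnormed.
        complex_banach_space Y \<and> finitely_representable_in Y X \<longrightarrow> reflexive Y)"

definition B_convex :: "'a cnormed \<Rightarrow> bool" where
  "B_convex X \<longleftrightarrow>
     (\<exists>\<delta>>0. \<exists>n\<ge>2. \<forall>x :: nat \<Rightarrow> 'a. x \<in> {1..n} \<rightarrow> carrier X \<longrightarrow>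
        (\<exists>\<epsilon> :: nat \<Rightarrow> complex. \<epsilon> \<in> {1..n} \<rightarrow> {1, -1} \<and>
           nrm X ((1 / of_nat n) \<odot>\<^bsub>X\<^esub> (\<Oplus>\<^bsub>X\<^esub>k\<in>{1..n}. \<epsilon> k \<odot>\<^bsub>X\<^esub> x k))
             \<le> (1 - \<delta>) * (MAX k\<in>{1..n}. nrm X (x k))))"


section \<open>Orlicz functions\<close>

text \<open>Functions on \<open>[0,\<infinity>)\<close> are total functions on \<^typ>\<open>real\<close> whose values at negative arguments
  are never used.\<close>

definition orlicz_function :: "(real \<Rightarrow> real) \<Rightarrow> bool" where
  "orlicz_function \<phi> \<longleftrightarrow>
     convex_on {0..} \<phi> \<and> (\<forall>t\<ge>0. \<phi> t \<ge> 0) \<and> (\<exists>t\<ge>0. \<phi> t \<noteq> 0) \<and>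
     \<phi> 0 = 0 \<and> (\<phi> \<longlongrightarrow> 0) (at_right 0)"

definition complementary :: "(real \<Rightarrow> real) \<Rightarrow> real \<Rightarrow> ereal" where
  "complementary \<phi> t = (SUP s\<in>{0..}. ereal (s * t - \<phi> s))"

definition Delta2_infty :: "(real \<Rightarrow> ereal) \<Rightarrow> bool" where
  "Delta2_infty \<psi> \<longleftrightarrow>
     (\<forall>u\<ge>0. \<bar>\<psi> u\<bar> \<noteq> \<infinity>) \<and>
     (\<exists>k>0. \<exists>u0\<ge>0. \<forall>u\<ge>u0. \<psi> (2 * u) \<le> ereal k * \<psi> u)"

definition modular :: "real set \<Rightarrow> (real \<Rightarrow> real) \<Rightarrow> (real \<Rightarrow> complex) \<Rightarrow> ennreal" where
  "modular \<Omega> \<phi> f = (\<integral>\<^sup>+x. ennreal (\<phi> (cmod (f x))) \<partial>lebesgue_on \<Omega>)"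

definition orlicz_functions :: "real set \<Rightarrow> (real \<Rightarrow> real) \<Rightarrow> (real \<Rightarrow> complex) set" where
  "orlicz_functions \<Omega> \<phi> =
     {f \<in> borel_measurable (lebesgue_on \<Omega>). \<exists>l>0. modular \<Omega> \<phi> (\<lambda>x. of_real l * f x) < \<infinity>}"

definition luxemburg_norm :: "real set \<Rightarrow> (real \<Rightarrow> real) \<Rightarrow> (real \<Rightarrow> complex) \<Rightarrow> real" where
  "luxemburg_norm \<Omega> \<phi> f = Inf {l. l > 0 \<and> modular \<Omega> \<phi> (\<lambda>x. f x / of_real l) \<le> 1}"


section \<open>Weak derivatives\<close>

definition locally_integrable :: "real set \<Rightarrow> (real \<Rightarrow> complex) \<Rightarrow> bool" where
  "locally_integrable \<Omega> f \<longleftrightarrow>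
     (\<forall>K. compact K \<and> K \<subseteq> \<Omega> \<longrightarrow> set_integrable lebesgue K f)"

definition test_functions :: "real set \<Rightarrow> (real \<Rightarrow> real) set" where
  "test_functions \<Omega> =
     {\<eta>. (\<forall>n. (deriv ^^ n) \<eta> differentiable_on UNIV) \<and>
         compact (closure {x. \<eta> x \<noteq> 0}) \<and> closure {x. \<eta> x \<noteq> 0} \<subseteq> \<Omega>}"

definition weak_derivative :: "real set \<Rightarrow> (real \<Rightarrow> complex) \<Rightarrow> (real \<Rightarrow> complex) \<Rightarrow> bool" where
  "weak_derivative \<Omega> f g \<longleftrightarrow>
     locally_integrable \<Omega> f \<and> locally_integrable \<Omega> g \<and>
     (\<forall>\<eta>\<in>test_functions \<Omega>.
        (LINT x|lebesgue_on \<Omega>. deriv \<eta> x *\<^sub>R f x) = - (LINT x|lebesgue_on \<Omega>. \<eta> x *\<^sub>R g x))"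


section \<open>The Orlicz-Sobolev space\<close>

text \<open>Elements are classes of measurable functions modulo equality almost everywhere on \<open>\<Omega>\<close>;
  the values of the representatives outside \<open>\<Omega>\<close> are arbitrary.\<close>

definition ae_class :: "real set \<Rightarrow> (real \<Rightarrow> complex) \<Rightarrow> (real \<Rightarrow> complex) set" where
  "ae_class \<Omega> f = {g \<in> borel_measurable (lebesgue_on \<Omega>). AE x in lebesgue_on \<Omega>. g x = f x}"

definition sobolev_functions :: "real set \<Rightarrow> (real \<Rightarrow> real) \<Rightarrow> (real \<Rightarrow> complex) set" where
  "sobolev_functions \<Omega> \<phi> =
     {f \<in> orlicz_functions \<Omega> \<phi>. \<exists>g\<in>orlicz_functions \<Omega> \<phi>. weak_derivative \<Omega> f g}"

text \<open>The norm is well-defined because the weak derivative is unique up to a null set.\<close>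

definition W1 :: "real set \<Rightarrow> (real \<Rightarrow> real) \<Rightarrow> (real \<Rightarrow> complex) set cnormed" where
  "W1 \<Omega> \<phi> =
     \<lparr>carrier = ae_class \<Omega> ` sobolev_functions \<Omega> \<phi>,
      monoid.mult = undefined,
      one = undefined,
      zero = ae_class \<Omega> (\<lambda>x. 0),
      add = (\<lambda>F G. \<Union>f\<in>F. \<Union>g\<in>G. ae_class \<Omega> (\<lambda>x. f x + g x)),
      smult = (\<lambda>c F. \<Union>f\<in>F. ae_class \<Omega> (\<lambda>x. c * f x)),
      nrm = (\<lambda>F. THE r. \<exists>f\<in>F. \<exists>g. weak_derivative \<Omega> f g \<and>
                     r = luxemburg_norm \<Omega> \<phi> f + luxemburg_norm \<Omega> \<phi> g)\<rparr>"

end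

theory Submission
  imports Defs "HOL-Library.Nat_Bijection" "HOL-Computational_Algebra.Polynomial"
begin

text \<open>
  The modular \<open>f \<mapsto> \<integral>\<phi>(|f|) + \<integral>\<phi>(|f'|)\<close>
  carries the geometry of the space, and both growth conditions concern large arguments only, which
  is what matters on a bounded interval. The growth conditions imply superreflexivity and
  \<open>B\<close>-convexity, superreflexivity implies reflexivity, and reflexivity as well as
  \<open>B\<close>-convexity implies the growth conditions.

  Suppose that both conditions hold. The condition on \<open>\<phi>\<^sup>*\<close> gives numbers
  \<open>a\<close> and \<open>s\<^sub>0\<close> with \<open>\<phi>(as) \<ge> 2a\<phi>(s)\<close>
  for \<open>s \<ge> s\<^sub>0\<close> (\<open>Delta2_complementary_growth\<close>), so
  \<open>\<phi>\<close> grows at least like a power with exponent \<open>r > 1\<close>. Hence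
  \<open>\<phi>\<close> is comparable to a function \<open>\<Psi>(u) = E(u\<^sup>r)\<close> with
  \<open>E\<close> convex, and \<open>\<Psi>\<close> inherits a quantitative strict convexity from
  \<open>|z|\<^sup>r\<close> (\<open>Psi_defect\<close>). The functional
  \<open>\<rho>(f) = \<integral>\<Psi>(|f|) + \<integral>\<Psi>(|f'|)\<close> is then a
  uniformly convex modular: if \<open>\<rho>(x)\<close> and \<open>\<rho>(y)\<close> are at most
  \<open>c\<close>, then either \<open>\<rho>\<close> of the midpoint drops below \<open>c\<close>
  by a fixed amount or \<open>\<rho>\<close> of the half difference is small. Condition
  \<open>\<Delta>\<^sub>2\<close> for \<open>\<phi>\<close> makes \<open>\<rho>\<close> finite and
  bounded on norm balls. It takes the place of a uniformly convex norm. Applied repeatedly to pairs,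
  the alternative produces signed means of small norm, which is \<open>B\<close>-convexity. For
  superreflexivity, a nonreflexive Banach space contains, by the theorem of James
  (\<open>james_chain\<close>), arbitrarily long sequences in which the averages of adjacent blocks
  stay apart. If such a space were finitely representable here, the images of the dyadic averages
  would force \<open>\<rho>\<close> to drop by the same amount at every level, although it cannot
  become negative.

  Superreflexivity implies reflexivity because the space is complete and has at most as many
  elements as there are real numbers: an isometric copy of it lives in the type over which
  superreflexivity quantifies (\<open>superreflexive_imp_reflexive\<close>).

  If one of the two conditions fails, there are numbers \<open>s\<^sub>j, t\<^sub>j\<close> with
  either \<open>\<phi>(s\<^sub>j)\<close> or \<open>\<phi>\<^sup>*(t\<^sub>j)\<close> smaller than
  \<open>s\<^sub>jt\<^sub>j\<close> by the factor \<open>2\<^sup>j\<close> and the other one at most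
  \<open>2s\<^sub>jt\<^sub>j\<close>. On disjoint intervals \<open>A\<^sub>j\<close> of length
  \<open>1/(2s\<^sub>jt\<^sub>j)\<close> take \<open>e\<^sub>j\<close> with derivative
  \<open>s\<^sub>j\<close> on \<open>A\<^sub>j\<close> and \<open>0\<close> elsewhere, and the
  functionals \<open>h\<^sub>j(f) = t\<^sub>j\<integral>\<^bsub>A\<^sub>j\<^esub>f'\<close>; these
  are biorthogonal up to the factor \<open>1/2\<close>. In the first case the
  \<open>e\<^sub>j\<close> behave like the unit vectors of \<open>c\<^sub>0\<close>, in the second
  like those of \<open>\<ell>\<^sup>1\<close>, and either sequence excludes both reflexivity and
  \<open>B\<close>-convexity.\<close>

section \<open>Linear functionals and the Hahn-Banach theorem\<close>

lemma complex_ring_simps [simp]: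
  "carrier complex_ring = UNIV" "x \<otimes>\<^bsub>complex_ring\<^esub> y = x * y" "\<one>\<^bsub>complex_ring\<^esub> = 1"
  "\<zero>\<^bsub>complex_ring\<^esub> = 0" "x \<oplus>\<^bsub>complex_ring\<^esub> y = x + y"
  by (simp_all add: complex_ring_def)

lemma cring_complex_ring: "cring complex_ring"
proof (rule cringI)
  show "abelian_group complex_ring"
    by (rule abelian_groupI) (auto intro: exI[of _ "- x" for x] add_eq_0_iff)
  show "Group.comm_monoid complex_ring"
    by (unfold_locales) (auto simp: mult_ac)
qed (auto simp: algebra_simps)

lemma complex_ring_a_inv [simp]: "\<ominus>\<^bsub>complex_ring\<^esub> x = - x"
proof -
  interpret cring complex_ring by (rule cring_complex_ring)
  show ?thesis by (rule minus_equality) auto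
qed

locale cmodule = Module.module complex_ring X for X :: "(complex, 'a, 'm) module_scheme" (structure)
begin

lemma sm_closed [simp, intro]: "x \<in> carrier X \<Longrightarrow> c \<odot> x \<in> carrier X"
  by simp
lemma sm_add: "x \<in> carrier X \<Longrightarrow> y \<in> carrier X \<Longrightarrow> c \<odot> (x \<oplus> y) = c \<odot> x \<oplus> c \<odot> y"
  using smult_r_distr[of c x y] by simp
lemma add_sm: "x \<in> carrier X \<Longrightarrow> (a + b) \<odot> x = a \<odot> x \<oplus> b \<odot> x"
  using smult_l_distr[of a b x] by simp
lemma sm_sm: "x \<in> carrier X \<Longrightarrow> a \<odot> (b \<odot> x) = (a * b) \<odot> x"
  using smult_assoc1[of a b x] by simp
lemma one_sm [simp]: "x \<in> carrier X \<Longrightarrow> 1 \<odot> x = x"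
  using smult_one[of x] by simp
lemma zero_sm [simp]: "x \<in> carrier X \<Longrightarrow> 0 \<odot> x = \<zero>"
  using smult_l_null[of x] by simp
lemma neg_sm: "x \<in> carrier X \<Longrightarrow> (-1) \<odot> x = \<ominus> x"
  using smult_l_minus[of 1 x] by simp
lemma minus_sm: "x \<in> carrier X \<Longrightarrow> y \<in> carrier X \<Longrightarrow> x \<ominus> y = x \<oplus> (-1) \<odot> y"
  by (simp add: a_minus_def neg_sm)

lemma add_swap4: "a \<in> carrier X \<Longrightarrow> b \<in> carrier X \<Longrightarrow> c \<in> carrier X \<Longrightarrow> d \<in> carrier X \<Longrightarrow>
  (a \<oplus> b) \<oplus> (c \<oplus> d) = (a \<oplus> c) \<oplus> (b \<oplus> d)"
  by (simp add: M.a_ac)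

definition sublin :: "('a \<Rightarrow> real) \<Rightarrow> bool" where
  "sublin q \<longleftrightarrow> (\<forall>x\<in>carrier X. \<forall>y\<in>carrier X. q (x \<oplus> y) \<le> q x + q y) \<and>
     (\<forall>x\<in>carrier X. \<forall>t\<ge>0. q (of_real t \<odot> x) = t * q x)"

lemma sublin_zero: "sublin q \<Longrightarrow> q \<zero> = 0"
proof -
  assume "sublin q"
  then have "q (of_real 0 \<odot> \<zero>) = 0 * q \<zero>" unfolding sublin_def by blast
  then show ?thesis by simp
qed

lemma sublin_lower: "sublin q \<Longrightarrow> x \<in> carrier X \<Longrightarrow> - q ((-1) \<odot> x) \<le> q x"
proof -
  assume q: "sublin q" and x: "x \<in> carrier X"
  have "x \<oplus> (-1) \<odot> x = \<zero>" using x by (simp add: neg_sm M.r_neg)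
  then have "0 \<le> q x + q ((-1) \<odot> x)"
    using q x sublin_zero[OF q] unfolding sublin_def by (metis sm_closed)
  then show ?thesis by simp
qed

text \<open>
  The tilt is the result of lowering \<open>q\<close> as far as sublinearity permits while favouring
  the direction \<open>y\<close>. It satisfies
  \<open>tilt q y x \<le> q (x + y) - q y\<close>, so a sublinear functional that cannot
  be lowered is superadditive as well.\<close>
definition tilt :: "('a \<Rightarrow> real) \<Rightarrow> 'a \<Rightarrow> 'a \<Rightarrow> real" where
  "tilt q y x = (if x \<in> carrier X then (INF t\<in>{0..}. q (x \<oplus> of_real t \<odot> y) - t * q y) else 0)"

lemma tilt_bdd:
  assumes q: "sublin q" and x: "x \<in> carrier X" and y: "y \<in> carrier X"
  shows "bdd_below ((\<lambda>t. q (x \<oplus> of_real t \<odot> y) - t * q y) ` {0..})"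
proof (rule bdd_belowI2)
  fix t :: real assume t: "t \<in> {0..}"
  have eq: "(x \<oplus> of_real t \<odot> y) \<oplus> (-1) \<odot> x = of_real t \<odot> y"
  proof -
    have "(x \<oplus> of_real t \<odot> y) \<oplus> (-1) \<odot> x = (x \<oplus> (-1) \<odot> x) \<oplus> of_real t \<odot> y"
      using x y by (simp add: M.a_ac)
    then show ?thesis using x y by (simp add: neg_sm M.r_neg)
  qed
  have "t * q y = q (of_real t \<odot> y)" using q y t unfolding sublin_def by auto
  also have "\<dots> \<le> q (x \<oplus> of_real t \<odot> y) + q ((-1) \<odot> x)"
    using q x y unfolding sublin_def by (metis eq sm_closed M.a_closed)
  finally show "- q ((-1) \<odot> x) \<le> q (x \<oplus> of_real t \<odot> y) - t * q y" by simp
qed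

lemma tilt_le:
  assumes q: "sublin q" and x: "x \<in> carrier X" and y: "y \<in> carrier X" and t: "t \<ge> 0"
  shows "tilt q y x \<le> q (x \<oplus> of_real t \<odot> y) - t * q y"
  unfolding tilt_def using x t by (auto intro: cINF_lower tilt_bdd[OF q x y])

lemma tilt_le_self:
  assumes q: "sublin q" and x: "x \<in> carrier X" and y: "y \<in> carrier X"
  shows "tilt q y x \<le> q x"
  using tilt_le[OF q x y, of 0] x y by simp

lemma tilt_greatest:
  assumes x: "x \<in> carrier X" and "\<And>t. t \<ge> 0 \<Longrightarrow> c \<le> q (x \<oplus> of_real t \<odot> y) - t * q y"
  shows "c \<le> tilt q y x"
  unfolding tilt_def using assms by (auto intro!: cINF_greatest)

lemma sublin_tilt:
  assumes q: "sublin q" and y: "y \<in> carrier X"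
  shows "sublin (tilt q y)"
  unfolding sublin_def
proof (intro conjI ballI allI impI)
  fix x z assume x: "x \<in> carrier X" and z: "z \<in> carrier X"
  have *: "tilt q y (x \<oplus> z) \<le> (q (x \<oplus> of_real t \<odot> y) - t * q y) + (q (z \<oplus> of_real s \<odot> y) - s * q y)"
    if "t \<ge> 0" "s \<ge> 0" for t s
  proof -
    have "tilt q y (x \<oplus> z) \<le> q ((x \<oplus> z) \<oplus> of_real (t + s) \<odot> y) - (t + s) * q y"
      using that x y z by (intro tilt_le q) auto
    also have "(x \<oplus> z) \<oplus> of_real (t + s) \<odot> y = (x \<oplus> of_real t \<odot> y) \<oplus> (z \<oplus> of_real s \<odot> y)"
      using x y z add_sm[OF y, of "of_real t" "of_real s"] by (simp add: add_swap4)
    also have "q \<dots> \<le> q (x \<oplus> of_real t \<odot> y) + q (z \<oplus> of_real s \<odot> y)"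
      using q x y z unfolding sublin_def by (meson sm_closed M.a_closed)
    finally show ?thesis by (simp add: algebra_simps)
  qed
  have "tilt q y (x \<oplus> z) - (q (x \<oplus> of_real t \<odot> y) - t * q y) \<le> tilt q y z" if "t \<ge> 0" for t
    using *[OF that] by (intro tilt_greatest z) (auto simp: algebra_simps)
  then have "tilt q y (x \<oplus> z) - tilt q y z \<le> q (x \<oplus> of_real t \<odot> y) - t * q y" if "t \<ge> 0" for t
    using that by (simp add: algebra_simps)
  then have "tilt q y (x \<oplus> z) - tilt q y z \<le> tilt q y x"
    by (intro tilt_greatest x) auto
  then show "tilt q y (x \<oplus> z) \<le> tilt q y x + tilt q y z" by simp
next
  fix x and s :: real assume x: "x \<in> carrier X" and s: "s \<ge> 0"
  have hom: "q (of_real s \<odot> z) = s * q z" if "z \<in> carrier X" "s \<ge> 0" for z s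
    using q that unfolding sublin_def by auto
  have le: "tilt q y (of_real s \<odot> x) \<le> s * tilt q y x" if s: "s > 0" and x: "x \<in> carrier X" for s x
  proof -
    have "tilt q y (of_real s \<odot> x) / s \<le> q (x \<oplus> of_real t \<odot> y) - t * q y" if t: "t \<ge> 0" for t
    proof -
      have "tilt q y (of_real s \<odot> x) \<le> q (of_real s \<odot> x \<oplus> of_real (s * t) \<odot> y) - (s * t) * q y"
        using s t x y by (intro tilt_le q) auto
      also have "of_real s \<odot> x \<oplus> of_real (s * t) \<odot> y = of_real s \<odot> (x \<oplus> of_real t \<odot> y)"
        using x y by (simp add: sm_add sm_sm)
      also have "q \<dots> = s * q (x \<oplus> of_real t \<odot> y)"
        using x y s by (intro hom) auto
      finally show ?thesis using s by (simp add: field_simps)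
    qed
    then have "tilt q y (of_real s \<odot> x) / s \<le> tilt q y x" by (intro tilt_greatest x) auto
    then show ?thesis using s by (simp add: field_simps)
  qed
  show "tilt q y (of_real s \<odot> x) = s * tilt q y x"
  proof (cases "s = 0")
    case True
    have "tilt q y \<zero> = 0"
    proof (rule antisym)
      show "tilt q y \<zero> \<le> 0" using tilt_le_self[OF q _ y, of \<zero>] sublin_zero[OF q] by simp
      show "0 \<le> tilt q y \<zero>" using y hom[OF y] by (intro tilt_greatest) auto
    qed
    then show ?thesis using True x by simp
  next
    case False
    then have s: "s > 0" using s by simp
    have "tilt q y (of_real (1/s) \<odot> (of_real s \<odot> x)) \<le> (1/s) * tilt q y (of_real s \<odot> x)"
      using s x by (intro le) auto
    then have "s * tilt q y x \<le> tilt q y (of_real s \<odot> x)"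
      using s x by (simp add: sm_sm field_simps)
    with le[OF s x] show ?thesis by simp
  qed
qed

text \<open>
  By Zorn's lemma: the pointwise infimum of a chain of sublinear functionals below \<open>p\<close>
  is sublinear, and it is finite because each of them is bounded below by \<open>-p(-x)\<close>.
  Zorn's lemma is applied to functionals that vanish outside the carrier, so that equality of
  functionals is equality on the carrier.\<close>
lemma minimal_sublin:
  assumes p: "sublin p"
  obtains q where "sublin q" "\<And>x. x \<in> carrier X \<Longrightarrow> q x \<le> p x"
    "\<And>r x. sublin r \<Longrightarrow> (\<And>x. x \<in> carrier X \<Longrightarrow> r x \<le> q x) \<Longrightarrow> x \<in> carrier X \<Longrightarrow> r x = q x"
proof -
  define S where "S = {q. sublin q \<and> (\<forall>x\<in>carrier X. q x \<le> p x) \<and> (\<forall>x. x \<notin> carrier X \<longrightarrow> q x = 0)}"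
  define P where "P = (\<lambda>a b :: 'a \<Rightarrow> real. b \<le> a)"
  define cut where "cut = (\<lambda>q x. if x \<in> carrier X then q x else 0 :: real)"
  have cut: "sublin (cut q)" if "sublin q" for q
    using that unfolding sublin_def cut_def by auto
  have "\<exists>m\<in>S. \<forall>a\<in>S. P m a \<longrightarrow> a = m"
  proof (rule predicate_Zorn)
    show "partial_order_on S (relation_of P S)"
      unfolding P_def by (rule partial_order_on_relation_ofI) auto
    fix C assume C: "C \<in> Chains (relation_of P S)"
    then have CS: "C \<subseteq> S" and tot: "\<And>a b. a \<in> C \<Longrightarrow> b \<in> C \<Longrightarrow> a \<le> b \<or> b \<le> a"
      unfolding Chains_def relation_of_def P_def by auto
    show "\<exists>u\<in>S. \<forall>a\<in>C. P a u"
    proof (cases "C = {}")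
      case True
      have "cut p \<in> S" using cut[OF p] by (auto simp: S_def cut_def)
      then show ?thesis using True by blast
    next
      case False
      define r where "r = (\<lambda>x. if x \<in> carrier X then INF q\<in>C. q x else 0)"
      have low: "- p ((-1) \<odot> x) \<le> q x" if "q \<in> C" "x \<in> carrier X" for q x
      proof -
        have "q \<in> S" using that CS by blast
        then have "- q ((-1) \<odot> x) \<le> q x" "q ((-1) \<odot> x) \<le> p ((-1) \<odot> x)"
          using sublin_lower that by (auto simp: S_def)
        then show ?thesis by simp
      qed
      have bdd: "bdd_below ((\<lambda>q. q x) ` C)" if "x \<in> carrier X" for x
        by (rule bdd_belowI2[where m = "- p ((-1) \<odot> x)"]) (use low that in auto)
      have rle: "r x \<le> q x" if "q \<in> C" "x \<in> carrier X" for q x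
        using that bdd by (auto simp: r_def intro: cINF_lower)
      have rge: "c \<le> r x" if "\<And>q. q \<in> C \<Longrightarrow> c \<le> q x" "x \<in> carrier X" for c x
        using that False by (auto simp: r_def intro: cINF_greatest)
      have "sublin r" unfolding sublin_def
      proof (intro conjI ballI allI impI)
        fix x y assume x: "x \<in> carrier X" and y: "y \<in> carrier X"
        have *: "r (x \<oplus> y) \<le> q1 x + q2 y" if q12: "q1 \<in> C" "q2 \<in> C" for q1 q2
        proof -
          obtain q where q: "q \<in> C" "q \<le> q1" "q \<le> q2"
            using tot[OF q12] q12 by (metis order_refl)
          have "r (x \<oplus> y) \<le> q (x \<oplus> y)" using q x y by (intro rle) auto
          also have "\<dots> \<le> q x + q y" using q CS x y unfolding S_def sublin_def by blast
          also have "\<dots> \<le> q1 x + q2 y" using q by (intro add_mono) (auto simp: le_fun_def)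
          finally show ?thesis .
        qed
        have "r (x \<oplus> y) - q1 x \<le> r y" if "q1 \<in> C" for q1
          using *[OF that] by (intro rge y) (simp add: algebra_simps)
        then have "r (x \<oplus> y) - r y \<le> r x" by (intro rge x) (simp add: algebra_simps)
        then show "r (x \<oplus> y) \<le> r x + r y" by simp
      next
        fix x and t :: real assume x: "x \<in> carrier X" and t: "t \<ge> 0"
        have hom: "q (of_real t \<odot> x) = t * q x" if "q \<in> C" for q
          using that CS x t unfolding S_def sublin_def by blast
        show "r (of_real t \<odot> x) = t * r x"
        proof (rule antisym)
          show "t * r x \<le> r (of_real t \<odot> x)"
            using t x rle by (intro rge) (auto simp: hom mult_left_mono)
          show "r (of_real t \<odot> x) \<le> t * r x"
          proof (cases "t = 0")
            case True
            obtain q where "q \<in> C" using False by blast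
            then show ?thesis using rle[of q "of_real t \<odot> x"] hom[of q] x True by simp
          next
            case False
            then have t: "t > 0" using t by simp
            have "r (of_real t \<odot> x) / t \<le> r x"
              using rle[of _ "of_real t \<odot> x"] hom x t by (intro rge x) (simp add: field_simps)
            then show ?thesis using t by (simp add: field_simps)
          qed
        qed
      qed
      moreover have "r x \<le> p x" if x: "x \<in> carrier X" for x
      proof -
        obtain q where "q \<in> C" using False by blast
        then show ?thesis using rle[of q x] x CS by (force simp: S_def)
      qed
      ultimately have "r \<in> S" by (auto simp: S_def r_def)
      moreover have "r \<le> q" if "q \<in> C" for q
        using rle[OF that] that CS by (auto simp: le_fun_def r_def S_def)
      ultimately show ?thesis unfolding P_def by blast
    qed
  qed
  then obtain m where m: "m \<in> S" "\<And>a. a \<in> S \<Longrightarrow> a \<le> m \<Longrightarrow> a = m" unfolding P_def by blast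
  show thesis
  proof (rule that[of m])
    show "sublin m" "\<And>x. x \<in> carrier X \<Longrightarrow> m x \<le> p x" using m(1) by (auto simp: S_def)
    fix r x assume r: "sublin r" "\<And>x. x \<in> carrier X \<Longrightarrow> r x \<le> m x" and x: "x \<in> carrier X"
    have "cut r \<le> m" "cut r \<in> S"
      using r cut[OF r(1)] m(1) by (force simp: cut_def S_def le_fun_def)+
    then have "cut r = m" using m(2) by blast
    from fun_cong[OF this, of x] show "r x = m x" using x by (simp add: cut_def)
  qed
qed

text \<open>
  A minimal sublinear functional equals all of its tilts and is therefore linear. Minimizing below
  \<open>tilt p x0\<close> instead of below \<open>p\<close> fixes the value at \<open>x0\<close>,
  since \<open>tilt p x0 (-x0) \<le> -p x0\<close>.\<close>
lemma real_hahn_banach: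
  assumes p: "sublin p" and x0: "x0 \<in> carrier X"
  obtains f where "\<And>x y. x \<in> carrier X \<Longrightarrow> y \<in> carrier X \<Longrightarrow> f (x \<oplus> y) = f x + f y"
    "\<And>t x. x \<in> carrier X \<Longrightarrow> f (of_real t \<odot> x) = t * f x"
    "\<And>x. x \<in> carrier X \<Longrightarrow> f x \<le> p x" "f x0 = (p x0 :: real)"
proof -
  obtain f where f: "sublin f" "\<And>x. x \<in> carrier X \<Longrightarrow> f x \<le> tilt p x0 x"
    and min: "\<And>r x. sublin r \<Longrightarrow> (\<And>x. x \<in> carrier X \<Longrightarrow> r x \<le> f x) \<Longrightarrow> x \<in> carrier X \<Longrightarrow> r x = f x"
    using minimal_sublin[OF sublin_tilt[OF p x0]] by blast
  have add: "f (x \<oplus> y) = f x + f y" if x: "x \<in> carrier X" and y: "y \<in> carrier X" for x y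
  proof (rule antisym)
    show "f (x \<oplus> y) \<le> f x + f y" using f x y by (auto simp: sublin_def)
    have "tilt f y x = f x"
      using f y by (intro min x sublin_tilt tilt_le_self) auto
    then show "f x + f y \<le> f (x \<oplus> y)"
      using tilt_le[OF f(1) x y, of 1] x y by simp
  qed
  have neg: "f ((-1) \<odot> x) = - f x" if x: "x \<in> carrier X" for x
    using add[of x "(-1) \<odot> x"] x sublin_zero[OF f(1)] by (simp add: neg_sm M.r_neg)
  have pos: "f (of_real t \<odot> x) = t * f x" if "t \<ge> 0" "x \<in> carrier X" for t x
    using f(1) that by (auto simp: sublin_def)
  have hom: "f (of_real t \<odot> x) = t * f x" if x: "x \<in> carrier X" for t x
  proof (cases "t \<ge> 0")
    case False
    have "f ((-1) \<odot> (of_real (-t) \<odot> x)) = - ((-t) * f x)"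
      using False x by (subst neg) (auto simp: pos simp del: of_real_minus)
    then show ?thesis using x by (simp add: sm_sm)
  qed (use pos x in auto)
  have le: "f x \<le> p x" if "x \<in> carrier X" for x
    using f(2)[OF that] tilt_le_self[OF p that x0] by simp
  have "f x0 = p x0"
  proof (rule antisym)
    have "x0 \<oplus> (-1) \<odot> x0 = \<zero>" using x0 by (simp add: neg_sm M.r_neg)
    then have "(-1) \<odot> x0 \<oplus> x0 = \<zero>" using x0 by (simp add: M.a_comm)
    then have "tilt p x0 ((-1) \<odot> x0) \<le> - p x0"
      using tilt_le[OF p, of "(-1) \<odot> x0" x0 1] x0 sublin_zero[OF p] by simp
    then show "p x0 \<le> f x0" using f(2)[of "(-1) \<odot> x0"] x0 neg[OF x0] by simp
  qed (use le x0 in auto)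
  then show thesis using that[of f] add hom le by blast
qed

definition lin :: "('a \<Rightarrow> complex) \<Rightarrow> bool" where
  "lin f \<longleftrightarrow> (\<forall>x\<in>carrier X. \<forall>y\<in>carrier X. f (x \<oplus> y) = f x + f y) \<and>
     (\<forall>c. \<forall>x\<in>carrier X. f (c \<odot> x) = c * f x)"

lemma linD:
  "lin f \<Longrightarrow> x \<in> carrier X \<Longrightarrow> y \<in> carrier X \<Longrightarrow> f (x \<oplus> y) = f x + f y"
  "lin f \<Longrightarrow> x \<in> carrier X \<Longrightarrow> f (c \<odot> x) = c * f x"
  by (auto simp: lin_def)

lemma lin_minus: "lin f \<Longrightarrow> x \<in> carrier X \<Longrightarrow> y \<in> carrier X \<Longrightarrow> f (x \<ominus> y) = f x - f y"
  by (simp add: minus_sm linD)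

lemma lin_finsum:
  assumes "lin f" "\<And>i. i \<in> A \<Longrightarrow> x i \<in> carrier X" "finite A"
  shows "f (\<Oplus>i\<in>A. x i) = (\<Sum>i\<in>A. f (x i))"
  using assms(3,2)
proof (induction A)
  case empty
  have "f (0 \<odot> \<zero>) = 0 * f \<zero>" using assms(1) by (intro linD) auto
  then show ?case by simp
next
  case (insert a A)
  then have "(\<Oplus>i\<in>insert a A. x i) = x a \<oplus> (\<Oplus>i\<in>A. x i)"
    by (intro M.finsum_insert) auto
  then show ?case using insert assms(1) by (simp add: linD M.finsum_closed Pi_def)
qed

text \<open>
  The complex functional with real part \<open>g\<close> is \<open>g(x) - i g(ix)\<close>, and
  rotating a value to the positive real axis bounds its modulus by the seminorm.\<close>
theorem hahn_banach:
  assumes add: "\<And>x y. x \<in> carrier X \<Longrightarrow> y \<in> carrier X \<Longrightarrow> p (x \<oplus> y) \<le> p x + p y"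
    and hom: "\<And>c x. x \<in> carrier X \<Longrightarrow> p (c \<odot> x) = cmod c * p x"
    and x0: "x0 \<in> carrier X"
  obtains f where "lin f" "\<And>x. x \<in> carrier X \<Longrightarrow> cmod (f x) \<le> p x" "f x0 = of_real (p x0)"
proof -
  have "sublin p" unfolding sublin_def using add hom by auto
  from real_hahn_banach[OF this x0] obtain g :: "'a \<Rightarrow> real" where
    gadd: "\<And>x y. x \<in> carrier X \<Longrightarrow> y \<in> carrier X \<Longrightarrow> g (x \<oplus> y) = g x + g y"
    and ghom: "\<And>t x. x \<in> carrier X \<Longrightarrow> g (of_real t \<odot> x) = t * g x"
    and gle: "\<And>x. x \<in> carrier X \<Longrightarrow> g x \<le> p x" and gx0: "g x0 = p x0" by metis
  define f where "f x = Complex (g x) (- g (\<i> \<odot> x))" for x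
  have gc: "g (c \<odot> x) = Re c * g x + Im c * g (\<i> \<odot> x)" if x: "x \<in> carrier X" for c x
  proof -
    have "c \<odot> x = of_real (Re c) \<odot> x \<oplus> of_real (Im c) \<odot> (\<i> \<odot> x)"
      using x complex_eq[of c] by (simp add: sm_sm add_sm[symmetric] mult.commute)
    then show ?thesis using x by (simp add: gadd ghom)
  qed
  have lin: "lin f" unfolding lin_def
  proof (intro conjI ballI allI)
    fix x y assume "x \<in> carrier X" "y \<in> carrier X"
    then show "f (x \<oplus> y) = f x + f y" by (simp add: f_def gadd sm_add complex_eq_iff)
  next
    fix c x assume "x \<in> carrier X"
    then show "f (c \<odot> x) = c * f x"
      by (simp add: f_def complex_eq_iff gc[of x c] gc[of x "\<i> * c"] sm_sm)
  qed
  have le: "cmod (f x) \<le> p x" if x: "x \<in> carrier X" for x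
  proof (cases "f x = 0")
    case True
    have "p \<zero> \<le> p x + p ((-1) \<odot> x)" using add[of x "(-1) \<odot> x"] x by (simp add: neg_sm M.r_neg)
    moreover have "p \<zero> = 0" using hom[of \<zero> 0] by simp
    ultimately show ?thesis using True hom[OF x, of "-1"] by simp
  next
    case False
    define c where "c = cnj (sgn (f x))"
    have c: "cmod c = 1" using False by (simp add: c_def norm_sgn)
    have "f (c \<odot> x) = c * f x" using linD(2)[OF lin x] .
    also have "\<dots> = of_real (cmod (f x))"
      using False by (simp add: c_def sgn_div_norm scaleR_conv_of_real complex_norm_square[symmetric] power2_eq_square field_simps)
    finally have "cmod (f x) = g (c \<odot> x)" by (simp add: f_def complex_eq_iff)
    also have "\<dots> \<le> p (c \<odot> x)" using x by (intro gle) auto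
    finally show ?thesis using hom[OF x] c by simp
  qed
  have "Re (f x0) = p x0" using gx0 by (simp add: f_def)
  moreover have "Im (f x0) = 0"
  proof -
    have "(cmod (f x0))\<^sup>2 \<le> (p x0)\<^sup>2" using le[OF x0] by (intro power_mono) auto
    then show ?thesis using \<open>Re (f x0) = p x0\<close> by (simp add: cmod_power2)
  qed
  ultimately have "f x0 = of_real (p x0)" by (simp add: complex_eq_iff)
  then show thesis using that lin le by blast
qed

end

section \<open>Dual spaces and generalized limits\<close>

context complex_normed_space
begin

sublocale cmodule X by unfold_locales

lemma nrm_zero [simp]: "nrm X \<zero> = 0"
  using nrm_eq_0_iff[of \<zero>] by simp

lemma nrm_nonneg: "x \<in> carrier X \<Longrightarrow> 0 \<le> nrm X x"
proof -
  assume x: "x \<in> carrier X"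
  have "nrm X (x \<oplus> (-1) \<odot> x) \<le> nrm X x + nrm X ((-1) \<odot> x)" using x by (intro nrm_triangle) auto
  moreover have "x \<oplus> (-1) \<odot> x = \<zero>" using x by (simp add: neg_sm M.r_neg)
  ultimately show ?thesis using x nrm_smult[of x "-1"] by simp
qed

lemma nrm_minus_commute: "x \<in> carrier X \<Longrightarrow> y \<in> carrier X \<Longrightarrow> nrm X (x \<ominus> y) = nrm X (y \<ominus> x)"
proof -
  assume x: "x \<in> carrier X" and y: "y \<in> carrier X"
  have "x \<ominus> y = (-1) \<odot> (y \<ominus> x)" using x y by (simp add: minus_sm sm_add sm_sm M.a_comm)
  then show ?thesis using nrm_smult[of "y \<ominus> x" "-1"] x y by simp
qed

lemma nrm_minus_triangle: "x \<in> carrier X \<Longrightarrow> y \<in> carrier X \<Longrightarrow> z \<in> carrier X \<Longrightarrow>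
  nrm X (x \<ominus> z) \<le> nrm X (x \<ominus> y) + nrm X (y \<ominus> z)"
proof -
  assume x: "x \<in> carrier X" and y: "y \<in> carrier X" and z: "z \<in> carrier X"
  have "(x \<ominus> y) \<oplus> (y \<ominus> z) = (x \<oplus> (\<ominus> y \<oplus> y)) \<oplus> \<ominus> z"
    using x y z by (simp add: a_minus_def M.a_assoc)
  also have "\<dots> = x \<ominus> z" using x y z by (simp add: M.l_neg a_minus_def)
  finally show ?thesis using nrm_triangle[of "x \<ominus> y" "y \<ominus> z"] x y z by simp
qed

lemma minus_eq_zero_iff: "x \<in> carrier X \<Longrightarrow> y \<in> carrier X \<Longrightarrow> x \<ominus> y = \<zero> \<longleftrightarrow> x = y"
  by (metis M.minus_equality M.minus_minus M.r_neg a_minus_def M.a_inv_closed M.a_comm)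

lemma Metric_space_nrm_dist: "Metric_space (carrier X) (nrm_dist X)"
proof
  show "0 \<le> nrm_dist X x y" for x y by (simp add: nrm_dist_def nrm_nonneg)
  show "nrm_dist X x y = nrm_dist X y x" for x y by (auto simp: nrm_dist_def nrm_minus_commute)
  show "nrm_dist X x y = 0 \<longleftrightarrow> x = y" if "x \<in> carrier X" "y \<in> carrier X" for x y
    using that nrm_eq_0_iff[of "x \<ominus> y"] by (simp add: nrm_dist_def minus_eq_zero_iff)
  show "nrm_dist X x z \<le> nrm_dist X x y + nrm_dist X y z"
    if "x \<in> carrier X" "y \<in> carrier X" "z \<in> carrier X" for x y z
    using that nrm_minus_triangle[of x y z] by (simp add: nrm_dist_def)
qed

text \<open>
  Linear with operator norm at most \<open>C\<close>. A bound \<open>C\<close> is easier to handle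
  than the norm of the dual, which is a supremum, and it also makes sense for functionals that are
  not extensional.\<close>
definition bl :: "real \<Rightarrow> ('a \<Rightarrow> complex) \<Rightarrow> bool" where
  "bl C f \<longleftrightarrow> lin f \<and> (\<forall>x\<in>carrier X. cmod (f x) \<le> C * nrm X x)"

lemma carrier_dual: "carrier (dual X) = {f \<in> extensional (carrier X). \<exists>C. bl C f}"
  by (auto simp: dual_def bounded_functionals_def bl_def lin_def)

lemma bl_mono: "bl C f \<Longrightarrow> C \<le> D \<Longrightarrow> bl D f"
  unfolding bl_def by (meson mult_right_mono nrm_nonneg order_trans)

lemma bl_lin: "bl C f \<Longrightarrow> lin f" by (simp add: bl_def)

lemma bl_le: "bl C f \<Longrightarrow> x \<in> carrier X \<Longrightarrow> cmod (f x) \<le> C * nrm X x"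
  by (simp add: bl_def)

lemma restrict_in_dual: "bl C f \<Longrightarrow> restrict f (carrier X) \<in> carrier (dual X)"
  by (auto simp: carrier_dual bl_def lin_def)

lemma bl_restrict: "bl C f \<Longrightarrow> bl C (restrict f (carrier X))"
  by (auto simp: bl_def lin_def)

lemma bl_add: "bl C f \<Longrightarrow> bl D g \<Longrightarrow> bl (C + D) (\<lambda>x. f x + g x)"
  unfolding bl_def lin_def
  by (auto simp: algebra_simps intro!: order_trans[OF norm_triangle_ineq add_mono])

lemma bl_smult: "bl C f \<Longrightarrow> bl (cmod c * C) (\<lambda>x. c * f x)"
  unfolding bl_def lin_def
  by (auto simp: norm_mult mult.assoc mult.left_commute[of C] mult.left_commute[of c] distrib_left
      intro!: mult_left_mono)

lemma bl_zero: "bl 0 (\<lambda>x. 0)"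
  by (simp add: bl_def lin_def)

lemma dual_simps:
  "zero (dual X) = (\<lambda>x\<in>carrier X. 0)" "f \<oplus>\<^bsub>dual X\<^esub> g = (\<lambda>x\<in>carrier X. f x + g x)"
  "c \<odot>\<^bsub>dual X\<^esub> f = (\<lambda>x\<in>carrier X. c * f x)"
  by (simp_all add: dual_def)

lemma nrm_dual_le:
  assumes "bl C f" "C \<ge> 0" shows "nrm (dual X) f \<le> C"
proof -
  have "Sup {cmod (f x) |x. x \<in> carrier X \<and> nrm X x \<le> 1} \<le> C"
  proof (rule cSup_least)
    show "{cmod (f x) |x. x \<in> carrier X \<and> nrm X x \<le> 1} \<noteq> {}"
      using M.zero_closed nrm_zero by (force intro: exI[of _ "\<zero>"])
    fix y assume "y \<in> {cmod (f x) |x. x \<in> carrier X \<and> nrm X x \<le> 1}"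
    then obtain x where x: "x \<in> carrier X" "nrm X x \<le> 1" "y = cmod (f x)" by blast
    have "y \<le> C * nrm X x" using bl_le[OF assms(1)] x by simp
    also have "\<dots> \<le> C * 1" using assms(2) x by (intro mult_left_mono) auto
    finally show "y \<le> C" by simp
  qed
  then show ?thesis by (simp add: dual_def)
qed

lemma nrm_dual_ge:
  assumes "bl C f" "x \<in> carrier X" "nrm X x \<le> 1" shows "cmod (f x) \<le> nrm (dual X) f"
proof -
  have "cmod (f x) \<le> Sup {cmod (f x) |x. x \<in> carrier X \<and> nrm X x \<le> 1}"
  proof (rule cSup_upper)
    show "bdd_above {cmod (f x) |x. x \<in> carrier X \<and> nrm X x \<le> 1}"
    proof (rule bdd_aboveI)
      fix y assume "y \<in> {cmod (f x) |x. x \<in> carrier X \<and> nrm X x \<le> 1}"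
      then obtain x where x: "x \<in> carrier X" "nrm X x \<le> 1" "y = cmod (f x)" by blast
      have "y \<le> \<bar>C\<bar> * nrm X x" using bl_le[OF bl_mono[OF assms(1)], of "\<bar>C\<bar>"] x by simp
      also have "\<dots> \<le> \<bar>C\<bar> * 1" using x by (intro mult_left_mono) auto
      finally show "y \<le> \<bar>C\<bar>" by simp
    qed
  qed (use assms in blast)
  then show ?thesis by (simp add: dual_def)
qed

lemma bl_nrm_dual:
  assumes "bl C f" shows "bl (nrm (dual X) f) f"
  unfolding bl_def
proof (intro conjI ballI)
  fix x assume x: "x \<in> carrier X"
  show "cmod (f x) \<le> nrm (dual X) f * nrm X x"
  proof (cases "nrm X x = 0")
    case True
    then show ?thesis using bl_le[OF assms x] by simp
  next
    case False
    then have n: "nrm X x > 0" using nrm_nonneg[OF x] by simp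
    have "cmod (f (of_real (1 / nrm X x) \<odot> x)) \<le> nrm (dual X) f"
      using n x by (intro nrm_dual_ge[OF assms]) (auto simp: nrm_smult norm_divide)
    then show ?thesis using n x linD(2)[OF bl_lin[OF assms] x] by (simp add: norm_mult norm_divide field_simps)
  qed
qed (use assms in \<open>simp add: bl_def\<close>)

lemma nrm_dual_nonneg: "bl C f \<Longrightarrow> nrm (dual X) f \<ge> 0"
  using nrm_dual_ge[of C f \<zero>] by (simp add: order_trans[OF norm_ge_zero])

lemma complex_normed_space_dual: "complex_normed_space (dual X)"
proof -
  have cl: "f \<in> extensional (carrier X)" "bl (nrm (dual X) f) f" if "f \<in> carrier (dual X)" for f
    using that bl_nrm_dual by (auto simp: carrier_dual)
  have in_dual: "(\<lambda>x\<in>carrier X. f x) \<in> carrier (dual X)" if "bl C f" for C f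
    using restrict_in_dual that .
  have add: "f \<oplus>\<^bsub>dual X\<^esub> g \<in> carrier (dual X)" if "f \<in> carrier (dual X)" "g \<in> carrier (dual X)" for f g
    using in_dual[OF bl_add[OF cl(2) cl(2)]] that by (simp add: dual_simps)
  have sm: "c \<odot>\<^bsub>dual X\<^esub> f \<in> carrier (dual X)" if "f \<in> carrier (dual X)" for f c
    using in_dual[OF bl_smult[OF cl(2)]] that by (simp add: dual_simps)
  have zero: "zero (dual X) \<in> carrier (dual X)"
    using in_dual[OF bl_zero] by (simp add: dual_simps)
  have ag: "abelian_group (dual X)"
  proof (rule abelian_groupI)
    fix f assume f: "f \<in> carrier (dual X)"
    show "\<exists>g\<in>carrier (dual X). g \<oplus>\<^bsub>dual X\<^esub> f = \<zero>\<^bsub>dual X\<^esub>"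
      by (rule bexI[OF _ sm[OF f, of "-1"]]) (auto simp: dual_simps intro!: restrict_ext)
    show "\<zero>\<^bsub>dual X\<^esub> \<oplus>\<^bsub>dual X\<^esub> f = f"
      using cl[OF f] by (auto simp: dual_simps extensional_def fun_eq_iff)
  qed (auto simp: add zero, auto simp: dual_simps fun_eq_iff algebra_simps)
  have md: "Module.module complex_ring (dual X)"
    by (rule Module.moduleI[OF cring_complex_ring ag])
      (auto simp: sm, auto simp: dual_simps fun_eq_iff algebra_simps, auto simp: carrier_dual extensional_def)
  show ?thesis
  proof (intro complex_normed_space.intro md complex_normed_space_axioms.intro)
    fix f assume f: "f \<in> carrier (dual X)"
    show "nrm (dual X) f = 0 \<longleftrightarrow> f = \<zero>\<^bsub>dual X\<^esub>"
    proof
      assume "nrm (dual X) f = 0"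
      then have "f x = 0" if "x \<in> carrier X" for x using bl_le[OF cl(2)[OF f] that] by simp
      then show "f = \<zero>\<^bsub>dual X\<^esub>" using cl(1)[OF f] by (auto simp: dual_simps extensional_def fun_eq_iff)
    next
      assume "f = \<zero>\<^bsub>dual X\<^esub>"
      then have "bl 0 f" using bl_restrict[OF bl_zero] by (simp add: dual_simps)
      then show "nrm (dual X) f = 0" using nrm_dual_le[of 0 f] nrm_dual_nonneg[of 0 f] by simp
    qed
    have le: "nrm (dual X) (c \<odot>\<^bsub>dual X\<^esub> f) \<le> cmod c * nrm (dual X) f" if f: "f \<in> carrier (dual X)" for c f
      unfolding dual_simps
      by (intro nrm_dual_le bl_restrict bl_smult cl f mult_nonneg_nonneg nrm_dual_nonneg[OF cl(2)]) auto
    fix c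
    show "nrm (dual X) (c \<odot>\<^bsub>dual X\<^esub> f) = cmod c * nrm (dual X) f"
    proof (rule antisym[OF le[OF f]])
      show "cmod c * nrm (dual X) f \<le> nrm (dual X) (c \<odot>\<^bsub>dual X\<^esub> f)"
      proof (cases "c = 0")
        case True
        then show ?thesis using nrm_dual_nonneg[OF cl(2)[OF sm[OF f]]] by simp
      next
        case False
        have "(1/c) \<odot>\<^bsub>dual X\<^esub> (c \<odot>\<^bsub>dual X\<^esub> f) = f"
          using False cl(1)[OF f] by (auto simp: dual_simps fun_eq_iff extensional_def)
        then show ?thesis using le[OF sm[OF f, of c], of "1/c"] False by (simp add: norm_divide field_simps)
      qed
    qed
    fix g assume g: "g \<in> carrier (dual X)"
    show "nrm (dual X) (f \<oplus>\<^bsub>dual X\<^esub> g) \<le> nrm (dual X) f + nrm (dual X) g"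
      unfolding dual_simps
      by (intro nrm_dual_le bl_restrict bl_add cl f g add_nonneg_nonneg nrm_dual_nonneg[OF cl(2)])
  qed
qed

lemma norming_functional:
  assumes "x0 \<in> carrier X"
  obtains f where "bl 1 f" "f x0 = of_real (nrm X x0)"
  using hahn_banach[of "nrm X" x0] nrm_triangle nrm_smult assms unfolding bl_def by (metis mult_1)

text \<open>
  The upper limit of \<open>|L n x|\<close> is a seminorm. A linear functional that it dominates
  acts as a limit of the sequence \<open>L\<close>: it vanishes wherever \<open>L n x\<close> is
  eventually \<open>0\<close>, and it can be made to take the eventual value of \<open>L\<close> at
  one point.\<close>
lemma generalized_limit:
  assumes L: "\<And>n::nat. lin (L n)" and bnd: "\<And>x. x \<in> carrier X \<Longrightarrow> \<exists>c. \<forall>n. cmod (L n x) \<le> c"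
    and x0: "x0 \<in> carrier X" and ev: "\<forall>\<^sub>F n in sequentially. L n x0 = of_real l" and l: "l \<ge> 0"
  obtains f where "lin f" "f x0 = of_real l"
    "\<And>x c. x \<in> carrier X \<Longrightarrow> \<forall>\<^sub>F n in sequentially. cmod (L n x) \<le> c \<Longrightarrow> cmod (f x) \<le> c"
proof -
  define S where "S x = {c. \<forall>\<^sub>F n in sequentially. cmod (L n x) \<le> c}" for x
  define p where "p x = Inf (S x)" for x
  have ne: "S x \<noteq> {}" if "x \<in> carrier X" for x using bnd[OF that] unfolding S_def by (auto intro!: eventuallyI)
  have pos: "0 \<le> c" if c: "c \<in> S x" for x c
  proof -
    obtain n where "cmod (L n x) \<le> c"
      using c unfolding S_def eventually_sequentially by blast
    then show ?thesis using norm_ge_zero[of "L n x"] by linarith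
  qed
  have bdd: "bdd_below (S x)" for x using pos by (auto intro!: bdd_belowI)
  have ple: "p x \<le> c" if "c \<in> S x" for x c
    unfolding p_def by (rule cInf_lower[OF that bdd])
  have pge: "c \<le> p x" if "x \<in> carrier X" "\<And>d. d \<in> S x \<Longrightarrow> c \<le> d" for c x
    unfolding p_def by (rule cInf_greatest[OF ne]) (use that in auto)
  have p_hom: "p (c \<odot> x) \<le> cmod c * p x" if x: "x \<in> carrier X" for c x
  proof (cases "c = 0")
    case True
    then show ?thesis using x linD(2)[OF L x, of _ 0] by (auto intro!: ple simp: S_def)
  next
    case False
    have "p (c \<odot> x) / cmod c \<le> d" if "d \<in> S x" for d
    proof -
      have "cmod c * d \<in> S (c \<odot> x)" using that x unfolding S_def
        by (auto simp: linD(2)[OF L x] norm_mult elim!: eventually_mono intro!: mult_left_mono)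
      from ple[OF this] show ?thesis using False by (simp add: field_simps)
    qed
    then have "p (c \<odot> x) / cmod c \<le> p x" by (intro pge x)
    then show ?thesis using False by (simp add: field_simps)
  qed
  have hom: "p (c \<odot> x) = cmod c * p x" if x: "x \<in> carrier X" for c x
  proof (rule antisym[OF p_hom[OF x]])
    show "cmod c * p x \<le> p (c \<odot> x)"
    proof (cases "c = 0")
      case True then show ?thesis using x pos by (auto intro!: pge)
    next
      case False
      then show ?thesis using p_hom[of "c \<odot> x" "1/c"] x by (simp add: sm_sm norm_divide field_simps)
    qed
  qed
  have add: "p (x \<oplus> y) \<le> p x + p y" if x: "x \<in> carrier X" and y: "y \<in> carrier X" for x y
  proof -
    have *: "p (x \<oplus> y) \<le> c + d" if "c \<in> S x" "d \<in> S y" for c d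
    proof -
      have "\<forall>\<^sub>F n in sequentially. cmod (L n x) \<le> c \<and> cmod (L n y) \<le> d"
        using that unfolding S_def by (auto intro: eventually_conj)
      then have "c + d \<in> S (x \<oplus> y)"
        unfolding S_def by (auto simp: linD(1)[OF L x y] elim!: eventually_mono intro: norm_triangle_le)
      then show ?thesis by (rule ple)
    qed
    have **: "p (x \<oplus> y) - c \<le> p y" if "c \<in> S x" for c
      using *[OF that] by (intro pge y) (simp add: algebra_simps)
    have "p (x \<oplus> y) - p y \<le> p x"
      using ** by (intro pge x) (simp add: algebra_simps)
    then show ?thesis by simp
  qed
  have px0: "p x0 = l"
  proof (rule antisym)
    show "p x0 \<le> l" using ev l by (intro ple) (auto simp: S_def elim!: eventually_mono)
    show "l \<le> p x0"
    proof (rule pge[OF x0])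
      fix d assume "d \<in> S x0"
      then have "\<forall>\<^sub>F n in sequentially. l \<le> d"
        unfolding S_def mem_Collect_eq using ev by eventually_elim (use l in auto)
      then show "l \<le> d" by (auto dest!: eventually_happens'[OF sequentially_bot])
    qed
  qed
  from hahn_banach[of p, OF add hom x0] obtain f where f: "lin f" "\<And>x. x \<in> carrier X \<Longrightarrow> cmod (f x) \<le> p x"
    "f x0 = of_real (p x0)" by blast
  show thesis
  proof (rule that[OF f(1)])
    show "f x0 = of_real l" using f px0 by simp
    fix x c assume "x \<in> carrier X" "\<forall>\<^sub>F n in sequentially. cmod (L n x) \<le> c"
    then show "cmod (f x) \<le> c" using f(2)[of x] ple[of c x] by (auto simp: S_def)
  qed
qed

end

section \<open>Helly's condition and Goldstine's theorem\<close>

text \<open>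
  A point that no functional separates strictly from a bounded convex set is a limit of points of
  that set. The hypothesis \<open>sup\<close> is the absence of strict separation. Only the first
  \<open>m\<close> coordinates count; the points are sequences so that \<open>m\<close> can vary.
  The proof replaces a nearest point, which need not exist, by one that nearly minimizes the squared
  distance.\<close>
lemma helly_approx:
  fixes K :: "(nat \<Rightarrow> complex) set" and c :: "nat \<Rightarrow> complex"
  assumes ne: "K \<noteq> {}"
    and conv: "\<And>u v s. u \<in> K \<Longrightarrow> v \<in> K \<Longrightarrow> 0 \<le> s \<Longrightarrow> s \<le> 1 \<Longrightarrow>
        \<exists>w\<in>K. \<forall>i<m. w i = u i + of_real s * (v i - u i)"
    and bnd: "\<And>u i. u \<in> K \<Longrightarrow> i < m \<Longrightarrow> cmod (u i) \<le> C"
    and sup: "\<And>a e. e > 0 \<Longrightarrow> \<exists>u\<in>K. Re (\<Sum>i<m. a i * c i) \<le> Re (\<Sum>i<m. a i * u i) + e"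
    and e: "e > 0"
  shows "\<exists>u\<in>K. \<forall>i<m. cmod (u i - c i) \<le> e"
proof -
  define q where "q u = (\<Sum>i<m. (cmod (c i - u i))\<^sup>2)" for u
  define d where "d = Inf (q ` K)"
  have bdd: "bdd_below (q ` K)" by (rule bdd_belowI2[of _ 0]) (simp add: q_def sum_nonneg)
  have d: "d \<le> q u" if "u \<in> K" for u unfolding d_def using that bdd by (intro cINF_lower)
  define B where "B = (\<Sum>i<m. (2 * C)\<^sup>2)"
  have B: "(\<Sum>i<m. (cmod (v i - u i))\<^sup>2) \<le> B" if "u \<in> K" "v \<in> K" for u v
    unfolding B_def
  proof (intro sum_mono power_mono)
    fix i assume "i \<in> {..<m}"
    then show "cmod (v i - u i) \<le> 2 * C"
      using bnd[OF that(1)] bnd[OF that(2)] norm_triangle_ineq4[of "v i" "u i"] by fastforce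
  qed auto
  have B0: "B \<ge> 0" by (simp add: B_def sum_nonneg)
  (* Moving from u towards v by the fraction s cannot lower q below d, hence the first-order term at
  u is small; v is almost extremal for the direction c - u. *)
  have key: "q u \<le> (B + 1) * s + s" if u: "u \<in> K" and qu: "q u < d + s\<^sup>2" and s: "0 < s" "s \<le> 1" for u s
  proof -
    define a where "a i = cnj (c i - u i)" for i
    obtain v where v: "v \<in> K" "Re (\<Sum>i<m. a i * c i) \<le> Re (\<Sum>i<m. a i * v i) + s"
      using sup[OF s(1)] by blast
    obtain w where w: "w \<in> K" "\<And>i. i < m \<Longrightarrow> w i = u i + of_real s * (v i - u i)"
      using conv[OF u v(1), of s] s by auto
    have sq: "(cmod (c i - w i))\<^sup>2 = (cmod (c i - u i))\<^sup>2 - 2 * s * Re (a i * (v i - u i)) + s\<^sup>2 * (cmod (v i - u i))\<^sup>2"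
      if "i < m" for i
      unfolding w(2)[OF that] a_def cmod_power2 by (simp add: power2_eq_square algebra_simps)
    have "d \<le> q w" by (rule d[OF w(1)])
    also have "q w = q u - 2 * s * Re (\<Sum>i<m. a i * (v i - u i)) + s\<^sup>2 * (\<Sum>i<m. (cmod (v i - u i))\<^sup>2)"
      unfolding q_def Re_sum
      by (simp add: sq sum.distrib sum_subtractf sum_distrib_left mult.assoc del: times_complex.sel minus_complex.sel)
    also have "\<dots> \<le> q u - 2 * s * Re (\<Sum>i<m. a i * (v i - u i)) + s\<^sup>2 * B"
      using B[OF u v(1)] by (intro add_left_mono mult_left_mono) auto
    finally have "s * (2 * Re (\<Sum>i<m. a i * (v i - u i))) \<le> s * (s + s * B)"
      using qu by (simp add: power2_eq_square algebra_simps)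
    then have 1: "2 * Re (\<Sum>i<m. a i * (v i - u i)) \<le> s + s * B" using s by simp
    have "q u = Re (\<Sum>i<m. a i * (c i - u i))"
      unfolding q_def a_def cmod_power2 by (simp add: power2_eq_square algebra_simps)
    also have "\<dots> = Re (\<Sum>i<m. a i * c i) - Re (\<Sum>i<m. a i * u i)"
      by (simp add: right_diff_distrib sum_subtractf)
    also have "\<dots> \<le> Re (\<Sum>i<m. a i * v i) + s - Re (\<Sum>i<m. a i * u i)" using v by simp
    also have "\<dots> = Re (\<Sum>i<m. a i * (v i - u i)) + s" by (simp add: right_diff_distrib sum_subtractf)
    also have "\<dots> \<le> (s + s * B) / 2 + s" using 1 by simp
    also have "\<dots> \<le> (B + 1) * s + s" using s B0 by (simp add: field_simps)
    finally show ?thesis .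
  qed
  define s where "s = min 1 (e\<^sup>2 / (B + 2))"
  have s: "0 < s" "s \<le> 1" using e B0 by (auto simp: s_def)
  have "d < d + s\<^sup>2" using s by simp
  then obtain u where u: "u \<in> K" "q u < d + s\<^sup>2"
    using cINF_less_iff[of K q "d + s\<^sup>2"] ne bdd unfolding d_def by blast
  have "q u \<le> (B + 2) * s" using key[OF u s] by (simp add: algebra_simps)
  also have "\<dots> \<le> (B + 2) * (e\<^sup>2 / (B + 2))" using B0 by (intro mult_left_mono) (auto simp: s_def)
  also have "\<dots> = e\<^sup>2" using B0 by simp
  finally have q: "q u \<le> e\<^sup>2" .
  have "cmod (u i - c i) \<le> e" if "i < m" for i
  proof -
    have "(cmod (c i - u i))\<^sup>2 \<le> q u" unfolding q_def using that by (intro member_le_sum) auto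
    then have "(cmod (c i - u i))\<^sup>2 \<le> e\<^sup>2" using q by simp
    then have "cmod (c i - u i) \<le> e" using e by (simp add: power2_le_iff_abs_le)
    then show ?thesis by (simp add: norm_minus_commute)
  qed
  then show ?thesis using u by blast
qed

context complex_normed_space
begin

text \<open>
  Elements of the bidual with a norm bound, without the requirement of being extensional.\<close>
definition bidual :: "real \<Rightarrow> (('a \<Rightarrow> complex) \<Rightarrow> complex) \<Rightarrow> bool" where
  "bidual M F \<longleftrightarrow> complex_normed_space.bl (dual X) M F"

lemma bidualD:
  assumes F: "bidual M F" 
  shows "f \<in> carrier (dual X) \<Longrightarrow> g \<in> carrier (dual X) \<Longrightarrow> F (f \<oplus>\<^bsub>dual X\<^esub> g) = F f + F g"
    "f \<in> carrier (dual X) \<Longrightarrow> F (c \<odot>\<^bsub>dual X\<^esub> f) = c * F f"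
    "f \<in> carrier (dual X) \<Longrightarrow> cmod (F f) \<le> M * nrm (dual X) f"
proof -
  interpret D: complex_normed_space "dual X" by (rule complex_normed_space_dual)
  show "f \<in> carrier (dual X) \<Longrightarrow> g \<in> carrier (dual X) \<Longrightarrow> F (f \<oplus>\<^bsub>dual X\<^esub> g) = F f + F g"
    "f \<in> carrier (dual X) \<Longrightarrow> F (c \<odot>\<^bsub>dual X\<^esub> f) = c * F f"
    "f \<in> carrier (dual X) \<Longrightarrow> cmod (F f) \<le> M * nrm (dual X) f"
    using F unfolding bidual_def D.bl_def D.lin_def by auto
qed

lemma in_bidual_iff:
  "F \<in> carrier (dual (dual X)) \<longleftrightarrow> F \<in> extensional (carrier (dual X)) \<and> (\<exists>M. bidual M F)"
proof -
  interpret D: complex_normed_space "dual X" by (rule complex_normed_space_dual)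
  show ?thesis unfolding D.carrier_dual bidual_def by auto
qed

lemma dual_bl: "f \<in> carrier (dual X) \<Longrightarrow> bl (nrm (dual X) f) f"
  using bl_nrm_dual by (auto simp: carrier_dual)

lemma lin_comb_dual:
  fixes m :: nat
  assumes "\<And>i. i < m \<Longrightarrow> f i \<in> carrier (dual X)"
  shows "(\<lambda>x\<in>carrier X. \<Sum>i<m. a i * f i x) \<in> carrier (dual X) \<and>
    (\<forall>M F. bidual M F \<longrightarrow> F (\<lambda>x\<in>carrier X. \<Sum>i<m. a i * f i x) = (\<Sum>i<m. a i * F (f i)))"
  using assms
proof (induction m)
  interpret D: complex_normed_space "dual X" by (rule complex_normed_space_dual)
  case 0
  have "(\<lambda>x\<in>carrier X. \<Sum>i<0. a i * f i x) = \<zero>\<^bsub>dual X\<^esub>" by (simp add: dual_simps)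
  moreover have "F \<zero>\<^bsub>dual X\<^esub> = 0" if "bidual M F" for M F
    using bidualD(2)[OF that D.M.zero_closed, of 0] by simp
  ultimately show ?case by (metis D.M.zero_closed lessThan_0 sum.empty)
next
  interpret D: complex_normed_space "dual X" by (rule complex_normed_space_dual)
  case (Suc m)
  let ?g = "\<lambda>x\<in>carrier X. \<Sum>i<m. a i * f i x"
  have eq: "(\<lambda>x\<in>carrier X. \<Sum>i<Suc m. a i * f i x) = ?g \<oplus>\<^bsub>dual X\<^esub> (a m \<odot>\<^bsub>dual X\<^esub> f m)"
    by (auto simp: dual_simps)
  have "?g \<in> carrier (dual X) \<and> (\<forall>M F. bidual M F \<longrightarrow> F ?g = (\<Sum>i<m. a i * F (f i)))"
    by (rule Suc.IH) (simp add: Suc.prems)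
  then have g: "?g \<in> carrier (dual X)" "\<And>M F. bidual M F \<Longrightarrow> F ?g = (\<Sum>i<m. a i * F (f i))"
    by blast+
  have fm: "f m \<in> carrier (dual X)" using Suc.prems by auto
  have "F (?g \<oplus>\<^bsub>dual X\<^esub> (a m \<odot>\<^bsub>dual X\<^esub> f m)) = (\<Sum>i<Suc m. a i * F (f i))" if F: "bidual M F" for M F
    using bidualD(1)[OF F g(1) D.sm_closed[OF fm, of "a m"]] bidualD(2)[OF F fm, of "a m"] g(2) F by simp
  then show ?case unfolding eq using D.M.a_closed[OF g(1) D.sm_closed[OF fm, of "a m"]] by blast
qed

lemma rotate_to_real:
  fixes z :: complex obtains c where "cmod c = 1" "c * z = of_real (cmod z)"
proof (cases "z = 0")
  case False
  have "cnj (sgn z) * z = of_real (cmod z)"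
    using False by (simp add: sgn_div_norm scaleR_conv_of_real field_simps complex_norm_square[symmetric] power2_eq_square)
  then show thesis using that[of "cnj (sgn z)"] False by (simp add: norm_sgn)
qed (use that[of 1] in auto)

lemma almost_norming:
  assumes f: "f \<in> carrier (dual X)" and e: "e > 0"
  obtains x where "x \<in> carrier X" "nrm X x \<le> 1" "nrm (dual X) f \<le> Re (f x) + e"
proof -
  have "\<exists>x\<in>carrier X. nrm X x \<le> 1 \<and> nrm (dual X) f - e < cmod (f x)"
  proof (rule ccontr)
    assume "\<not> ?thesis"
    then have le: "cmod (f x) \<le> nrm (dual X) f - e" if "x \<in> carrier X" "nrm X x \<le> 1" for x
      using that by force
    have "bl (nrm (dual X) f - e) f" unfolding bl_def
    proof (intro conjI ballI)
      show l: "lin f" using dual_bl[OF f] by (simp add: bl_def)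
      fix x assume x: "x \<in> carrier X"
      show "cmod (f x) \<le> (nrm (dual X) f - e) * nrm X x"
      proof (cases "nrm X x = 0")
        case True
        then show ?thesis using bl_le[OF dual_bl[OF f] x] by simp
      next
        case False
        then have n: "nrm X x > 0" using nrm_nonneg[OF x] by simp
        have "cmod (f (of_real (1 / nrm X x) \<odot> x)) \<le> nrm (dual X) f - e"
          using n x by (intro le) (auto simp: nrm_smult norm_divide)
        then show ?thesis using n linD(2)[OF l x] by (simp add: norm_mult norm_divide field_simps)
      qed
    qed
    moreover have "nrm (dual X) f - e \<ge> 0" using order_trans[OF norm_ge_zero le[of \<zero>]] by simp
    ultimately have "nrm (dual X) f \<le> nrm (dual X) f - e" by (rule nrm_dual_le)
    then show False using e by simp
  qed
  then obtain x where x: "x \<in> carrier X" "nrm X x \<le> 1" "nrm (dual X) f - e < cmod (f x)" by blast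
  obtain c where c: "cmod c = 1" "c * f x = of_real (cmod (f x))" by (rule rotate_to_real)
  have "f (c \<odot> x) = of_real (cmod (f x))"
    using linD(2)[OF bl_lin[OF dual_bl[OF f]] x(1)] c by simp
  then show thesis using that[of "c \<odot> x"] x c by (simp add: nrm_smult)
qed

text \<open>
  The values at \<open>f 0, \<dots>, f (m - 1)\<close> of the vectors of norm at most
  \<open>M\<close> form a bounded convex set, and \<open>F\<close> cannot be separated from it: a
  combination of the \<open>f i\<close> nearly attains its norm on a vector of the unit ball.\<close>
lemma goldstine:
  fixes m :: nat
  assumes F: "bidual M F" and f: "\<And>i. i < m \<Longrightarrow> f i \<in> carrier (dual X)" and e: "e > 0" and M: "M > 0"
  obtains x where "x \<in> carrier X" "nrm X x \<le> M" "\<And>i. i < m \<Longrightarrow> cmod (f i x - F (f i)) \<le> e"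
proof -
  define K where "K = (\<lambda>x i. f i x) ` {x \<in> carrier X. nrm X x \<le> M}"
  have "\<exists>u\<in>K. \<forall>i<m. cmod (u i - F (f i)) \<le> e"
  proof (rule helly_approx[where C = "Max ((\<lambda>i. nrm (dual X) (f i) * M) ` {..<m})"])
    show "K \<noteq> {}" using M M.zero_closed unfolding K_def by (auto intro!: exI[of _ \<zero>])
  next
    fix u v and s :: real assume "u \<in> K" "v \<in> K" and s: "0 \<le> s" "s \<le> 1"
    then obtain x y where x: "x \<in> carrier X" "nrm X x \<le> M" "u = (\<lambda>i. f i x)"
      and y: "y \<in> carrier X" "nrm X y \<le> M" "v = (\<lambda>i. f i y)" unfolding K_def by auto
    let ?z = "of_real (1 - s) \<odot> x \<oplus> of_real s \<odot> y"
    have "nrm X ?z \<le> nrm X (of_real (1 - s) \<odot> x) + nrm X (of_real s \<odot> y)"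
      using x y by (intro nrm_triangle) auto
    also have "\<dots> = (1 - s) * nrm X x + s * nrm X y" using x y s by (simp add: nrm_smult del: of_real_diff)
    also have "\<dots> \<le> (1 - s) * M + s * M" using x y s by (intro add_mono mult_left_mono) auto
    finally have "nrm X ?z \<le> M" by (simp add: algebra_simps)
    moreover have "f i ?z = u i + of_real s * (v i - u i)" if "i < m" for i
      using linD[OF bl_lin[OF dual_bl[OF f[OF that]]]] x y by (simp add: algebra_simps)
    ultimately show "\<exists>w\<in>K. \<forall>i<m. w i = u i + of_real s * (v i - u i)"
      unfolding K_def using x y by (intro bexI[of _ "\<lambda>i. f i ?z"]) auto
  next
    fix u i assume "u \<in> K" and i: "i < m"
    then obtain x where x: "x \<in> carrier X" "nrm X x \<le> M" "u = (\<lambda>i. f i x)" unfolding K_def by auto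
    have "cmod (u i) \<le> nrm (dual X) (f i) * nrm X x" using bl_le[OF dual_bl[OF f[OF i]] x(1)] x by simp
    also have "\<dots> \<le> nrm (dual X) (f i) * M"
      using x nrm_dual_nonneg[OF dual_bl[OF f[OF i]]] by (intro mult_left_mono)
    also have "\<dots> \<le> Max ((\<lambda>i. nrm (dual X) (f i) * M) ` {..<m})" using i by (intro Max_ge) auto
    finally show "cmod (u i) \<le> Max ((\<lambda>i. nrm (dual X) (f i) * M) ` {..<m})" .
  next
    fix a and e :: real assume e: "e > 0"
    let ?g = "\<lambda>x\<in>carrier X. \<Sum>i<m. a i * f i x"
    have g: "?g \<in> carrier (dual X)" "F ?g = (\<Sum>i<m. a i * F (f i))"
      using lin_comb_dual[of m f a] f F by blast+
    obtain x where x: "x \<in> carrier X" "nrm X x \<le> 1" "nrm (dual X) ?g \<le> Re (?g x) + e / M"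
      using almost_norming[OF g(1), of "e / M"] e M by auto
    let ?y = "of_real M \<odot> x"
    have "Re (\<Sum>i<m. a i * F (f i)) \<le> cmod (F ?g)" unfolding g(2)[symmetric] by (rule complex_Re_le_cmod)
    also have "\<dots> \<le> M * nrm (dual X) ?g" using F g(1) by (rule bidualD(3))
    also have "\<dots> \<le> M * (Re (?g x) + e / M)" using x M by (intro mult_left_mono) auto
    also have "\<dots> = Re (of_real M * ?g x) + e" using M by (simp add: algebra_simps)
    also have "of_real M * ?g x = (\<Sum>i<m. a i * f i ?y)"
      using x by (simp add: sum_distrib_left linD(2)[OF bl_lin[OF dual_bl[OF f]]] mult_ac)
    finally have "Re (\<Sum>i<m. a i * F (f i)) \<le> Re (\<Sum>i<m. a i * f i ?y) + e" .
    moreover have "(\<lambda>i. f i ?y) \<in> K" unfolding K_def using x M by (auto simp: nrm_smult)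
    ultimately show "\<exists>u\<in>K. Re (\<Sum>i<m. a i * F (f i)) \<le> Re (\<Sum>i<m. a i * u i) + e"
      by (intro bexI[of _ "\<lambda>i. f i ?y"])
  qed (use e in auto)
  then show thesis using that unfolding K_def by auto
qed

text \<open>
  Here Helly's condition is used in the dual space for the functionals
  \<open>x 0, \<dots>, x (m - 1), F\<close> on it. The condition holds because
  \<open>F\<close> has distance at least \<open>d\<close> from every combination of the
  \<open>x i\<close>.\<close>
lemma separating_functional:
  fixes m :: nat
  assumes F: "bidual M F" and M: "M > 0"
    and d: "d > 0" "\<And>x. x \<in> carrier X \<Longrightarrow> \<exists>g\<in>carrier (dual X). nrm (dual X) g \<le> 1 \<and> d \<le> cmod (F g - g x)"
    and x: "\<And>i. i < m \<Longrightarrow> x i \<in> carrier X" and e: "e > 0"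
  obtains g where "g \<in> carrier (dual X)" "nrm (dual X) g \<le> 1" "cmod (F g - of_real d) \<le> e"
    "\<And>i. i < m \<Longrightarrow> cmod (g (x i)) \<le> e"
proof -
  interpret D: complex_normed_space "dual X" by (rule complex_normed_space_dual)
  define ev where "ev g i = (if i < m then g (x i) else F g)" for g :: "'a \<Rightarrow> complex" and i
  define c where "c i = (if i < m then 0 else of_real d :: complex)" for i
  define K where "K = ev ` {g \<in> carrier (dual X). nrm (dual X) g \<le> 1}"
  define C where "C = Max (insert M ((\<lambda>i. nrm X (x i)) ` {..<m}))"
  have Cge: "M \<le> C" "\<And>i. i < m \<Longrightarrow> nrm X (x i) \<le> C" unfolding C_def by (auto intro!: Max_ge)
  have ev_add: "ev (g \<oplus>\<^bsub>dual X\<^esub> h) i = ev g i + ev h i" if "g \<in> carrier (dual X)" "h \<in> carrier (dual X)" for g h i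
    by (cases "i < m") (use that x bidualD(1)[OF F that] in \<open>auto simp: ev_def dual_simps(2)\<close>)
  have ev_sm: "ev (c \<odot>\<^bsub>dual X\<^esub> g) i = c * ev g i" if "g \<in> carrier (dual X)" for g c i
    by (cases "i < m") (use that x bidualD(2)[OF F that] in \<open>auto simp: ev_def dual_simps(3)\<close>)
  have "\<exists>u\<in>K. \<forall>i<Suc m. cmod (u i - c i) \<le> e"
  proof (rule helly_approx[where C = C])
    show "K \<noteq> {}" unfolding K_def by (auto intro!: exI[of _ "\<zero>\<^bsub>dual X\<^esub>"])
  next
    fix u v and s :: real assume "u \<in> K" "v \<in> K" and s: "0 \<le> s" "s \<le> 1"
    then obtain f g where f: "f \<in> carrier (dual X)" "nrm (dual X) f \<le> 1" "u = ev f"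
      and g: "g \<in> carrier (dual X)" "nrm (dual X) g \<le> 1" "v = ev g" unfolding K_def by auto
    let ?z = "of_real (1 - s) \<odot>\<^bsub>dual X\<^esub> f \<oplus>\<^bsub>dual X\<^esub> of_real s \<odot>\<^bsub>dual X\<^esub> g"
    have "nrm (dual X) ?z \<le> nrm (dual X) (of_real (1 - s) \<odot>\<^bsub>dual X\<^esub> f) + nrm (dual X) (of_real s \<odot>\<^bsub>dual X\<^esub> g)"
      using f g by (intro D.nrm_triangle) auto
    also have "\<dots> = (1 - s) * nrm (dual X) f + s * nrm (dual X) g"
      using f g s by (simp add: D.nrm_smult del: of_real_diff)
    also have "\<dots> \<le> (1 - s) * 1 + s * 1" using f g s by (intro add_mono mult_left_mono) auto
    finally have "nrm (dual X) ?z \<le> 1" by simp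
    moreover have "ev ?z i = u i + of_real s * (v i - u i)" for i
      using f g by (simp add: ev_add ev_sm algebra_simps)
    ultimately show "\<exists>w\<in>K. \<forall>i<Suc m. w i = u i + of_real s * (v i - u i)"
      unfolding K_def using f g by (intro bexI[of _ "ev ?z"]) auto
  next
    fix u i assume "u \<in> K" and i: "i < Suc m"
    then obtain f where f: "f \<in> carrier (dual X)" "nrm (dual X) f \<le> 1" "u = ev f" unfolding K_def by auto
    show "cmod (u i) \<le> C"
    proof (cases "i < m")
      case True
      have "cmod (f (x i)) \<le> nrm (dual X) f * nrm X (x i)" using bl_le[OF dual_bl[OF f(1)] x[OF True]] .
      also have "\<dots> \<le> 1 * nrm X (x i)" using f nrm_nonneg[OF x[OF True]] by (intro mult_right_mono)
      finally show ?thesis using True f Cge(2)[OF True] by (simp add: ev_def)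
    next
      case False
      have "cmod (F f) \<le> M * nrm (dual X) f" using bidualD(3)[OF F f(1)] .
      also have "\<dots> \<le> M * 1" using f M by (intro mult_left_mono) auto
      finally show ?thesis using False f Cge(1) by (simp add: ev_def)
    qed
  next
    fix a and e :: real assume e: "e > 0"
    show "\<exists>u\<in>K. Re (\<Sum>i<Suc m. a i * c i) \<le> Re (\<Sum>i<Suc m. a i * u i) + e"
    proof (cases "a m = 0")
      case True
      have "ev \<zero>\<^bsub>dual X\<^esub> i = 0" for i using ev_sm[OF D.M.zero_closed, of 0] by simp
      moreover have "ev \<zero>\<^bsub>dual X\<^esub> \<in> K" unfolding K_def by auto
      moreover have "(\<Sum>i<Suc m. a i * c i) = 0" using True by (simp add: c_def)
      ultimately show ?thesis using e by (intro bexI[of _ "ev \<zero>\<^bsub>dual X\<^esub>"]) simp_all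
    next
      case False
      define y where "y = (\<Oplus>i\<in>{..<m}. (- a i / a m) \<odot> x i)"
      have y: "y \<in> carrier X" unfolding y_def using x by (intro M.finsum_closed) auto
      obtain g where g: "g \<in> carrier (dual X)" "nrm (dual X) g \<le> 1" "d \<le> cmod (F g - g y)"
        using d(2)[OF y] by blast
      have l: "lin g" using bl_lin[OF dual_bl[OF g(1)]] .
      have gy: "g y = (\<Sum>i<m. (- a i / a m) * g (x i))"
        unfolding y_def using lin_finsum[OF l, of "{..<m}" "\<lambda>i. (- a i / a m) \<odot> x i"] x linD(2)[OF l] by simp
      obtain w where w: "cmod w = 1" "w * (a m * (F g - g y)) = of_real (cmod (a m * (F g - g y)))"
        by (rule rotate_to_real)
      let ?h = "w \<odot>\<^bsub>dual X\<^esub> g"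
      have "(\<Sum>i<Suc m. a i * ev ?h i) = w * (\<Sum>i<Suc m. a i * ev g i)"
        using g(1) by (simp add: ev_sm sum_distrib_left algebra_simps)
      also have "(\<Sum>i<Suc m. a i * ev g i) = a m * (F g - g y)"
        using False by (simp add: ev_def gy right_diff_distrib sum_distrib_left sum_negf distrib_left)
      finally have "Re (\<Sum>i<Suc m. a i * ev ?h i) = cmod (a m) * cmod (F g - g y)"
        by (simp only: w(2) norm_mult Re_complex_of_real)
      moreover have "Re (\<Sum>i<Suc m. a i * c i) \<le> cmod (a m) * d"
        using d(1) complex_Re_le_cmod[of "a m"] by (auto simp: c_def intro!: mult_right_mono)
      moreover have "cmod (a m) * d \<le> cmod (a m) * cmod (F g - g y)" using g by (intro mult_left_mono) auto
      moreover have "ev ?h \<in> K" unfolding K_def using g w by (auto simp: D.nrm_smult)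
      ultimately show ?thesis using e by (intro bexI[of _ "ev ?h"]) auto
    qed
  qed (use e in auto)
  then obtain g where g: "g \<in> carrier (dual X)" "nrm (dual X) g \<le> 1" "\<And>i. i < Suc m \<Longrightarrow> cmod (ev g i - c i) \<le> e"
    unfolding K_def by auto
  show thesis
  proof (rule that[OF g(1,2)])
    show "cmod (F g - of_real d) \<le> e" using g(3)[of m] by (simp add: ev_def c_def)
    show "cmod (g (x i)) \<le> e" if "i < m" for i using g(3)[of i] that by (simp add: ev_def c_def)
  qed
qed

lemma canonical_in_bidual:
  assumes x: "x \<in> carrier X" shows "canonical_embedding X x \<in> carrier (dual (dual X))"
proof -
  interpret D: complex_normed_space "dual X" by (rule complex_normed_space_dual)
  have "D.bl (nrm X x) (canonical_embedding X x)"
    unfolding D.bl_def D.lin_def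
  proof (intro conjI ballI allI)
    fix f g assume f: "f \<in> carrier (dual X)" and g: "g \<in> carrier (dual X)"
    show "canonical_embedding X x (f \<oplus>\<^bsub>dual X\<^esub> g) = canonical_embedding X x f + canonical_embedding X x g"
      using D.M.a_closed[OF f g] f g x by (simp add: canonical_embedding_def) (simp add: dual_simps)
  next
    fix c f assume f: "f \<in> carrier (dual X)"
    show "canonical_embedding X x (c \<odot>\<^bsub>dual X\<^esub> f) = c * canonical_embedding X x f"
      using D.sm_closed[OF f, of c] f x by (simp add: canonical_embedding_def) (simp add: dual_simps)
  next
    fix f assume f: "f \<in> carrier (dual X)"
    show "cmod (canonical_embedding X x f) \<le> nrm X x * nrm (dual X) f"
      using bl_le[OF dual_bl[OF f] x] f by (simp add: canonical_embedding_def mult.commute)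
  qed
  then show ?thesis by (auto simp: D.carrier_dual canonical_embedding_def)
qed

end

section \<open>James sequences and reflexivity\<close>

context complex_normed_space
begin

lemma mcomplete_nrm_iff:
  "Metric_space.mcomplete (carrier X) (nrm_dist X) \<longleftrightarrow>
    (\<forall>\<sigma>. (\<forall>n::nat. \<sigma> n \<in> carrier X) \<longrightarrow> (\<forall>e>0. \<exists>N. \<forall>m\<ge>N. \<forall>n\<ge>N. nrm X (\<sigma> m \<ominus> \<sigma> n) < e) \<longrightarrow>
      (\<exists>x\<in>carrier X. \<forall>e>0. \<exists>N. \<forall>n\<ge>N. nrm X (\<sigma> n \<ominus> x) < e))"
proof -
  interpret Metric_space "carrier X" "nrm_dist X" by (rule Metric_space_nrm_dist)
  have *: "MCauchy \<sigma> \<longleftrightarrow> (\<forall>n. \<sigma> n \<in> carrier X) \<and> (\<forall>e>0. \<exists>N. \<forall>m\<ge>N. \<forall>n\<ge>N. nrm X (\<sigma> m \<ominus> \<sigma> n) < e)" for \<sigma>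
    unfolding MCauchy_def image_subset_iff nrm_dist_def by (auto simp: image_subset_iff)
  have **: "limitin mtopology \<sigma> x sequentially \<longleftrightarrow> x \<in> carrier X \<and> (\<forall>e>0. \<exists>N. \<forall>n\<ge>N. nrm X (\<sigma> n \<ominus> x) < e)"
    if "\<forall>n. \<sigma> n \<in> carrier X" for \<sigma> x
    unfolding limit_metric_sequentially nrm_dist_def using that by auto
  show ?thesis unfolding mcomplete_def
  proof (rule iff_allI)
    fix \<sigma>
    show "(MCauchy \<sigma> \<longrightarrow> (\<exists>x. limitin mtopology \<sigma> x sequentially)) \<longleftrightarrow>
      ((\<forall>n. \<sigma> n \<in> carrier X) \<longrightarrow> (\<forall>e>0. \<exists>N. \<forall>m\<ge>N. \<forall>n\<ge>N. nrm X (\<sigma> m \<ominus> \<sigma> n) < e) \<longrightarrow>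
      (\<exists>x\<in>carrier X. \<forall>e>0. \<exists>N. \<forall>n\<ge>N. nrm X (\<sigma> n \<ominus> x) < e))"
      by (cases "\<forall>n. \<sigma> n \<in> carrier X") (simp_all only: * ** Bex_def simp_thms)
  qed
qed

text \<open>
  In a Banach space the image of the canonical embedding is closed. An element \<open>F\<close> of
  the bidual outside the image therefore has positive distance from it; points approximating
  \<open>F\<close> would form a Cauchy sequence whose limit represents \<open>F\<close>.\<close>
lemma nonreflexive_witness:
  assumes comp: "Metric_space.mcomplete (carrier X) (nrm_dist X)" and nr: "\<not> reflexive X"
  shows "\<exists>F M d. bidual M F \<and> M > 0 \<and> d > 0 \<and>
    (\<forall>x\<in>carrier X. \<exists>g\<in>carrier (dual X). nrm (dual X) g \<le> 1 \<and> d \<le> cmod (F g - g x))"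
proof -
  interpret D: complex_normed_space "dual X" by (rule complex_normed_space_dual)
  obtain F where F: "F \<in> carrier (dual (dual X))" "F \<notin> canonical_embedding X ` carrier X"
    using nr canonical_in_bidual unfolding reflexive_def by blast
  obtain M0 where M0: "bidual M0 F" "F \<in> extensional (carrier (dual X))" using F in_bidual_iff by blast
  define M where "M = max M0 1"
  have M: "bidual M F" "M > 0" using M0 D.bl_mono unfolding bidual_def M_def by auto
  have "\<exists>d>0. \<forall>x\<in>carrier X. \<exists>g\<in>carrier (dual X). nrm (dual X) g \<le> 1 \<and> d \<le> cmod (F g - g x)"
  proof (rule ccontr)
    assume "\<not> ?thesis"
    then have "\<exists>x\<in>carrier X. \<forall>g\<in>carrier (dual X). nrm (dual X) g \<le> 1 \<longrightarrow> cmod (F g - g x) < e" if "e > 0" for e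
      using that by (meson not_le)
    from this[of "inverse (real (Suc n))" for n]
    have "\<exists>x\<in>carrier X. \<forall>g\<in>carrier (dual X). nrm (dual X) g \<le> 1 \<longrightarrow> cmod (F g - g x) < inverse (real (Suc n))" for n
      by simp
    then obtain s where s: "\<And>n. s n \<in> carrier X"
      "\<And>n g. g \<in> carrier (dual X) \<Longrightarrow> nrm (dual X) g \<le> 1 \<Longrightarrow> cmod (F g - g (s n)) < inverse (real (Suc n))"
      by metis
    have cau: "nrm X (s m \<ominus> s n) < inverse (real (Suc m)) + inverse (real (Suc n))" for m n
    proof -
      obtain g where g: "bl 1 g" "g (s m \<ominus> s n) = of_real (nrm X (s m \<ominus> s n))"
        using norming_functional[of "s m \<ominus> s n"] s by blast
      let ?g = "restrict g (carrier X)"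
      have g': "?g \<in> carrier (dual X)" "nrm (dual X) ?g \<le> 1"
        using restrict_in_dual[OF g(1)] nrm_dual_le[OF bl_restrict[OF g(1)]] by auto
      have "nrm X (s m \<ominus> s n) = cmod (g (s m \<ominus> s n))" using g s by (simp add: nrm_nonneg)
      also have "\<dots> = cmod ((F ?g - ?g (s n)) - (F ?g - ?g (s m)))"
        using s lin_minus[OF bl_lin[OF g(1)]] by simp
      also have "\<dots> \<le> cmod (F ?g - ?g (s n)) + cmod (F ?g - ?g (s m))" by (rule norm_triangle_ineq4)
      also have "\<dots> < inverse (real (Suc n)) + inverse (real (Suc m))"
        using s(2)[OF g', of n] s(2)[OF g', of m] by simp
      finally show ?thesis by simp
    qed
    have "\<exists>x\<in>carrier X. \<forall>e>0. \<exists>N. \<forall>n\<ge>N. nrm X (s n \<ominus> x) < e"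
    proof (rule comp[unfolded mcomplete_nrm_iff, rule_format])
      fix e :: real assume "e > 0"
      then obtain N where N: "inverse (real (Suc N)) < e / 2" using reals_Archimedean[of "e / 2"] by auto
      have small: "inverse (real (Suc n)) < e / 2" if "n \<ge> N" for n
        using N that by (meson inverse_le_iff_le le_less_trans of_nat_0_less_iff of_nat_mono not_less_eq_eq zero_less_Suc Suc_le_mono)
      show "\<exists>N. \<forall>m\<ge>N. \<forall>n\<ge>N. nrm X (s m \<ominus> s n) < e"
      proof (intro exI allI impI)
        fix m n assume "m \<ge> N" "n \<ge> N"
        then show "nrm X (s m \<ominus> s n) < e" using cau[of m n] small[of m] small[of n] by linarith
      qed
    qed (rule s(1))
    then obtain x where x: "x \<in> carrier X" "\<And>e. e > 0 \<Longrightarrow> \<exists>N. \<forall>n\<ge>N. nrm X (s n \<ominus> x) < e" by blast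
    have eq1: "F g = g x" if g: "g \<in> carrier (dual X)" "nrm (dual X) g \<le> 1" for g
    proof -
      have "cmod (F g - g x) \<le> e" if e: "e > 0" for e
      proof -
        obtain N where N: "\<And>n. n \<ge> N \<Longrightarrow> nrm X (s n \<ominus> x) < e / 2" using x(2)[of "e/2"] e by auto
        obtain K where K: "inverse (real (Suc K)) < e / 2" using reals_Archimedean[of "e / 2"] e by auto
        define n where "n = max N K"
        have n: "inverse (real (Suc n)) \<le> inverse (real (Suc K))" unfolding n_def by (intro le_imp_inverse_le) auto
        have "cmod (g (s n) - g x) \<le> nrm (dual X) g * nrm X (s n \<ominus> x)"
          using bl_le[OF dual_bl[OF g(1)], of "s n \<ominus> x"] s x lin_minus[OF bl_lin[OF dual_bl[OF g(1)]]] by simp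
        also have "\<dots> \<le> 1 * nrm X (s n \<ominus> x)" using g s x by (intro mult_right_mono nrm_nonneg) auto
        also have "\<dots> < e / 2" using N[of n] by (simp add: n_def)
        finally have 1: "cmod (g (s n) - g x) < e / 2" .
        have 2: "cmod (F g - g (s n)) < e / 2" using s(2)[OF g, of n] n K by linarith
        have "cmod (F g - g x) \<le> cmod (F g - g (s n)) + cmod (g (s n) - g x)"
          using norm_triangle_ineq[of "F g - g (s n)" "g (s n) - g x"] by simp
        then show ?thesis using 1 2 by simp
      qed
      then have "cmod (F g - g x) \<le> 0" by (rule field_le_epsilon[where y = 0, simplified]) auto
      then show ?thesis by simp
    qed
    have eq: "F g = g x" if g: "g \<in> carrier (dual X)" for g
    proof -
      define r where "r = nrm (dual X) g + 1"
      have r: "r > 0" using D.nrm_nonneg[OF g] by (simp add: r_def)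
      let ?h = "of_real (1 / r) \<odot>\<^bsub>dual X\<^esub> g"
      have h: "?h \<in> carrier (dual X)" using g by simp
      have "nrm (dual X) ?h = nrm (dual X) g / r" using g r by (simp add: D.nrm_smult norm_divide)
      also have "\<dots> \<le> 1" using r by (simp add: r_def field_simps)
      finally have "F ?h = ?h x" using eq1[OF h] by simp
      moreover have "?h x = of_real (1 / r) * g x" using x by (simp add: dual_simps(3))
      ultimately have "of_real (1 / r) * F g = of_real (1 / r) * g x"
        using bidualD(2)[OF M(1) g, of "of_real (1 / r)"] by argo
      then show ?thesis using r by simp
    qed
    have "F = canonical_embedding X x"
      using M0(2) eq by (auto simp: canonical_embedding_def fun_eq_iff extensional_def)
    then show False using F(2) x(1) by blast
  qed
  then show ?thesis using M by blast
qed

text \<open>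
  James's construction. Choose alternately a functional that is close to \<open>0\<close> on all
  vectors chosen so far although \<open>F\<close> gives it a value close to \<open>d\<close>
  (\<open>separating_functional\<close>), and a vector on which all functionals chosen so far take
  nearly the values that \<open>F\<close> gives them (\<open>goldstine\<close>).\<close>
lemma james_chain:
  assumes comp: "Metric_space.mcomplete (carrier X) (nrm_dist X)" and nr: "\<not> reflexive X"
  obtains M d where "M > 0" "d > 0"
    "\<And>n::nat. \<exists>x f. (\<forall>i<n. x i \<in> carrier X \<and> nrm X (x i) \<le> M \<and> bl 1 (f i)) \<and>
       (\<forall>i<n. \<forall>j<n. cmod (f i (x j) - (if j < i then 0 else of_real d)) \<le> d / 4)"
proof -
  obtain F M d where F: "bidual M F" and M: "M > 0" and d: "d > 0"
    "\<And>x. x \<in> carrier X \<Longrightarrow> \<exists>g\<in>carrier (dual X). nrm (dual X) g \<le> 1 \<and> d \<le> cmod (F g - g x)"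
    using nonreflexive_witness[OF assms] by auto
  have e: "d / 8 > 0" using d by simp
  have "\<exists>x f. (\<forall>i<n. x i \<in> carrier X \<and> nrm X (x i) \<le> M \<and> f i \<in> carrier (dual X) \<and> nrm (dual X) (f i) \<le> 1
      \<and> cmod (F (f i) - of_real d) \<le> d / 8) \<and>
      (\<forall>i<n. \<forall>j<n. cmod (f i (x j) - (if j < i then 0 else F (f i))) \<le> d / 8)" for n :: nat
  proof (induction n)
    case (Suc n)
    then obtain x f where IH: "\<forall>i<n. x i \<in> carrier X \<and> nrm X (x i) \<le> M \<and> f i \<in> carrier (dual X) \<and> nrm (dual X) (f i) \<le> 1
      \<and> cmod (F (f i) - of_real d) \<le> d / 8"
      "\<forall>i<n. \<forall>j<n. cmod (f i (x j) - (if j < i then 0 else F (f i))) \<le> d / 8" by blast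
    obtain g where g: "g \<in> carrier (dual X)" "nrm (dual X) g \<le> 1" "cmod (F g - of_real d) \<le> d / 8"
      "\<And>i. i < n \<Longrightarrow> cmod (g (x i)) \<le> d / 8"
      by (rule separating_functional[OF F M d, of n x, OF _ _ e]) (use IH in auto)
    define f' where "f' = f(n := g)"
    have f': "f' i \<in> carrier (dual X)" if "i < Suc n" for i
      using that IH(1) g by (auto simp: f'_def less_Suc_eq)
    obtain y where y: "y \<in> carrier X" "nrm X y \<le> M" "\<And>i. i < Suc n \<Longrightarrow> cmod (f' i y - F (f' i)) \<le> d / 8"
      by (rule goldstine[OF F f' e M, of "Suc n"]) (auto intro: that)
    have y0: "cmod (g y - F g) \<le> d / 8" using y(3)[of n] by (simp add: f'_def)
    have y1: "cmod (f i y - F (f i)) \<le> d / 8" if "i < n" for i using y(3)[of i] that by (simp add: f'_def)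
    have IH2: "cmod (f i (x j)) \<le> d / 8" if "i < n" "j < i" for i j
      using IH(2)[rule_format, of i j] that by simp
    have IH3: "cmod (f i (x j) - F (f i)) \<le> d / 8" if "i < n" "j < n" "\<not> j < i" for i j
      using IH(2)[rule_format, of i j] that by simp
    show ?case
      using IH(1) IH2 IH3 g y(1,2) y0 y1 by (intro exI[of _ "x(n := y)"] exI[of _ f']) (auto simp: f'_def less_Suc_eq)
  qed auto
  note * = this
  show thesis
  proof (rule that[OF M d(1)])
    fix n :: nat
    obtain x f where xf: "\<forall>i<n. x i \<in> carrier X \<and> nrm X (x i) \<le> M \<and> f i \<in> carrier (dual X) \<and> nrm (dual X) (f i) \<le> 1
      \<and> cmod (F (f i) - of_real d) \<le> d / 8"
      "\<forall>i<n. \<forall>j<n. cmod (f i (x j) - (if j < i then 0 else F (f i))) \<le> d / 8" using *[of n] by blast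
    have "cmod (f i (x j) - (if j < i then 0 else of_real d)) \<le> d / 4" if "i < n" "j < n" for i j
    proof (cases "j < i")
      case True
      then show ?thesis using xf(2)[rule_format, OF that] d(1) by simp
    next
      case False
      then have "cmod (f i (x j) - F (f i)) \<le> d / 8" using xf(2)[rule_format, OF that] by simp
      moreover have "cmod (F (f i) - of_real d) \<le> d / 8" using xf(1) that by blast
      ultimately show ?thesis using False norm_triangle_ineq[of "f i (x j) - F (f i)" "F (f i) - of_real d"] by simp
    qed
    moreover have "bl 1 (f i)" if "i < n" for i using xf(1) that bl_mono[OF dual_bl] by blast
    ultimately show "\<exists>x f. (\<forall>i<n. x i \<in> carrier X \<and> nrm X (x i) \<le> M \<and> bl 1 (f i)) \<and>
       (\<forall>i<n. \<forall>j<n. cmod (f i (x j) - (if j < i then 0 else of_real d)) \<le> d / 4)"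
      using xf(1) by (intro exI[of _ x] exI[of _ f]) blast
  qed
qed

text \<open>
  An infinite triangular system excludes reflexivity by interchanging two limits. A generalized
  limit of the vectors \<open>x j\<close> is represented by some \<open>w\<close>, and all
  \<open>f n\<close> take the value \<open>\<theta>\<close> at \<open>w\<close>. A generalized
  limit \<open>G\<close> of the functionals then satisfies \<open>G w = \<theta>\<close>, but it
  vanishes on every \<open>x j\<close>, hence also at their generalized limit \<open>w\<close>.\<close>
lemma james_not_reflexive:
  assumes x: "\<And>n::nat. x n \<in> carrier X" "\<And>n. nrm X (x n) \<le> C"
    and f: "\<And>n::nat. bl D (f n)"
    and fx: "\<And>n j. f n (x j) = (if n \<le> j then of_real \<theta> else 0)" and \<theta>: "\<theta> > 0" and D: "D \<ge> 0"
  shows "\<not> reflexive X"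
proof
  assume refl: "reflexive X"
  interpret D: complex_normed_space "dual X" by (rule complex_normed_space_dual)
  define r where "r n = restrict (f n) (carrier X)" for n
  have r: "r n \<in> carrier (dual X)" for n unfolding r_def by (rule restrict_in_dual[OF f])
  have ev_lin: "D.lin (\<lambda>g. g (x n))" for n
    unfolding D.lin_def using x(1) by (auto simp: dual_simps)
  have bnd: "cmod (g (x n)) \<le> nrm (dual X) g * C" if "g \<in> carrier (dual X)" for g n
  proof -
    have "cmod (g (x n)) \<le> nrm (dual X) g * nrm X (x n)" using bl_le[OF dual_bl[OF that] x(1)] .
    also have "\<dots> \<le> nrm (dual X) g * C" using x(2) D.nrm_nonneg[OF that] by (intro mult_left_mono)
    finally show ?thesis .
  qed
  have bnd': "\<exists>c. \<forall>n. cmod (g (x n)) \<le> c" if "g \<in> carrier (dual X)" for g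
    using bnd[OF that] by blast
  obtain F where F: "D.lin F" "F (r 0) = of_real \<theta>"
    "\<And>g c. g \<in> carrier (dual X) \<Longrightarrow> \<forall>\<^sub>F n in sequentially. cmod (g (x n)) \<le> c \<Longrightarrow> cmod (F g) \<le> c"
    using D.generalized_limit[of "\<lambda>n g. g (x n)" "r 0" \<theta>, OF ev_lin bnd' r] \<theta> x(1) fx
    by (auto simp: r_def)
  have "D.bl C F" unfolding D.bl_def
    using F bnd by (auto intro!: F(3) simp: mult.commute)
  then have "restrict F (carrier (dual X)) \<in> carrier (dual (dual X))" by (rule D.restrict_in_dual)
  then obtain w where w: "w \<in> carrier X" "restrict F (carrier (dual X)) = canonical_embedding X w"
    using refl unfolding reflexive_def by blast
  have Fw: "F g = g w" if "g \<in> carrier (dual X)" for g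
    using fun_cong[OF w(2), of g] that by (simp add: canonical_embedding_def)
  have fw: "f n w = of_real \<theta>" for n
  proof -
    have m: "r n \<ominus>\<^bsub>dual X\<^esub> r 0 \<in> carrier (dual X)" using r by simp
    have ev: "(r n \<ominus>\<^bsub>dual X\<^esub> r 0) (x j) = f n (x j) - f 0 (x j)" for j
      using x(1) r by (simp add: D.minus_sm dual_simps r_def)
    have "\<forall>\<^sub>F j in sequentially. cmod ((r n \<ominus>\<^bsub>dual X\<^esub> r 0) (x j)) \<le> 0"
      using eventually_ge_at_top[of n] by eventually_elim (simp add: ev fx)
    then have "cmod (F (r n \<ominus>\<^bsub>dual X\<^esub> r 0)) \<le> 0" by (rule F(3)[OF m])
    then have "F (r n) = F (r 0)" using D.lin_minus[OF F(1) r r, of n 0] by simp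
    then show ?thesis using Fw[OF r, of n] F(2) w(1) by (simp add: r_def)
  qed
  have bnd2: "\<exists>c. \<forall>n. cmod (f n u) \<le> c" if "u \<in> carrier X" for u
    using bl_le[OF f that] by blast
  obtain G where G: "lin G" "G w = of_real \<theta>"
    "\<And>u c. u \<in> carrier X \<Longrightarrow> \<forall>\<^sub>F n in sequentially. cmod (f n u) \<le> c \<Longrightarrow> cmod (G u) \<le> c"
    using generalized_limit[of f w \<theta>, OF bl_lin[OF f] bnd2 w(1)] \<theta> fw by auto
  have "bl D G" unfolding bl_def using G bl_le[OF f] by (auto intro!: G(3))
  then have Gd: "restrict G (carrier X) \<in> carrier (dual X)" by (rule restrict_in_dual)
  have "G (x j) = 0" for j
  proof -
    have "\<forall>\<^sub>F n in sequentially. cmod (f n (x j)) \<le> 0"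
      using eventually_gt_at_top[of j] by eventually_elim (simp add: fx)
    then have "cmod (G (x j)) \<le> 0" by (rule G(3)[OF x(1)])
    then show ?thesis by simp
  qed
  then have "cmod (F (restrict G (carrier X))) \<le> 0" using x(1) by (intro F(3)[OF Gd]) simp
  then have "G w = 0" using Fw[OF Gd] w(1) by simp
  then show False using G(2) \<theta> by simp
qed

end

section \<open>Uniformly convex modulars and superreflexivity\<close>

context complex_normed_space
begin

text \<open>
  The average of \<open>x a, \<dots>, x (a + 2 ^ l - 1)\<close>, organized as a binary
  tree of midpoints.\<close>
primrec dyadic :: "(nat \<Rightarrow> 'a) \<Rightarrow> nat \<Rightarrow> nat \<Rightarrow> 'a" where
  "dyadic x 0 a = x a"
| "dyadic x (Suc l) a = (1/2) \<odot> (dyadic x l a \<oplus> dyadic x l (a + 2 ^ l))"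

lemma dyadic_closed:
  "(\<And>j. a \<le> j \<Longrightarrow> j < a + 2 ^ l \<Longrightarrow> x j \<in> carrier X) \<Longrightarrow> dyadic x l a \<in> carrier X"
proof (induction l arbitrary: a)
  case (Suc l)
  have "dyadic x l a \<in> carrier X" "dyadic x l (a + 2 ^ l) \<in> carrier X"
    by (rule Suc.IH; rule Suc.prems; simp)+
  then show ?case by simp
qed simp

lemma lin_dyadic:
  assumes f: "lin f"
  shows "(\<And>j. a \<le> j \<Longrightarrow> j < a + 2 ^ l \<Longrightarrow> x j \<in> carrier X) \<Longrightarrow>
    (\<And>j. a \<le> j \<Longrightarrow> j < a + 2 ^ l \<Longrightarrow> cmod (f (x j) - c) \<le> e) \<Longrightarrow> cmod (f (dyadic x l a) - c) \<le> e"
proof (induction l arbitrary: a)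
  case (Suc l)
  have cl: "dyadic x l a \<in> carrier X" "dyadic x l (a + 2 ^ l) \<in> carrier X"
    by (rule dyadic_closed; rule Suc.prems(1); simp)+
  have 1: "cmod (f (dyadic x l a) - c) \<le> e" by (rule Suc.IH; rule Suc.prems; simp)
  have 2: "cmod (f (dyadic x l (a + 2 ^ l)) - c) \<le> e" by (rule Suc.IH; rule Suc.prems; simp)
  have "f (dyadic x (Suc l) a) - c = (1/2) * ((f (dyadic x l a) - c) + (f (dyadic x l (a + 2 ^ l)) - c))"
    using cl by (simp add: linD[OF f] field_simps)
  then have "cmod (f (dyadic x (Suc l) a) - c) = (1/2) * cmod ((f (dyadic x l a) - c) + (f (dyadic x l (a + 2 ^ l)) - c))"
    by (simp only: norm_mult) simp
  also have "\<dots> \<le> (1/2) * (e + e)" using 1 2 by (intro mult_left_mono norm_triangle_mono) auto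
  finally show ?case by simp
qed simp

end

text \<open>
  This replaces a uniformly convex norm. By the defect inequality, a half difference with large
  \<open>\<rho>\<close> forces the midpoint to have \<open>\<rho>\<close> well below the average;
  the last two conditions relate \<open>\<rho>\<close> to the norm.\<close>
locale uniformly_convex_modular = complex_normed_space +
  fixes \<rho> :: "'a \<Rightarrow> real"
  assumes rho_nonneg: "x \<in> carrier X \<Longrightarrow> 0 \<le> \<rho> x"
    and rho_defect: "t > 0 \<Longrightarrow> \<exists>K\<ge>0. \<forall>x\<in>carrier X. \<forall>y\<in>carrier X.
        \<rho> ((1/2) \<odot> (x \<ominus> y)) \<le> t * (\<rho> x + \<rho> y) + K * ((\<rho> x + \<rho> y) / 2 - \<rho> ((1/2) \<odot> (x \<oplus> y)))"
    and rho_bounded: "\<exists>R. \<forall>x\<in>carrier X. nrm X x \<le> M \<longrightarrow> \<rho> x \<le> R"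
    and rho_small: "e > 0 \<Longrightarrow> \<exists>k>0. \<forall>x\<in>carrier X. \<rho> x \<le> k \<longrightarrow> nrm X x \<le> e"
begin

text \<open>
  The amount \<open>\<eta>\<close> depends on \<open>R\<close> and \<open>k\<close> only and not on
  the level \<open>r\<close>, so the step can be iterated.\<close>
lemma midpoint_drops_or_difference_small:
  assumes k: "k > 0"
  obtains \<eta> where "\<eta> > 0"
    "\<And>x y r. x \<in> carrier X \<Longrightarrow> y \<in> carrier X \<Longrightarrow> r \<le> R \<Longrightarrow> \<rho> x \<le> r \<Longrightarrow> \<rho> y \<le> r \<Longrightarrow>
      \<rho> ((1/2) \<odot> (x \<oplus> y)) \<le> r - \<eta> \<or> \<rho> ((1/2) \<odot> (x \<ominus> y)) \<le> k"
proof -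
  (* With this t the first term of the defect inequality is at most k/2, so a large half difference
  must come from the second term. *)
  define t where "t = k / (4 * (\<bar>R\<bar> + 1))"
  have t: "t > 0" using k by (simp add: t_def)
  obtain K where K0: "K \<ge> 0" and K: "\<forall>x\<in>carrier X. \<forall>y\<in>carrier X.
        \<rho> ((1/2) \<odot> (x \<ominus> y)) \<le> t * (\<rho> x + \<rho> y) + K * ((\<rho> x + \<rho> y) / 2 - \<rho> ((1/2) \<odot> (x \<oplus> y)))"
    using rho_defect[OF t] by blast
  define \<eta> where "\<eta> = k / (2 * (K + 1))"
  have \<eta>: "\<eta> > 0" using k K0 by (simp add: \<eta>_def)
  show thesis
  proof (rule that[OF \<eta>])
    fix x y r assume x: "x \<in> carrier X" and y: "y \<in> carrier X" and r: "r \<le> R" "\<rho> x \<le> r" "\<rho> y \<le> r"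
    show "\<rho> ((1/2) \<odot> (x \<oplus> y)) \<le> r - \<eta> \<or> \<rho> ((1/2) \<odot> (x \<ominus> y)) \<le> k"
    proof (rule disjCI)
      assume no: "\<not> \<rho> ((1/2) \<odot> (x \<ominus> y)) \<le> k"
      define \<Delta> where "\<Delta> = (\<rho> x + \<rho> y) / 2 - \<rho> ((1/2) \<odot> (x \<oplus> y))"
      have "t * (\<rho> x + \<rho> y) \<le> t * (2 * (\<bar>R\<bar> + 1))"
        using t r by (intro mult_left_mono) auto
      also have "\<dots> = k / 2" by (simp add: t_def field_simps)
      finally have big: "k / 2 < K * \<Delta>"
        using K[rule_format, OF x y] no unfolding \<Delta>_def by linarith
      have "\<not> \<Delta> \<le> 0" using mult_nonneg_nonpos[of K \<Delta>] K0 k big by linarith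
      then have "k / 2 < (K + 1) * \<Delta>" using big by (simp add: algebra_simps)
      then have "\<eta> < \<Delta>" using K0 by (simp add: \<eta>_def field_simps)
      moreover have "\<rho> ((1/2) \<odot> (x \<oplus> y)) = \<rho> x / 2 + \<rho> y / 2 - \<Delta>"
        by (simp add: \<Delta>_def add_divide_distrib)
      moreover have "\<rho> x / 2 + \<rho> y / 2 \<le> r" using r by simp
      ultimately show "\<rho> ((1/2) \<odot> (x \<oplus> y)) \<le> r - \<eta>" by linarith
    qed
  qed
qed

text \<open>
  In the image under \<open>T\<close> of a long James sequence, two neighbouring dyadic averages of
  level \<open>l\<close> are separated by the functional attached to the beginning of the second
  block. Their half difference thus has norm at least \<open>d/8\<close>, and the midpoint, which is
  the average of level \<open>l + 1\<close>, loses \<open>\<eta>\<close> in \<open>\<rho>\<close>.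
  After more than \<open>R/\<eta>\<close> levels \<open>\<rho>\<close> would be negative.\<close>
theorem superreflexive: "superreflexive TYPE('b) X"
  unfolding superreflexive_def
proof (intro allI impI; elim conjE)
  fix Y :: "'b cnormed"
  assume Y: "complex_banach_space Y" and fr: "finitely_representable_in Y X"
  interpret Y: complex_banach_space Y by (rule Y)
  show "reflexive Y"
  proof (rule ccontr)
    assume nr: "\<not> reflexive Y"
    obtain M d where M: "M > 0" and d: "d > 0" and chain:
      "\<And>n::nat. \<exists>x f. (\<forall>i<n. x i \<in> carrier Y \<and> nrm Y (x i) \<le> M \<and> Y.bl 1 (f i)) \<and>
       (\<forall>i<n. \<forall>j<n. cmod (f i (x j) - (if j < i then 0 else of_real d)) \<le> d / 4)"
      using Y.james_chain[OF Y.complete nr] by metis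
    obtain R where R: "\<And>x. x \<in> carrier X \<Longrightarrow> nrm X x \<le> 2 * M \<Longrightarrow> \<rho> x \<le> R"
      using rho_bounded[of "2 * M"] by blast
    have "d / 16 > 0" using d by simp
    then obtain k where k: "k > 0" "\<And>x. x \<in> carrier X \<Longrightarrow> \<rho> x \<le> k \<Longrightarrow> nrm X x \<le> d / 16"
      using rho_small by blast
    obtain \<eta> where \<eta>: "\<eta> > 0" and con:
      "\<And>x y r. x \<in> carrier X \<Longrightarrow> y \<in> carrier X \<Longrightarrow> r \<le> R \<Longrightarrow> \<rho> x \<le> r \<Longrightarrow> \<rho> y \<le> r \<Longrightarrow>
      \<rho> ((1/2) \<odot> (x \<oplus> y)) \<le> r - \<eta> \<or> \<rho> ((1/2) \<odot> (x \<ominus> y)) \<le> k"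
      using midpoint_drops_or_difference_small[OF k(1), of R] by metis
    obtain L where L: "R < real L * \<eta>" using reals_Archimedean3[OF \<eta>] by blast
    define n where "n = (2::nat) ^ L"
    obtain x f where x: "\<And>i. i < n \<Longrightarrow> x i \<in> carrier Y" "\<And>i. i < n \<Longrightarrow> nrm Y (x i) \<le> M"
      and f: "\<And>i. i < n \<Longrightarrow> Y.bl 1 (f i)"
      and fx: "\<And>i j. i < n \<Longrightarrow> j < n \<Longrightarrow> cmod (f i (x j) - (if j < i then 0 else of_real d)) \<le> d / 4"
      using chain[of n] by metis
    define S where "S = x ` {..<n}"
    define E where "E = {(\<Oplus>\<^bsub>Y\<^esub>s\<in>S. a s \<odot>\<^bsub>Y\<^esub> s) |a. True}"
    have S: "finite S" "S \<subseteq> carrier Y" using x by (auto simp: S_def)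
    then have "finite_dim_subspace Y E" unfolding finite_dim_subspace_def E_def by blast
    then obtain T where T: "linear_map_on E Y X T"
      and T_le: "\<And>y. y \<in> E \<Longrightarrow> nrm Y y / (1 + 1) \<le> nrm X (T y) \<and> nrm X (T y) \<le> (1 + 1) * nrm Y y"
      using fr unfolding finitely_representable_in_def by (metis zero_less_one)
    have Tcl: "T y \<in> carrier X" if "y \<in> E" for y using T that by (auto simp: linear_map_on_def)
    have Tadd: "T (u \<oplus>\<^bsub>Y\<^esub> v) = T u \<oplus> T v" if "u \<in> E" "v \<in> E" for u v
      using T that by (simp add: linear_map_on_def)
    have Tsm: "T (c \<odot>\<^bsub>Y\<^esub> u) = c \<odot> T u" if "u \<in> E" for u c
      using T that by (simp add: linear_map_on_def)
    have E_add: "u \<oplus>\<^bsub>Y\<^esub> v \<in> E" if uv: "u \<in> E" "v \<in> E" for u v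
    proof -
      obtain a b where ab: "u = (\<Oplus>\<^bsub>Y\<^esub>s\<in>S. a s \<odot>\<^bsub>Y\<^esub> s)" "v = (\<Oplus>\<^bsub>Y\<^esub>s\<in>S. b s \<odot>\<^bsub>Y\<^esub> s)"
        using uv unfolding E_def by blast
      have "(\<Oplus>\<^bsub>Y\<^esub>s\<in>S. (a s + b s) \<odot>\<^bsub>Y\<^esub> s) = (\<Oplus>\<^bsub>Y\<^esub>s\<in>S. a s \<odot>\<^bsub>Y\<^esub> s \<oplus>\<^bsub>Y\<^esub> b s \<odot>\<^bsub>Y\<^esub> s)"
        using S by (intro Y.M.finsum_cong') (auto simp: Y.add_sm)
      also have "\<dots> = u \<oplus>\<^bsub>Y\<^esub> v"
        unfolding ab using S by (intro Y.M.finsum_addf) auto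
      finally show ?thesis unfolding E_def by (intro CollectI exI[of _ "\<lambda>s. a s + b s"]) simp
    qed
    have E_sm: "c \<odot>\<^bsub>Y\<^esub> u \<in> E" if uv: "u \<in> E" for u c
    proof -
      obtain a where a: "u = (\<Oplus>\<^bsub>Y\<^esub>s\<in>S. a s \<odot>\<^bsub>Y\<^esub> s)" using uv unfolding E_def by blast
      have "c \<odot>\<^bsub>Y\<^esub> u = (\<Oplus>\<^bsub>Y\<^esub>s\<in>S. c \<odot>\<^bsub>Y\<^esub> (a s \<odot>\<^bsub>Y\<^esub> s))"
        unfolding a using S by (intro Y.finsum_smult_ldistr) auto
      also have "\<dots> = (\<Oplus>\<^bsub>Y\<^esub>s\<in>S. (c * a s) \<odot>\<^bsub>Y\<^esub> s)"
        using S by (intro Y.M.finsum_cong') (auto simp: Y.sm_sm)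
      finally show ?thesis unfolding E_def by (intro CollectI exI[of _ "\<lambda>s. c * a s"]) simp
    qed
    have E_x: "x j \<in> E" if j: "j < n" for j
    proof -
      have "(\<Oplus>\<^bsub>Y\<^esub>s\<in>S. (if s = x j then 1 else 0) \<odot>\<^bsub>Y\<^esub> s) = (\<Oplus>\<^bsub>Y\<^esub>s\<in>S. if x j = s then s else \<zero>\<^bsub>Y\<^esub>)"
        using S by (intro Y.M.finsum_cong') auto
      also have "\<dots> = x j"
        using S j by (intro Y.M.finsum_singleton) (auto simp: S_def)
      finally show ?thesis unfolding E_def by (intro CollectI exI[of _ "\<lambda>s. if s = x j then 1 else 0"]) simp
    qed
    have E_sub: "E \<subseteq> carrier Y"
      unfolding E_def using S by (auto intro!: Y.M.finsum_closed)
    (* The invariant of the induction on levels: each level costs \<eta>. *)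
    have dy: "Y.dyadic x l a \<in> E \<and> \<rho> (T (Y.dyadic x l a)) \<le> R - real l * \<eta>" if "a + 2 ^ l \<le> n" for l a
      using that
    proof (induction l arbitrary: a)
      case 0
      then have "nrm X (T (x a)) \<le> 2 * nrm Y (x a)" "nrm Y (x a) \<le> M" using T_le[OF E_x] x by auto
      then have "\<rho> (T (x a)) \<le> R" using 0 E_x Tcl by (intro R) auto
      then show ?case using E_x 0 by simp
    next
      case (Suc l)
      define u where "u = Y.dyadic x l a"
      define v where "v = Y.dyadic x l (a + 2 ^ l)"
      have u: "u \<in> E" "\<rho> (T u) \<le> R - real l * \<eta>" using Suc.IH[of a] Suc.prems by (auto simp: u_def)
      have v: "v \<in> E" "\<rho> (T v) \<le> R - real l * \<eta>" using Suc.IH[of "a + 2 ^ l"] Suc.prems by (auto simp: v_def)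
      have uv: "u \<in> carrier Y" "v \<in> carrier Y" using u v E_sub by auto
      let ?f = "f (a + 2 ^ l)"
      have mid: "a + 2 ^ l < n"
      proof -
        have "(0::nat) < 2 ^ l" by simp
        then show ?thesis using Suc.prems unfolding power_Suc by linarith
      qed
      have f1: "Y.bl 1 ?f" by (rule f[OF mid])
      note f2 = Y.bl_lin[OF f1]
      have 1: "cmod (?f u - 0) \<le> d / 4" unfolding u_def
      proof (rule Y.lin_dyadic[OF f2])
        fix j assume "a \<le> j" "j < a + 2 ^ l"
        then show "x j \<in> carrier Y" "cmod (?f (x j) - 0) \<le> d / 4"
          using fx[OF mid, of j] x(1)[of j] mid Suc.prems by auto
      qed
      have 2: "cmod (?f v - of_real d) \<le> d / 4" unfolding v_def
      proof (rule Y.lin_dyadic[OF f2])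
        fix j assume "a + 2 ^ l \<le> j" "j < a + 2 ^ l + 2 ^ l"
        then show "x j \<in> carrier Y" "cmod (?f (x j) - of_real d) \<le> d / 4"
          using fx[OF mid, of j] x(1)[of j] mid Suc.prems by auto
      qed
      have "cmod (?f (u \<ominus>\<^bsub>Y\<^esub> v)) \<le> nrm Y (u \<ominus>\<^bsub>Y\<^esub> v)" using Y.bl_le[OF f1, of "u \<ominus>\<^bsub>Y\<^esub> v"] uv by simp
      moreover have "?f (u \<ominus>\<^bsub>Y\<^esub> v) = (?f u - 0) - (?f v - of_real d) - of_real d"
        using Y.lin_minus[OF f2 uv] by simp
      moreover have "d \<le> cmod ((?f u - 0) - (?f v - of_real d) - of_real d) + cmod (?f u - 0) + cmod (?f v - of_real d)"
      proof -
        have "of_real d = (?f u - 0) - (?f v - of_real d) - ((?f u - 0) - (?f v - of_real d) - of_real d)" by simp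
        then have "cmod (of_real d) \<le> cmod ((?f u - 0) - (?f v - of_real d)) + cmod ((?f u - 0) - (?f v - of_real d) - of_real d)"
          by (metis norm_triangle_ineq4)
        then show ?thesis using norm_triangle_ineq4[of "?f u - 0" "?f v - of_real d"] d by simp
      qed
      ultimately have sep: "d / 2 \<le> nrm Y (u \<ominus>\<^bsub>Y\<^esub> v)" using 1 2 by simp
      have m: "u \<ominus>\<^bsub>Y\<^esub> v = u \<oplus>\<^bsub>Y\<^esub> (-1) \<odot>\<^bsub>Y\<^esub> v" using uv by (simp add: Y.minus_sm)
      have mE: "u \<ominus>\<^bsub>Y\<^esub> v \<in> E" unfolding m using u v by (intro E_add E_sm)
      have "T (u \<ominus>\<^bsub>Y\<^esub> v) = T u \<ominus> T v"
        unfolding m using u v Tcl by (simp add: Tadd Tsm E_sm minus_sm)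
      then have "d / 4 \<le> nrm X (T u \<ominus> T v)" using T_le[OF mE] sep by simp
      then have "d / 8 \<le> nrm X ((1/2) \<odot> (T u \<ominus> T v))"
        using u v Tcl by (simp add: nrm_smult)
      then have big: "\<not> \<rho> ((1/2) \<odot> (T u \<ominus> T v)) \<le> k"
        using k(2)[of "(1/2) \<odot> (T u \<ominus> T v)"] u v Tcl d by auto
      have eq: "T (Y.dyadic x (Suc l) a) = (1/2) \<odot> (T u \<oplus> T v)"
        using u v by (simp add: Tadd Tsm E_add u_def[symmetric] v_def[symmetric])
      have "\<rho> ((1/2) \<odot> (T u \<oplus> T v)) \<le> R - real l * \<eta> - \<eta>"
        using con[OF Tcl[OF u(1)] Tcl[OF v(1)] _ u(2) v(2)] big \<eta> by simp
      then have "\<rho> (T (Y.dyadic x (Suc l) a)) \<le> R - real (Suc l) * \<eta>" unfolding eq by (simp add: algebra_simps)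
      moreover have "Y.dyadic x (Suc l) a \<in> E" using u v by (simp add: E_add E_sm u_def[symmetric] v_def[symmetric])
      ultimately show ?case by simp
    qed
    have "\<rho> (T (Y.dyadic x L 0)) \<le> R - real L * \<eta>" "T (Y.dyadic x L 0) \<in> carrier X"
      using dy[of 0 L] Tcl by (auto simp: n_def)
    then show False using L rho_nonneg by fastforce
  qed
qed

end

section \<open>Signed means and B-convexity\<close>

context complex_normed_space
begin

definition signed_mean :: "nat \<Rightarrow> (nat \<Rightarrow> complex) \<Rightarrow> (nat \<Rightarrow> 'a) \<Rightarrow> 'a" where
  "signed_mean n s x = (1 / of_nat n) \<odot> (\<Oplus>i\<in>{..<n}. s i \<odot> x i)"

definition signed_means :: "nat \<Rightarrow> (nat \<Rightarrow> 'a) \<Rightarrow> 'a set" where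
  "signed_means n x = {signed_mean n s x | s. \<forall>i. s i \<in> {1, -1}}"

lemma signed_meansI: "(\<And>i. s i \<in> {1, -1}) \<Longrightarrow> z = signed_mean n s x \<Longrightarrow> z \<in> signed_means n x"
  by (auto simp: signed_means_def)

lemma signed_mean_closed: "(\<And>i. x i \<in> carrier X) \<Longrightarrow> signed_mean n s x \<in> carrier X"
  unfolding signed_mean_def by (auto intro!: M.finsum_closed)

lemma signed_means_closed: "z \<in> signed_means n x \<Longrightarrow> (\<And>i. x i \<in> carrier X) \<Longrightarrow> z \<in> carrier X"
  by (auto simp: signed_means_def signed_mean_closed)

lemma lin_signed_mean:
  "lin f \<Longrightarrow> (\<And>i. x i \<in> carrier X) \<Longrightarrow> f (signed_mean n s x) = (\<Sum>i<n. s i * f (x i)) / of_nat n"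
  unfolding signed_mean_def
  using lin_finsum[of f "{..<n}" "\<lambda>i. s i \<odot> x i"] by (simp add: linD M.finsum_closed Pi_def)

lemma signed_mean_scale:
  assumes "\<And>i. x i \<in> carrier X"
  shows "signed_mean n s (\<lambda>i. c \<odot> x i) = c \<odot> signed_mean n s x"
proof -
  have "c \<odot> (\<Oplus>i\<in>{..<n}. s i \<odot> x i) = (\<Oplus>i\<in>{..<n}. c \<odot> (s i \<odot> x i))"
    using assms by (intro finsum_smult_ldistr) auto
  also have "\<dots> = (\<Oplus>i\<in>{..<n}. s i \<odot> (c \<odot> x i))"
    using assms by (intro M.finsum_cong') (auto simp: sm_sm mult.commute)
  finally have eq: "c \<odot> (\<Oplus>i\<in>{..<n}. s i \<odot> x i) = (\<Oplus>i\<in>{..<n}. s i \<odot> (c \<odot> x i))" .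
  have "(\<Oplus>i\<in>{..<n}. s i \<odot> x i) \<in> carrier X" using assms by (intro M.finsum_closed) auto
  then show ?thesis unfolding signed_mean_def eq[symmetric] by (simp add: sm_sm mult.commute)
qed

lemma finsum_blocks:
  fixes q n :: nat
  assumes g: "\<And>i. g i \<in> carrier X"
  shows "(\<Oplus>i\<in>{..<q * n}. g i) = (\<Oplus>j\<in>{..<q}. \<Oplus>i\<in>{..<n}. g (j * n + i))"
proof (induction q)
  case (Suc q)
  have split: "{..<Suc q * n} = {..<q * n} \<union> (\<lambda>i. q * n + i) ` {..<n}"
  proof (intro Set.set_eqI iffI)
    fix k assume k: "k \<in> {..<Suc q * n}"
    show "k \<in> {..<q * n} \<union> (\<lambda>i. q * n + i) ` {..<n}"
    proof (cases "k < q * n")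
      case False
      then have "k = q * n + (k - q * n)" "k - q * n < n" using k by auto
      then show ?thesis by blast
    qed auto
  qed auto
  have "(\<Oplus>i\<in>{..<Suc q * n}. g i) = (\<Oplus>i\<in>{..<q * n}. g i) \<oplus> (\<Oplus>i\<in>(\<lambda>i. q * n + i) ` {..<n}. g i)"
    unfolding split using g by (intro M.finsum_Un_disjoint) auto
  also have "(\<Oplus>i\<in>(\<lambda>i. q * n + i) ` {..<n}. g i) = (\<Oplus>i\<in>{..<n}. g (q * n + i))"
    using g by (intro M.finsum_reindex) (auto simp: inj_on_def)
  finally show ?case
    using g Suc.IH by (simp add: lessThan_Suc M.finsum_insert M.finsum_closed Pi_def M.a_comm)
qed simp

text \<open>
  Signed means of signed means are signed means. This makes both the iteration of B-convexity and
  the induction over dyadic blocks possible.\<close>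
lemma signed_means_nest:
  assumes x: "\<And>i. x i \<in> carrier X" and n: "n > 0" and y: "\<And>j. y j \<in> signed_means n (\<lambda>i. x (j * n + i))"
    and z: "z \<in> signed_means q y"
  shows "z \<in> signed_means (q * n) x"
proof -
  obtain s where s: "\<And>j i. s j i \<in> {1, -1}" "\<And>j. y j = signed_mean n (s j) (\<lambda>i. x (j * n + i))"
    using y unfolding signed_means_def by (auto simp: subset_iff) metis
  obtain t where t: "\<And>j. t j \<in> {1, -1}" "z = signed_mean q t y" using z unfolding signed_means_def by blast
  define u where "u k = t (k div n) * s (k div n) (k mod n)" for k
  have u: "u k \<in> {1, -1}" for k using s(1)[of "k div n" "k mod n"] t(1)[of "k div n"] by (auto simp: u_def)
  have uj: "u (j * n + i) = t j * s j i" if "i < n" for i j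
    using that n by (simp add: u_def)
  have ycl: "y j \<in> carrier X" for j using signed_means_closed[OF y] x by blast
  have inner: "(\<Oplus>i\<in>{..<n}. s j i \<odot> x (j * n + i)) \<in> carrier X" for j
    using x by (intro M.finsum_closed) auto
  have "signed_mean (q * n) u x = (1 / of_nat (q * n)) \<odot> (\<Oplus>j\<in>{..<q}. \<Oplus>i\<in>{..<n}. u (j * n + i) \<odot> x (j * n + i))"
    unfolding signed_mean_def using x by (subst finsum_blocks) auto
  also have "(\<Oplus>j\<in>{..<q}. \<Oplus>i\<in>{..<n}. u (j * n + i) \<odot> x (j * n + i)) =
      (\<Oplus>j\<in>{..<q}. of_nat n \<odot> (t j \<odot> y j))"
  proof (intro M.finsum_cong')
    fix j assume "j \<in> {..<q}"
    have "(\<Oplus>i\<in>{..<n}. u (j * n + i) \<odot> x (j * n + i)) = (\<Oplus>i\<in>{..<n}. t j \<odot> (s j i \<odot> x (j * n + i)))"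
      using x by (intro M.finsum_cong') (auto simp: uj sm_sm)
    also have "\<dots> = t j \<odot> (\<Oplus>i\<in>{..<n}. s j i \<odot> x (j * n + i))"
      using x by (intro finsum_smult_ldistr[symmetric]) auto
    also have "\<dots> = of_nat n \<odot> (t j \<odot> y j)"
      using inner[of j] n by (simp add: s(2) signed_mean_def sm_sm)
    finally show "(\<Oplus>i\<in>{..<n}. u (j * n + i) \<odot> x (j * n + i)) = of_nat n \<odot> (t j \<odot> y j)" .
  qed (use ycl in auto)
  also have "\<dots> = of_nat n \<odot> (\<Oplus>j\<in>{..<q}. t j \<odot> y j)"
    using ycl by (intro finsum_smult_ldistr[symmetric]) auto
  also have "(1 / of_nat (q * n)) \<odot> \<dots> = z"
  proof -
    have "(\<Oplus>j\<in>{..<q}. t j \<odot> y j) \<in> carrier X" using ycl by (intro M.finsum_closed) auto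
    then show ?thesis using n by (simp add: t(2) signed_mean_def sm_sm)
  qed
  finally show ?thesis by (intro signed_meansI[of u, OF u]) simp
qed

lemma signed_means_2:
  assumes x: "\<And>i. x i \<in> carrier X"
  shows "(1/2) \<odot> (x 0 \<oplus> x 1) \<in> signed_means 2 x" "(1/2) \<odot> (x 0 \<ominus> x 1) \<in> signed_means 2 x"
proof -
  have 2: "(\<Oplus>i\<in>{..<2}. s i \<odot> x i) = s 0 \<odot> x 0 \<oplus> s 1 \<odot> x 1" for s
    using x by (simp add: numeral_2_eq_2 lessThan_Suc M.finsum_insert Pi_def M.a_comm)
  have sm2: "signed_mean 2 s x = (1/2) \<odot> (s 0 \<odot> x 0 \<oplus> s 1 \<odot> x 1)" for s
    by (simp only: signed_mean_def 2 of_nat_numeral)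
  show "(1/2) \<odot> (x 0 \<oplus> x 1) \<in> signed_means 2 x"
    by (rule signed_meansI[of "\<lambda>i. 1"]) (use x in \<open>simp_all add: sm2\<close>)
  show "(1/2) \<odot> (x 0 \<ominus> x 1) \<in> signed_means 2 x"
    by (rule signed_meansI[of "\<lambda>i. if i = 0 then 1 else -1"]) (use x in \<open>simp_all add: sm2 minus_sm\<close>)
qed

lemma reindex_Suc:
  assumes "\<And>k. g k \<in> carrier X"
  shows "(\<Oplus>k\<in>{1..n}. g k) = (\<Oplus>i\<in>{..<n}. g (Suc i))"
proof -
  have "{1..n} = Suc ` {..<n}" by (auto simp: image_iff Bex_def) (metis Suc_le_D Suc_le_lessD)
  then show ?thesis using assms by (simp add: M.finsum_reindex Pi_def)
qed

text \<open>
  The inequality of B-convexity for vectors in the unit ball, with indices starting at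
  \<open>0\<close>. Infinite sequences, of which the first \<open>n\<close> entries matter, can be
  cut into blocks without bounds on the indices.\<close>
definition sign_contractive :: "nat \<Rightarrow> real \<Rightarrow> bool" where
  "sign_contractive n c \<longleftrightarrow>
    (\<forall>x. (\<forall>i. x i \<in> carrier X \<and> nrm X (x i) \<le> 1) \<longrightarrow> (\<exists>z\<in>signed_means n x. nrm X z \<le> c))"

lemma sign_contractiveD:
  assumes "sign_contractive n c" "\<And>i. x i \<in> carrier X" "\<And>i. nrm X (x i) \<le> 1"
  shows "\<exists>s. (\<forall>i. s i \<in> {1, -1}) \<and> nrm X (signed_mean n s x) \<le> c"
proof -
  have "\<exists>z\<in>signed_means n x. nrm X z \<le> c"
    using assms(1)[unfolded sign_contractive_def, rule_format, of x] assms(2,3) by simp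
  then show ?thesis unfolding signed_means_def by auto
qed

lemma B_convexI:
  assumes n: "n \<ge> 2" and c: "c < 1" and sc: "sign_contractive n c"
  shows "B_convex X"
  unfolding B_convex_def
proof (intro exI[of _ "1 - c"] conjI exI[of _ n] allI impI n)
  show "1 - c > 0" using c by simp
  fix x :: "nat \<Rightarrow> 'a" assume x: "x \<in> {1..n} \<rightarrow> carrier X"
  define m where "m = (MAX k\<in>{1..n}. nrm X (x k))"
  have m: "nrm X (x k) \<le> m" if "k \<in> {1..n}" for k unfolding m_def using that by (intro Max_ge) auto
  have m0: "m \<ge> 0" using m[of 1] nrm_nonneg[of "x 1"] x n by force
  define y where "y i = (if i < n then x (Suc i) else \<zero>)" for i
  have y: "y i \<in> carrier X" "nrm X (y i) \<le> m" for i
    using x m[of "Suc i"] m0 by (auto simp: y_def Pi_def)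
  obtain s where s: "\<And>i. s i \<in> {1, -1::complex}" "nrm X (signed_mean n s y) \<le> c * m"
  proof (cases "m = 0")
    case True
    have "y i = \<zero>" for i
      using y[of i] nrm_nonneg[OF y(1), of i] nrm_eq_0_iff[OF y(1), of i] True by simp
    then have "signed_mean n (\<lambda>i. 1) y = \<zero>" unfolding signed_mean_def by simp
    then show thesis using that[of "\<lambda>i. 1"] True by simp
  next
    case False
    then have mp: "m > 0" using m0 by simp
    define y' where "y' i = of_real (1 / m) \<odot> y i" for i
    have "y' i \<in> carrier X" "nrm X (y' i) \<le> 1" for i
      using y[of i] mp by (simp_all add: y'_def nrm_smult norm_divide)
    then obtain s where s: "\<And>i. s i \<in> {1, -1::complex}" "nrm X (signed_mean n s y') \<le> c"
      using sign_contractiveD[OF sc, of y'] by auto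
    have "signed_mean n s y' = of_real (1 / m) \<odot> signed_mean n s y"
      unfolding y'_def using y by (intro signed_mean_scale)
    then have "nrm X (signed_mean n s y) \<le> c * m"
      using s(2) mp signed_mean_closed[of y n s] y by (simp add: nrm_smult norm_divide field_simps)
    then show thesis using that s(1) by blast
  qed
  define \<epsilon> where "\<epsilon> k = s (k - 1)" for k
  have "(\<Oplus>k\<in>{1..n}. \<epsilon> k \<odot> x k) = (\<Oplus>k\<in>{1..n}. \<epsilon> k \<odot> y (k - 1))"
    using x by (intro M.finsum_cong') (auto simp: y_def Pi_def)
  also have "\<dots> = (\<Oplus>i\<in>{..<n}. s i \<odot> y i)"
    using y(1) by (subst reindex_Suc) (auto simp: \<epsilon>_def)
  finally have "(1 / of_nat n) \<odot> (\<Oplus>k\<in>{1..n}. \<epsilon> k \<odot> x k) = signed_mean n s y"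
    by (simp add: signed_mean_def)
  then show "\<exists>\<epsilon>. \<epsilon> \<in> {1..n} \<rightarrow> {1, -1} \<and>
           nrm X ((1 / of_nat n) \<odot> (\<Oplus>k\<in>{1..n}. \<epsilon> k \<odot> x k)) \<le> (1 - (1 - c)) * (MAX k\<in>{1..n}. nrm X (x k))"
    using s by (intro exI[of _ \<epsilon>]) (auto simp: \<epsilon>_def m_def)
qed

lemma B_convexD:
  assumes "B_convex X"
  obtains n c where "n \<ge> 2" "0 < c" "c < 1" "sign_contractive n c"
proof -
  obtain \<delta> n where \<delta>: "\<delta> > 0" and n: "n \<ge> 2" and B: "\<And>x. x \<in> {1..n} \<rightarrow> carrier X \<Longrightarrow>
        (\<exists>\<epsilon> :: nat \<Rightarrow> complex. \<epsilon> \<in> {1..n} \<rightarrow> {1, -1} \<and>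
           nrm X ((1 / of_nat n) \<odot> (\<Oplus>k\<in>{1..n}. \<epsilon> k \<odot> x k)) \<le> (1 - \<delta>) * (MAX k\<in>{1..n}. nrm X (x k)))"
    using assms unfolding B_convex_def by blast
  define c where "c = max (1 / 2) (1 - \<delta>)"
  have "sign_contractive n c" unfolding sign_contractive_def
  proof (intro allI impI)
    fix y :: "nat \<Rightarrow> 'a" assume y: "\<forall>i. y i \<in> carrier X \<and> nrm X (y i) \<le> 1"
    define x where "x k = y (k - 1)" for k
    have "x \<in> {1..n} \<rightarrow> carrier X" using y by (auto simp: x_def)
    from B[OF this] obtain \<epsilon> :: "nat \<Rightarrow> complex" where \<epsilon>: "\<epsilon> \<in> {1..n} \<rightarrow> {1, -1}"
      "nrm X ((1 / of_nat n) \<odot> (\<Oplus>k\<in>{1..n}. \<epsilon> k \<odot> x k)) \<le> (1 - \<delta>) * (MAX k\<in>{1..n}. nrm X (x k))" by blast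
    define s where "s i = (if i < n then \<epsilon> (Suc i) else 1)" for i
    have s: "s i \<in> {1, -1}" for i using \<epsilon>(1) by (auto simp: s_def Pi_def)
    have "(\<Oplus>k\<in>{1..n}. \<epsilon> k \<odot> x k) = (\<Oplus>i\<in>{..<n}. \<epsilon> (Suc i) \<odot> x (Suc i))"
      using y by (intro reindex_Suc) (auto simp: x_def)
    also have "\<dots> = (\<Oplus>i\<in>{..<n}. s i \<odot> y i)"
      using y by (intro M.finsum_cong') (auto simp: s_def x_def)
    finally have eq: "(1 / of_nat n) \<odot> (\<Oplus>k\<in>{1..n}. \<epsilon> k \<odot> x k) = signed_mean n s y"
      by (simp add: signed_mean_def)
    define m where "m = (MAX k\<in>{1..n}. nrm X (x k))"
    have "m \<le> 1" unfolding m_def using n y by (subst Max_le_iff) (auto simp: x_def)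
    have "nrm X (x 1) \<le> m" unfolding m_def using n by (intro Max_ge) auto
    then have "m \<ge> 0" using nrm_nonneg[of "x 1"] y by (auto simp: x_def)
    have "(1 - \<delta>) * m \<le> c * m" using \<open>m \<ge> 0\<close> by (intro mult_right_mono) (auto simp: c_def)
    also have "\<dots> \<le> c * 1" using \<open>m \<le> 1\<close> by (intro mult_left_mono) (auto simp: c_def)
    finally have "nrm X (signed_mean n s y) \<le> c" using \<epsilon>(2) unfolding eq m_def[symmetric] by simp
    moreover have "signed_mean n s y \<in> signed_means n y" by (rule signed_meansI[of s, OF s refl])
    ultimately show "\<exists>z\<in>signed_means n y. nrm X z \<le> c" by blast
  qed
  then show thesis using that[of n c] n \<delta> by (auto simp: c_def)
qed

lemma sign_contractive_mult:
  assumes A: "sign_contractive n a" and B: "sign_contractive q b" and a: "a > 0" and n: "n > 0"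
  shows "sign_contractive (q * n) (a * b)"
  unfolding sign_contractive_def
proof (intro allI impI)
  fix x :: "nat \<Rightarrow> 'a" assume x: "\<forall>i. x i \<in> carrier X \<and> nrm X (x i) \<le> 1"
  have "\<exists>z\<in>signed_means n (\<lambda>i. x (j * n + i)). nrm X z \<le> a" for j
    using A[unfolded sign_contractive_def, rule_format, of "\<lambda>i. x (j * n + i)"] x by simp
  then obtain y where y: "\<And>j. y j \<in> signed_means n (\<lambda>i. x (j * n + i))" "\<And>j. nrm X (y j) \<le> a" by metis
  have ycl: "y j \<in> carrier X" for j using signed_means_closed[OF y(1)] x by blast
  have "of_real (1 / a) \<odot> y j \<in> carrier X" "nrm X (of_real (1 / a) \<odot> y j) \<le> 1" for j
    using ycl y(2) a by (simp_all add: nrm_smult norm_divide)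
  then obtain s where s: "\<And>i. s i \<in> {1, -1::complex}" "nrm X (signed_mean q s (\<lambda>j. of_real (1 / a) \<odot> y j)) \<le> b"
    using sign_contractiveD[OF B, of "\<lambda>j. of_real (1 / a) \<odot> y j"] by auto
  have "nrm X (signed_mean q s y) \<le> a * b"
    using s(2) a signed_mean_closed[OF ycl, of q s] signed_mean_scale[OF ycl, where c = "of_real (1 / a)"]
    by (simp add: nrm_smult norm_divide field_simps)
  moreover have "signed_mean q s y \<in> signed_means (q * n) x"
    by (rule signed_means_nest[OF _ n y(1) signed_meansI[of s, OF s(1) refl]]) (use x in auto)
  ultimately show "\<exists>z\<in>signed_means (q * n) x. nrm X z \<le> a * b" by blast
qed

text \<open>
  Taking means of means multiplies the constants, so in a B-convex space the constant can be made
  arbitrarily small at the price of more vectors.\<close>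
lemma B_convex_iterate:
  assumes "B_convex X" and e: "e > 0"
  obtains n where "n > 0" "sign_contractive n e"
proof -
  obtain n c where n: "n \<ge> 2" and c: "0 < c" "c < 1" and sc: "sign_contractive n c" by (rule B_convexD[OF assms(1)])
  have *: "sign_contractive (n ^ Suc k) (c ^ Suc k)" for k
  proof (induction k)
    case (Suc k)
    then show ?case using sign_contractive_mult[OF sc Suc] c n by (simp add: mult_ac)
  qed (use sc in simp)
  obtain k where "c ^ k < e" using real_arch_pow_inv[OF e c(2)] by blast
  moreover have "c ^ Suc k \<le> c ^ k" using c by (simp add: mult_left_le_one_le)
  ultimately have "c ^ Suc k \<le> e" by linarith
  then have "sign_contractive (n ^ Suc k) e" using *[of k] unfolding sign_contractive_def by (meson order_trans)
  then show thesis using that[of "n ^ Suc k"] n by simp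
qed

text \<open>
  By \<open>hsum\<close>, every signed mean of the \<open>e j\<close> has norm at least
  \<open>\<theta>/D\<close>, as in \<open>\<ell>\<^sup>1\<close>.\<close>
lemma l1_not_B_convex:
  assumes e: "\<And>j::nat. e j \<in> carrier X" "\<And>j. nrm X (e j) \<le> C"
    and h: "\<And>i. lin (h i)" and hsum: "\<And>n x. x \<in> carrier X \<Longrightarrow> (\<Sum>i<n. cmod (h i x)) \<le> D * nrm X x"
    and he: "\<And>i j. h i (e j) = (if i = j then of_real \<theta> else 0)"
    and pos: "\<theta> > 0" "C > 0" "D > 0"
  shows "\<not> B_convex X"
proof
  assume "B_convex X"
  then obtain n where n: "n > 0" and sc: "sign_contractive n (\<theta> / (2 * C * D))"
    using B_convex_iterate[of "\<theta> / (2 * C * D)"] pos by auto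
  define x where "x j = of_real (1 / C) \<odot> e j" for j
  have x: "x j \<in> carrier X" for j using e by (simp add: x_def)
  have "nrm X (x i) \<le> 1" for i
    using e pos by (simp add: x_def nrm_smult norm_divide)
  then obtain s where s: "\<And>i. s i \<in> {1, -1::complex}" "nrm X (signed_mean n s x) \<le> \<theta> / (2 * C * D)"
    using sign_contractiveD[OF sc, of x] x by auto
  have "cmod (h i (signed_mean n s x)) = \<theta> / (C * real n)" if i: "i < n" for i
  proof -
    have "h i (signed_mean n s x) = (\<Sum>j<n. s j * h i (x j)) / of_nat n" by (rule lin_signed_mean[OF h x])
    also have "(\<Sum>j<n. s j * h i (x j)) = (\<Sum>j<n. if i = j then s j * of_real (\<theta> / C) else 0)"
      using e by (intro sum.cong) (auto simp: x_def linD[OF h] he)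
    also have "\<dots> = s i * of_real (\<theta> / C)" using i by simp
    finally have eq: "h i (signed_mean n s x) = s i * of_real (\<theta> / C) / of_nat n" .
    have "cmod (s i) = 1" using s(1)[of i] by auto
    then show ?thesis using pos by (simp add: eq norm_mult norm_divide del: of_real_divide)
  qed
  then have "(\<Sum>i<n. cmod (h i (signed_mean n s x))) = \<theta> / C" using n by simp
  moreover have "(\<Sum>i<n. cmod (h i (signed_mean n s x))) \<le> D * nrm X (signed_mean n s x)"
    by (rule hsum[OF signed_mean_closed[OF x]])
  moreover have "D * nrm X (signed_mean n s x) \<le> D * (\<theta> / (2 * C * D))" using s(2) pos by (intro mult_left_mono) auto
  moreover have "D * (\<theta> / (2 * C * D)) = \<theta> / C / 2" using pos by (simp add: field_simps)
  ultimately have "\<theta> / C \<le> \<theta> / C / 2" by (metis order_trans)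
  moreover have "\<theta> / C > 0" using pos by simp
  ultimately show False by simp
qed

text \<open>
  The span of vectors with bounded signed sums contains Rademacher-like systems: the
  \<open>i\<close>-th vector has in coordinate \<open>j\<close> the sign given by the
  \<open>i\<close>-th binary digit of \<open>j\<close>. Every choice of \<open>n\<close> signs
  occurs in some coordinate, and that coordinate bounds the norm of the signed mean from below.\<close>
lemma linfty_not_B_convex:
  assumes e: "\<And>j::nat. e j \<in> carrier X"
    and esum: "\<And>n s. (\<And>j. s j \<in> {1, -1}) \<Longrightarrow> nrm X (\<Oplus>j\<in>{..<n}. s j \<odot> e j) \<le> C"
    and h: "\<And>i. bl D (h i)"
    and he: "\<And>i j. h i (e j) = (if i = j then of_real \<theta> else 0)"
    and pos: "\<theta> > 0" "C > 0" "D > 0"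
  shows "\<not> B_convex X"
proof
  assume "B_convex X"
  then obtain n where n: "n > 0" and sc: "sign_contractive n (\<theta> / (2 * C * D))"
    using B_convex_iterate[of "\<theta> / (2 * C * D)"] pos by auto
  (* The binary digits of j encode a subset of the indices i, that is, a choice of signs. *)
  define r where "r i j = (if i \<in> set_decode j then 1 else -1 :: complex)" for i j
  define N where "N = Suc (Max (set_encode ` Pow {..<n}))"
  define x where "x i = of_real (1 / C) \<odot> (\<Oplus>j\<in>{..<N}. r i j \<odot> e j)" for i
  have cl: "(\<Oplus>j\<in>{..<N}. r i j \<odot> e j) \<in> carrier X" for i using e by (intro M.finsum_closed) auto
  have x: "x i \<in> carrier X" for i using cl by (simp add: x_def)
  have "nrm X (\<Oplus>j\<in>{..<N}. r i j \<odot> e j) \<le> C" for i by (rule esum) (auto simp: r_def)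
  then have "nrm X (x i) \<le> 1" for i
    using cl pos by (simp add: x_def nrm_smult norm_divide)
  then obtain s where s: "\<And>i. s i \<in> {1, -1::complex}" "nrm X (signed_mean n s x) \<le> \<theta> / (2 * C * D)"
    using sign_contractiveD[OF sc, of x] x by auto
  define k where "k = set_encode {i. i < n \<and> s i = 1}"
  have "k \<in> set_encode ` Pow {..<n}" by (auto simp: k_def)
  then have k: "k < N" unfolding N_def by (simp add: le_imp_less_Suc)
  have rk: "r i k = s i" if "i < n" for i
    using that s(1)[of i] by (auto simp: r_def k_def)
  have hx: "h k (x i) = of_real (\<theta> / C) * r i k" for i
  proof -
    have "h k (\<Oplus>j\<in>{..<N}. r i j \<odot> e j) = (\<Sum>j<N. h k (r i j \<odot> e j))"
      using e by (intro lin_finsum bl_lin[OF h]) auto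
    also have "\<dots> = (\<Sum>j<N. if k = j then r i j * of_real \<theta> else 0)"
      using e by (intro sum.cong) (auto simp: linD[OF bl_lin[OF h]] he)
    also have "\<dots> = r i k * of_real \<theta>" using k by simp
    finally show ?thesis unfolding x_def using cl by (simp add: linD[OF bl_lin[OF h]])
  qed
  have "h k (signed_mean n s x) = (\<Sum>i<n. s i * h k (x i)) / of_nat n" by (rule lin_signed_mean[OF bl_lin[OF h] x])
  also have "(\<Sum>i<n. s i * h k (x i)) = (\<Sum>i<n. of_real (\<theta> / C))"
  proof (intro sum.cong refl)
    fix i assume "i \<in> {..<n}"
    moreover have "s i * s i = 1" using s(1)[of i] by auto
    ultimately show "s i * h k (x i) = of_real (\<theta> / C)" using rk[of i] by (simp add: hx)
  qed
  finally have "h k (signed_mean n s x) = of_real (\<theta> / C)" using n by simp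
  then have "\<theta> / C \<le> D * nrm X (signed_mean n s x)"
    using bl_le[OF h signed_mean_closed[of x, OF x], of k n s] pos by (simp add: norm_divide)
  moreover have "D * nrm X (signed_mean n s x) \<le> D * (\<theta> / (2 * C * D))" using s(2) pos by (intro mult_left_mono) auto
  moreover have "D * (\<theta> / (2 * C * D)) = \<theta> / C / 2" using pos by (simp add: field_simps)
  ultimately have "\<theta> / C \<le> \<theta> / C / 2" by (metis order_trans)
  moreover have "\<theta> / C > 0" using pos by simp
  ultimately show False by simp
qed

text \<open>
  The partial sums of the \<open>e j\<close> and the coordinate functionals form a triangular
  system, as the summing basis does in \<open>c\<^sub>0\<close>.\<close>
lemma linfty_not_reflexive:
  assumes e: "\<And>j::nat. e j \<in> carrier X"
    and esum: "\<And>n s. (\<And>j. s j \<in> {1, -1}) \<Longrightarrow> nrm X (\<Oplus>j\<in>{..<n}. s j \<odot> e j) \<le> C"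
    and h: "\<And>i. bl D (h i)"
    and he: "\<And>i j. h i (e j) = (if i = j then of_real \<theta> else 0)"
    and pos: "\<theta> > 0" "D > 0"
  shows "\<not> reflexive X"
proof (rule james_not_reflexive)
  fix n j :: nat
  have cl: "(\<Oplus>j\<in>{..<Suc n}. 1 \<odot> e j) \<in> carrier X" for n using e by (intro M.finsum_closed) auto
  show "(\<Oplus>j\<in>{..<Suc n}. 1 \<odot> e j) \<in> carrier X" by (rule cl)
  show "nrm X (\<Oplus>j\<in>{..<Suc n}. 1 \<odot> e j) \<le> C" by (rule esum) auto
  show "bl D (h n)" by (rule h)
  have "h n (\<Oplus>i\<in>{..<Suc j}. 1 \<odot> e i) = (\<Sum>i<Suc j. h n (1 \<odot> e i))"
    using e by (intro lin_finsum bl_lin[OF h]) auto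
  also have "\<dots> = (\<Sum>i<Suc j. if n = i then of_real \<theta> else 0)"
    using e by (intro sum.cong) (auto simp: he)
  also have "\<dots> = (if n \<le> j then of_real \<theta> else 0)" by auto
  finally show "h n (\<Oplus>i\<in>{..<Suc j}. 1 \<odot> e i) = (if n \<le> j then of_real \<theta> else 0)" .
qed (use pos in auto)

text \<open>
  The \<open>e j\<close> themselves and the tails of the sum of all coordinates form a triangular
  system.\<close>
lemma l1_not_reflexive:
  assumes e: "\<And>j::nat. e j \<in> carrier X" "\<And>j. nrm X (e j) \<le> C"
    and h: "\<And>i. lin (h i)" and hsum: "\<And>n x. x \<in> carrier X \<Longrightarrow> (\<Sum>i<n. cmod (h i x)) \<le> D * nrm X x"
    and he: "\<And>i j. h i (e j) = (if i = j then of_real \<theta> else 0)"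
    and pos: "\<theta> > 0" "D > 0"
  shows "\<not> reflexive X"
proof (rule james_not_reflexive[OF e])
  fix n j :: nat
  define f where "f n x = (\<Sum>i. h (i + n) x)" for n x
  have summ: "summable (\<lambda>i. cmod (h i x))" if "x \<in> carrier X" for x
    using hsum[OF that] by (intro summableI_nonneg_bounded[where x = "D * nrm X x"]) auto
  have summ': "summable (\<lambda>i. cmod (h (i + n) x))" if "x \<in> carrier X" for x n
    by (rule summable_ignore_initial_segment[OF summ[OF that]])
  have summ'': "summable (\<lambda>i. h (i + n) x)" if "x \<in> carrier X" for x n
    using summ'[OF that] by (rule summable_norm_cancel)
  have "bl D (f n)" unfolding bl_def lin_def
  proof (intro conjI ballI allI)
    fix x y assume "x \<in> carrier X" "y \<in> carrier X"
    then show "f n (x \<oplus> y) = f n x + f n y" unfolding f_def by (simp add: linD[OF h] suminf_add summ'')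
  next
    fix c x assume "x \<in> carrier X"
    then show "f n (c \<odot> x) = c * f n x" unfolding f_def by (simp add: linD[OF h] suminf_mult summ'')
  next
    fix x assume x: "x \<in> carrier X"
    have "cmod (f n x) \<le> (\<Sum>i. cmod (h (i + n) x))" unfolding f_def by (rule summable_norm[OF summ'[OF x]])
    also have "\<dots> \<le> (\<Sum>i. cmod (h i x))"
      using suminf_split_initial_segment[OF summ[OF x], of n] by (simp add: sum_nonneg)
    also have "\<dots> \<le> D * nrm X x" by (rule suminf_le_const[OF summ[OF x] hsum[OF x]])
    finally show "cmod (f n x) \<le> D * nrm X x" .
  qed
  then show "bl D (\<lambda>x. \<Sum>i. h (i + n) x)" unfolding f_def .
  show "(\<Sum>i. h (i + n) (e j)) = (if n \<le> j then of_real \<theta> else 0)"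
  proof (cases "n \<le> j")
    case True
    have "(\<Sum>i. h (i + n) (e j)) = (\<Sum>i\<in>{j - n}. h (i + n) (e j))"
      using True by (intro suminf_finite) (auto simp: he)
    then show ?thesis using True by (simp add: he)
  qed (auto simp: he)
qed (use pos in auto)

end

text \<open>
  Among \<open>2 ^ l\<close> vectors there is a signed mean with \<open>\<rho>\<close> at most
  \<open>max (R - l \<eta>) k\<close>: combine the signed means of the two halves by a midpoint
  if that lowers \<open>\<rho>\<close>, and by a half difference otherwise.\<close>
theorem (in uniformly_convex_modular) B_convex: "B_convex X"
proof -
  obtain R where R: "\<And>x. x \<in> carrier X \<Longrightarrow> nrm X x \<le> 1 \<Longrightarrow> \<rho> x \<le> R"
    using rho_bounded[of 1] by blast
  have "(1/2::real) > 0" by simp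
  then obtain k where k: "k > 0" "\<And>x. x \<in> carrier X \<Longrightarrow> \<rho> x \<le> k \<Longrightarrow> nrm X x \<le> 1 / 2"
    using rho_small by blast
  obtain \<eta> where \<eta>: "\<eta> > 0" and con:
      "\<And>x y r. x \<in> carrier X \<Longrightarrow> y \<in> carrier X \<Longrightarrow> r \<le> max R k \<Longrightarrow> \<rho> x \<le> r \<Longrightarrow> \<rho> y \<le> r \<Longrightarrow>
      \<rho> ((1/2) \<odot> (x \<oplus> y)) \<le> r - \<eta> \<or> \<rho> ((1/2) \<odot> (x \<ominus> y)) \<le> k"
    using midpoint_drops_or_difference_small[OF k(1), of "max R k"] by metis
  have step: "\<exists>z\<in>signed_means (2 ^ l) x. \<rho> z \<le> max (R - real l * \<eta>) k"
    if "\<forall>i. x i \<in> carrier X \<and> \<rho> (x i) \<le> R" for l x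
    using that
  proof (induction l arbitrary: x)
    case 0
    have "x 0 \<in> signed_means 1 x"
      by (rule signed_meansI[of "\<lambda>i. 1"]) (use 0 in \<open>auto simp: signed_mean_def lessThan_Suc\<close>)
    then show ?case using 0 by (intro bexI[of _ "x 0"]) (auto intro: max.coboundedI1)
  next
    case (Suc l)
    let ?r = "max (R - real l * \<eta>) k"
    have "\<exists>z\<in>signed_means (2 ^ l) (\<lambda>i. x (j * 2 ^ l + i)). \<rho> z \<le> ?r" for j
      using Suc.prems by (intro Suc.IH) auto
    then obtain y where y: "\<And>j. y j \<in> signed_means (2 ^ l) (\<lambda>i. x (j * 2 ^ l + i))" "\<And>j. \<rho> (y j) \<le> ?r"
      by metis
    have ycl: "y j \<in> carrier X" for j using signed_means_closed[OF y(1)] Suc.prems by blast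
    have r: "?r \<le> max R k" using \<eta> by (intro max.mono) auto
    have "\<exists>z\<in>signed_means 2 y. \<rho> z \<le> max (R - real (Suc l) * \<eta>) k"
      using con[OF ycl ycl r y(2) y(2), of 0 1]
    proof
      assume "\<rho> ((1/2) \<odot> (y 0 \<oplus> y 1)) \<le> ?r - \<eta>"
      also have "?r - \<eta> \<le> max (R - real (Suc l) * \<eta>) k" using \<eta> by (auto simp: algebra_simps max_def)
      finally show ?thesis using signed_means_2(1)[of y, OF ycl] by blast
    next
      assume "\<rho> ((1/2) \<odot> (y 0 \<ominus> y 1)) \<le> k"
      then have "\<rho> ((1/2) \<odot> (y 0 \<ominus> y 1)) \<le> max (R - real (Suc l) * \<eta>) k" by simp
      then show ?thesis using signed_means_2(2)[of y, OF ycl] by blast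
    qed
    moreover have "signed_means 2 y \<subseteq> signed_means (2 * 2 ^ l) x"
    proof
      fix z assume "z \<in> signed_means 2 y"
      then show "z \<in> signed_means (2 * 2 ^ l) x"
        by (rule signed_means_nest[of x "2 ^ l" y z 2, rotated 3]) (use Suc.prems y(1) in auto)
    qed
    ultimately show ?case by auto
  qed
  obtain L where L: "R < real L * \<eta>" using reals_Archimedean3[OF \<eta>] by blast
  have "sign_contractive (2 ^ Suc L) (1 / 2)" unfolding sign_contractive_def
  proof (intro allI impI)
    fix x :: "nat \<Rightarrow> 'a" assume x: "\<forall>i. x i \<in> carrier X \<and> nrm X (x i) \<le> 1"
    then obtain z where z: "z \<in> signed_means (2 ^ Suc L) x" "\<rho> z \<le> max (R - real (Suc L) * \<eta>) k"
      using step[of x "Suc L"] R by blast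
    have "R - real (Suc L) * \<eta> \<le> k" using L \<eta> k(1) by (simp add: algebra_simps)
    then have "\<rho> z \<le> k" using z(2) by simp
    then show "\<exists>z\<in>signed_means (2 ^ Suc L) x. nrm X z \<le> 1 / 2"
      using z(1) k(2)[of z] signed_means_closed[OF z(1)] x by blast
  qed
  moreover have "(2::nat) ^ Suc L \<ge> 2" by simp
  ultimately show ?thesis by (intro B_convexI[of "2 ^ Suc L" "1 / 2"]) auto
qed

section \<open>Superreflexivity implies reflexivity\<close>

text \<open>
  Every space is finitely representable in itself, but superreflexivity speaks about spaces with
  carrier in the type \<open>'b\<close>. The injection \<open>h\<close> transports the structure of
  \<open>X\<close> to its image \<open>Y\<close>, and reflexivity is carried back along the isometry
  \<open>g\<close>.\<close>
theorem superreflexive_imp_reflexive: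
  fixes X :: "'a cnormed" (structure) and h :: "'a \<Rightarrow> 'b"
  assumes "complex_banach_space X" and inj: "inj_on h (carrier X)" and super: "superreflexive TYPE('b) X"
  shows "reflexive X"
proof -
  interpret complex_banach_space X by fact
  define g where "g = inv_into (carrier X) h"
  have gh: "g (h x) = x" if "x \<in> carrier X" for x using that inj by (simp add: g_def)
  define Y :: "'b cnormed" where "Y = \<lparr>carrier = h ` carrier X, monoid.mult = undefined, one = undefined,
    zero = h \<zero>, add = (\<lambda>a b. h (g a \<oplus> g b)), smult = (\<lambda>c a. h (c \<odot> g a)), nrm = (\<lambda>a. nrm X (g a))\<rparr>"
  have Y: "carrier Y = h ` carrier X" "\<zero>\<^bsub>Y\<^esub> = h \<zero>" "\<And>a b. a \<oplus>\<^bsub>Y\<^esub> b = h (g a \<oplus> g b)"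
    "\<And>c a. c \<odot>\<^bsub>Y\<^esub> a = h (c \<odot> g a)" "\<And>a. nrm Y a = nrm X (g a)"
    by (simp_all add: Y_def)
  have gcl: "g a \<in> carrier X" "h (g a) = a" if "a \<in> carrier Y" for a
    using that gh by (auto simp: Y)
  have ag: "abelian_group Y"
  proof (rule abelian_groupI)
    fix a assume a: "a \<in> carrier Y"
    have "h (\<ominus> g a) \<in> carrier Y" using gcl[OF a] by (simp add: Y)
    moreover have "h (\<ominus> g a) \<oplus>\<^bsub>Y\<^esub> a = \<zero>\<^bsub>Y\<^esub>" using gcl[OF a] by (simp add: Y gh M.l_neg)
    ultimately show "\<exists>b\<in>carrier Y. b \<oplus>\<^bsub>Y\<^esub> a = \<zero>\<^bsub>Y\<^esub>" by blast
  qed (auto simp: Y gh M.a_ac)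
  have md: "Module.module complex_ring Y"
    by (rule Module.moduleI[OF cring_complex_ring ag]) (auto simp: Y gh sm_add add_sm sm_sm)
  have cn: "complex_normed_space Y"
  proof (intro complex_normed_space.intro md complex_normed_space_axioms.intro)
    fix a assume a: "a \<in> carrier Y"
    show "nrm Y a = 0 \<longleftrightarrow> a = \<zero>\<^bsub>Y\<^esub>"
      using nrm_eq_0_iff[OF gcl(1)[OF a]] gcl[OF a] gh[of \<zero>] by (auto simp: Y(2,5))
    show "nrm Y (c \<odot>\<^bsub>Y\<^esub> a) = cmod c * nrm Y a" for c
      using gcl[OF a] by (simp add: Y gh nrm_smult)
    fix b assume b: "b \<in> carrier Y"
    show "nrm Y (a \<oplus>\<^bsub>Y\<^esub> b) \<le> nrm Y a + nrm Y b"
      using gcl[OF a] gcl[OF b] by (simp add: Y gh nrm_triangle)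
  qed
  interpret Y: complex_normed_space Y by (rule cn)
  have g_add: "g (a \<oplus>\<^bsub>Y\<^esub> b) = g a \<oplus> g b" if "a \<in> carrier Y" "b \<in> carrier Y" for a b
    using gcl that by (simp add: Y(3) gh)
  have g_sm: "g (c \<odot>\<^bsub>Y\<^esub> a) = c \<odot> g a" if "a \<in> carrier Y" for c a
    using gcl that by (simp add: Y(4) gh)
  have g_minus: "g (a \<ominus>\<^bsub>Y\<^esub> b) = g a \<ominus> g b" if "a \<in> carrier Y" "b \<in> carrier Y" for a b
    using that gcl by (simp add: Y.minus_sm minus_sm g_add g_sm)
  have h_cl: "h x \<in> carrier Y" if "x \<in> carrier X" for x using that by (simp add: Y)
  have "Metric_space.mcomplete (carrier Y) (nrm_dist Y)"
    unfolding Y.mcomplete_nrm_iff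
  proof (intro allI impI)
    fix \<sigma> :: "nat \<Rightarrow> 'b" assume s: "\<forall>n. \<sigma> n \<in> carrier Y"
      and cau: "\<forall>e>0. \<exists>N. \<forall>m\<ge>N. \<forall>n\<ge>N. nrm Y (\<sigma> m \<ominus>\<^bsub>Y\<^esub> \<sigma> n) < e"
    have eq: "nrm Y (\<sigma> m \<ominus>\<^bsub>Y\<^esub> \<sigma> n) = nrm X (g (\<sigma> m) \<ominus> g (\<sigma> n))" for m n
      using s by (simp add: Y(5) g_minus)
    have "\<exists>x\<in>carrier X. \<forall>e>0. \<exists>N. \<forall>n\<ge>N. nrm X (g (\<sigma> n) \<ominus> x) < e"
      using complete[unfolded mcomplete_nrm_iff, rule_format, of "\<lambda>n. g (\<sigma> n)"] s gcl cau eq by auto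
    then obtain x where x: "x \<in> carrier X" "\<forall>e>0. \<exists>N. \<forall>n\<ge>N. nrm X (g (\<sigma> n) \<ominus> x) < e" by blast
    have "nrm Y (\<sigma> n \<ominus>\<^bsub>Y\<^esub> h x) = nrm X (g (\<sigma> n) \<ominus> x)" for n
      using s x h_cl by (simp add: Y(5) g_minus gh)
    then show "\<exists>y\<in>carrier Y. \<forall>e>0. \<exists>N. \<forall>n\<ge>N. nrm Y (\<sigma> n \<ominus>\<^bsub>Y\<^esub> y) < e"
      using x h_cl by (intro bexI[of _ "h x"]) auto
  qed
  then have bY: "complex_banach_space Y"
    by (intro complex_banach_space.intro cn complex_banach_space_axioms.intro)
  have "finitely_representable_in Y X" unfolding finitely_representable_in_def
  proof (intro allI impI; elim conjE)
    fix E and \<epsilon> :: real assume E: "finite_dim_subspace Y E" and \<epsilon>: "\<epsilon> > 0"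
    have EY: "E \<subseteq> carrier Y"
      using E unfolding finite_dim_subspace_def by (auto intro!: Y.M.finsum_closed)
    have "linear_map_on E Y X g" unfolding linear_map_on_def using EY gcl(1) g_add g_sm by blast
    moreover have "nrm Y y / (1 + \<epsilon>) \<le> nrm X (g y) \<and> nrm X (g y) \<le> (1 + \<epsilon>) * nrm Y y" if "y \<in> E" for y
    proof -
      have "nrm X (g y) \<ge> 0" using that EY gcl by (intro nrm_nonneg) auto
      then show ?thesis using \<epsilon> by (simp add: Y(5) field_simps)
    qed
    ultimately show "\<exists>T. linear_map_on E Y X T \<and>
        (\<forall>y\<in>E. nrm Y y / (1 + \<epsilon>) \<le> nrm X (T y) \<and> nrm X (T y) \<le> (1 + \<epsilon>) * nrm Y y)" by blast
  qed
  then have rY: "reflexive Y" using super bY unfolding superreflexive_def by blast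
  interpret D: complex_normed_space "dual X" by (rule complex_normed_space_dual)
  interpret DY: complex_normed_space "dual Y" by (rule Y.complex_normed_space_dual)
  define pull where "pull f = (\<lambda>x\<in>carrier X. f (h x))" for f :: "'b \<Rightarrow> complex"
  have h_add: "h (x \<oplus> y) = h x \<oplus>\<^bsub>Y\<^esub> h y" if "x \<in> carrier X" "y \<in> carrier X" for x y
    using that by (simp add: Y(3) gh)
  have h_sm: "h (c \<odot> x) = c \<odot>\<^bsub>Y\<^esub> h x" if "x \<in> carrier X" for x c
    using that by (simp add: Y(4) gh)
  have pull_bl: "bl C (pull f)" if f: "Y.bl C f" for f C
  proof -
    have le: "cmod (f (h x)) \<le> C * nrm X x" if "x \<in> carrier X" for x
      using Y.bl_le[OF f h_cl[OF that]] gh[OF that] by (simp add: Y(5))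
    have "bl C (\<lambda>x. f (h x))" unfolding bl_def lin_def
      using Y.linD[OF Y.bl_lin[OF f]] le h_cl h_add h_sm by auto
    then show ?thesis unfolding pull_def by (rule bl_restrict)
  qed
  have pull_dual: "pull f \<in> carrier (dual X)" "nrm (dual X) (pull f) \<le> nrm (dual Y) f" if f: "f \<in> carrier (dual Y)" for f
    using pull_bl[OF Y.dual_bl[OF f]] DY.nrm_nonneg[OF f] nrm_dual_le
    by (auto simp: carrier_dual pull_def)
  show "reflexive X"
    unfolding reflexive_def
  proof (intro equalityI subsetI)
    fix F assume "F \<in> canonical_embedding X ` carrier X"
    then show "F \<in> carrier (dual (dual X))" using canonical_in_bidual by blast
  next
    fix F assume F: "F \<in> carrier (dual (dual X))"
    obtain M0 where M0: "bidual M0 F" and Fext: "F \<in> extensional (carrier (dual X))" using F in_bidual_iff by blast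
    define M where "M = max M0 0"
    have M: "bidual M F" "M \<ge> 0" using M0 D.bl_mono unfolding bidual_def M_def by auto
    define G where "G f = F (pull f)" for f
    have "DY.bl M G" unfolding DY.bl_def DY.lin_def
    proof (intro conjI ballI allI)
      fix f1 f2 assume f: "f1 \<in> carrier (dual Y)" "f2 \<in> carrier (dual Y)"
      have "pull (f1 \<oplus>\<^bsub>dual Y\<^esub> f2) = pull f1 \<oplus>\<^bsub>dual X\<^esub> pull f2"
        using h_cl by (auto simp: pull_def Y.dual_simps dual_simps fun_eq_iff)
      then show "G (f1 \<oplus>\<^bsub>dual Y\<^esub> f2) = G f1 + G f2"
        unfolding G_def using bidualD(1)[OF M(1) pull_dual(1) pull_dual(1)] f by simp
    next
      fix c f assume f: "f \<in> carrier (dual Y)"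
      have "pull (c \<odot>\<^bsub>dual Y\<^esub> f) = c \<odot>\<^bsub>dual X\<^esub> pull f"
        using h_cl by (auto simp: pull_def Y.dual_simps dual_simps fun_eq_iff)
      then show "G (c \<odot>\<^bsub>dual Y\<^esub> f) = c * G f"
        unfolding G_def using bidualD(2)[OF M(1) pull_dual(1)] f by simp
    next
      fix f assume f: "f \<in> carrier (dual Y)"
      have "cmod (G f) \<le> M * nrm (dual X) (pull f)" unfolding G_def by (rule bidualD(3)[OF M(1) pull_dual(1)[OF f]])
      also have "\<dots> \<le> M * nrm (dual Y) f" using pull_dual(2)[OF f] M(2) by (intro mult_left_mono)
      finally show "cmod (G f) \<le> M * nrm (dual Y) f" .
    qed
    then have "restrict G (carrier (dual Y)) \<in> carrier (dual (dual Y))" by (rule DY.restrict_in_dual)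
    then obtain y where y: "y \<in> carrier Y" "restrict G (carrier (dual Y)) = canonical_embedding Y y"
      using rY unfolding reflexive_def by blast
    have "F f = f (g y)" if f: "f \<in> carrier (dual X)" for f
    proof -
      define k where "k = (\<lambda>a\<in>carrier Y. f (g a))"
      have "Y.bl (nrm (dual X) f) (\<lambda>a. f (g a))" unfolding Y.bl_def Y.lin_def
        using linD[OF bl_lin[OF dual_bl[OF f]]] bl_le[OF dual_bl[OF f]] gcl(1) by (auto simp: g_add g_sm Y(5))
      then have k: "k \<in> carrier (dual Y)" unfolding k_def by (rule Y.restrict_in_dual)
      have "pull k = f" using f h_cl gh
        by (auto simp: pull_def k_def carrier_dual extensional_def fun_eq_iff)
      then have "F f = canonical_embedding Y y k" using fun_cong[OF y(2), of k] k by (simp add: G_def)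
      then show ?thesis using k y(1) by (simp add: canonical_embedding_def k_def)
    qed
    then have "F = canonical_embedding X (g y)"
      using Fext by (auto simp: canonical_embedding_def extensional_def fun_eq_iff)
    then show "F \<in> canonical_embedding X ` carrier X" using gcl(1)[OF y(1)] by blast
  qed
qed

section \<open>Orlicz functions and the growth conditions\<close>

locale orlicz =
  fixes \<phi> :: "real \<Rightarrow> real"
  assumes orlicz: "orlicz_function \<phi>"
begin

lemma phi_convex: "convex_on {0..} \<phi>" and phi_nonneg: "t \<ge> 0 \<Longrightarrow> \<phi> t \<ge> 0" and phi_0 [simp]: "\<phi> 0 = 0"
  and phi_tendsto_0: "(\<phi> \<longlongrightarrow> 0) (at_right 0)" and phi_nontrivial: "\<exists>t\<ge>0. \<phi> t \<noteq> 0"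
  using orlicz by (auto simp: orlicz_function_def)

lemma phi_scale:
  assumes "0 \<le> c" "c \<le> 1" "t \<ge> 0" shows "\<phi> (c * t) \<le> c * \<phi> t"
  using convex_onD[OF phi_convex, of c 0 t] assms by simp

lemma phi_mono: assumes "0 \<le> s" "s \<le> t" shows "\<phi> s \<le> \<phi> t"
proof (cases "t = 0")
  case False
  then have t: "t > 0" using assms by simp
  have "\<phi> ((s / t) * t) \<le> (s / t) * \<phi> t" using assms t by (intro phi_scale) auto
  also have "\<dots> \<le> 1 * \<phi> t" using assms t phi_nonneg[of t] by (intro mult_right_mono) auto
  finally show ?thesis using t by simp
qed (use assms in simp)

lemma phi_linear_lower: obtains C where "C > 0" "\<And>u. u \<ge> 0 \<Longrightarrow> u \<le> C * (\<phi> u + 1)"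
proof -
  obtain t where t: "t \<ge> 0" "\<phi> t \<noteq> 0" using phi_nontrivial by blast
  then have tp: "t > 0" "\<phi> t > 0" using phi_nonneg[of t] by (auto simp: less_le)
  define C where "C = max t (t / \<phi> t)"
  have C: "C \<ge> t" "C \<ge> t / \<phi> t" by (auto simp: C_def)
  show thesis
  proof (rule that[of C])
    show "C > 0" using C tp by linarith
    fix u :: real assume u: "u \<ge> 0"
    show "u \<le> C * (\<phi> u + 1)"
    proof (cases "u \<le> t")
      case True
      have "t * 1 \<le> C * (\<phi> u + 1)" using C tp phi_nonneg[OF u] by (intro mult_mono) auto
      then show ?thesis using True by simp
    next
      case False
      then have up: "u > 0" using tp by simp
      have "\<phi> ((t / u) * u) \<le> (t / u) * \<phi> u" using False up tp by (intro phi_scale) auto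
      then have "u \<le> t / \<phi> t * \<phi> u" using up tp by (simp add: field_simps)
      also have "\<dots> \<le> C * (\<phi> u + 1)" using C tp phi_nonneg[OF u] by (intro mult_mono) auto
      finally show ?thesis .
    qed
  qed
qed

lemma phi_at_top: obtains u0 where "u0 > 0" "\<And>u. u \<ge> u0 \<Longrightarrow> \<phi> u \<ge> M"
proof -
  obtain C where C: "C > 0" "\<And>u. u \<ge> 0 \<Longrightarrow> u \<le> C * (\<phi> u + 1)" by (rule phi_linear_lower) blast
  show thesis
  proof (rule that[of "C * (\<bar>M\<bar> + 1)"])
    show "C * (\<bar>M\<bar> + 1) > 0" using C by simp
    fix u assume u: "u \<ge> C * (\<bar>M\<bar> + 1)"
    then have "u \<ge> 0" using C by (meson less_imp_le abs_ge_zero add_nonneg_nonneg mult_nonneg_nonneg order_trans zero_le_one)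
    then have "C * (\<bar>M\<bar> + 1) \<le> C * (\<phi> u + 1)" using C(2)[of u] u by linarith
    then show "\<phi> u \<ge> M" using C by simp
  qed
qed

text \<open>
  With this slope \<open>t\<close> the supremum defining \<open>\<phi>\<^sup>*(t)\<close> is
  attained at \<open>s\<close>: Young's inequality is an equality.\<close>
lemma subgradient:
  assumes s: "s > 0"
  obtains t where "t \<ge> 0" "\<And>x. x \<ge> 0 \<Longrightarrow> \<phi> x \<ge> \<phi> s + t * (x - s)"
proof -
  define t where "t = Inf ((\<lambda>x. (\<phi> s - \<phi> x) / (s - x)) ` ({s<..} \<inter> {0..}))"
  have "s \<in> interior {0..}" by (rule interiorI[of "{0<..}"]) (use s in auto)
  then have le: "\<phi> x \<ge> \<phi> s + t * (x - s)" if "x \<ge> 0" for x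
    using convex_le_Inf_differential[OF phi_convex, of s x] that unfolding t_def by simp
  have "t \<ge> 0" unfolding t_def
  proof (rule cINF_greatest)
    have "s + 1 \<in> {s<..} \<inter> {0..}" using s by simp
    then show "{s<..} \<inter> {0..} \<noteq> {}" by blast
    fix x assume "x \<in> {s<..} \<inter> {0..}"
    then have "s < x" "\<phi> s \<le> \<phi> x" using s by (auto intro: phi_mono)
    then show "0 \<le> (\<phi> s - \<phi> x) / (s - x)" by (simp add: divide_nonpos_neg)
  qed
  then show thesis using that le by blast
qed

lemma phi_continuous: "continuous_on {0..} \<phi>"
  unfolding continuous_on_eq_continuous_within
proof
  fix x :: real assume x: "x \<in> {0..}"
  show "continuous (at x within {0..}) \<phi>"
  proof (cases "x = 0")
    case True
    have "at (0::real) within {0..} = at_right 0" by (simp add: at_within_Ici_at_right)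
    then show ?thesis using phi_tendsto_0 True by (simp add: continuous_within)
  next
    case False
    have "convex_on {0<..} \<phi>" using phi_convex by (rule convex_on_subset) auto
    then have "continuous_on {0<..} \<phi>" by (intro convex_on_continuous) auto
    then have "isCont \<phi> x" using False x by (simp add: continuous_on_eq_continuous_at)
    then show ?thesis by (rule continuous_at_imp_continuous_within)
  qed
qed

text \<open>
  Take \<open>s\<close> with \<open>\<phi>(2s) > 2k\<phi>(s)\<close> and let \<open>t\<close> be
  the slope at \<open>2s\<close>. Equality in Young's inequality at \<open>2s\<close> gives
  \<open>\<phi>(2s) + \<phi>\<^sup>*(t) = 2st\<close>, which bounds both
  \<open>k\<phi>(s)\<close> and \<open>\<phi>\<^sup>*(t)\<close>.\<close>
lemma not_Delta2_pairs:
  assumes nd: "\<not> Delta2_infty (\<lambda>u. ereal (\<phi> u))" and k: "k > 0"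
  obtains s t where "s > 0" "t > 0" "s * t \<ge> M" "k * \<phi> s \<le> s * t" "\<And>x. x \<ge> 0 \<Longrightarrow> x * t - \<phi> x \<le> 2 * (s * t)"
proof -
  obtain u0 where u0: "u0 > 0" "\<And>u. u \<ge> u0 \<Longrightarrow> \<phi> u \<ge> 2 * \<bar>M\<bar> + 1" by (rule phi_at_top) blast
  have "\<not> (\<forall>u\<ge>u0. ereal (\<phi> (2 * u)) \<le> ereal (2 * k) * ereal (\<phi> u))"
  proof
    assume "\<forall>u\<ge>u0. ereal (\<phi> (2 * u)) \<le> ereal (2 * k) * ereal (\<phi> u)"
    then have "Delta2_infty (\<lambda>u. ereal (\<phi> u))"
      unfolding Delta2_infty_def using k u0(1) by (intro conjI exI[of _ "2 * k"] exI[of _ u0]) auto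
    then show False using nd by blast
  qed
  then obtain u where u: "u \<ge> u0" "2 * k * \<phi> u < \<phi> (2 * u)" by (auto simp: not_le)
  have up: "u > 0" using u u0 by simp
  obtain t where t: "t \<ge> 0" "\<And>x. x \<ge> 0 \<Longrightarrow> \<phi> x \<ge> \<phi> (2 * u) + t * (x - 2 * u)"
    using subgradient[of "2 * u"] up by auto
  have le: "\<phi> (2 * u) \<le> 2 * (u * t)" using t(2)[of 0] by (simp add: algebra_simps)
  have big: "\<phi> (2 * u) \<ge> 2 * \<bar>M\<bar> + 1" using u0(2)[of "2 * u"] u up by simp
  show thesis
  proof (rule that[of u t])
    show "t > 0" using le big t(1) by (cases "t = 0") auto
    show "u * t \<ge> M" using le big by linarith
    show "k * \<phi> u \<le> u * t" using le u by simp
    fix x :: real assume "x \<ge> 0"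
    then have "x * t - \<phi> x \<le> 2 * (u * t) - \<phi> (2 * u)" using t(2)[of x] by (simp add: algebra_simps)
    then show "x * t - \<phi> x \<le> 2 * (u * t)" using phi_nonneg[of "2 * u"] up by simp
  qed (use up in auto)
qed

lemma complementary_ge: "x \<ge> 0 \<Longrightarrow> ereal (x * t - \<phi> x) \<le> complementary \<phi> t"
  unfolding complementary_def by (intro SUP_upper) auto

lemma complementary_le: "(\<And>x. x \<ge> 0 \<Longrightarrow> x * t - \<phi> x \<le> c) \<Longrightarrow> complementary \<phi> t \<le> ereal c"
  unfolding complementary_def by (intro SUP_least) auto

lemma complementary_nonneg: "complementary \<phi> t \<ge> 0"
  using complementary_ge[of 0 t] by (simp add: zero_ereal_def)

lemma complementary_finite_iff: "\<bar>complementary \<phi> t\<bar> \<noteq> \<infinity> \<longleftrightarrow> (\<exists>c. \<forall>x\<ge>0. x * t - \<phi> x \<le> c)"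
proof
  assume fin: "\<bar>complementary \<phi> t\<bar> \<noteq> \<infinity>"
  then have "ereal (real_of_ereal (complementary \<phi> t)) = complementary \<phi> t" by (simp add: ereal_real)
  then show "\<exists>c. \<forall>x\<ge>0. x * t - \<phi> x \<le> c" using complementary_ge by (metis ereal_less_eq(3))
next
  assume "\<exists>c. \<forall>x\<ge>0. x * t - \<phi> x \<le> c"
  then obtain c where "complementary \<phi> t \<le> ereal c" using complementary_le by blast
  then show "\<bar>complementary \<phi> t\<bar> \<noteq> \<infinity>" using complementary_nonneg[of t] by auto
qed

text \<open>
  Dual to \<open>not_Delta2_pairs\<close>: take \<open>t\<close> with
  \<open>\<phi>\<^sup>*(2t) > 2k\<phi>\<^sup>*(t)\<close> and let \<open>s\<close> nearly attain
  the supremum \<open>\<phi>\<^sup>*(2t)\<close>, so that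
  \<open>2st - \<phi>(s) > 2k\<phi>\<^sup>*(t)\<close>. If \<open>\<phi>\<^sup>*\<close> takes
  the value \<open>\<infinity>\<close>, there is a point \<open>t\<close> with
  \<open>\<phi>\<^sup>*(t)\<close> finite and \<open>\<phi>\<^sup>*(2t)\<close> infinite, and
  \<open>s\<close> can be chosen even more freely.\<close>
lemma not_Delta2_complementary_pairs:
  assumes nd: "\<not> Delta2_infty (complementary \<phi>)" and k: "k > 0"
  obtains s t where "s > 0" "t > 0" "s * t \<ge> M" "\<phi> s \<le> 2 * (s * t)" "\<And>x. x \<ge> 0 \<Longrightarrow> k * (x * t - \<phi> x) \<le> s * t"
proof -
  define fin where "fin t \<longleftrightarrow> (\<exists>c. \<forall>x\<ge>0. x * t - \<phi> x \<le> c)" for t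
  note result = that
  have main: thesis if t: "t > 0" and c: "\<And>x. x \<ge> 0 \<Longrightarrow> x * t - \<phi> x \<le> c"
    and s: "s \<ge> 0" "2 * (s * t) - \<phi> s > 2 * (k * c)" "2 * (s * t) - \<phi> s > 2 * (\<bar>M\<bar> + 1)" for s t c
  proof (rule result)
    have half: "b < x" if "2 * b < 2 * x - y" "0 \<le> y" for b x y :: real using that by simp
    have big: "s * t > k * c" "s * t > \<bar>M\<bar> + 1"
      using half[OF s(2) phi_nonneg[OF s(1)]] half[OF s(3) phi_nonneg[OF s(1)]] by blast+
    show "s > 0" using big s t by (cases "s = 0") auto
    show "s * t \<ge> M" using big by linarith
    have "\<phi> s \<le> 2 * (s * t) - 2 * (\<bar>M\<bar> + 1)" using s(3) by simp
    also have "\<dots> \<le> 2 * (s * t)" by simp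
    finally show "\<phi> s \<le> 2 * (s * t)" .
    fix x :: real assume "x \<ge> 0"
    then have "k * (x * t - \<phi> x) \<le> k * c" using c k by (intro mult_left_mono) auto
    then show "k * (x * t - \<phi> x) \<le> s * t" using big by linarith
  qed (use t in auto)
  show thesis
  proof (cases "\<forall>T\<ge>0. fin T")
    case False
    then obtain T where T: "T \<ge> 0" "\<not> fin T" by blast
    have fin_mono: "fin u" if v: "fin v" "u \<le> v" for u v
    proof -
      obtain c where "\<forall>x\<ge>0. x * v - \<phi> x \<le> c" using v by (auto simp: fin_def)
      then have "\<forall>x\<ge>0. x * u - \<phi> x \<le> c" using v(2)
        by (meson diff_right_mono mult_left_mono order_trans)
      then show ?thesis by (auto simp: fin_def)
    qed
    obtain C where C: "C > 0" "\<And>u. u \<ge> 0 \<Longrightarrow> u \<le> C * (\<phi> u + 1)" by (rule phi_linear_lower) blast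
    have "u * (1 / C) - \<phi> u \<le> 1" if "u \<ge> 0" for u
      using C(2)[OF that] C(1) by (simp add: field_simps)
    then have f0: "fin (2 ^ 0 / C)" unfolding fin_def by (intro exI[of _ 1]) auto
    obtain n where "T * C < 2 ^ n" using real_arch_pow[of 2 "T * C"] by auto
    then have "T \<le> 2 ^ n / C" using C(1) by (simp add: field_simps)
    then have ex: "\<exists>n. \<not> fin (2 ^ n / C)" using fin_mono T by blast
    (* The first dyadic multiple of 1/C at which the complementary function is infinite; it is
    finite at half that point. *)
    define n where "n = (LEAST n. \<not> fin (2 ^ n / C))"
    have n: "\<not> fin (2 ^ n / C)" unfolding n_def using ex by (rule LeastI_ex)
    then have "n \<noteq> 0" using f0 by metis
    then obtain m where m: "n = Suc m" by (cases n) auto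
    have "fin (2 ^ m / C)" using not_less_Least[of m "\<lambda>n. \<not> fin (2 ^ n / C)"] m unfolding n_def by auto
    then obtain c where c: "\<And>x. x \<ge> 0 \<Longrightarrow> x * (2 ^ m / C) - \<phi> x \<le> c" by (auto simp: fin_def)
    obtain s where s: "s \<ge> 0" "s * (2 ^ n / C) - \<phi> s > max (2 * (k * c)) (2 * (\<bar>M\<bar> + 1))"
      using n unfolding fin_def by (meson not_le)
    have "2 * (s * (2 ^ m / C)) = s * (2 ^ n / C)" by (simp add: m)
    then have "2 * (s * (2 ^ m / C)) - \<phi> s > 2 * (k * c)" "2 * (s * (2 ^ m / C)) - \<phi> s > 2 * (\<bar>M\<bar> + 1)"
      using s(2) by (simp_all only: max_less_iff_conj)
    then show thesis using C(1) by (intro main[of "2 ^ m / C" c s] c s(1)) auto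
  next
    case True
    then have "\<forall>u\<ge>0. \<bar>complementary \<phi> u\<bar> \<noteq> \<infinity>" by (simp add: complementary_finite_iff fin_def)
    moreover define u0 where "u0 = (\<bar>M\<bar> + 1) / k + \<phi> 1"
    moreover have u0: "u0 > 0" using k phi_nonneg[of 1] by (simp add: u0_def add_pos_nonneg)
    ultimately have "\<not> (\<forall>u\<ge>u0. complementary \<phi> (2 * u) \<le> ereal (2 * k) * complementary \<phi> u)"
      using nd k unfolding Delta2_infty_def
      by (metis less_imp_le mult_pos_pos zero_less_numeral)
    then obtain t where t: "t \<ge> u0" "ereal (2 * k) * complementary \<phi> t < complementary \<phi> (2 * t)"
      by (auto simp: not_le)
    define c where "c = real_of_ereal (complementary \<phi> t)"
    have ceq: "complementary \<phi> t = ereal c"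
      using \<open>\<forall>u\<ge>0. \<bar>complementary \<phi> u\<bar> \<noteq> \<infinity>\<close> t u0 unfolding c_def by (simp add: ereal_real)
    have c: "x * t - \<phi> x \<le> c" if "x \<ge> 0" for x using complementary_ge[OF that, of t] ceq by simp
    have "ereal (2 * k * c) < (SUP s\<in>{0..}. ereal (s * (2 * t) - \<phi> s))"
      using t ceq unfolding complementary_def by simp
    then obtain s where s: "s \<ge> 0" "2 * k * c < s * (2 * t) - \<phi> s" by (auto simp: less_SUP_iff)
    have "u0 - \<phi> 1 \<le> c" using c[of 1] t by simp
    then have "\<bar>M\<bar> + 1 \<le> k * c" using k by (simp add: u0_def field_simps)
    then show thesis using main[of t c s] c s t u0 by (simp add: algebra_simps)
  qed
qed

text \<open>
  Iterating the doubling condition removes any dilation of the argument. The summand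
  \<open>1\<close> absorbs the bounded range of \<open>u\<close> on which the condition says
  nothing.\<close>
lemma Delta2_bound:
  assumes L: "L \<ge> 0" and "Delta2_infty (\<lambda>u. ereal (\<phi> u))"
  obtains C where "C > 0" "\<And>u. u \<ge> 0 \<Longrightarrow> \<phi> (L * u) \<le> C * (\<phi> u + 1)"
proof -
  obtain k u0 where k: "k > 0" "u0 \<ge> 0" "\<And>u. u \<ge> u0 \<Longrightarrow> \<phi> (2 * u) \<le> k * \<phi> u"
    using assms unfolding Delta2_infty_def by auto
  define K where "K = k + \<phi> (2 * u0) + 1"
  have K: "K \<ge> 1" using k phi_nonneg[of "2 * u0"] by (simp add: K_def)
  have 1: "\<phi> (2 * u) + 1 \<le> (K + 1) * (\<phi> u + 1)" if u: "u \<ge> 0" for u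
  proof -
    have "\<phi> (2 * u) \<le> K * (\<phi> u + 1)"
    proof (cases "u \<ge> u0")
      case True
      have "\<phi> (2 * u) \<le> k * \<phi> u" using k True by blast
      also have "\<dots> \<le> K * (\<phi> u + 1)" using k phi_nonneg[OF u] phi_nonneg[of "2 * u0"] by (intro mult_mono) (auto simp: K_def)
      finally show ?thesis .
    next
      case False
      then have "\<phi> (2 * u) \<le> \<phi> (2 * u0)" using u by (intro phi_mono) auto
      also have "\<dots> \<le> K * 1" using k by (simp add: K_def)
      also have "\<dots> \<le> K * (\<phi> u + 1)" using K phi_nonneg[OF u] by (intro mult_left_mono) auto
      finally show ?thesis .
    qed
    then show ?thesis using phi_nonneg[OF u] by (simp add: algebra_simps)
  qed
  have n: "\<phi> (2 ^ n * u) + 1 \<le> (K + 1) ^ n * (\<phi> u + 1)" if u: "u \<ge> 0" for n u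
  proof (induction n)
    case (Suc n)
    have "\<phi> (2 ^ Suc n * u) + 1 \<le> (K + 1) * (\<phi> (2 ^ n * u) + 1)" using 1[of "2 ^ n * u"] u by (simp add: mult.assoc)
    also have "\<dots> \<le> (K + 1) * ((K + 1) ^ n * (\<phi> u + 1))" using Suc K by (intro mult_left_mono) auto
    finally show ?case by (simp add: mult.assoc)
  qed simp
  obtain n where nL: "\<bar>L\<bar> < 2 ^ n" using real_arch_pow[of 2 "\<bar>L\<bar>"] by auto
  show thesis
  proof (rule that[of "(K + 1) ^ n"])
    show "(K + 1) ^ n > 0" using K by simp
    fix u :: real assume u: "u \<ge> 0"
    have "\<phi> (L * u) \<le> \<phi> (2 ^ n * u)" using u L nL by (intro phi_mono mult_right_mono) auto
    also have "\<dots> \<le> (K + 1) ^ n * (\<phi> u + 1)" using n[OF u, of n] by simp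
    finally show "\<phi> (L * u) \<le> (K + 1) ^ n * (\<phi> u + 1)" .
  qed
qed

text \<open>
  Let \<open>t\<close> be the slope at \<open>s\<close>. Young's inequality for \<open>as\<close>
  and \<open>2t\<close> gives \<open>2ast \<le> \<phi>(as) + \<phi>\<^sup>*(2t)\<close>, while
  \<open>\<phi>\<^sup>*(2t) \<le> k\<phi>\<^sup>*(t) = k(st - \<phi>(s))\<close>. For
  \<open>k \<le> 2a\<close> the terms with \<open>st\<close> cancel.\<close>
lemma Delta2_complementary_growth:
  assumes "Delta2_infty (complementary \<phi>)"
  obtains a s0 where "a \<ge> 2" "s0 > 0" "\<And>s. s \<ge> s0 \<Longrightarrow> 2 * a * \<phi> s \<le> \<phi> (a * s)" "\<phi> s0 > 0"
proof -
  obtain k t0 where k: "k > 0" "t0 \<ge> 0" and fin: "\<And>u. u \<ge> 0 \<Longrightarrow> \<bar>complementary \<phi> u\<bar> \<noteq> \<infinity>"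
    and d2: "\<And>u. u \<ge> t0 \<Longrightarrow> complementary \<phi> (2 * u) \<le> ereal k * complementary \<phi> u"
    using assms unfolding Delta2_infty_def by blast
  define ps where "ps t = real_of_ereal (complementary \<phi> t)" for t
  have ps: "complementary \<phi> t = ereal (ps t)" if "t \<ge> 0" for t using fin[OF that] by (simp add: ps_def ereal_real)
  have young: "x * t \<le> \<phi> x + ps t" if "x \<ge> 0" "t \<ge> 0" for x t
    using complementary_ge[OF that(1), of t] ps[OF that(2)] by simp
  have ps_le: "ps t \<le> c" if "t \<ge> 0" "\<And>x. x \<ge> 0 \<Longrightarrow> x * t - \<phi> x \<le> c" for t c
    using complementary_le[OF that(2)] ps[OF that(1)] by simp
  have ps_pos: "ps t \<ge> 0" if "t \<ge> 0" for t using young[of 0 t] that by simp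
  define a where "a = max k 4 / 2"
  have a: "a \<ge> 2" "k \<le> 2 * a" by (auto simp: a_def)
  obtain u1 where u1: "u1 > 0" "\<And>u. u \<ge> u1 \<Longrightarrow> \<phi> u \<ge> 1" by (rule phi_at_top[of 1]) blast
  (* This choice makes the slope at every s \<ge> s0 at least t0, where the doubling condition
  applies. *)
  define s0 where "s0 = max u1 (ps (t0 + 1))"
  have s0: "s0 > 0" "s0 \<ge> u1" "s0 \<ge> ps (t0 + 1)" using u1 by (auto simp: s0_def)
  show thesis
  proof (rule that[of a s0])
    show "\<phi> s0 > 0" using u1(2)[of s0] s0 by simp
    fix s assume s: "s \<ge> s0"
    then have sp: "s > 0" using s0 by simp
    obtain t where t: "t \<ge> 0" "\<And>x. x \<ge> 0 \<Longrightarrow> \<phi> x \<ge> \<phi> s + t * (x - s)" using subgradient[OF sp] by blast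
    have "\<phi> s \<le> s * t" using t(2)[of 0] by (simp add: algebra_simps)
    then have "s * (t0 + 1) \<le> s * t + ps (t0 + 1)" using young[of s "t0 + 1"] sp k by simp
    also have "\<dots> \<le> s * (t + 1)" using s s0 by (simp add: algebra_simps)
    finally have tt: "t0 \<le> t" using sp by simp
    have pst: "ps t \<le> s * t - \<phi> s"
    proof (rule ps_le[OF t(1)])
      fix x :: real assume "x \<ge> 0"
      then show "x * t - \<phi> x \<le> s * t - \<phi> s" using t(2)[of x] by (simp add: algebra_simps)
    qed
    have "ps (2 * t) \<le> k * ps t" using d2[OF tt] t(1) by (simp add: ps)
    also have "\<dots> \<le> 2 * a * ps t" using a ps_pos[OF t(1)] by (intro mult_right_mono)
    also have "\<dots> \<le> 2 * a * (s * t - \<phi> s)" using a pst by (intro mult_left_mono) auto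
    finally have "ps (2 * t) \<le> 2 * a * (s * t) - 2 * a * \<phi> s" by (simp add: algebra_simps)
    moreover have "2 * a * (s * t) \<le> \<phi> (a * s) + ps (2 * t)"
      using young[of "a * s" "2 * t"] a sp t(1) by (simp add: algebra_simps)
    ultimately show "2 * a * \<phi> s \<le> \<phi> (a * s)" by linarith
  qed (use a s0 in auto)
qed

end

section \<open>An equivalent uniformly convex function\<close>

lemma powr_strict_midconvex:
  fixes x y r :: real
  assumes r: "r > 1" and x: "0 \<le> x" and xy: "x < y"
  shows "((x + y) / 2) powr r < (x powr r + y powr r) / 2"
proof -
  define m where "m = (x + y) / 2"
  have m: "x < m" "m < y" "m - x = y - m" using xy by (auto simp: m_def field_simps)
  have cont: "continuous_on {p..q} (\<lambda>z::real. z powr r)" if "0 \<le> p" for p q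
    using that r by (intro continuous_on_powr' continuous_intros) auto
  have der: "((\<lambda>z. z powr r) has_real_derivative r * z powr (r - 1)) (at z)" if "z > 0" for z :: real
    using has_real_derivative_powr[OF that] .
  have mvt: "\<exists>z. p < z \<and> z < q \<and> q powr r - p powr r = (q - p) * (r * z powr (r - 1))"
    if pq: "0 \<le> p" "p < q" for p q :: real
  proof -
    have "(\<lambda>z. z powr r) differentiable (at z)" if "p < z" "z < q" for z
      using der[of z] that pq by (auto simp: real_differentiable_def)
    then obtain l z where z: "p < z" "z < q" "DERIV (\<lambda>z. z powr r) z :> l" "q powr r - p powr r = (q - p) * l"
      using MVT[OF pq(2) cont[OF pq(1)]] by blast
    have "l = r * z powr (r - 1)" using DERIV_unique[OF z(3) der] z pq by simp
    then show ?thesis using z by blast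
  qed
  obtain \<zeta> where z: "x < \<zeta>" "\<zeta> < m" "m powr r - x powr r = (m - x) * (r * \<zeta> powr (r - 1))"
    using mvt[OF x m(1)] by blast
  obtain \<xi> where xi: "m < \<xi>" "\<xi> < y" "y powr r - m powr r = (y - m) * (r * \<xi> powr (r - 1))"
    using mvt[of m y] x m by auto
  have "\<zeta> powr (r - 1) < \<xi> powr (r - 1)" using z xi x r by (intro powr_less_mono2) auto
  then have "(m - x) * (r * \<zeta> powr (r - 1)) < (y - m) * (r * \<xi> powr (r - 1))"
    unfolding m(3)[symmetric] using m r by simp
  then show ?thesis using z xi unfolding m_def[symmetric] by simp
qed

text \<open>
  If the moduli differ, strict convexity of the power suffices; if they agree, the parallelogram law
  makes the modulus of the midpoint strictly smaller.\<close>
lemma norm_powr_strict_midconvex: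
  fixes a b :: complex
  assumes r: "r > 1" and ab: "a \<noteq> b"
  shows "cmod ((a + b) / 2) powr r < (cmod a powr r + cmod b powr r) / 2"
proof (cases "cmod a = cmod b")
  case True
  have "(cmod (a + b))\<^sup>2 + (cmod (a - b))\<^sup>2 = 2 * (cmod a)\<^sup>2 + 2 * (cmod b)\<^sup>2"
    unfolding cmod_power2 by (simp add: power2_eq_square algebra_simps)
  moreover have "(cmod (a - b))\<^sup>2 > 0" using ab by simp
  ultimately have "(cmod (a + b))\<^sup>2 < 2 * (cmod a)\<^sup>2 + 2 * (cmod b)\<^sup>2" by linarith
  also have "\<dots> = (2 * cmod a)\<^sup>2" using True by (simp add: power_mult_distrib)
  finally have "(cmod (a + b))\<^sup>2 < (2 * cmod a)\<^sup>2" .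
  then have "cmod (a + b) < 2 * cmod a" by (rule power2_less_imp_less) simp
  then have "cmod ((a + b) / 2) < cmod a" by (simp add: norm_divide)
  then have "cmod ((a + b) / 2) powr r < cmod a powr r" using r by (intro powr_less_mono2) auto
  then show ?thesis using True by simp
next
  case False
  have "cmod ((a + b) / 2) \<le> (cmod a + cmod b) / 2"
    using norm_triangle_ineq[of a b] by (simp add: norm_divide)
  then have "cmod ((a + b) / 2) powr r \<le> ((cmod a + cmod b) / 2) powr r" using r by (intro powr_mono2) auto
  also have "\<dots> < (cmod a powr r + cmod b powr r) / 2"
  proof (cases "cmod a < cmod b")
    case True
    then show ?thesis using powr_strict_midconvex[OF r, of "cmod a" "cmod b"] by simp
  next
    case F: False
    then show ?thesis using powr_strict_midconvex[OF r, of "cmod b" "cmod a"] False by (simp add: add.commute)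
  qed
  finally show ?thesis .
qed

text \<open>
  By homogeneity it is enough to treat pairs with \<open>max |a| |b| = 1\<close>. Those with
  \<open>|a - b| \<ge> t\<close> form a compact set, on which the midpoint defect is continuous
  and positive.\<close>
lemma norm_powr_uniformly_convex:
  assumes r: "r > 1" and t: "t > 0"
  obtains \<delta> where "0 < \<delta>" "\<delta> \<le> 1"
    "\<And>a b :: complex. t * max (cmod a) (cmod b) \<le> cmod (a - b) \<Longrightarrow>
      cmod ((a + b) / 2) powr r \<le> (1 - \<delta>) * ((cmod a powr r + cmod b powr r) / 2)"
proof -
  define D where "D = (\<lambda>(a, b). (cmod a powr r + cmod b powr r) / 2 - cmod ((a + b) / 2) powr r)"
  define S where "S = {z :: complex \<times> complex. max (cmod (fst z)) (cmod (snd z)) = 1} \<inter> {z. t \<le> cmod (fst z - snd z)}"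
  have cl: "closed S" unfolding S_def
    by (intro closed_Int closed_Collect_eq closed_Collect_le continuous_intros)
  have "S \<subseteq> cball 0 1 \<times> cball 0 1" by (auto simp: S_def max_def split: if_splits)
  then have "compact S"
    using cl compact_Int_closed[OF compact_Times[OF compact_cball compact_cball], of S 0 1 0 1]
    by (simp add: Int_absorb1)
  have contD: "continuous_on S D" unfolding D_def case_prod_unfold
    using r by (intro continuous_intros continuous_on_powr') auto
  have "\<exists>\<delta>. 0 < \<delta> \<and> \<delta> \<le> 1 \<and> (\<forall>z\<in>S. \<delta> \<le> D z)"
  proof (cases "S = {}")
    case False
    obtain z where z: "z \<in> S" "\<And>w. w \<in> S \<Longrightarrow> D z \<le> D w"
      using continuous_attains_inf[OF \<open>compact S\<close> False contD] by blast
    have "fst z \<noteq> snd z" using z(1) t by (auto simp: S_def)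
    then have "D z > 0" using norm_powr_strict_midconvex[OF r, of "fst z" "snd z"] by (simp add: D_def case_prod_unfold)
    then show ?thesis using z(2) by (intro exI[of _ "min 1 (D z)"]) (auto simp: min.coboundedI2)
  qed (auto intro: exI[of _ 1])
  then obtain \<delta> where \<delta>: "0 < \<delta>" "\<delta> \<le> 1" "\<And>z. z \<in> S \<Longrightarrow> \<delta> \<le> D z" by blast
  show thesis
  proof (rule that[OF \<delta>(1,2)])
    fix a b :: complex assume ab: "t * max (cmod a) (cmod b) \<le> cmod (a - b)"
    define m where "m = max (cmod a) (cmod b)"
    show "cmod ((a + b) / 2) powr r \<le> (1 - \<delta>) * ((cmod a powr r + cmod b powr r) / 2)"
    proof (cases "m = 0")
      case True
      then have "a = 0" "b = 0" by (auto simp: m_def max_def split: if_splits)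
      then show ?thesis by simp
    next
      case False
      have "m \<ge> 0" by (simp add: m_def le_max_iff_disj)
      then have m: "m > 0" using False by simp
      define a' where "a' = a / of_real m"
      define b' where "b' = b / of_real m"
      have a: "a = of_real m * a'" "b = of_real m * b'" using m by (auto simp: a'_def b'_def)
      have n: "cmod a' = cmod a / m" "cmod b' = cmod b / m" using m by (auto simp: a'_def b'_def norm_divide)
      have mx: "max (cmod a') (cmod b') = 1"
        unfolding n using m by (auto simp: m_def max_def split: if_splits)
      have "a - b = of_real m * (a' - b')" unfolding a by (simp add: algebra_simps)
      then have "cmod (a - b) = m * cmod (a' - b')" using m by (simp add: norm_mult)
      then have "t \<le> cmod (a' - b')" using ab m unfolding m_def[symmetric] by simp
      then have "(a', b') \<in> S" using mx by (simp add: S_def)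
      then have D: "\<delta> \<le> D (a', b')" by (rule \<delta>(3))
      have "cmod a' powr r \<le> 1 powr r" "cmod b' powr r \<le> 1 powr r"
        using mx r by (intro powr_mono2; simp; linarith)+
      then have le1: "(cmod a' powr r + cmod b' powr r) / 2 \<le> 1" by simp
      have "\<delta> * ((cmod a' powr r + cmod b' powr r) / 2) \<le> \<delta> * 1" using \<delta>(1) le1 by (intro mult_left_mono) auto
      then have "cmod ((a' + b') / 2) powr r \<le> (1 - \<delta>) * ((cmod a' powr r + cmod b' powr r) / 2)"
        using D unfolding D_def case_prod_conv left_diff_distrib by linarith
      then have "m powr r * cmod ((a' + b') / 2) powr r \<le> m powr r * ((1 - \<delta>) * ((cmod a' powr r + cmod b' powr r) / 2))"
        by (intro mult_left_mono) auto
      moreover have "(a + b) / 2 = of_real m * ((a' + b') / 2)" unfolding a by (simp add: algebra_simps)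
      then have "cmod ((a + b) / 2) powr r = m powr r * cmod ((a' + b') / 2) powr r"
        using m by (simp only: norm_mult powr_mult) simp
      moreover have "cmod a powr r = m powr r * cmod a' powr r" "cmod b powr r = m powr r * cmod b' powr r"
        unfolding a using m by (simp_all add: norm_mult powr_mult)
      ultimately show ?thesis by (simp add: algebra_simps)
    qed
  qed
qed

locale orlicz_growth = orlicz +
  fixes a s0 :: real
  assumes a: "a \<ge> 2" and s0: "s0 > 0" "\<phi> s0 > 0"
    and growth: "\<And>s. s \<ge> s0 \<Longrightarrow> 2 * a * \<phi> s \<le> \<phi> (a * s)"
    and D2: "Delta2_infty (\<lambda>u. ereal (\<phi> u))"
begin

definition r where "r = 1 + log a 2"

lemma r: "r > 1" using a by (simp add: r_def)

lemma a_powr_r: "a powr r = 2 * a" using a by (simp add: r_def powr_add)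

text \<open>
  The exponent satisfies \<open>a\<^sup>r = 2a\<close>, so the growth hypothesis says
  \<open>\<phi>(as) \<ge> a\<^sup>r\<phi>(s)\<close>; iterating it and interpolating by
  monotonicity costs the factor \<open>2a\<close>.\<close>
lemma growth_powr:
  assumes w: "w \<ge> s0" and l: "c \<ge> 1" shows "c powr r * \<phi> w \<le> 2 * a * \<phi> (c * w)"
proof -
  have "c powr r * \<phi> w \<le> 2 * a * \<phi> (c * w)" if "1 \<le> c" "c \<le> a ^ n" for n c
    using that
  proof (induction n arbitrary: c)
    case 0
    then have "c = 1" by simp
    moreover have "1 * \<phi> w \<le> 2 * a * \<phi> w" using a w s0 phi_nonneg[of w] by (intro mult_right_mono) auto
    ultimately show ?case by simp
  next
    case (Suc n)
    have wp: "w > 0" using w s0 by simp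
    show ?case
    proof (cases "c \<le> a")
      case True
      have "c powr r \<le> a powr r" using Suc.prems True r by (intro powr_mono2) auto
      moreover have "\<phi> w \<le> \<phi> (c * w)" using Suc.prems wp by (intro phi_mono) auto
      ultimately show ?thesis unfolding a_powr_r using phi_nonneg[of w] wp a by (intro mult_mono) auto
    next
      case False
      define \<mu> where "\<mu> = c / a"
      have mu: "1 \<le> \<mu>" "\<mu> \<le> a ^ n" "c = a * \<mu>" using False Suc.prems a by (auto simp: \<mu>_def field_simps)
      have "s0 * 1 \<le> w * \<mu>" using mu w s0 by (intro mult_mono) auto
      then have g: "2 * a * \<phi> (\<mu> * w) \<le> \<phi> (a * (\<mu> * w))" by (intro growth) (simp add: mult.commute)
      have "c powr r * \<phi> w = (2 * a) * (\<mu> powr r * \<phi> w)"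
        unfolding mu(3) using mu a by (simp add: powr_mult a_powr_r)
      also have "\<dots> \<le> (2 * a) * (2 * a * \<phi> (\<mu> * w))" using Suc.IH[OF mu(1,2)] a by (intro mult_left_mono) auto
      also have "\<dots> \<le> (2 * a) * \<phi> (a * (\<mu> * w))" using g a by (intro mult_left_mono) auto
      finally show ?thesis unfolding mu(3) by (simp add: mult.assoc)
    qed
  qed
  moreover obtain n where "c < a ^ n" using real_arch_pow[of a c] a by auto
  ultimately show ?thesis using l by (meson less_imp_le)
qed

text \<open>
  As a function of \<open>v\<close> this vanishes up to \<open>w\<^sup>r\<close> and is affine
  afterwards, with slope \<open>\<phi>(w)/w\<^sup>r\<close>.\<close>
definition hinge where "hinge w v = max 0 (\<phi> w * (v / w powr r - 1))"

text \<open>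
  A convex function of \<open>v = u\<^sup>r\<close> comparable to \<open>\<phi>(u)\<close> for
  large \<open>u\<close>. Since the hinges with \<open>w\<^sup>r \<ge> v\<close> do not
  contribute, the growth of \<open>\<phi>\<close> keeps the supremum finite. The summand
  \<open>v\<close> makes the function positive away from \<open>0\<close>, so that a small modular
  forces a small norm even where \<open>\<phi>\<close> vanishes.\<close>
definition convex_env where "convex_env v = v + (SUP w\<in>{s0..}. hinge w v)"

lemma hinge_le:
  assumes w: "w \<ge> s0" shows "hinge w v \<le> 2 * a * \<phi> (max 0 v powr (1 / r))"
proof -
  have wp: "w > 0" using w s0 by simp
  have rhs: "0 \<le> 2 * a * \<phi> (max 0 v powr (1 / r))" using a phi_nonneg by simp
  show ?thesis
  proof (cases "v \<le> w powr r")
    case True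
    then have "v / w powr r - 1 \<le> 0" using wp by simp
    then have "\<phi> w * (v / w powr r - 1) \<le> 0" using phi_nonneg[of w] wp by (intro mult_nonneg_nonpos) auto
    then have "hinge w v = 0" unfolding hinge_def by (rule max_absorb1)
    then show ?thesis using rhs by simp
  next
    case False
    have "w powr r > 0" using wp by simp
    then have v: "v > 0" using False by linarith
    define u where "u = v powr (1 / r)"
    have ur: "u powr r = v" using v r by (simp add: u_def powr_powr)
    have up: "u > 0" using v by (simp add: u_def)
    have "w < u"
    proof (rule ccontr)
      assume "\<not> w < u"
      then have "u powr r \<le> w powr r" using up r by (intro powr_mono2) auto
      then show False using False ur by simp
    qed
    then have "(u / w) powr r * \<phi> w \<le> 2 * a * \<phi> (u / w * w)" using wp by (intro growth_powr w) auto
    then have "v / w powr r * \<phi> w \<le> 2 * a * \<phi> u" using wp up ur by (simp add: powr_divide)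
    moreover have "\<phi> w * (v / w powr r - 1) \<le> v / w powr r * \<phi> w" using phi_nonneg[of w] wp by (simp add: algebra_simps)
    ultimately show ?thesis using rhs v unfolding hinge_def u_def by simp
  qed
qed

lemma bdd_above_hinge: "bdd_above ((\<lambda>w. hinge w v) ` {s0..})"
  using hinge_le by (intro bdd_aboveI2[where M = "2 * a * \<phi> (max 0 v powr (1 / r))"]) auto

lemma convex_env_ge: "w \<ge> s0 \<Longrightarrow> v + hinge w v \<le> convex_env v"
  unfolding convex_env_def by (intro add_left_mono cSUP_upper bdd_above_hinge) auto

lemma convex_env_le: "(\<And>w. w \<ge> s0 \<Longrightarrow> v + hinge w v \<le> c) \<Longrightarrow> convex_env v \<le> c"
proof -
  assume "\<And>w. w \<ge> s0 \<Longrightarrow> v + hinge w v \<le> c"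
  then have "(SUP w\<in>{s0..}. hinge w v) \<le> c - v" by (intro cSUP_least) (auto simp: algebra_simps)
  then show ?thesis by (simp add: convex_env_def)
qed

lemma convex_env_ge_self: "v \<le> convex_env v"
  using convex_env_ge[of s0 v] by (auto simp: hinge_def max_def split: if_splits)

lemma convex_env_mono: "v \<le> v' \<Longrightarrow> convex_env v \<le> convex_env v'"
proof (rule convex_env_le)
  fix w assume vv: "v \<le> v'" and w: "w \<ge> s0"
  have "\<phi> w * (v / w powr r - 1) \<le> \<phi> w * (v' / w powr r - 1)"
    using vv w s0 phi_nonneg[of w] by (intro mult_left_mono diff_right_mono divide_right_mono) auto
  then have "v + hinge w v \<le> v' + hinge w v'" unfolding hinge_def using vv by linarith
  then show "v + hinge w v \<le> convex_env v'" using convex_env_ge[OF w, of v'] by simp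
qed

lemma convex_env_scale: assumes c: "0 \<le> c" "c \<le> 1" shows "convex_env (c * v) \<le> c * convex_env v"
proof (rule convex_env_le)
  fix w assume w: "w \<ge> s0"
  have p: "\<phi> w \<ge> 0" using w s0 by (intro phi_nonneg) auto
  have "\<phi> w * (c * v / w powr r - 1) \<le> \<phi> w * (c * (v / w powr r - 1))"
    using p c by (intro mult_left_mono) (auto simp: algebra_simps)
  also have "\<dots> = c * (\<phi> w * (v / w powr r - 1))" by simp
  also have "\<dots> \<le> c * hinge w v" unfolding hinge_def using c by (intro mult_left_mono) auto
  finally have "hinge w (c * v) \<le> c * hinge w v" unfolding hinge_def[of w "c * v"] using c by (simp add: hinge_def)
  then have "c * v + hinge w (c * v) \<le> c * (v + hinge w v)" by (simp add: distrib_left)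
  also have "\<dots> \<le> c * convex_env v" using convex_env_ge[OF w] c by (intro mult_left_mono) auto
  finally show "c * v + hinge w (c * v) \<le> c * convex_env v" .
qed

lemma convex_env_midconvex: "convex_env ((v + v') / 2) \<le> (convex_env v + convex_env v') / 2"
proof (rule convex_env_le)
  fix w assume w: "w \<ge> s0"
  have eq: "\<phi> w * ((v + v') / 2 / w powr r - 1) = (\<phi> w * (v / w powr r - 1) + \<phi> w * (v' / w powr r - 1)) / 2"
    by (simp add: algebra_simps add_divide_distrib)
  have "max 0 ((x + y) / 2) \<le> (max 0 x + max 0 y) / 2" for x y :: real by (auto simp: max_def field_simps)
  then have "hinge w ((v + v') / 2) \<le> (hinge w v + hinge w v') / 2" unfolding hinge_def eq .
  then have "(v + v') / 2 + hinge w ((v + v') / 2) \<le> ((v + hinge w v) + (v' + hinge w v')) / 2" by (simp add: field_simps)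
  also have "\<dots> \<le> (convex_env v + convex_env v') / 2" using convex_env_ge[OF w, of v] convex_env_ge[OF w, of v'] by simp
  finally show "(v + v') / 2 + hinge w ((v + v') / 2) \<le> (convex_env v + convex_env v') / 2" .
qed

definition \<Psi> where "\<Psi> u = convex_env (max 0 u powr r)"

lemma Psi_mono: "u \<le> v \<Longrightarrow> \<Psi> u \<le> \<Psi> v"
  unfolding \<Psi>_def using r by (intro convex_env_mono powr_mono2) auto

lemma Psi_ge: "max 0 u powr r \<le> \<Psi> u"
  unfolding \<Psi>_def by (rule convex_env_ge_self)

lemma Psi_nonneg: "0 \<le> \<Psi> u"
  using Psi_ge[of u] order_trans[OF powr_ge_zero] by blast

lemma Psi_midconvex:
  fixes x y :: complex shows "\<Psi> (cmod ((x + y) / 2)) \<le> (\<Psi> (cmod x) + \<Psi> (cmod y)) / 2"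
proof -
  have "cmod ((x + y) / 2) powr r \<le> (cmod x powr r + cmod y powr r) / 2"
    using norm_powr_strict_midconvex[OF r, of x y] by (cases "x = y") auto
  from order_trans[OF convex_env_mono[OF this] convex_env_midconvex] show ?thesis by (simp add: \<Psi>_def)
qed

text \<open>
  If \<open>|x - y|\<close> is not small compared to \<open>max |x| |y|\<close>, the uniform
  convexity of \<open>|z|\<^sup>r\<close> makes the midpoint defect at least a fixed fraction of
  \<open>\<Psi>|x| + \<Psi>|y|\<close>. Otherwise \<open>\<Psi>(|x - y|/2)\<close> is itself at
  most \<open>t(\<Psi>|x| + \<Psi>|y|)\<close>. Convexity of the outer function passes both
  estimates from \<open>|z|\<^sup>r\<close> to \<open>\<Psi>\<close>.\<close>
theorem Psi_defect:
  assumes t: "t > 0"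
  obtains K where "K \<ge> 0" "\<And>x y :: complex. \<Psi> (cmod ((x - y) / 2)) \<le>
     t * (\<Psi> (cmod x) + \<Psi> (cmod y)) + K * ((\<Psi> (cmod x) + \<Psi> (cmod y)) / 2 - \<Psi> (cmod ((x + y) / 2)))"
proof -
  define t' where "t' = min t 1"
  have t': "t' > 0" "t' \<le> 1" "t' \<le> t" using t by (auto simp: t'_def)
  obtain \<delta> where d: "0 < \<delta>" "\<delta> \<le> 1" and uc:
    "\<And>a b :: complex. t' * max (cmod a) (cmod b) \<le> cmod (a - b) \<Longrightarrow>
      cmod ((a + b) / 2) powr r \<le> (1 - \<delta>) * ((cmod a powr r + cmod b powr r) / 2)"
    by (rule norm_powr_uniformly_convex[OF r t'(1)]) blast
  show thesis
  proof (rule that[of "2 / \<delta>"])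
    show "2 / \<delta> \<ge> 0" using d by simp
    fix x y :: complex
    let ?S = "\<Psi> (cmod x) + \<Psi> (cmod y)"
    let ?\<Delta> = "?S / 2 - \<Psi> (cmod ((x + y) / 2))"
    have S0: "?S \<ge> 0" using Psi_nonneg by simp
    have D0: "?\<Delta> \<ge> 0" using Psi_midconvex[of x y] by simp
    have mx: "\<Psi> (max (cmod x) (cmod y)) \<le> ?S"
      using Psi_nonneg[of "cmod x"] Psi_nonneg[of "cmod y"] by (cases "cmod x \<le> cmod y") (auto simp: max_def)
    show "\<Psi> (cmod ((x - y) / 2)) \<le> t * ?S + 2 / \<delta> * ?\<Delta>"
    proof (cases "t' * max (cmod x) (cmod y) \<le> cmod (x - y)")
      case True
      have "\<Psi> (cmod ((x + y) / 2)) \<le> convex_env ((1 - \<delta>) * ((cmod x powr r + cmod y powr r) / 2))"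
        unfolding \<Psi>_def using uc[OF True] by (intro convex_env_mono) simp
      also have "\<dots> \<le> (1 - \<delta>) * convex_env ((cmod x powr r + cmod y powr r) / 2)" using d by (intro convex_env_scale) auto
      also have "\<dots> \<le> (1 - \<delta>) * (?S / 2)"
        unfolding \<Psi>_def using d convex_env_midconvex[of "cmod x powr r" "cmod y powr r"] by (intro mult_left_mono) auto
      finally have le: "\<Psi> (cmod ((x + y) / 2)) \<le> (1 - \<delta>) * (?S / 2)" .
      have "\<delta> * p \<le> p - z" if "z \<le> (1 - \<delta>) * p" for p z :: real using that by (simp add: algebra_simps)
      from this[OF le] have "\<delta> * (?S / 2) \<le> ?\<Delta>" .
      then have "?S \<le> 2 / \<delta> * ?\<Delta>" using d by (simp add: field_simps)
      moreover have "cmod ((x - y) / 2) \<le> max (cmod x) (cmod y)"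
        using norm_triangle_ineq4[of x y] by (simp add: norm_divide)
      then have "\<Psi> (cmod ((x - y) / 2)) \<le> ?S" using Psi_mono mx by (meson order_trans)
      moreover have "0 \<le> t * ?S" using t S0 by simp
      ultimately show ?thesis by linarith
    next
      case False
      define m where "m = max (cmod x) (cmod y)"
      have m: "m \<ge> 0" by (simp add: m_def le_max_iff_disj)
      have "0 \<le> t' * m" using t' m by simp
      moreover have "cmod (x - y) \<le> t' * m" using False unfolding m_def by simp
      ultimately have "cmod (x - y) / 2 \<le> t' * m" by linarith
      then have "cmod ((x - y) / 2) \<le> t' * m" by (simp add: norm_divide)
      then have "cmod ((x - y) / 2) powr r \<le> (t' * m) powr r" using r by (intro powr_mono2) auto
      also have "\<dots> = t' powr r * m powr r" using t' m by (simp add: powr_mult)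
      also have "\<dots> \<le> t' * m powr r"
      proof (intro mult_right_mono)
        have "t' powr r \<le> t' powr 1" using t' r by (intro powr_mono') auto
        then show "t' powr r \<le> t'" using t' by simp
      qed simp
      finally have "\<Psi> (cmod ((x - y) / 2)) \<le> convex_env (t' * m powr r)" unfolding \<Psi>_def by (intro convex_env_mono) simp
      also have "\<dots> \<le> t' * convex_env (m powr r)" using t' by (intro convex_env_scale) auto
      also have "\<dots> = t' * \<Psi> m" using m by (simp add: \<Psi>_def)
      also have "\<dots> \<le> t * ?S" using mx t t' Psi_nonneg unfolding m_def[symmetric] by (intro mult_mono) auto
      also have "\<dots> \<le> t * ?S + 2 / \<delta> * ?\<Delta>" using d D0 by simp
      finally show ?thesis .
    qed
  qed
qed

theorem Psi_upper:
  assumes l: "l > 0"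
  obtains C where "C > 0" "\<And>u. u \<ge> 0 \<Longrightarrow> \<Psi> u \<le> C * (\<phi> (l * u) + 1)"
proof -
  have base: "\<Psi> u \<le> (s0 powr r * (2 * a / \<phi> s0) + s0 powr r + 2 * a) * (\<phi> u + 1)" if u: "u \<ge> 0" for u
  proof -
    have up: "u powr r \<le> (s0 powr r * (2 * a / \<phi> s0) + s0 powr r) * (\<phi> u + 1)"
    proof (cases "u \<ge> s0")
      case True
      have "(u / s0) powr r * \<phi> s0 \<le> 2 * a * \<phi> (u / s0 * s0)" using True s0 by (intro growth_powr) auto
      then have "u powr r \<le> s0 powr r * (2 * a / \<phi> s0) * \<phi> u"
        using s0 u by (simp add: powr_divide field_simps)
      also have "\<dots> \<le> (s0 powr r * (2 * a / \<phi> s0) + s0 powr r) * (\<phi> u + 1)"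
        using phi_nonneg[OF u] a s0 by (intro mult_mono) auto
      finally show ?thesis .
    next
      case False
      have "u powr r \<le> s0 powr r * 1" using False u r by (simp add: powr_mono2)
      also have "\<dots> \<le> (s0 powr r * (2 * a / \<phi> s0) + s0 powr r) * (\<phi> u + 1)"
        using phi_nonneg[OF u] a s0 by (intro mult_mono) auto
      finally show ?thesis .
    qed
    have "\<Psi> u \<le> u powr r + 2 * a * \<phi> u"
      unfolding \<Psi>_def
    proof (rule convex_env_le)
      fix w assume w: "w \<ge> s0"
      have "(u powr r) powr (1 / r) = u" using u r by (simp add: powr_powr)
      then show "max 0 u powr r + hinge w (max 0 u powr r) \<le> u powr r + 2 * a * \<phi> u"
        using hinge_le[OF w, of "u powr r"] u by simp
    qed
    also have "2 * a * \<phi> u \<le> 2 * a * (\<phi> u + 1)" using a by simp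
    finally show ?thesis using up by (simp add: distrib_right)
  qed
  define B where "B = s0 powr r * (2 * a / \<phi> s0) + s0 powr r + 2 * a"
  have B: "B > 0" unfolding B_def using a s0 by (intro add_nonneg_pos) auto
  obtain C where C: "C > 0" "\<And>u. u \<ge> 0 \<Longrightarrow> \<phi> ((1 / l) * u) \<le> C * (\<phi> u + 1)"
    using Delta2_bound[OF _ D2, of "1 / l"] l by auto
  show thesis
  proof (rule that[of "B * (C + 1)"])
    show "B * (C + 1) > 0" using B C by simp
    fix u :: real assume u: "u \<ge> 0"
    have "\<phi> ((1 / l) * (l * u)) \<le> C * (\<phi> (l * u) + 1)" using u l by (intro C) auto
    then have "\<phi> u + 1 \<le> (C + 1) * (\<phi> (l * u) + 1)" using l phi_nonneg[of "l * u"] u by (simp add: algebra_simps)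
    then have "B * (\<phi> u + 1) \<le> B * ((C + 1) * (\<phi> (l * u) + 1))" using B by (intro mult_left_mono) auto
    then show "\<Psi> u \<le> B * (C + 1) * (\<phi> (l * u) + 1)" using base[OF u] unfolding B_def by (simp add: mult.assoc)
  qed
qed

text \<open>
  For large \<open>u\<close> the hinge at \<open>w = u/2\<close> gives
  \<open>\<Psi>(u) \<ge> \<phi>(u/2)\<close>, because \<open>2\<^sup>r - 1 \<ge> 1\<close>. In
  the middle range the summand \<open>u\<^sup>r\<close> of \<open>\<Psi>(u)\<close> is bounded
  below, and near \<open>0\<close> the left side is at most \<open>\<sigma>\<close>.\<close>
theorem Psi_lower:
  assumes e: "e > 0" and sg: "\<sigma> > 0"
  obtains K where "K > 0" "\<And>u. u \<ge> 0 \<Longrightarrow> \<phi> (u / e) \<le> K * \<Psi> u + \<sigma>"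
proof -
  obtain C where C: "C > 0" "\<And>u. u \<ge> 0 \<Longrightarrow> \<phi> ((2 / e) * u) \<le> C * (\<phi> u + 1)"
    using Delta2_bound[OF _ D2, of "2 / e"] e by auto
  have "\<forall>\<^sub>F x in at_right 0. dist (\<phi> x) 0 < \<sigma>" using phi_tendsto_0 sg by (auto simp: tendsto_iff)
  then obtain \<tau> where tau: "\<tau> > 0" "\<And>x. 0 < x \<Longrightarrow> x < \<tau> \<Longrightarrow> dist (\<phi> x) 0 < \<sigma>"
    unfolding eventually_at_right_field by auto
  define q where "q = e * \<tau> / 2"
  have q: "q > 0" using e tau by (simp add: q_def)
  define K where "K = C + C / (2 * s0) powr r + \<phi> (2 * s0 / e) / q powr r"
  have pos: "C / (2 * s0) powr r \<ge> 0" "\<phi> (2 * s0 / e) / q powr r \<ge> 0"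
    using C s0 e phi_nonneg[of "2 * s0 / e"] by auto
  show thesis
  proof (rule that[of K])
    show "K > 0" unfolding K_def using C pos by (intro add_pos_nonneg)
    fix u :: real assume u: "u \<ge> 0"
    have urP: "u powr r \<le> \<Psi> u" using Psi_ge[of u] u by simp
    consider "u \<ge> 2 * s0" | "u < q" | "q \<le> u" "u < 2 * s0" by linarith
    then show "\<phi> (u / e) \<le> K * \<Psi> u + \<sigma>"
    proof cases
      case 1
      have half: "\<phi> (u / 2) \<le> \<Psi> u"
      proof -
        have "2 powr 1 \<le> 2 powr r" using r by (intro powr_mono) auto
        moreover have "u powr r / (u / 2) powr r = 2 powr r" using 1 s0 by (simp add: powr_divide)
        ultimately have "1 \<le> u powr r / (u / 2) powr r - 1" by simp
        then have "\<phi> (u / 2) * 1 \<le> \<phi> (u / 2) * (u powr r / (u / 2) powr r - 1)"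
          using u by (intro mult_left_mono phi_nonneg) auto
        also have "\<dots> \<le> hinge (u / 2) (u powr r)" by (simp add: hinge_def)
        also have "\<dots> \<le> u powr r + hinge (u / 2) (u powr r)" by simp
        also have "\<dots> \<le> convex_env (u powr r)" using 1 by (intro convex_env_ge) auto
        finally show ?thesis using u by (simp add: \<Psi>_def)
      qed
      have "(2 * s0) powr r \<le> u powr r" using 1 s0 r by (intro powr_mono2) auto
      then have "1 \<le> \<Psi> u / (2 * s0) powr r" using urP s0 by (simp add: field_simps)
      then have c1: "C * 1 \<le> C * (\<Psi> u / (2 * s0) powr r)" using C by (intro mult_left_mono) auto
      have "\<phi> (u / e) = \<phi> ((2 / e) * (u / 2))" by simp
      also have "\<dots> \<le> C * (\<phi> (u / 2) + 1)" using u by (intro C) auto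
      also have "\<dots> = C * \<phi> (u / 2) + C * 1" by (simp add: distrib_left)
      also have "\<dots> \<le> C * \<Psi> u + C * (\<Psi> u / (2 * s0) powr r)"
        using C by (intro add_mono c1 mult_left_mono[OF half]) auto
      also have "\<dots> = (C + C / (2 * s0) powr r) * \<Psi> u" by (simp add: distrib_right)
      also have "\<dots> \<le> K * \<Psi> u" using pos Psi_nonneg by (intro mult_right_mono) (auto simp: K_def)
      finally show ?thesis using sg by simp
    next
      case 2
      have "\<phi> (u / e) \<le> \<phi> (\<tau> / 2)" using 2 u e by (intro phi_mono) (auto simp: q_def field_simps)
      also have "\<dots> \<le> \<sigma>" using tau(2)[of "\<tau> / 2"] tau(1) by simp
      also have "\<dots> \<le> K * \<Psi> u + \<sigma>" using \<open>K > 0\<close> Psi_nonneg by simp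
      finally show ?thesis .
    next
      case 3
      have "q powr r \<le> u powr r" using 3 q r by (intro powr_mono2) auto
      then have one: "1 \<le> \<Psi> u / q powr r" using urP q by (simp add: field_simps)
      have "\<phi> (u / e) \<le> \<phi> (2 * s0 / e)" using 3 u e by (intro phi_mono divide_right_mono) auto
      also have "\<dots> \<le> \<phi> (2 * s0 / e) * (\<Psi> u / q powr r)"
        using one phi_nonneg[of "2 * s0 / e"] s0 e mult_left_mono[OF one, of "\<phi> (2 * s0 / e)"] by simp
      also have "\<dots> = \<phi> (2 * s0 / e) / q powr r * \<Psi> u" by simp
      also have "\<dots> \<le> K * \<Psi> u" using pos C Psi_nonneg by (intro mult_right_mono) (auto simp: K_def)
      finally show ?thesis using sg by simp
    qed
  qed
qed

end

section \<open>The Orlicz class on a bounded interval\<close>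

locale orlicz_interval = orlicz +
  fixes \<alpha> \<beta> :: real
  assumes interval: "\<alpha> < \<beta>"
begin

abbreviation "\<Omega> \<equiv> {\<alpha><..<\<beta>}"
abbreviation "M \<equiv> lebesgue_on \<Omega>"
abbreviation "I \<equiv> modular \<Omega> \<phi>"
abbreviation "lux \<equiv> luxemburg_norm \<Omega> \<phi>"
abbreviation "L \<equiv> orlicz_functions \<Omega> \<phi>"

lemma space_M [simp]: "space M = \<Omega>" by simp

lemma emeasure_M: "emeasure M \<Omega> = ennreal (\<beta> - \<alpha>)"
  using interval by (simp add: emeasure_restrict_space)

lemma finite_measure_M: "finite_measure M"
  by (rule finite_measureI) (simp add: emeasure_M)

lemma measurable_phi [measurable]:
  assumes [measurable]: "f \<in> borel_measurable N"
  shows "(\<lambda>x. \<phi> (cmod (f x))) \<in> borel_measurable N"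
proof -
  have "mono (\<lambda>u. \<phi> (max 0 u))" by (intro monoI phi_mono) auto
  then have [measurable]: "(\<lambda>u. \<phi> (max 0 u)) \<in> borel_measurable borel" by (rule borel_measurable_mono)
  have "(\<lambda>x. \<phi> (max 0 (cmod (f x)))) \<in> borel_measurable N" by measurable
  then show ?thesis by simp
qed

lemma I_cong: "AE x in M. f x = g x \<Longrightarrow> I f = I g"
  unfolding modular_def by (intro nn_integral_cong_AE) auto

lemma I_mono: "(\<And>x. cmod (f x) \<le> cmod (g x)) \<Longrightarrow> I f \<le> I g"
  unfolding modular_def by (intro nn_integral_mono ennreal_leI phi_mono) auto

lemma I_scale:
  assumes c: "0 \<le> c" "c \<le> 1" and [measurable]: "f \<in> borel_measurable M"
  shows "I (\<lambda>x. of_real c * f x) \<le> ennreal c * I f"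
proof -
  have "I (\<lambda>x. of_real c * f x) \<le> (\<integral>\<^sup>+x. ennreal c * ennreal (\<phi> (cmod (f x))) \<partial>M)"
    unfolding modular_def
  proof (rule nn_integral_mono)
    fix x
    have "\<phi> (cmod (of_real c * f x)) \<le> c * \<phi> (cmod (f x))"
      using phi_scale[OF c, of "cmod (f x)"] c by (simp add: norm_mult)
    then show "ennreal (\<phi> (cmod (of_real c * f x))) \<le> ennreal c * ennreal (\<phi> (cmod (f x)))"
      using c by (simp add: ennreal_mult'[symmetric] ennreal_leI)
  qed
  also have "\<dots> = ennreal c * I f" unfolding modular_def by (intro nn_integral_cmult) measurable
  finally show ?thesis .
qed

text \<open>
  The condition that enters the Luxemburg norm: \<open>f\<close> lies in \<open>l\<close> times the
  modular unit ball. It holds for all \<open>l\<close> above the norm, so that norm estimates become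
  statements about balls.\<close>
definition lball :: "real \<Rightarrow> (real \<Rightarrow> complex) \<Rightarrow> bool" where
  "lball l f \<longleftrightarrow> f \<in> borel_measurable M \<and> l > 0 \<and> I (\<lambda>x. f x / of_real l) \<le> 1"

lemma lballD: "lball l f \<Longrightarrow> f \<in> borel_measurable M" "lball l f \<Longrightarrow> l > 0"
  "lball l f \<Longrightarrow> I (\<lambda>x. f x / of_real l) \<le> 1"
  by (auto simp: lball_def)

lemma L_measurable: "f \<in> L \<Longrightarrow> f \<in> borel_measurable M"
  by (simp add: orlicz_functions_def)

lemma lball_in_L: "lball l f \<Longrightarrow> f \<in> L"
proof -
  assume l: "lball l f"
  then have "I (\<lambda>x. of_real (1 / l) * f x) < \<infinity>"
    using lballD(3)[OF l] by (simp add: field_simps) (auto simp: less_top[symmetric] top_unique)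
  then show ?thesis using lballD[OF l] unfolding orlicz_functions_def by (intro CollectI conjI exI[of _ "1 / l"]) auto
qed

lemma lball_mono: "lball l f \<Longrightarrow> l \<le> k \<Longrightarrow> lball k f"
proof -
  assume l: "lball l f" and k: "l \<le> k"
  have "I (\<lambda>x. f x / of_real k) \<le> I (\<lambda>x. f x / of_real l)"
    using lballD(2)[OF l] k by (intro I_mono) (auto simp: norm_divide intro!: divide_left_mono)
  then show ?thesis using l k unfolding lball_def by auto
qed

lemma ex_lball: assumes "f \<in> L" obtains l where "lball l f"
proof -
  obtain k where k: "k > 0" "I (\<lambda>x. of_real k * f x) < \<infinity>" and [measurable]: "f \<in> borel_measurable M"
    using assms by (auto simp: orlicz_functions_def)
  define m where "m = enn2real (I (\<lambda>x. of_real k * f x))"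
  have m: "I (\<lambda>x. of_real k * f x) = ennreal m" "m \<ge> 0" using k by (auto simp: m_def)
  have "I (\<lambda>x. of_real (1 / (m + 1)) * (of_real k * f x)) \<le> ennreal (1 / (m + 1)) * ennreal m"
    unfolding m(1)[symmetric] using m(2) by (intro I_scale) auto
  also have "\<dots> = ennreal (m / (m + 1))" using m by (simp add: ennreal_mult'[symmetric])
  also have "\<dots> \<le> 1" using m(2) by (simp add: ennreal_le_1)
  finally have "lball ((m + 1) / k) f" unfolding lball_def using k m by (simp add: field_simps)
  then show thesis by (rule that)
qed

lemma lux_eq: "f \<in> borel_measurable M \<Longrightarrow> lux f = Inf {l. lball l f}"
  unfolding luxemburg_norm_def lball_def by simp

lemma bdd_lball: "bdd_below {l. lball l f}"
  by (rule bdd_belowI[of _ 0]) (auto simp: lball_def)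

lemma lux_le: "lball l f \<Longrightarrow> lux f \<le> l"
  using lux_eq[OF lballD(1)] bdd_lball by (auto intro: cInf_lower)

lemma lux_nonneg: "f \<in> L \<Longrightarrow> 0 \<le> lux f"
proof -
  assume f: "f \<in> L"
  obtain l where "lball l f" using ex_lball[OF f] .
  then have "{l. lball l f} \<noteq> {}" by blast
  then show ?thesis unfolding lux_eq[OF L_measurable[OF f]]
    by (intro cInf_greatest) (auto simp: lball_def)
qed

lemma lux_lball: assumes f: "f \<in> L" and l: "lux f < l" shows "lball l f"
proof -
  obtain k where "lball k f" using ex_lball[OF f] .
  then have "{l. lball l f} \<noteq> {}" by blast
  then obtain k where "lball k f" "k < l"
    using cInf_lessD[of "{l. lball l f}" l] l unfolding lux_eq[OF L_measurable[OF f]] by blast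
  then show ?thesis using lball_mono by simp
qed

lemma lux_leI: "f \<in> L \<Longrightarrow> (\<And>l. lball l f \<Longrightarrow> c \<le> l) \<Longrightarrow> c \<le> lux f"
  by (rule dense_ge) (use lux_lball in blast)

text \<open>
  The quotient \<open>(f + g)/(l + k)\<close> is a convex combination of \<open>f/l\<close> and
  \<open>g/k\<close>.\<close>
lemma lball_add:
  assumes f: "lball l f" and g: "lball k g" shows "lball (l + k) (\<lambda>x. f x + g x)"
proof -
  note [measurable] = lballD(1)[OF f] lballD(1)[OF g]
  have l: "l > 0" and k: "k > 0" using f g by (auto simp: lball_def)
  define s where "s = l / (l + k)"
  have s: "0 \<le> s" "s \<le> 1" "1 - s = k / (l + k)" using l k by (auto simp: s_def field_simps)
  have pt: "\<phi> (cmod ((f x + g x) / of_real (l + k))) \<le> s * \<phi> (cmod (f x / of_real l)) + (1 - s) * \<phi> (cmod (g x / of_real k))" for x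
  proof -
    have "cmod ((f x + g x) / of_real (l + k)) = cmod (f x + g x) / (l + k)"
      using l k by (simp add: norm_divide del: of_real_add)
    also have "\<dots> \<le> (cmod (f x) + cmod (g x)) / (l + k)" using l k by (intro divide_right_mono norm_triangle_ineq) auto
    also have "\<dots> = s * (cmod (f x) / l) + (1 - s) * (cmod (g x) / k)"
      unfolding s(3) using l k by (simp add: s_def add_divide_distrib)
    finally have "\<phi> (cmod ((f x + g x) / of_real (l + k))) \<le> \<phi> ((1 - s) * (cmod (g x) / k) + s * (cmod (f x) / l))"
      by (intro phi_mono) auto
    also have "\<dots> \<le> (1 - s) * \<phi> (cmod (g x) / k) + s * \<phi> (cmod (f x) / l)"
      using convex_onD[OF phi_convex s(1,2), of "cmod (g x) / k" "cmod (f x) / l"] l k by simp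
    finally show ?thesis using l k by (simp add: norm_divide)
  qed
  have "I (\<lambda>x. (f x + g x) / of_real (l + k)) \<le>
      (\<integral>\<^sup>+x. ennreal s * ennreal (\<phi> (cmod (f x / of_real l))) + ennreal (1 - s) * ennreal (\<phi> (cmod (g x / of_real k))) \<partial>M)"
    unfolding modular_def
  proof (rule nn_integral_mono)
    fix x
    show "ennreal (\<phi> (cmod ((f x + g x) / of_real (l + k)))) \<le>
      ennreal s * ennreal (\<phi> (cmod (f x / of_real l))) + ennreal (1 - s) * ennreal (\<phi> (cmod (g x / of_real k)))"
    proof -
      have "ennreal (\<phi> (cmod ((f x + g x) / of_real (l + k)))) \<le>
          ennreal (s * \<phi> (cmod (f x / of_real l)) + (1 - s) * \<phi> (cmod (g x / of_real k)))"
        by (rule ennreal_leI[OF pt])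
      also have "\<dots> = ennreal (s * \<phi> (cmod (f x / of_real l))) + ennreal ((1 - s) * \<phi> (cmod (g x / of_real k)))"
        using s phi_nonneg by (intro ennreal_plus mult_nonneg_nonneg) auto
      also have "ennreal (s * \<phi> (cmod (f x / of_real l))) = ennreal s * ennreal (\<phi> (cmod (f x / of_real l)))"
        using s by (intro ennreal_mult')
      also have "ennreal ((1 - s) * \<phi> (cmod (g x / of_real k))) = ennreal (1 - s) * ennreal (\<phi> (cmod (g x / of_real k)))"
        using s(2) by (intro ennreal_mult') simp
      finally show ?thesis .
    qed
  qed
  also have "\<dots> = ennreal s * I (\<lambda>x. f x / of_real l) + ennreal (1 - s) * I (\<lambda>x. g x / of_real k)"
    unfolding modular_def by (subst nn_integral_add) (auto simp: nn_integral_cmult)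
  also have "\<dots> \<le> ennreal s * 1 + ennreal (1 - s) * 1"
    using lballD(3)[OF f] lballD(3)[OF g] by (intro add_mono mult_left_mono) auto
  also have "\<dots> = 1" using s by (simp add: ennreal_plus[symmetric] del: ennreal_plus)
  finally show ?thesis unfolding lball_def using l k by simp
qed

lemma lball_smult:
  assumes f: "lball l f" and c: "c \<noteq> 0" shows "lball (cmod c * l) (\<lambda>x. c * f x)"
proof -
  note [measurable] = lballD(1)[OF f]
  have "I (\<lambda>x. c * f x / of_real (cmod c * l)) \<le> I (\<lambda>x. f x / of_real l)"
    using c lballD(2)[OF f] by (intro I_mono) (simp add: norm_divide norm_mult)
  then show ?thesis using f c unfolding lball_def by auto
qed

lemma L_add: "f \<in> L \<Longrightarrow> g \<in> L \<Longrightarrow> (\<lambda>x. f x + g x) \<in> L"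
proof -
  assume f: "f \<in> L" and g: "g \<in> L"
  obtain l where "lball l f" using ex_lball[OF f] .
  moreover obtain k where "lball k g" using ex_lball[OF g] .
  ultimately show ?thesis using lball_in_L[OF lball_add] by blast
qed

lemma lball_zero: "l > 0 \<Longrightarrow> lball l (\<lambda>x. 0)"
  by (simp add: lball_def modular_def)

lemma L_zero: "(\<lambda>x. 0) \<in> L"
  using lball_zero[of 1] lball_in_L by simp

lemma L_smult: "f \<in> L \<Longrightarrow> (\<lambda>x. c * f x) \<in> L"
proof (cases "c = 0")
  case False
  assume f: "f \<in> L"
  obtain l where "lball l f" using ex_lball[OF f] .
  from lball_in_L[OF lball_smult[OF this False]] show ?thesis .
qed (simp add: L_zero)

lemma L_diff: "f \<in> L \<Longrightarrow> g \<in> L \<Longrightarrow> (\<lambda>x. f x - g x) \<in> L"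
  using L_add[of f "\<lambda>x. (-1) * g x"] L_smult[of g "-1"] by simp

lemma lux_add:
  assumes f: "f \<in> L" and g: "g \<in> L" shows "lux (\<lambda>x. f x + g x) \<le> lux f + lux g"
proof (rule field_le_epsilon)
  fix e :: real assume "e > 0"
  then have "lball (lux f + e / 2) f" "lball (lux g + e / 2) g" using f g by (auto intro: lux_lball)
  from lux_le[OF lball_add[OF this]] show "lux (\<lambda>x. f x + g x) \<le> lux f + lux g + e" by simp
qed

lemma lux_zero: "lux (\<lambda>x. 0) = 0"
proof -
  have "lux (\<lambda>x. 0) \<le> 0 + e" if "e > 0" for e using lux_le[OF lball_zero[OF that]] by simp
  then show ?thesis using lux_nonneg[OF L_zero] field_le_epsilon[of "lux (\<lambda>x. 0)" 0] by force
qed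

lemma lux_smult: assumes f: "f \<in> L" shows "lux (\<lambda>x. c * f x) = cmod c * lux f"
proof -
  have le: "lux (\<lambda>x. c * f x) \<le> cmod c * lux f" if c: "c \<noteq> 0" and f: "f \<in> L" for c f
  proof -
    have "lux (\<lambda>x. c * f x) / cmod c \<le> lux f"
    proof (rule lux_leI[OF f])
      fix l assume "lball l f"
      from lux_le[OF lball_smult[OF this c]] show "lux (\<lambda>x. c * f x) / cmod c \<le> l" using c by (simp add: field_simps)
    qed
    then show ?thesis using c by (simp add: field_simps)
  qed
  show ?thesis
  proof (cases "c = 0")
    case False
    have "lux (\<lambda>x. (1 / c) * (c * f x)) \<le> cmod (1 / c) * lux (\<lambda>x. c * f x)"
      using False L_smult[OF f] by (intro le) auto
    then have "cmod c * lux f \<le> lux (\<lambda>x. c * f x)" using False by (simp add: norm_divide field_simps)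
    then show ?thesis using le[OF False f] by simp
  qed (simp add: lux_zero)
qed

lemma lux_diff_commute: "lux (\<lambda>x. f x - g x) = lux (\<lambda>x. g x - f x)"
proof -
  have "I (\<lambda>x. (f x - g x) / of_real l) = I (\<lambda>x. (g x - f x) / of_real l)" for l
    unfolding modular_def by (simp add: norm_divide norm_minus_commute)
  then show ?thesis unfolding luxemburg_norm_def by simp
qed

lemma lux_cong: "AE x in M. f x = g x \<Longrightarrow> lux f = lux g"
proof -
  assume ae: "AE x in M. f x = g x"
  have "I (\<lambda>x. f x / of_real l) = I (\<lambda>x. g x / of_real l)" for l using ae by (intro I_cong) auto
  then show ?thesis unfolding luxemburg_norm_def by simp
qed

text \<open>
  A nonzero convex function with value \<open>0\<close> at \<open>0\<close> dominates a linear
  function up to a constant, and on a set of finite measure the constant is integrable.\<close>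
lemma L1_bound:
  obtains C where "C > 0" "\<And>f. f \<in> L \<Longrightarrow> integrable M f" "\<And>f. f \<in> L \<Longrightarrow> (LINT x|M. cmod (f x)) \<le> C * lux f"
    "\<And>f. f \<in> L \<Longrightarrow> (\<integral>\<^sup>+x. ennreal (cmod (f x)) \<partial>M) \<le> ennreal (C * lux f)"
proof -
  obtain c where c: "c > 0" "\<And>u. u \<ge> 0 \<Longrightarrow> u \<le> c * (\<phi> u + 1)" by (rule phi_linear_lower) blast
  define C where "C = c * (1 + (\<beta> - \<alpha>))"
  have C: "C > 0" using c interval by (simp add: C_def)
  have ball: "(\<integral>\<^sup>+x. ennreal (cmod (f x)) \<partial>M) \<le> ennreal (C * l)" if f: "lball l f" for f l
  proof -
    note [measurable] = lballD(1)[OF f]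
    note l = lballD(2)[OF f]
    have "(\<integral>\<^sup>+x. ennreal (cmod (f x)) \<partial>M) \<le> (\<integral>\<^sup>+x. ennreal (l * c) * (ennreal (\<phi> (cmod (f x / of_real l))) + 1) \<partial>M)"
    proof (rule nn_integral_mono)
      fix x
      have "cmod (f x) / l \<le> c * (\<phi> (cmod (f x) / l) + 1)" using l by (intro c) auto
      then have "cmod (f x) \<le> (l * c) * (\<phi> (cmod (f x / of_real l)) + 1)" using l by (simp add: norm_divide field_simps)
      then have "ennreal (cmod (f x)) \<le> ennreal ((l * c) * (\<phi> (cmod (f x / of_real l)) + 1))" by (rule ennreal_leI)
      also have "\<dots> = ennreal (l * c) * ennreal (\<phi> (cmod (f x / of_real l)) + 1)"
        using l c by (intro ennreal_mult') simp
      also have "ennreal (\<phi> (cmod (f x / of_real l)) + 1) = ennreal (\<phi> (cmod (f x / of_real l))) + 1"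
        using phi_nonneg by (subst ennreal_plus) auto
      finally show "ennreal (cmod (f x)) \<le> ennreal (l * c) * (ennreal (\<phi> (cmod (f x / of_real l))) + 1)" .
    qed
    also have "\<dots> = ennreal (l * c) * (I (\<lambda>x. f x / of_real l) + ennreal (\<beta> - \<alpha>))"
      unfolding modular_def by (simp add: nn_integral_cmult nn_integral_add emeasure_M[simplified])
    also have "\<dots> \<le> ennreal (l * c) * (1 + ennreal (\<beta> - \<alpha>))"
      using lballD(3)[OF f] by (intro mult_left_mono add_mono) auto
    also have "\<dots> = ennreal (C * l)"
    proof -
      have "1 + ennreal (\<beta> - \<alpha>) = ennreal (1 + (\<beta> - \<alpha>))" using interval by (subst ennreal_plus) auto
      moreover have "C * l = (l * c) * (1 + (\<beta> - \<alpha>))" by (simp add: C_def)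
      moreover have "ennreal ((l * c) * (1 + (\<beta> - \<alpha>))) = ennreal (l * c) * ennreal (1 + (\<beta> - \<alpha>))"
        using l c by (intro ennreal_mult') simp
      ultimately show ?thesis by (simp only:)
    qed
    finally show ?thesis .
  qed
  have main: "(\<integral>\<^sup>+x. ennreal (cmod (f x)) \<partial>M) \<le> ennreal (C * lux f)" if f: "f \<in> L" for f
  proof (rule ennreal_le_epsilon)
    fix e :: real assume e: "e > 0"
    have "lux f < lux f + e / C" using e C by simp
    from ball[OF lux_lball[OF f this]]
    have "(\<integral>\<^sup>+x. ennreal (cmod (f x)) \<partial>M) \<le> ennreal (C * (lux f + e / C))" .
    also have "C * (lux f + e / C) = C * lux f + e" using C by (simp add: field_simps)
    finally show "(\<integral>\<^sup>+x. ennreal (cmod (f x)) \<partial>M) \<le> ennreal (C * lux f) + ennreal e"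
      using e C lux_nonneg[OF f] by (simp add: ennreal_plus)
  qed
  have int: "integrable M f" if f: "f \<in> L" for f
    unfolding integrable_iff_bounded
    using L_measurable[OF f] main[OF f] by (auto intro: le_less_trans)
  show thesis
  proof (rule that[OF C int _ main])
    fix f assume f: "f \<in> L"
    have "(LINT x|M. cmod (f x)) = enn2real (\<integral>\<^sup>+x. ennreal (cmod (f x)) \<partial>M)"
      using L_measurable[OF f] by (intro integral_eq_nn_integral) auto
    also have "\<dots> \<le> enn2real (ennreal (C * lux f))" using main[OF f] by (intro enn2real_mono) auto
    also have "\<dots> = C * lux f" using C lux_nonneg[OF f] by simp
    finally show "(LINT x|M. cmod (f x)) \<le> C * lux f" .
  qed
qed

lemma L_integrable: "f \<in> L \<Longrightarrow> integrable M f"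
  by (rule L1_bound) blast

lemma lux_eq_0_iff: assumes f: "f \<in> L" shows "lux f = 0 \<longleftrightarrow> (AE x in M. f x = 0)"
proof
  assume z: "lux f = 0"
  obtain C where "(\<integral>\<^sup>+x. ennreal (cmod (f x)) \<partial>M) \<le> ennreal (C * lux f)"
    by (rule L1_bound) (use f in blast)
  then have "(\<integral>\<^sup>+x. ennreal (cmod (f x)) \<partial>M) = 0" using z by simp
  then show "AE x in M. f x = 0" using L_measurable[OF f] by (subst (asm) nn_integral_0_iff_AE) auto
next
  assume "AE x in M. f x = 0"
  then show "lux f = 0" using lux_cong[of f "\<lambda>x. 0"] lux_zero by simp
qed

text \<open>
  Since \<open>\<phi>\<close> tends to \<open>0\<close> at \<open>0\<close> and the interval has
  finite length, a function with small values has modular at most \<open>1\<close>.\<close>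
lemma bounded_lball:
  obtains C where "C > 0" "\<And>f m. f \<in> borel_measurable M \<Longrightarrow> m > 0 \<Longrightarrow> (\<And>x. cmod (f x) \<le> m) \<Longrightarrow> lball (C * m) f"
proof -
  have "\<forall>\<^sub>F x in at_right 0. dist (\<phi> x) 0 < 1 / (\<beta> - \<alpha>)" using phi_tendsto_0 interval by (auto simp: tendsto_iff)
  then obtain \<tau> where tau: "\<tau> > 0" "\<And>x. 0 < x \<Longrightarrow> x < \<tau> \<Longrightarrow> dist (\<phi> x) 0 < 1 / (\<beta> - \<alpha>)"
    unfolding eventually_at_right_field by auto
  show thesis
  proof (rule that[of "2 / \<tau>"])
    show "2 / \<tau> > 0" using tau by simp
    fix f :: "real \<Rightarrow> complex" and m assume f: "f \<in> borel_measurable M" and m: "m > 0" "\<And>x. cmod (f x) \<le> m"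
    have "I (\<lambda>x. f x / of_real (2 / \<tau> * m)) \<le> (\<integral>\<^sup>+x. ennreal (1 / (\<beta> - \<alpha>)) \<partial>M)"
      unfolding modular_def
    proof (intro nn_integral_mono ennreal_leI)
      fix x
      have "cmod (f x / of_real (2 / \<tau> * m)) \<le> \<tau> / 2"
        using m(2)[of x] m(1) tau(1) by (simp add: norm_divide norm_mult field_simps)
      then have "\<phi> (cmod (f x / of_real (2 / \<tau> * m))) \<le> \<phi> (\<tau> / 2)" by (intro phi_mono) auto
      also have "\<dots> \<le> 1 / (\<beta> - \<alpha>)" using tau(2)[of "\<tau> / 2"] tau(1) by simp
      finally show "\<phi> (cmod (f x / of_real (2 / \<tau> * m))) \<le> 1 / (\<beta> - \<alpha>)" .
    qed
    also have "\<dots> = 1" using interval by (simp add: emeasure_M[simplified] ennreal_mult'[symmetric])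
    finally show "lball (2 / \<tau> * m) f" unfolding lball_def using f m tau by simp
  qed
qed

end

section \<open>Test functions and uniqueness of weak derivatives\<close>

text \<open>
  The functions \<open>p(1/y) exp(-1/y)\<close>, extended by \<open>0\<close>: a family that
  contains its own derivatives.\<close>
definition flat :: "real poly \<Rightarrow> real \<Rightarrow> real" where
  "flat p y = (if y > 0 then poly p (1 / y) * exp (- (1 / y)) else 0)"

lemma poly_div_exp_tendsto_0: "((\<lambda>z::real. poly p z * exp (- z)) \<longlongrightarrow> 0) at_top"
proof -
  have mono: "((\<lambda>z::real. z ^ k * exp (- z)) \<longlongrightarrow> 0) at_top" for k
    using tendsto_power_div_exp_0[of k] by (simp add: exp_minus field_simps)
  have "((\<lambda>z::real. \<Sum>i\<le>degree p. coeff p i * (z ^ i * exp (- z))) \<longlongrightarrow> (\<Sum>i\<le>degree p. coeff p i * 0)) at_top"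
    by (intro tendsto_sum tendsto_mult tendsto_const mono)
  then show ?thesis by (simp add: poly_altdef sum_distrib_right mult.assoc)
qed

lemma flat_tendsto_0: "((\<lambda>y. flat p y) \<longlongrightarrow> 0) (at_right 0)"
proof -
  have "((\<lambda>y. poly p (1 / y) * exp (- (1 / y))) \<longlongrightarrow> 0) (at_right 0)"
    using filterlim_compose[OF poly_div_exp_tendsto_0[of p] filterlim_inverse_at_top_right]
    by (simp add: inverse_eq_divide)
  moreover have "\<forall>\<^sub>F y in at_right 0. poly p (1 / y) * exp (- (1 / y)) = flat p y"
    using eventually_at_right_less[of 0] by eventually_elim (simp add: flat_def)
  ultimately show ?thesis by (rule Lim_transform_eventually)
qed

lemma flat_deriv: "(flat p has_real_derivative flat ([:0, 0, 1:] * (p - pderiv p)) y) (at y)"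
proof -
  consider "y > 0" | "y < 0" | "y = 0" by linarith
  then show ?thesis
  proof cases
    case 1
    have "((\<lambda>y. poly p (1 / y) * exp (- (1 / y))) has_real_derivative
        flat ([:0, 0, 1:] * (p - pderiv p)) y) (at y)"
      using 1 by (auto intro!: derivative_eq_intros DERIV_chain2[OF poly_DERIV] simp: flat_def field_simps power2_eq_square)
    moreover have "\<forall>\<^sub>F z in nhds y. flat p z = poly p (1 / z) * exp (- (1 / z))"
      using eventually_nhds_in_open[of "{0<..}" y] 1 by (auto elim!: eventually_mono simp: flat_def)
    ultimately show ?thesis by (subst DERIV_cong_ev[OF refl _ refl]) auto
  next
    case 2
    have "\<forall>\<^sub>F z in nhds y. flat p z = 0"
      using eventually_nhds_in_open[of "{..<0}" y] 2 by (auto elim!: eventually_mono simp: flat_def)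
    moreover have "((\<lambda>z. 0) has_real_derivative flat ([:0, 0, 1:] * (p - pderiv p)) y) (at y)"
      using 2 by (simp add: flat_def)
    ultimately show ?thesis by (subst DERIV_cong_ev[OF refl _ refl]) auto
  next
    case 3
    have "((\<lambda>z. flat p z / z) \<longlongrightarrow> 0) (at_right 0)"
    proof (rule Lim_transform_eventually[OF flat_tendsto_0[of "[:0, 1:] * p"]])
      show "\<forall>\<^sub>F z in at_right 0. flat ([:0, 1:] * p) z = flat p z / z"
        using eventually_at_right_less[of 0] by eventually_elim (simp add: flat_def)
    qed
    moreover have "((\<lambda>z. flat p z / z) \<longlongrightarrow> 0) (at_left 0)"
    proof (rule Lim_transform_eventually[OF tendsto_const])
      show "\<forall>\<^sub>F z in at_left 0. 0 = flat p z / z"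
        unfolding eventually_at_filter by (auto simp: flat_def intro!: always_eventually)
    qed
    ultimately have "((\<lambda>z. flat p z / z) \<longlongrightarrow> 0) (at 0)" by (simp add: filterlim_at_split)
    then show ?thesis unfolding 3 DERIV_def by (simp add: flat_def)
  qed
qed

text \<open>
  The algebra generated by these functions after affine substitutions. It is closed under
  derivatives, so all its members are smooth.\<close>
inductive smooth_gen :: "(real \<Rightarrow> real) \<Rightarrow> bool" where
  base: "smooth_gen (\<lambda>x. flat p (u * x + v))"
| const: "smooth_gen (\<lambda>x. c)"
| add: "smooth_gen f \<Longrightarrow> smooth_gen g \<Longrightarrow> smooth_gen (\<lambda>x. f x + g x)"
| mult: "smooth_gen f \<Longrightarrow> smooth_gen g \<Longrightarrow> smooth_gen (\<lambda>x. f x * g x)"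

lemma smooth_gen_deriv: "smooth_gen f \<Longrightarrow> \<exists>f'. smooth_gen f' \<and> (\<forall>x. (f has_real_derivative f' x) (at x))"
proof (induction rule: smooth_gen.induct)
  case (base p u v)
  have "((\<lambda>x. flat p (u * x + v)) has_real_derivative flat ([:0, 0, 1:] * (p - pderiv p)) (u * x + v) * u) (at x)" for x
    by (rule DERIV_chain2[OF flat_deriv]) (auto intro!: derivative_eq_intros)
  then show ?case using smooth_gen.intros by blast
next
  case (const c)
  have "\<forall>x. ((\<lambda>x. c) has_real_derivative 0) (at x)" by simp
  then show ?case using smooth_gen.const[of 0] by blast
next
  case (add f g)
  then obtain f' g' where "smooth_gen f'" "smooth_gen g'" and d: "\<And>x. (f has_real_derivative f' x) (at x)"
    "\<And>x. (g has_real_derivative g' x) (at x)" by blast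
  then have "smooth_gen (\<lambda>x. f' x + g' x)" "\<forall>x. ((\<lambda>x. f x + g x) has_real_derivative f' x + g' x) (at x)"
    by (auto intro: smooth_gen.add DERIV_add)
  then show ?case by blast
next
  case (mult f g)
  then obtain f' g' where s: "smooth_gen f'" "smooth_gen g'" and d: "\<And>x. (f has_real_derivative f' x) (at x)"
    "\<And>x. (g has_real_derivative g' x) (at x)" by blast
  have "smooth_gen (\<lambda>x. f' x * g x + g' x * f x)" using s mult.hyps by (intro smooth_gen.add smooth_gen.mult)
  moreover have "\<forall>x. ((\<lambda>x. f x * g x) has_real_derivative f' x * g x + g' x * f x) (at x)"
    using d by (auto intro: DERIV_mult)
  ultimately show ?case by blast
qed

lemma smooth_gen_differentiable:
  assumes "smooth_gen f" shows "(deriv ^^ n) f differentiable_on UNIV"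
proof -
  have "smooth_gen ((deriv ^^ n) f)"
  proof (induction n)
    case (Suc n)
    obtain f' where f': "smooth_gen f'" "\<And>x. ((deriv ^^ n) f has_real_derivative f' x) (at x)"
      using smooth_gen_deriv[OF Suc] by blast
    then have "(deriv ^^ Suc n) f = f'" by (auto simp: fun_eq_iff intro: DERIV_imp_deriv)
    then show ?case using f' by simp
  qed (use assms in simp)
  from smooth_gen_deriv[OF this] obtain f' where "\<And>x. ((deriv ^^ n) f has_real_derivative f' x) (at x)" by blast
  then show ?thesis unfolding differentiable_on_def by (auto simp: real_differentiable_def)
qed

text \<open>
  As \<open>n\<close> grows, \<open>exp(-1/(n(x - a))) exp(-1/(n(b - x)))\<close> increases to
  \<open>1\<close> on the interval \<open>(a, b)\<close>. Test functions that approximate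
  indicators pointwise and boundedly make mollification unnecessary.\<close>
definition bump :: "real \<Rightarrow> real \<Rightarrow> nat \<Rightarrow> real \<Rightarrow> real" where
  "bump a b n x = flat 1 (real (Suc n) * x + - real (Suc n) * a) * flat 1 (- real (Suc n) * x + real (Suc n) * b)"

lemma bump_eq: "bump a b n x = (if a < x \<and> x < b then exp (- (1 / (real (Suc n) * (x - a)))) * exp (- (1 / (real (Suc n) * (b - x)))) else 0)"
proof -
  have *: "real (Suc n) * x + - real (Suc n) * a = real (Suc n) * (x - a)" "- real (Suc n) * x + real (Suc n) * b = real (Suc n) * (b - x)"
    by (simp_all add: algebra_simps)
  show ?thesis unfolding bump_def * flat_def by (auto simp: zero_less_mult_iff simp del: of_nat_Suc)
qed

lemma bump_test:
  assumes "\<alpha> < a" "a < b" "b < \<beta>" shows "bump a b n \<in> test_functions {\<alpha><..<\<beta>}"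
proof -
  have sm: "smooth_gen (bump a b n)" unfolding bump_def[abs_def] by (intro smooth_gen.mult smooth_gen.base)
  have "{x. bump a b n x \<noteq> 0} = {a<..<b}" by (auto simp: bump_eq)
  then have cl: "closure {x. bump a b n x \<noteq> 0} = {a..b}" using assms by simp
  show ?thesis unfolding test_functions_def mem_Collect_eq cl using assms smooth_gen_differentiable[OF sm] by auto
qed

lemma bump_le_1: "\<bar>bump a b n x\<bar> \<le> indicator {a<..<b} x"
  by (auto simp: bump_eq mult_le_one)

lemma bump_tendsto: "(\<lambda>n. bump a b n x) \<longlonglongrightarrow> indicator {a<..<b} x"
proof (cases "a < x \<and> x < b")
  case True
  have lim: "(\<lambda>n. exp (- (1 / (real (Suc n) * c)))) \<longlonglongrightarrow> exp (- (0 * (1 / c)))" for c :: real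
  proof -
    have "(\<lambda>n. inverse (real (Suc n)) * (1 / c)) \<longlonglongrightarrow> 0 * (1 / c)"
      by (intro tendsto_mult LIMSEQ_inverse_real_of_nat tendsto_const)
    then have "(\<lambda>n. exp (- (inverse (real (Suc n)) * (1 / c)))) \<longlonglongrightarrow> exp (- (0 * (1 / c)))"
      by (intro tendsto_exp tendsto_minus)
    then show ?thesis by (simp add: divide_simps del: of_nat_Suc)
  qed
  have "(\<lambda>n. exp (- (1 / (real (Suc n) * (x - a)))) * exp (- (1 / (real (Suc n) * (b - x))))) \<longlonglongrightarrow> exp (- (0 * (1 / (x - a)))) * exp (- (0 * (1 / (b - x))))"
    by (intro tendsto_mult lim)
  then show ?thesis using True by (simp add: bump_eq)
next
  case False
  then show ?thesis by (auto simp: bump_eq)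
qed

text \<open>
  Half-lines with rational end points generate the Borel sets and are stable under intersection.
  Rational end points are enough, so a class of integrable functions is determined by countably many
  numbers.\<close>
lemma AE_zero_if_integrals_zero:
  fixes h :: "real \<Rightarrow> complex"
  assumes h: "integrable lebesgue h" and z: "\<And>q. q \<in> \<rat> \<Longrightarrow> (LINT x|lebesgue. indicator {..<q} x *\<^sub>R h x) = 0"
  shows "AE x in lebesgue. h x = 0"
proof -
  have ih: "integrable lebesgue (\<lambda>x. indicator A x *\<^sub>R h x)" if "A \<in> sets lebesgue" for A
    using that h by (rule integrable_mult_indicator)
  have lim: "(LINT x|lebesgue. indicator A x *\<^sub>R h x) = 0"
    if A: "A \<in> sets lebesgue" and q: "\<And>n. q n \<in> \<rat>" and conv: "\<And>x. (\<lambda>n. indicator {..<q n} x :: real) \<longlonglongrightarrow> indicator A x"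
    for A and q :: "nat \<Rightarrow> real"
  proof -
    have "(\<lambda>n. LINT x|lebesgue. indicator {..<q n} x *\<^sub>R h x) \<longlonglongrightarrow> (LINT x|lebesgue. indicator A x *\<^sub>R h x)"
    proof (rule integral_dominated_convergence[where w = "\<lambda>x. norm (h x)"])
      show "(\<lambda>x. indicator A x *\<^sub>R h x) \<in> borel_measurable lebesgue" using ih[OF A] by auto
      show "(\<lambda>x. indicator {..<q n} x *\<^sub>R h x) \<in> borel_measurable lebesgue" for n using ih[of "{..<q n}"] by auto
      show "integrable lebesgue (\<lambda>x. norm (h x))" using h by simp
      show "AE x in lebesgue. (\<lambda>n. indicator {..<q n} x *\<^sub>R h x) \<longlonglongrightarrow> indicator A x *\<^sub>R h x"
        using conv by (intro AE_I2 tendsto_scaleR tendsto_const)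
      show "AE x in lebesgue. norm (indicator {..<q n} x *\<^sub>R h x) \<le> norm (h x)" for n
        by (intro AE_I2) (auto simp: indicator_def)
    qed
    moreover have "(\<lambda>n. LINT x|lebesgue. indicator {..<q n} x *\<^sub>R h x) = (\<lambda>n. 0)" using z q by auto
    ultimately show ?thesis by (simp add: LIMSEQ_const_iff)
  qed
  have all: "(LINT x|lebesgue. indicator {..<a} x *\<^sub>R h x) = 0" for a
  proof -
    have "\<exists>q\<in>\<rat>. a - inverse (real (Suc n)) < q \<and> q < a" for n
      using Rats_dense_in_real[of "a - inverse (real (Suc n))" a] by auto
    then obtain q where q: "\<And>n. q n \<in> \<rat>" "\<And>n. a - inverse (real (Suc n)) < q n" "\<And>n. q n < a" by metis
    have ql: "q \<longlonglongrightarrow> a"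
    proof (rule tendsto_sandwich)
      show "(\<lambda>n. a - inverse (real (Suc n))) \<longlonglongrightarrow> a"
        using tendsto_diff[OF tendsto_const LIMSEQ_inverse_real_of_nat, of a] by simp
      show "(\<lambda>n. a) \<longlonglongrightarrow> a" by simp
    qed (use q in \<open>auto intro!: always_eventually less_imp_le\<close>)
    show ?thesis
    proof (rule lim[of _ q])
      fix x
      show "(\<lambda>n. indicator {..<q n} x :: real) \<longlonglongrightarrow> indicator {..<a} x"
      proof (cases "x < a")
        case True
        have "\<forall>\<^sub>F n in sequentially. x < q n" using order_tendstoD(1)[OF ql True] .
        then have "\<forall>\<^sub>F n in sequentially. (indicator {..<a} x :: real) = indicator {..<q n} x"
          by eventually_elim (use True in auto)
        then show ?thesis by (rule Lim_transform_eventually[OF tendsto_const])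
      next
        case False
        then have "\<not> x < q n" for n using q(3)[of n] by linarith
        then show ?thesis using False by simp
      qed
    qed (use q in auto)
  qed
  have UN: "(LINT x|lebesgue. indicator UNIV x *\<^sub>R h x) = 0"
  proof (rule lim[of _ "\<lambda>n. real n"])
    fix x :: real
    obtain m where "x < real m" using reals_Archimedean2 by blast
    note m = this
    have "\<forall>\<^sub>F n in sequentially. (indicator UNIV x :: real) = indicator {..<real n} x"
      using eventually_ge_at_top[of m]
    proof eventually_elim
      case (elim n)
      then have "real m \<le> real n" by simp
      then have "x < real n" using m by linarith
      then show ?case by simp
    qed
    then show "(\<lambda>n. indicator {..<real n} x :: real) \<longlonglongrightarrow> indicator UNIV x"
      by (rule Lim_transform_eventually[OF tendsto_const])
  qed auto
  have borel: "(LINT x|lebesgue. indicator A x *\<^sub>R h x) = 0" if "A \<in> sets borel" for A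
  proof -
    have sig: "sigma_sets UNIV (range (\<lambda>a::real. {..<a})) = sets borel"
      by (subst borel_Iio) (simp add: sets_measure_of)
    have IS: "Int_stable (range (\<lambda>a::real. {..<a}))"
    proof (rule Int_stableI)
      fix A B assume "A \<in> range (\<lambda>a::real. {..<a})" "B \<in> range (\<lambda>a::real. {..<a})"
      then obtain a b where "A = {..<a}" "B = {..<b}" by blast
      then have "A \<inter> B = {..<min a b}" by auto
      then show "A \<inter> B \<in> range (\<lambda>a::real. {..<a})" by blast
    qed
    have leb: "B \<in> sets lebesgue" if "B \<in> sigma_sets UNIV (range (\<lambda>a::real. {..<a}))" for B
      using that unfolding sig by auto
    have "A \<in> sigma_sets UNIV (range (\<lambda>a::real. {..<a}))" using that unfolding sig .
    then show ?thesis
    proof (rule sigma_sets_induct_disjoint[OF IS, rotated 1])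
      fix A assume "A \<in> range (\<lambda>a::real. {..<a})"
      then show "(LINT x|lebesgue. indicator A x *\<^sub>R h x) = 0" using all by auto
    next
      fix A assume A: "A \<in> sigma_sets UNIV (range (\<lambda>a::real. {..<a}))" and 0: "(LINT x|lebesgue. indicator A x *\<^sub>R h x) = 0"
      have "(LINT x|lebesgue. indicator (UNIV - A) x *\<^sub>R h x) = (LINT x|lebesgue. indicator UNIV x *\<^sub>R h x - indicator A x *\<^sub>R h x)"
        by (intro Bochner_Integration.integral_cong) (auto simp: indicator_def)
      also have "\<dots> = 0" using UN 0 ih[of UNIV] ih[OF leb[OF A]] by (subst Bochner_Integration.integral_diff) auto
      finally show "(LINT x|lebesgue. indicator (UNIV - A) x *\<^sub>R h x) = 0" .
    next
      fix A :: "nat \<Rightarrow> real set" assume d: "disjoint_family A" and A: "range A \<subseteq> sigma_sets UNIV (range (\<lambda>a::real. {..<a}))"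
        and 0: "\<And>i. (LINT x|lebesgue. indicator (A i) x *\<^sub>R h x) = 0"
      have Ai: "A i \<in> sets lebesgue" for i using A leb by blast
      have "(LINT x:(\<Union>i. A i)|lebesgue. h x) = (\<Sum>i. (LINT x:(A i)|lebesgue. h x))"
      proof (rule lebesgue_integral_countable_add[OF Ai])
        show "A i \<inter> A j = {}" if "i \<noteq> j" for i j using d that by (auto simp: disjoint_family_on_def)
        show "set_integrable lebesgue (\<Union>i. A i) h" unfolding set_integrable_def using Ai by (intro ih) auto
      qed
      then show "(LINT x|lebesgue. indicator (\<Union>i. A i) x *\<^sub>R h x) = 0"
        using 0 by (simp add: set_lebesgue_integral_def)
    qed auto
  qed
  have sf: "sigma_finite_measure (lebesgue :: real measure)"
  proof
    have "\<exists>n. x \<in> {- real n..real n}" for x :: real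
      using real_arch_simple[of "\<bar>x\<bar>"] by (auto simp: abs_le_iff) (metis minus_le_iff)
    then have "(\<Union>n. {- real n..real n}) = space lebesgue" by auto
    then show "\<exists>A::real set set. countable A \<and> A \<subseteq> sets lebesgue \<and> \<Union>A = space lebesgue \<and> (\<forall>a\<in>A. emeasure lebesgue a \<noteq> \<infinity>)"
      by (intro exI[of _ "range (\<lambda>n. {- real n..real n})"]) auto
  qed
  show ?thesis
  proof (rule sigma_finite_measure.density_unique_banach[OF sf h, where f' = "\<lambda>x. 0"])
    fix A :: "real set" assume A: "A \<in> sets lebesgue"
    then have Ac: "A \<in> sets (completion lborel)" by simp
    define B where "B = main_part lborel A"
    have B: "B \<in> sets borel" unfolding B_def using main_part_sets[OF Ac] by simp
    have "AE x in lborel. x \<in> B \<longleftrightarrow> x \<in> A" unfolding B_def by (rule AE_in_main_part[OF Ac])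
    then have "AE x in lebesgue. x \<in> B \<longleftrightarrow> x \<in> A" by (rule AE_completion)
    then have "AE x in lebesgue. indicator A x *\<^sub>R h x = indicator B x *\<^sub>R h x"
      by eventually_elim (auto simp: indicator_def)
    then have "(LINT x|lebesgue. indicator A x *\<^sub>R h x) = (LINT x|lebesgue. indicator B x *\<^sub>R h x)"
      using ih[OF A] ih[of B] B by (intro integral_cong_AE) auto
    then show "set_lebesgue_integral lebesgue A h = set_lebesgue_integral lebesgue A (\<lambda>x. 0)"
      using borel[OF B] by (simp add: set_lebesgue_integral_def)
  qed simp
qed

context orlicz_interval
begin

lemma AE_M_iff: "(AE x in M. P x) \<longleftrightarrow> (AE x in lebesgue. x \<in> \<Omega> \<longrightarrow> P x)"
  by (subst AE_restrict_space_iff) auto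

lemma integrable_M_iff: "integrable M f \<longleftrightarrow> integrable lebesgue (\<lambda>x. indicator \<Omega> x *\<^sub>R f x)"
  for f :: "real \<Rightarrow> complex"
  by (rule integrable_restrict_space) simp

lemma integral_M: "(LINT x|M. f x) = (LINT x|lebesgue. indicator \<Omega> x *\<^sub>R f x)"
  for f :: "real \<Rightarrow> complex"
  by (rule integral_restrict_space) simp

lemma locally_integrable_integrable: "integrable M f \<Longrightarrow> locally_integrable \<Omega> f"
  unfolding locally_integrable_def
proof (intro allI impI, elim conjE)
  fix K assume f: "integrable M f" and K: "compact K" "K \<subseteq> \<Omega>"
  have "set_integrable lebesgue \<Omega> f" unfolding set_integrable_def using f by (simp add: integrable_M_iff)
  moreover have "K \<in> sets lebesgue" by (rule fmeasurableD[OF lmeasurable_compact[OF K(1)]])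
  ultimately show "set_integrable lebesgue K f" using K(2) by (rule set_integrable_subset)
qed

lemma integrable_compact_weight:
  fixes u :: "real \<Rightarrow> real" and g :: "real \<Rightarrow> complex"
  assumes u: "continuous_on UNIV u" and K: "compact K" "K \<subseteq> \<Omega>" and supp: "\<And>x. x \<notin> K \<Longrightarrow> u x = 0"
    and g: "locally_integrable \<Omega> g"
  shows "integrable M (\<lambda>x. u x *\<^sub>R g x)"
proof -
  have gK: "integrable lebesgue (\<lambda>x. indicator K x *\<^sub>R g x)"
    using g K unfolding locally_integrable_def set_integrable_def by blast
  have "compact (u ` K)" using K(1) continuous_on_subset[OF u] by (intro compact_continuous_image) auto
  then obtain C where C: "\<And>x. x \<in> K \<Longrightarrow> \<bar>u x\<bar> \<le> C"
    using compact_imp_bounded[of "u ` K"] by (auto simp: bounded_iff)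
  have um: "u \<in> borel_measurable lebesgue"
    using borel_measurable_continuous_onI[OF u] by (intro measurable_completion) simp
  have "integrable lebesgue (\<lambda>x. u x *\<^sub>R (indicator K x *\<^sub>R g x))"
  proof (rule Bochner_Integration.integrable_bound[of lebesgue "\<lambda>x. C *\<^sub>R (indicator K x *\<^sub>R g x)"])
    show "integrable lebesgue (\<lambda>x. C *\<^sub>R (indicator K x *\<^sub>R g x))" using gK by (rule integrable_scaleR_right)
    show "(\<lambda>x. u x *\<^sub>R (indicator K x *\<^sub>R g x)) \<in> borel_measurable lebesgue"
      by (intro borel_measurable_scaleR um borel_measurable_integrable[OF gK])
    show "AE x in lebesgue. norm (u x *\<^sub>R (indicator K x *\<^sub>R g x)) \<le> norm (C *\<^sub>R (indicator K x *\<^sub>R g x))"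
    proof (rule AE_I2)
      fix x
      show "norm (u x *\<^sub>R (indicator K x *\<^sub>R g x)) \<le> norm (C *\<^sub>R (indicator K x *\<^sub>R g x))"
        using C[of x] by (cases "x \<in> K") (auto simp: mult_right_mono)
    qed
  qed
  moreover have "(\<lambda>x. u x *\<^sub>R (indicator K x *\<^sub>R g x)) = (\<lambda>x. indicator \<Omega> x *\<^sub>R (u x *\<^sub>R g x))"
    using supp K(2) by (auto simp: indicator_def fun_eq_iff)
  ultimately show ?thesis by (simp add: integrable_M_iff)
qed

lemma test_functionE:
  assumes "\<eta> \<in> test_functions \<Omega>"
  obtains K where "compact K" "K \<subseteq> \<Omega>" "\<And>x. x \<notin> K \<Longrightarrow> \<eta> x = 0" "\<And>x. x \<notin> K \<Longrightarrow> deriv \<eta> x = 0"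
    "continuous_on UNIV \<eta>" "continuous_on UNIV (deriv \<eta>)" "\<And>x. (\<eta> has_real_derivative deriv \<eta> x) (at x)"
proof -
  define K where "K = closure {x. \<eta> x \<noteq> 0}"
  have K: "compact K" "K \<subseteq> \<Omega>" and d: "(deriv ^^ n) \<eta> differentiable_on UNIV" for n
    using assms by (auto simp: test_functions_def K_def)
  have 0: "\<eta> x = 0" if "x \<notin> K" for x using that subsetD[OF closure_subset, of x "{x. \<eta> x \<noteq> 0}"] unfolding K_def by auto
  have "closed K" by (simp add: K_def)
  have 1: "deriv \<eta> x = 0" if "x \<notin> K" for x
  proof -
    have "\<forall>\<^sub>F y in nhds x. \<eta> y = 0"
      using eventually_nhds_in_open[of "- K" x] that \<open>closed K\<close> by (auto elim!: eventually_mono simp: 0 open_Compl)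
    then have "(\<eta> has_real_derivative 0) (at x)" by (subst DERIV_cong_ev[OF refl _ refl, of _ "\<lambda>_. 0"]) auto
    then show ?thesis by (rule DERIV_imp_deriv)
  qed
  have d0: "\<eta> differentiable_on UNIV" and d1: "deriv \<eta> differentiable_on UNIV" using d[of 0] d[of 1] by simp_all
  have der: "(\<eta> has_real_derivative deriv \<eta> x) (at x)" for x
    using d0 by (simp add: differentiable_on_def DERIV_deriv_iff_real_differentiable)
  show thesis
    by (rule that[OF K 0 1 differentiable_imp_continuous_on[OF d0] differentiable_imp_continuous_on[OF d1] der])
qed

lemma test_integrable:
  assumes "\<eta> \<in> test_functions \<Omega>" "locally_integrable \<Omega> g"
  shows "integrable M (\<lambda>x. \<eta> x *\<^sub>R g x)" "integrable M (\<lambda>x. deriv \<eta> x *\<^sub>R g x)"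
  by (rule test_functionE[OF assms(1)]; rule integrable_compact_weight[OF _ _ _ _ assms(2)]; assumption)+

text \<open>
  Testing with bumps that tend to the indicator of \<open>(a, b)\<close> shows that the integral of
  \<open>h\<close> over every such interval is \<open>0\<close>. Since \<open>h\<close> is only
  locally integrable, the conclusion is drawn on compactly contained intervals first.\<close>
lemma fundamental_lemma:
  assumes h: "locally_integrable \<Omega> h" and z: "\<And>\<eta>. \<eta> \<in> test_functions \<Omega> \<Longrightarrow> (LINT x|M. \<eta> x *\<^sub>R h x) = 0"
  shows "AE x in M. h x = 0"
proof -
  have hK: "integrable lebesgue (\<lambda>x. indicator {a..b} x *\<^sub>R h x)" if "\<alpha> < a" "b < \<beta>" for a b
  proof -
    have "{a..b} \<subseteq> \<Omega>" using that by auto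
    then show ?thesis using h[unfolded locally_integrable_def set_integrable_def, rule_format, of "{a..b}"] by simp
  qed
  have hO: "integrable lebesgue (\<lambda>x. indicator {a<..<b} x *\<^sub>R h x)" if "\<alpha> < a" "b < \<beta>" for a b
  proof -
    have "integrable lebesgue (\<lambda>x. indicator {a<..<b} x *\<^sub>R (indicator {a..b} x *\<^sub>R h x))"
      by (rule integrable_mult_indicator[OF _ hK[OF that]]) simp
    moreover have "(\<lambda>x. indicator {a<..<b} x *\<^sub>R (indicator {a..b} x *\<^sub>R h x)) = (\<lambda>x. indicator {a<..<b} x *\<^sub>R h x)"
      by (auto simp: indicator_def fun_eq_iff)
    ultimately show ?thesis by simp
  qed
  have int0: "(LINT x|lebesgue. indicator {a<..<b} x *\<^sub>R h x) = 0" if ab: "\<alpha> < a" "a < b" "b < \<beta>" for a b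
  proof -
    have "(\<lambda>n. LINT x|lebesgue. bump a b n x *\<^sub>R h x) \<longlonglongrightarrow> (LINT x|lebesgue. indicator {a<..<b} x *\<^sub>R h x)"
    proof (rule integral_dominated_convergence[where w = "\<lambda>x. norm (indicator {a<..<b} x *\<^sub>R h x)"])
      show "(\<lambda>x. indicator {a<..<b} x *\<^sub>R h x) \<in> borel_measurable lebesgue" using hO[of a b] ab by auto
      show "integrable lebesgue (\<lambda>x. norm (indicator {a<..<b} x *\<^sub>R h x))" using hO[of a b] ab by (intro integrable_norm) auto
      fix n
      have "integrable M (\<lambda>x. bump a b n x *\<^sub>R h x)" using test_integrable(1)[OF bump_test[OF ab] h] .
      moreover have "(\<lambda>x. indicator \<Omega> x *\<^sub>R (bump a b n x *\<^sub>R h x)) = (\<lambda>x. bump a b n x *\<^sub>R h x)"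
        using ab by (auto simp: indicator_def fun_eq_iff bump_eq)
      ultimately show "(\<lambda>x. bump a b n x *\<^sub>R h x) \<in> borel_measurable lebesgue" by (simp add: integrable_M_iff)
      show "AE x in lebesgue. norm (bump a b n x *\<^sub>R h x) \<le> norm (indicator {a<..<b} x *\<^sub>R h x)"
        by (intro AE_I2) (simp add: mult_right_mono[OF bump_le_1])
    next
      show "AE x in lebesgue. (\<lambda>n. bump a b n x *\<^sub>R h x) \<longlonglongrightarrow> indicator {a<..<b} x *\<^sub>R h x"
        by (intro AE_I2 tendsto_scaleR tendsto_const bump_tendsto)
    qed
    moreover have "(LINT x|lebesgue. bump a b n x *\<^sub>R h x) = 0" for n
    proof -
      have "(\<lambda>x. indicator \<Omega> x *\<^sub>R (bump a b n x *\<^sub>R h x)) = (\<lambda>x. bump a b n x *\<^sub>R h x)"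
        using ab by (auto simp: indicator_def fun_eq_iff bump_eq)
      then show ?thesis using z[OF bump_test[OF ab], of n] by (simp add: integral_M)
    qed
    ultimately show ?thesis by (simp add: LIMSEQ_const_iff)
  qed
  have ae: "AE x in lebesgue. indicator {a<..<b} x *\<^sub>R h x = 0" if ab: "\<alpha> < a" "b < \<beta>" for a b
  proof (rule AE_zero_if_integrals_zero[OF hO[OF ab]])
    fix q :: real
    have eq: "(\<lambda>x. indicator {..<q} x *\<^sub>R (indicator {a<..<b} x *\<^sub>R h x)) = (\<lambda>x. indicator {a<..<min q b} x *\<^sub>R h x)"
      by (auto simp: indicator_def fun_eq_iff)
    show "(LINT x|lebesgue. indicator {..<q} x *\<^sub>R (indicator {a<..<b} x *\<^sub>R h x)) = 0"
      unfolding eq using int0[of a "min q b"] ab by (cases "a < min q b") auto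
  qed
  have "AE x in lebesgue. \<forall>n. indicator {\<alpha> + inverse (real (Suc n))<..<\<beta> - inverse (real (Suc n))} x *\<^sub>R h x = 0"
    unfolding AE_all_countable by (intro allI ae) auto
  then have "AE x in lebesgue. x \<in> \<Omega> \<longrightarrow> h x = 0"
  proof eventually_elim
    case (elim x)
    show ?case
    proof
      assume x: "x \<in> \<Omega>"
      then obtain n where n: "inverse (real (Suc n)) < min (x - \<alpha>) (\<beta> - x)"
        using reals_Archimedean[of "min (x - \<alpha>) (\<beta> - x)"] by auto
      then have "x \<in> {\<alpha> + inverse (real (Suc n))<..<\<beta> - inverse (real (Suc n))}" by auto
      then show "h x = 0" using elim[rule_format, of n] by (simp only: indicator_simps scaleR_one) 
    qed
  qed
  then show ?thesis by (simp add: AE_M_iff)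
qed

abbreviation "wd \<equiv> weak_derivative \<Omega>"

lemma wd_unique: assumes "wd f g" "wd f g'" shows "AE x in M. g x = g' x"
proof -
  have l: "locally_integrable \<Omega> g" "locally_integrable \<Omega> g'" using assms by (auto simp: weak_derivative_def)
  have "AE x in M. g x - g' x = 0"
  proof (rule fundamental_lemma)
    show "locally_integrable \<Omega> (\<lambda>x. g x - g' x)" using l unfolding locally_integrable_def by (auto intro: set_integral_diff(1))
    fix \<eta> assume e: "\<eta> \<in> test_functions \<Omega>"
    have "(LINT x|M. \<eta> x *\<^sub>R (g x - g' x)) = (LINT x|M. \<eta> x *\<^sub>R g x) - (LINT x|M. \<eta> x *\<^sub>R g' x)"
      unfolding scaleR_diff_right by (intro Bochner_Integration.integral_diff test_integrable e l)
    also have "\<dots> = 0" using assms e by (auto simp: weak_derivative_def)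
    finally show "(LINT x|M. \<eta> x *\<^sub>R (g x - g' x)) = 0" .
  qed
  then show ?thesis by eventually_elim simp
qed

lemma wd_add: assumes "wd f g" "wd f' g'" shows "wd (\<lambda>x. f x + f' x) (\<lambda>x. g x + g' x)"
  unfolding weak_derivative_def
proof (intro conjI ballI)
  have l: "locally_integrable \<Omega> f" "locally_integrable \<Omega> g" "locally_integrable \<Omega> f'" "locally_integrable \<Omega> g'"
    using assms by (auto simp: weak_derivative_def)
  show "locally_integrable \<Omega> (\<lambda>x. f x + f' x)" "locally_integrable \<Omega> (\<lambda>x. g x + g' x)"
    using l unfolding locally_integrable_def by (auto intro: set_integral_add(1))
  fix \<eta> assume e: "\<eta> \<in> test_functions \<Omega>"
  show "(LINT x|M. deriv \<eta> x *\<^sub>R (f x + f' x)) = - (LINT x|M. \<eta> x *\<^sub>R (g x + g' x))"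
    unfolding scaleR_add_right
      Bochner_Integration.integral_add[OF test_integrable(2)[OF e l(1)] test_integrable(2)[OF e l(3)]]
      Bochner_Integration.integral_add[OF test_integrable(1)[OF e l(2)] test_integrable(1)[OF e l(4)]]
    using assms e by (simp add: weak_derivative_def)
qed

lemma wd_smult: assumes "wd f g" shows "wd (\<lambda>x. c * f x) (\<lambda>x. c * g x)"
  unfolding weak_derivative_def
proof (intro conjI ballI)
  show "locally_integrable \<Omega> (\<lambda>x. c * f x)" "locally_integrable \<Omega> (\<lambda>x. c * g x)"
    using assms unfolding weak_derivative_def locally_integrable_def by (auto intro: set_integrable_mult_right)
  fix \<eta> assume e: "\<eta> \<in> test_functions \<Omega>"
  have "(LINT x|M. u x *\<^sub>R (c * f x)) = c * (LINT x|M. u x *\<^sub>R f x)" for u and f :: "real \<Rightarrow> complex"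
  proof -
    have "(LINT x|M. u x *\<^sub>R (c * f x)) = (LINT x|M. c * (u x *\<^sub>R f x))" by simp
    then show ?thesis by (simp only: integral_mult_right_zero)
  qed
  then show "(LINT x|M. deriv \<eta> x *\<^sub>R (c * f x)) = - (LINT x|M. \<eta> x *\<^sub>R (c * g x))"
    using assms e by (simp add: weak_derivative_def)
qed

lemma wd_zero: "wd (\<lambda>x. 0) (\<lambda>x. 0)"
  unfolding weak_derivative_def locally_integrable_def by (simp add: set_integrable_def)

lemma wd_cong:
  assumes w: "wd f g" and f: "AE x in M. f' x = f x" and g: "AE x in M. g' x = g x"
    and li: "locally_integrable \<Omega> f'" "locally_integrable \<Omega> g'"
  shows "wd f' g'"
  unfolding weak_derivative_def
proof (intro conjI ballI li)
  fix \<eta> assume e: "\<eta> \<in> test_functions \<Omega>"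
  have lw: "locally_integrable \<Omega> f" "locally_integrable \<Omega> g" using w by (auto simp: weak_derivative_def)
  have "(LINT x|M. deriv \<eta> x *\<^sub>R f' x) = (LINT x|M. deriv \<eta> x *\<^sub>R f x)"
    using f by (intro integral_cong_AE borel_measurable_integrable test_integrable[OF e] li lw) auto
  moreover have "(LINT x|M. \<eta> x *\<^sub>R g' x) = (LINT x|M. \<eta> x *\<^sub>R g x)"
    using g by (intro integral_cong_AE borel_measurable_integrable test_integrable[OF e] li lw) auto
  ultimately show "(LINT x|M. deriv \<eta> x *\<^sub>R f' x) = - (LINT x|M. \<eta> x *\<^sub>R g' x)"
    using w e by (simp add: weak_derivative_def)
qed

end

section \<open>The Orlicz-Sobolev space as a Banach space\<close>

context orlicz_interval
begin

abbreviation "W \<equiv> W1 \<Omega> \<phi>"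
abbreviation "cls \<equiv> ae_class \<Omega>"

text \<open>
  The relation between a Sobolev function and a version of its weak derivative. Working with such
  pairs avoids choosing derivatives.\<close>
definition sob :: "(real \<Rightarrow> complex) \<Rightarrow> (real \<Rightarrow> complex) \<Rightarrow> bool" where
  "sob f g \<longleftrightarrow> f \<in> L \<and> g \<in> L \<and> wd f g"

lemma sobD: "sob f g \<Longrightarrow> f \<in> L" "sob f g \<Longrightarrow> g \<in> L" "sob f g \<Longrightarrow> wd f g"
  by (auto simp: sob_def)

lemma sob_measurable: "sob f g \<Longrightarrow> f \<in> borel_measurable M"
  using L_measurable sobD(1) by blast

lemma sob_add: "sob f g \<Longrightarrow> sob f' g' \<Longrightarrow> sob (\<lambda>x. f x + f' x) (\<lambda>x. g x + g' x)"
  by (auto simp: sob_def L_add wd_add)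
lemma sob_smult: "sob f g \<Longrightarrow> sob (\<lambda>x. c * f x) (\<lambda>x. c * g x)"
  by (auto simp: sob_def L_smult wd_smult)
lemma sob_zero: "sob (\<lambda>x. 0) (\<lambda>x. 0)"
  by (auto simp: sob_def L_zero wd_zero)
lemma sob_diff: "sob f g \<Longrightarrow> sob f' g' \<Longrightarrow> sob (\<lambda>x. f x - f' x) (\<lambda>x. g x - g' x)"
  using sob_add[of f g "\<lambda>x. -1 * f' x" "\<lambda>x. -1 * g' x"] sob_smult[of f' g' "-1"] by simp

lemma mem_cls: "u \<in> cls f \<longleftrightarrow> u \<in> borel_measurable M \<and> (AE x in M. u x = f x)"
  by (simp add: ae_class_def)

lemma cls_cong: "AE x in M. f x = g x \<Longrightarrow> cls f = cls g"
  unfolding ae_class_def by (auto elim: AE_mp)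

lemma cls_eq_iff: "f \<in> borel_measurable M \<Longrightarrow> cls f = cls g \<longleftrightarrow> (AE x in M. f x = g x)"
  using mem_cls[of f f] mem_cls[of f g] cls_cong by auto

lemma W_carrier: "carrier W = {cls f | f g. sob f g}"
  unfolding W1_def sobolev_functions_def sob_def by auto

lemma W_ex: "F \<in> carrier W \<Longrightarrow> \<exists>f g. sob f g \<and> F = cls f"
  unfolding W_carrier by blast

lemma W_I: "sob f g \<Longrightarrow> cls f \<in> carrier W"
  unfolding W_carrier by blast

lemma W_zero: "\<zero>\<^bsub>W\<^esub> = cls (\<lambda>x. 0)" by (simp add: W1_def)

lemma W_add:
  assumes f: "f \<in> borel_measurable M" and g: "g \<in> borel_measurable M"
  shows "cls f \<oplus>\<^bsub>W\<^esub> cls g = cls (\<lambda>x. f x + g x)"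
proof -
  have eq: "cls (\<lambda>x. u x + v x) = cls (\<lambda>x. f x + g x)" if "u \<in> cls f" "v \<in> cls g" for u v
  proof (rule cls_cong)
    have "AE x in M. u x = f x" "AE x in M. v x = g x" using that by (auto simp: mem_cls)
    then show "AE x in M. u x + v x = f x + g x" by eventually_elim simp
  qed
  have ne: "cls f \<noteq> {}" "cls g \<noteq> {}" using f g mem_cls[of f f] mem_cls[of g g] by auto
  have "(\<Union>u\<in>cls f. \<Union>v\<in>cls g. cls (\<lambda>x. u x + v x)) = cls (\<lambda>x. f x + g x)"
    by (intro SUP_eq_const ne eq)
  then show ?thesis by (simp add: W1_def)
qed

lemma W_smult:
  assumes f: "f \<in> borel_measurable M" shows "c \<odot>\<^bsub>W\<^esub> cls f = cls (\<lambda>x. c * f x)"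
proof -
  have eq: "cls (\<lambda>x. c * u x) = cls (\<lambda>x. c * f x)" if "u \<in> cls f" for u
  proof (rule cls_cong)
    have "AE x in M. u x = f x" using that by (auto simp: mem_cls)
    then show "AE x in M. c * u x = c * f x" by eventually_elim simp
  qed
  have ne: "cls f \<noteq> {}" using f mem_cls[of f f] by auto
  have "(\<Union>u\<in>cls f. cls (\<lambda>x. c * u x)) = cls (\<lambda>x. c * f x)"
    by (intro SUP_eq_const ne eq)
  then show ?thesis by (simp add: W1_def)
qed

lemma wd_of_ae_eq:
  assumes fg: "sob f g" and ae: "AE x in M. u x = f x" and w: "wd u v"
  shows "AE x in M. v x = g x"
proof -
  have lu: "locally_integrable \<Omega> u" using w by (simp add: weak_derivative_def)
  have lg: "locally_integrable \<Omega> g" using sobD(3)[OF fg] by (simp add: weak_derivative_def)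
  have "wd u g" by (rule wd_cong[OF sobD(3)[OF fg] ae _ lu lg]) simp
  then show ?thesis using w by (intro wd_unique)
qed

text \<open>
  All versions of all representatives give the same number because the weak derivative is unique
  almost everywhere.\<close>
lemma W_nrm: assumes fg: "sob f g" shows "nrm W (cls f) = lux f + lux g"
proof -
  have "(THE r. \<exists>u\<in>cls f. \<exists>v. wd u v \<and> r = lux u + lux v) = lux f + lux g"
  proof (rule the_equality)
    have "f \<in> cls f" using sob_measurable[OF fg] by (simp add: mem_cls)
    then show "\<exists>u\<in>cls f. \<exists>v. wd u v \<and> lux f + lux g = lux u + lux v" using sobD(3)[OF fg] by blast
  next
    fix r assume "\<exists>u\<in>cls f. \<exists>v. wd u v \<and> r = lux u + lux v"
    then obtain u v where u: "u \<in> cls f" "wd u v" "r = lux u + lux v" by blast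
    have ae: "AE x in M. u x = f x" using u(1) by (simp add: mem_cls)
    show "r = lux f + lux g" using lux_cong[OF ae] lux_cong[OF wd_of_ae_eq[OF fg ae u(2)]] u(3) by simp
  qed
  then show ?thesis by (simp add: W1_def)
qed

lemma W_normed: "complex_normed_space W"
proof -
  have ag: "abelian_group W"
  proof (rule abelian_groupI)
    fix F G assume F: "F \<in> carrier W" and G: "G \<in> carrier W"
    obtain f f' where f: "sob f f'" "F = cls f" using W_ex[OF F] by blast
    obtain g g' where g: "sob g g'" "G = cls g" using W_ex[OF G] by blast
    note m = sob_measurable[OF f(1)] sob_measurable[OF g(1)]
    show "F \<oplus>\<^bsub>W\<^esub> G \<in> carrier W" using W_I[OF sob_add[OF f(1) g(1)]] by (simp add: f g W_add m)
    show "F \<oplus>\<^bsub>W\<^esub> G = G \<oplus>\<^bsub>W\<^esub> F" by (simp add: f g W_add m add.commute)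
    fix H assume H: "H \<in> carrier W"
    obtain h h' where h: "sob h h'" "H = cls h" using W_ex[OF H] by blast
    show "F \<oplus>\<^bsub>W\<^esub> G \<oplus>\<^bsub>W\<^esub> H = F \<oplus>\<^bsub>W\<^esub> (G \<oplus>\<^bsub>W\<^esub> H)"
      using m sob_measurable[OF h(1)] by (simp add: f g h W_add add.assoc)
  next
    show "\<zero>\<^bsub>W\<^esub> \<in> carrier W" using W_I[OF sob_zero] by (simp add: W_zero)
  next
    fix F assume F: "F \<in> carrier W"
    obtain f f' where f: "sob f f'" "F = cls f" using W_ex[OF F] by blast
    show "\<zero>\<^bsub>W\<^esub> \<oplus>\<^bsub>W\<^esub> F = F" using sob_measurable[OF f(1)] by (simp add: f W_zero W_add)
    have "cls (\<lambda>x. -1 * f x) \<oplus>\<^bsub>W\<^esub> F = \<zero>\<^bsub>W\<^esub>" using sob_measurable[OF f(1)] by (simp add: f W_zero W_add)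
    then show "\<exists>G\<in>carrier W. G \<oplus>\<^bsub>W\<^esub> F = \<zero>\<^bsub>W\<^esub>" using W_I[OF sob_smult[OF f(1), of "-1"]] by blast
  qed
  have md: "Module.module complex_ring W"
  proof (rule Module.moduleI[OF cring_complex_ring ag]; simp only: complex_ring_simps)
    fix c F assume F: "F \<in> carrier W"
    obtain f f' where f: "sob f f'" "F = cls f" using W_ex[OF F] by blast
    note m = sob_measurable[OF f(1)]
    show "c \<odot>\<^bsub>W\<^esub> F \<in> carrier W" using W_I[OF sob_smult[OF f(1), of c]] by (simp add: f W_smult m)
    fix d
    show "(c + d) \<odot>\<^bsub>W\<^esub> F = c \<odot>\<^bsub>W\<^esub> F \<oplus>\<^bsub>W\<^esub> d \<odot>\<^bsub>W\<^esub> F" using m by (simp add: f W_smult W_add distrib_right)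
    show "(c * d) \<odot>\<^bsub>W\<^esub> F = c \<odot>\<^bsub>W\<^esub> (d \<odot>\<^bsub>W\<^esub> F)" using m by (simp add: f W_smult mult.assoc)
    fix G assume G: "G \<in> carrier W"
    obtain g g' where g: "sob g g'" "G = cls g" using W_ex[OF G] by blast
    show "c \<odot>\<^bsub>W\<^esub> (F \<oplus>\<^bsub>W\<^esub> G) = c \<odot>\<^bsub>W\<^esub> F \<oplus>\<^bsub>W\<^esub> c \<odot>\<^bsub>W\<^esub> G"
      using m sob_measurable[OF g(1)] by (simp add: f g W_smult W_add distrib_left)
  next
    fix F assume F: "F \<in> carrier W"
    obtain f f' where f: "sob f f'" "F = cls f" using W_ex[OF F] by blast
    show "1 \<odot>\<^bsub>W\<^esub> F = F" using sob_measurable[OF f(1)] by (simp add: f W_smult)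
  qed
  show ?thesis
  proof (intro complex_normed_space.intro md complex_normed_space_axioms.intro)
    fix F assume F: "F \<in> carrier W"
    obtain f f' where f: "sob f f'" "F = cls f" using W_ex[OF F] by blast
    note m = sob_measurable[OF f(1)]
    show "nrm W F = 0 \<longleftrightarrow> F = \<zero>\<^bsub>W\<^esub>"
    proof
      assume "nrm W F = 0"
      then have "lux f = 0" using lux_nonneg[OF sobD(1)[OF f(1)]] lux_nonneg[OF sobD(2)[OF f(1)]] by (simp add: f(2) W_nrm[OF f(1)])
      then have "AE x in M. f x = 0" using lux_eq_0_iff[OF sobD(1)[OF f(1)]] by simp
      then show "F = \<zero>\<^bsub>W\<^esub>" unfolding f W_zero by (rule cls_cong)
    next
      assume "F = \<zero>\<^bsub>W\<^esub>"
      then show "nrm W F = 0" using W_nrm[OF sob_zero] by (simp add: W_zero lux_zero)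
    qed
    show "nrm W (c \<odot>\<^bsub>W\<^esub> F) = cmod c * nrm W F" for c
      using W_nrm[OF sob_smult[OF f(1), of c]] m f
      by (simp add: W_smult W_nrm[OF f(1)] lux_smult[OF sobD(1)[OF f(1)]] lux_smult[OF sobD(2)[OF f(1)]] distrib_left)
    fix G assume G: "G \<in> carrier W"
    obtain g g' where g: "sob g g'" "G = cls g" using W_ex[OF G] by blast
    show "nrm W (F \<oplus>\<^bsub>W\<^esub> G) \<le> nrm W F + nrm W G"
      using W_nrm[OF sob_add[OF f(1) g(1)]] m sob_measurable[OF g(1)] f g
        lux_add[OF sobD(1)[OF f(1)] sobD(1)[OF g(1)]] lux_add[OF sobD(2)[OF f(1)] sobD(2)[OF g(1)]]
      by (simp add: W_add W_nrm[OF f(1)] W_nrm[OF g(1)])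
  qed
qed

sublocale W: complex_normed_space "W1 \<Omega> \<phi>" by (rule W_normed)

lemma W_minus:
  assumes "sob f f'" "sob g g'" shows "cls f \<ominus>\<^bsub>W\<^esub> cls g = cls (\<lambda>x. f x - g x)"
  using assms W_I sob_measurable[OF assms(1)] sob_measurable[OF assms(2)]
  by (simp add: W.minus_sm W_smult W_add)

text \<open>
  The Riesz-Fischer argument: the increments are summable in \<open>L\<^sup>1\<close>, so the
  sequence converges almost everywhere, and Fatou's lemma for the modulars estimates the distance to
  the limit.\<close>
lemma L_complete:
  assumes u: "\<And>j::nat. u j \<in> L" and d: "\<And>j. lux (\<lambda>x. u (Suc j) x - u j x) \<le> (1/2) ^ j"
  shows "\<exists>v\<in>L. \<forall>n. lux (\<lambda>x. u n x - v x) \<le> 3 * (1/2) ^ n"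
proof -
  note [measurable] = L_measurable[OF u]
  have dL: "(\<lambda>x. u m x - u n x) \<in> L" for m n by (rule L_diff[OF u u])
  obtain C where C: "C > 0" "\<And>f. f \<in> L \<Longrightarrow> (\<integral>\<^sup>+x. ennreal (cmod (f x)) \<partial>M) \<le> ennreal (C * lux f)"
    by (rule L1_bound) blast
  have "(\<integral>\<^sup>+x. (\<Sum>j. ennreal (cmod (u (Suc j) x - u j x))) \<partial>M) = (\<Sum>j. \<integral>\<^sup>+x. ennreal (cmod (u (Suc j) x - u j x)) \<partial>M)"
    by (intro nn_integral_suminf) measurable
  also have "\<dots> \<le> (\<Sum>j. ennreal (C * (1/2) ^ j))"
  proof (intro suminf_le)
    fix j
    have "(\<integral>\<^sup>+x. ennreal (cmod (u (Suc j) x - u j x)) \<partial>M) \<le> ennreal (C * lux (\<lambda>x. u (Suc j) x - u j x))" by (rule C(2)[OF dL])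
    also have "\<dots> \<le> ennreal (C * (1/2) ^ j)" using d[of j] C(1) by (intro ennreal_leI mult_left_mono) auto
    finally show "(\<integral>\<^sup>+x. ennreal (cmod (u (Suc j) x - u j x)) \<partial>M) \<le> ennreal (C * (1/2) ^ j)" .
  qed auto
  also have "\<dots> = ennreal (\<Sum>j. C * (1/2) ^ j)"
    using C(1) by (intro suminf_ennreal2) (auto intro!: summable_mult summable_geometric)
  also have "\<dots> < \<infinity>" by simp
  finally have "AE x in M. (\<Sum>j. ennreal (cmod (u (Suc j) x - u j x))) \<noteq> \<infinity>"
    by (intro nn_integral_noteq_infinite) auto
  then have conv: "AE x in M. (\<lambda>j. u j x) \<longlonglongrightarrow> lim (\<lambda>j. u j x)"
  proof eventually_elim
    case (elim x)
    then have "summable (\<lambda>j. cmod (u (Suc j) x - u j x))" by (intro summable_suminf_not_top) auto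
    then have "summable (\<lambda>j. u (Suc j) x - u j x)" by (rule summable_norm_cancel)
    then have "convergent (\<lambda>n. \<Sum>j<n. u (Suc j) x - u j x)" by (simp add: summable_iff_convergent)
    then obtain s where "(\<lambda>n. \<Sum>j<n. u (Suc j) x - u j x) \<longlonglongrightarrow> s" by (auto simp: convergent_def)
    then have "(\<lambda>n. u n x - u 0 x) \<longlonglongrightarrow> s" using sum_lessThan_telescope[of "\<lambda>j. u j x"] by simp
    then have "(\<lambda>n. u n x - u 0 x + u 0 x) \<longlonglongrightarrow> s + u 0 x" by (intro tendsto_add tendsto_const)
    then have "convergent (\<lambda>n. u n x)" by (auto simp: convergent_def)
    then show ?case by (simp add: convergent_LIMSEQ_iff)
  qed
  define v where "v x = lim (\<lambda>j. u j x)" for x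
  have [measurable]: "v \<in> borel_measurable M" unfolding v_def[abs_def] by measurable
  have far: "lux (\<lambda>x. u (n + i) x - u n x) \<le> 2 * (1/2) ^ n * (1 - (1/2) ^ i)" for n i
  proof (induction i)
    case 0
    then show ?case by (simp add: lux_zero)
  next
    case (Suc i)
    have "lux (\<lambda>x. u (n + Suc i) x - u n x) = lux (\<lambda>x. (u (Suc (n + i)) x - u (n + i) x) + (u (n + i) x - u n x))"
      by simp
    also have "\<dots> \<le> lux (\<lambda>x. u (Suc (n + i)) x - u (n + i) x) + lux (\<lambda>x. u (n + i) x - u n x)" by (intro lux_add dL)
    also have "\<dots> \<le> (1/2) ^ (n + i) + 2 * (1/2) ^ n * (1 - (1/2) ^ i)" by (intro add_mono d Suc)
    also have "\<dots> = 2 * (1/2) ^ n * (1 - (1/2) ^ Suc i)" by (simp add: power_add field_simps)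
    finally show ?case .
  qed
  (* The tails of the sequence lie within 2 * (1/2) ^ n; a strictly larger radius places them in the
  modular ball, to which Fatou's lemma applies. *)
  have lb: "lball (3 * (1/2) ^ n) (\<lambda>x. u n x - v x)" for n
  proof -
    define l :: real where "l = 3 * (1/2) ^ n"
    have l: "l > 0" by (simp add: l_def)
    have Im: "I (\<lambda>x. (u n x - u (n + i) x) / of_real l) \<le> 1" for i
    proof (rule lballD(3))
      have "lux (\<lambda>x. u n x - u (n + i) x) = lux (\<lambda>x. u (n + i) x - u n x)" by (rule lux_diff_commute)
      also have "\<dots> \<le> 2 * (1/2) ^ n * (1 - (1/2) ^ i)" by (rule far)
      also have "\<dots> \<le> 2 * (1/2) ^ n * 1" by (intro mult_left_mono) auto
      also have "\<dots> < l" by (simp add: l_def)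
      finally show "lball l (\<lambda>x. u n x - u (n + i) x)" by (rule lux_lball[OF dL])
    qed
    have "I (\<lambda>x. (u n x - v x) / of_real l) = (\<integral>\<^sup>+x. liminf (\<lambda>i. ennreal (\<phi> (cmod ((u n x - u (n + i) x) / of_real l)))) \<partial>M)"
      unfolding modular_def
    proof (rule nn_integral_cong_AE)
      from conv show "AE x in M. ennreal (\<phi> (cmod ((u n x - v x) / of_real l))) = liminf (\<lambda>i. ennreal (\<phi> (cmod ((u n x - u (n + i) x) / of_real l))))"
      proof eventually_elim
        case (elim x)
        have "(\<lambda>i. u (n + i) x) \<longlonglongrightarrow> v x" using LIMSEQ_ignore_initial_segment[OF elim, of n] by (simp add: v_def add.commute)
        then have "(\<lambda>i. cmod ((u n x - u (n + i) x) / of_real l)) \<longlonglongrightarrow> cmod ((u n x - v x) / of_real l)"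
          using l by (intro tendsto_intros) auto
        then have "(\<lambda>i. \<phi> (cmod ((u n x - u (n + i) x) / of_real l))) \<longlonglongrightarrow> \<phi> (cmod ((u n x - v x) / of_real l))"
          by (intro continuous_on_tendsto_compose[OF phi_continuous]) auto
        then have "(\<lambda>i. ennreal (\<phi> (cmod ((u n x - u (n + i) x) / of_real l)))) \<longlonglongrightarrow> ennreal (\<phi> (cmod ((u n x - v x) / of_real l)))"
          by (rule tendsto_ennrealI)
        then show ?case by (intro lim_imp_Liminf[symmetric]) auto
      qed
    qed
    also have "\<dots> \<le> liminf (\<lambda>i. I (\<lambda>x. (u n x - u (n + i) x) / of_real l))"
      unfolding modular_def by (intro nn_integral_liminf) measurable
    also have "\<dots> \<le> liminf (\<lambda>i::nat. 1)" using Im by (intro Liminf_mono always_eventually) auto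
    also have "\<dots> = 1" by (simp add: Liminf_const)
    finally show ?thesis unfolding lball_def l_def[symmetric] using l by simp
  qed
  have "(\<lambda>x. u 0 x - (u 0 x - v x)) \<in> L" by (rule L_diff[OF u lball_in_L[OF lb]])
  then have "v \<in> L" by simp
  then show ?thesis using lux_le[OF lb] by blast
qed

text \<open>
  Norm convergence implies convergence in \<open>L\<^sup>1\<close>, and a test function and its
  derivative are bounded; both sides of the integration by parts formula pass to the limit.\<close>
lemma wd_limit:
  assumes s: "\<And>n::nat. sob (f n) (g n)" and f: "f0 \<in> L" and g: "g0 \<in> L"
    and lf: "(\<lambda>n. lux (\<lambda>x. f n x - f0 x)) \<longlonglongrightarrow> 0" and lg: "(\<lambda>n. lux (\<lambda>x. g n x - g0 x)) \<longlonglongrightarrow> 0"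
  shows "wd f0 g0"
proof -
  obtain C where C: "C > 0" "\<And>f. f \<in> L \<Longrightarrow> (LINT x|M. cmod (f x)) \<le> C * lux f"
    by (rule L1_bound) blast
  have lim: "(\<lambda>n. LINT x|M. w x *\<^sub>R h n x) \<longlonglongrightarrow> (LINT x|M. w x *\<^sub>R h0 x)"
    if h: "\<And>n. h n \<in> L" "h0 \<in> L" and l: "(\<lambda>n. lux (\<lambda>x. h n x - h0 x)) \<longlonglongrightarrow> 0"
      and w: "\<And>h. h \<in> L \<Longrightarrow> integrable M (\<lambda>x. w x *\<^sub>R h x)" and B: "\<And>x. \<bar>w x\<bar> \<le> B"
    for w :: "real \<Rightarrow> real" and h h0 B
  proof -
    have bnd: "cmod ((LINT x|M. w x *\<^sub>R h n x) - (LINT x|M. w x *\<^sub>R h0 x)) \<le> B * (C * lux (\<lambda>x. h n x - h0 x))" for n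
    proof -
      have dL: "(\<lambda>x. h n x - h0 x) \<in> L" by (intro L_diff h)
      have "(LINT x|M. w x *\<^sub>R h n x) - (LINT x|M. w x *\<^sub>R h0 x) = (LINT x|M. w x *\<^sub>R (h n x - h0 x))"
        unfolding scaleR_diff_right by (intro Bochner_Integration.integral_diff[symmetric] w h)
      also have "cmod \<dots> \<le> (LINT x|M. cmod (w x *\<^sub>R (h n x - h0 x)))" by (rule integral_norm_bound)
      also have "\<dots> \<le> (LINT x|M. B * cmod (h n x - h0 x))"
        using B by (intro integral_mono integrable_norm[OF w[OF dL]] integrable_mult_right integrable_norm[OF L_integrable[OF dL]])
          (auto intro!: mult_right_mono)
      also have "\<dots> = B * (LINT x|M. cmod (h n x - h0 x))" by simp
      also have "\<dots> \<le> B * (C * lux (\<lambda>x. h n x - h0 x))"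
        using C(2)[OF dL] order_trans[OF abs_ge_zero B] by (intro mult_left_mono) auto
      finally show ?thesis .
    qed
    have "(\<lambda>n. B * (C * lux (\<lambda>x. h n x - h0 x))) \<longlonglongrightarrow> B * (C * 0)"
      by (intro tendsto_mult tendsto_const l)
    then have z: "(\<lambda>n. B * (C * lux (\<lambda>x. h n x - h0 x))) \<longlonglongrightarrow> 0" by simp
    have "(\<lambda>n. (LINT x|M. w x *\<^sub>R h n x) - (LINT x|M. w x *\<^sub>R h0 x)) \<longlonglongrightarrow> 0"
      by (rule Lim_null_comparison[OF always_eventually[OF allI[OF bnd]] z])
    then show ?thesis by (rule LIM_zero_cancel)
  qed
  have li: "locally_integrable \<Omega> h" if "h \<in> L" for h
    using that by (intro locally_integrable_integrable L_integrable)
  show ?thesis unfolding weak_derivative_def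
  proof (intro conjI ballI li f g)
    fix \<eta> assume e: "\<eta> \<in> test_functions \<Omega>"
    obtain K where K: "compact K" "\<And>x. x \<notin> K \<Longrightarrow> \<eta> x = 0" "\<And>x. x \<notin> K \<Longrightarrow> deriv \<eta> x = 0"
      "continuous_on UNIV \<eta>" "continuous_on UNIV (deriv \<eta>)"
    proof -
      note * = that
      show thesis by (rule test_functionE[OF e]) (rule *)
    qed
    have bnd: "\<exists>B. \<forall>x. \<bar>w x\<bar> \<le> B" if w: "continuous_on UNIV w" "\<And>x. x \<notin> K \<Longrightarrow> w x = 0" for w :: "real \<Rightarrow> real"
    proof -
      have "compact (w ` K)" using K(1) continuous_on_subset[OF w(1)] by (intro compact_continuous_image) auto
      then obtain B where "\<forall>x\<in>K. \<bar>w x\<bar> \<le> B" using compact_imp_bounded[of "w ` K"] by (auto simp: bounded_iff)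
      then have "\<forall>x. \<bar>w x\<bar> \<le> max B 0" using w(2) by (metis abs_zero max.coboundedI1 max.cobounded2)
      then show ?thesis by blast
    qed
    obtain B1 where B1: "\<And>x. \<bar>\<eta> x\<bar> \<le> B1" using bnd[OF K(4) K(2)] by auto
    obtain B2 where B2: "\<And>x. \<bar>deriv \<eta> x\<bar> \<le> B2" using bnd[OF K(5) K(3)] by auto
    have "(\<lambda>n. LINT x|M. deriv \<eta> x *\<^sub>R f n x) \<longlonglongrightarrow> (LINT x|M. deriv \<eta> x *\<^sub>R f0 x)"
      by (rule lim[OF sobD(1)[OF s] f lf test_integrable(2)[OF e li] B2])
    moreover have "(\<lambda>n. LINT x|M. \<eta> x *\<^sub>R g n x) \<longlonglongrightarrow> (LINT x|M. \<eta> x *\<^sub>R g0 x)"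
      by (rule lim[OF sobD(2)[OF s] g lg test_integrable(1)[OF e li] B1])
    then have "(\<lambda>n. - (LINT x|M. \<eta> x *\<^sub>R g n x)) \<longlonglongrightarrow> - (LINT x|M. \<eta> x *\<^sub>R g0 x)" by (rule tendsto_minus)
    moreover have "(LINT x|M. deriv \<eta> x *\<^sub>R f n x) = - (LINT x|M. \<eta> x *\<^sub>R g n x)" for n
      using sobD(3)[OF s] e by (simp add: weak_derivative_def)
    ultimately show "(LINT x|M. deriv \<eta> x *\<^sub>R f0 x) = - (LINT x|M. \<eta> x *\<^sub>R g0 x)"
      by (simp add: LIMSEQ_unique)
  qed
qed

theorem W_banach: "complex_banach_space W"
proof (intro complex_banach_space.intro W_normed complex_banach_space_axioms.intro)
  show "Metric_space.mcomplete (carrier W) (nrm_dist W)"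
    unfolding W.mcomplete_nrm_iff
  proof (intro allI impI)
    fix \<sigma> :: "nat \<Rightarrow> (real \<Rightarrow> complex) set"
    assume \<sigma>: "\<forall>n. \<sigma> n \<in> carrier W" and cau: "\<forall>e>0. \<exists>N. \<forall>m\<ge>N. \<forall>n\<ge>N. nrm W (\<sigma> m \<ominus>\<^bsub>W\<^esub> \<sigma> n) < e"
    have "\<exists>N. \<forall>m\<ge>N. \<forall>n\<ge>N. nrm W (\<sigma> m \<ominus>\<^bsub>W\<^esub> \<sigma> n) < (1/2) ^ j" for j :: nat
      using cau by simp
    then obtain N where N: "\<And>j m n. m \<ge> N j \<Longrightarrow> n \<ge> N j \<Longrightarrow> nrm W (\<sigma> m \<ominus>\<^bsub>W\<^esub> \<sigma> n) < (1/2) ^ j" by metis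
    (* The subsequence has increments below (1/2) ^ j; the summand j makes the indices unbounded. *)
    define k where "k j = (\<Sum>i\<le>j. N i) + j" for j
    have k: "N j \<le> k j" "k j \<le> k (Suc j)" for j
      unfolding k_def using member_le_sum[of j "{..j}" N] by (auto simp: trans_le_add1)
    have kid: "j \<le> k j" for j by (simp add: k_def)
    have "\<exists>f g. sob f g \<and> \<sigma> (k j) = cls f" for j using \<sigma> by (intro W_ex) blast
    then obtain f g where fg: "\<And>j. sob (f j) (g j)" "\<And>j. \<sigma> (k j) = cls (f j)" by metis
    have step: "lux (\<lambda>x. f (Suc j) x - f j x) + lux (\<lambda>x. g (Suc j) x - g j x) \<le> (1/2) ^ j" for j
    proof -
      have "nrm W (\<sigma> (k (Suc j)) \<ominus>\<^bsub>W\<^esub> \<sigma> (k j)) < (1/2) ^ j"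
        using k(1)[of j] k(2)[of j] by (intro N) auto
      then show ?thesis using W_nrm[OF sob_diff[OF fg(1) fg(1), of "Suc j" j]] by (simp add: fg W_minus[OF fg(1) fg(1)])
    qed
    have nn: "0 \<le> lux (\<lambda>x. f m x - f n x)" "0 \<le> lux (\<lambda>x. g m x - g n x)" for m n
      using lux_nonneg sobD(1,2)[OF sob_diff[OF fg(1) fg(1)]] by blast+
    have sf: "lux (\<lambda>x. f (Suc j) x - f j x) \<le> (1/2) ^ j" and sg: "lux (\<lambda>x. g (Suc j) x - g j x) \<le> (1/2) ^ j" for j
      using step[of j] nn[of "Suc j" j] by simp_all
    obtain f0 where f0: "f0 \<in> L" "\<And>n. lux (\<lambda>x. f n x - f0 x) \<le> 3 * (1/2) ^ n"
      using L_complete[of f, OF sobD(1)[OF fg(1)] sf] by auto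
    obtain g0 where g0: "g0 \<in> L" "\<And>n. lux (\<lambda>x. g n x - g0 x) \<le> 3 * (1/2) ^ n"
      using L_complete[of g, OF sobD(2)[OF fg(1)] sg] by auto
    have z: "(\<lambda>n. 3 * (1/2) ^ n :: real) \<longlonglongrightarrow> 0"
      using tendsto_mult[OF tendsto_const LIMSEQ_realpow_zero[of "1/2"], of 3] by simp
    have lf: "(\<lambda>n. lux (\<lambda>x. f n x - f0 x)) \<longlonglongrightarrow> 0"
      by (rule tendsto_sandwich[OF _ _ tendsto_const z])
        (auto intro!: always_eventually f0(2) lux_nonneg L_diff f0(1) sobD(1)[OF fg(1)])
    have lg: "(\<lambda>n. lux (\<lambda>x. g n x - g0 x)) \<longlonglongrightarrow> 0"
      by (rule tendsto_sandwich[OF _ _ tendsto_const z])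
        (auto intro!: always_eventually g0(2) lux_nonneg L_diff g0(1) sobD(2)[OF fg(1)])
    have s0: "sob f0 g0" unfolding sob_def using f0(1) g0(1) wd_limit[OF fg(1) f0(1) g0(1) lf lg] by blast
    have nr: "nrm W (\<sigma> (k n) \<ominus>\<^bsub>W\<^esub> cls f0) = lux (\<lambda>x. f n x - f0 x) + lux (\<lambda>x. g n x - g0 x)" for n
      using W_nrm[OF sob_diff[OF fg(1) s0, of n]] by (simp add: fg W_minus[OF fg(1) s0])
    show "\<exists>x\<in>carrier W. \<forall>e>0. \<exists>N. \<forall>n\<ge>N. nrm W (\<sigma> n \<ominus>\<^bsub>W\<^esub> x) < e"
    proof (intro bexI[of _ "cls f0"] W_I[OF s0] allI impI)
      fix e :: real assume e: "e > 0"
      then obtain N1 where N1: "\<And>m n. m \<ge> N1 \<Longrightarrow> n \<ge> N1 \<Longrightarrow> nrm W (\<sigma> m \<ominus>\<^bsub>W\<^esub> \<sigma> n) < e / 2"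
        using cau[rule_format, of "e / 2"] by auto
      have "(\<lambda>n. lux (\<lambda>x. f n x - f0 x) + lux (\<lambda>x. g n x - g0 x)) \<longlonglongrightarrow> 0 + 0" by (intro tendsto_add lf lg)
      then have "\<forall>\<^sub>F n in sequentially. nrm W (\<sigma> (k n) \<ominus>\<^bsub>W\<^esub> cls f0) < e / 2"
        using e by (auto simp: nr dest: order_tendstoD(2)[of _ _ _ "e / 2"])
      then obtain N2 where N2: "\<And>n. n \<ge> N2 \<Longrightarrow> nrm W (\<sigma> (k n) \<ominus>\<^bsub>W\<^esub> cls f0) < e / 2" by (auto simp: eventually_sequentially)
      have "\<exists>p\<ge>N2. k p \<ge> N1"
        by (intro exI[of _ "max N1 N2"]) (auto intro: order_trans[OF _ kid])
      then obtain p where p: "p \<ge> N2" "k p \<ge> N1" by blast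
      have "nrm W (\<sigma> n \<ominus>\<^bsub>W\<^esub> cls f0) < e" if "n \<ge> N1" for n
        using W.nrm_minus_triangle[of "\<sigma> n" "\<sigma> (k p)" "cls f0"] \<sigma> W_I[OF s0] N1[OF that p(2)] N2[OF p(1)] by simp
      then show "\<exists>N. \<forall>n\<ge>N. nrm W (\<sigma> n \<ominus>\<^bsub>W\<^esub> cls f0) < e" by blast
    qed
  qed
qed

text \<open>
  A class is determined by its integrals over half-lines with rational end points, and each of these
  numbers by its set of rational lower bounds. This encodes the class as a subset of a countable
  set, hence as a real number.\<close>
lemma W_inj_real: "\<exists>h :: (real \<Rightarrow> complex) set \<Rightarrow> real. inj_on h (carrier W)"
proof -
  define rp where "rp F = (SOME f. \<exists>g. sob f g \<and> F = cls f)" for F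
  have rp: "\<exists>g. sob (rp F) g \<and> F = cls (rp F)" if "F \<in> carrier W" for F
  proof -
    have "\<exists>f g. sob f g \<and> F = cls f" by (rule W_ex[OF that])
    then show ?thesis unfolding rp_def by (rule someI_ex[of "\<lambda>f. \<exists>g. sob f g \<and> F = cls f"])
  qed
  define T where "T F q = (LINT x|lebesgue. indicator {..<of_rat q} x *\<^sub>R (indicator \<Omega> x *\<^sub>R rp F x))" for F and q :: rat
  define J where "J F = {(q, r :: rat, b). real_of_rat r < (if b then Re (T F q) else Im (T F q))}" for F
  have inj: "inj_on J (carrier W)"
  proof (rule inj_onI)
    fix F G assume F: "F \<in> carrier W" and G: "G \<in> carrier W" and J: "J F = J G"
    have dense: "x = y" if "\<And>r. real_of_rat r < x \<longleftrightarrow> real_of_rat r < y" for x y :: real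
    proof (rule ccontr)
      assume "x \<noteq> y"
      then consider "x < y" | "y < x" by linarith
      then show False
      proof cases
        case 1
        then obtain r where "x < real_of_rat r" "real_of_rat r < y" using of_rat_dense by blast
        then show False using that[of r] by simp
      next
        case 2
        then obtain r where "y < real_of_rat r" "real_of_rat r < x" using of_rat_dense by blast
        then show False using that[of r] by simp
      qed
    qed
    have iff: "real_of_rat r < (if b then Re (T F q) else Im (T F q)) \<longleftrightarrow>
      real_of_rat r < (if b then Re (T G q) else Im (T G q))" for q r b
    proof -
      have "((q, r, b) \<in> J F) = ((q, r, b) \<in> J G)" using J by simp
      then show ?thesis unfolding J_def mem_Collect_eq case_prod_conv .
    qed
    have "Re (T F q) = Re (T G q)" for q by (rule dense) (use iff[of _ True q] in simp)
    moreover have "Im (T F q) = Im (T G q)" for q by (rule dense) (use iff[of _ False q] in simp)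
    ultimately have TT: "T F q = T G q" for q by (simp add: complex_eq_iff)
    obtain f' where f: "sob (rp F) f'" "F = cls (rp F)" using rp[OF F] by blast
    obtain g' where g: "sob (rp G) g'" "G = cls (rp G)" using rp[OF G] by blast
    have intf: "integrable lebesgue (\<lambda>x. indicator \<Omega> x *\<^sub>R rp F x)" "integrable lebesgue (\<lambda>x. indicator \<Omega> x *\<^sub>R rp G x)"
      using L_integrable[OF sobD(1)[OF f(1)]] L_integrable[OF sobD(1)[OF g(1)]] by (simp_all add: integrable_M_iff)
    have "AE x in lebesgue. indicator \<Omega> x *\<^sub>R rp F x - indicator \<Omega> x *\<^sub>R rp G x = 0"
    proof (rule AE_zero_if_integrals_zero)
      show "integrable lebesgue (\<lambda>x. indicator \<Omega> x *\<^sub>R rp F x - indicator \<Omega> x *\<^sub>R rp G x)" using intf by (rule Bochner_Integration.integrable_diff)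
      fix q :: real assume "q \<in> \<rat>"
      then obtain p where p: "q = of_rat p" by (rule Rats_cases)
      have "(LINT x|lebesgue. indicator {..<q} x *\<^sub>R (indicator \<Omega> x *\<^sub>R rp F x - indicator \<Omega> x *\<^sub>R rp G x)) = T F p - T G p"
        unfolding T_def p scaleR_diff_right
        by (intro Bochner_Integration.integral_diff integrable_mult_indicator[OF _ intf(1)] integrable_mult_indicator[OF _ intf(2)]) auto
      then show "(LINT x|lebesgue. indicator {..<q} x *\<^sub>R (indicator \<Omega> x *\<^sub>R rp F x - indicator \<Omega> x *\<^sub>R rp G x)) = 0" using TT by simp
    qed
    then have "AE x in lebesgue. x \<in> \<Omega> \<longrightarrow> rp F x = rp G x" by eventually_elim (auto simp: indicator_def)
    then have "AE x in M. rp F x = rp G x" by (simp add: AE_M_iff)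
    then have "cls (rp F) = cls (rp G)" by (rule cls_cong)
    then show "F = G" using f(2) g(2) by simp
  qed
  obtain b :: "nat set \<Rightarrow> real" where b: "bij b"
    using nat_sets_eqpoll_reals unfolding eqpoll_def by blast
  have "inj_on (\<lambda>F. b (to_nat ` J F)) (carrier W)"
  proof (rule inj_onI)
    fix F G assume FG: "F \<in> carrier W" "G \<in> carrier W" and eq: "b (to_nat ` J F) = b (to_nat ` J G)"
    have "to_nat ` J F = to_nat ` J G" using injD[OF bij_is_inj[OF b] eq] .
    then have "J F = J G" using inj_image_eq_iff[OF inj_to_nat] by blast
    then show "F = G" using inj_onD[OF inj] FG by blast
  qed
  then show ?thesis by blast
qed

end

section \<open>Disjoint ramps when a growth condition fails\<close>

context orlicz_interval
begin

definition rep :: "(real \<Rightarrow> complex) set \<Rightarrow> (real \<Rightarrow> complex) \<times> (real \<Rightarrow> complex)" where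
  "rep F = (SOME p. sob (fst p) (snd p) \<and> F = cls (fst p))"

lemma rep: assumes "F \<in> carrier W" shows "sob (fst (rep F)) (snd (rep F))" "F = cls (fst (rep F))"
proof -
  obtain f g where "sob f g" "F = cls f" using W_ex[OF assms] by blast
  then have "\<exists>p. sob (fst p) (snd p) \<and> F = cls (fst p)" by (intro exI[of _ "(f, g)"]) simp
  from someI_ex[OF this] show "sob (fst (rep F)) (snd (rep F))" "F = cls (fst (rep F))"
    unfolding rep_def by blast+
qed

lemma rep_ae:
  assumes s: "sob f g"
  shows "AE x in M. fst (rep (cls f)) x = f x" "AE x in M. snd (rep (cls f)) x = g x"
proof -
  have r: "sob (fst (rep (cls f))) (snd (rep (cls f)))" "cls f = cls (fst (rep (cls f)))"
    by (rule rep[OF W_I[OF s]])+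
  then show 1: "AE x in M. fst (rep (cls f)) x = f x"
    using cls_eq_iff[OF sob_measurable[OF r(1)], of f] by metis
  show "AE x in M. snd (rep (cls f)) x = g x"
    by (rule wd_of_ae_eq[OF s 1 sobD(3)[OF r(1)]])
qed

definition dint :: "real set \<Rightarrow> (real \<Rightarrow> complex) set \<Rightarrow> complex" where
  "dint A F = (LINT x|M. indicator A x *\<^sub>R snd (rep F) x)"

lemma ind_integrable:
  assumes A: "A \<in> sets M" and g: "g \<in> L" shows "integrable M (\<lambda>x. indicator A x *\<^sub>R g x)"
  by (rule integrable_mult_indicator[OF A L_integrable[OF g]])

lemma dint_eq:
  assumes A: "A \<in> sets M" and s: "sob f g" shows "dint A (cls f) = (LINT x|M. indicator A x *\<^sub>R g x)"
  unfolding dint_def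
proof (rule integral_cong_AE)
  show "(\<lambda>x. indicator A x *\<^sub>R snd (rep (cls f)) x) \<in> borel_measurable M"
    using ind_integrable[OF A sobD(2)[OF rep(1)[OF W_I[OF s]]]] by (rule borel_measurable_integrable)
  show "(\<lambda>x. indicator A x *\<^sub>R g x) \<in> borel_measurable M"
    using ind_integrable[OF A sobD(2)[OF s]] by (rule borel_measurable_integrable)
  show "AE x in M. indicator A x *\<^sub>R snd (rep (cls f)) x = indicator A x *\<^sub>R g x"
    using rep_ae(2)[OF s] by eventually_elim simp
qed

lemma dint_lin: assumes A: "A \<in> sets M" shows "W.lin (dint A)"
  unfolding W.lin_def
proof (intro conjI ballI allI)
  fix F G assume F: "F \<in> carrier W" and G: "G \<in> carrier W"
  obtain f f' where f: "sob f f'" "F = cls f" using W_ex[OF F] by blast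
  obtain g g' where g: "sob g g'" "G = cls g" using W_ex[OF G] by blast
  have "dint A (F \<oplus>\<^bsub>W\<^esub> G) = (LINT x|M. indicator A x *\<^sub>R (f' x + g' x))"
    unfolding f g using dint_eq[OF A sob_add[OF f(1) g(1)]] by (simp add: W_add sob_measurable[OF f(1)] sob_measurable[OF g(1)])
  also have "\<dots> = dint A F + dint A G"
    unfolding f g dint_eq[OF A f(1)] dint_eq[OF A g(1)] scaleR_add_right
    by (intro Bochner_Integration.integral_add ind_integrable A sobD(2)[OF f(1)] sobD(2)[OF g(1)])
  finally show "dint A (F \<oplus>\<^bsub>W\<^esub> G) = dint A F + dint A G" .
next
  fix c F assume F: "F \<in> carrier W"
  obtain f f' where f: "sob f f'" "F = cls f" using W_ex[OF F] by blast
  have "dint A (c \<odot>\<^bsub>W\<^esub> F) = (LINT x|M. indicator A x *\<^sub>R (c * f' x))"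
    unfolding f using dint_eq[OF A sob_smult[OF f(1)]] by (simp add: W_smult sob_measurable[OF f(1)])
  also have "\<dots> = (LINT x|M. c * (indicator A x *\<^sub>R f' x))" by simp
  also have "\<dots> = c * dint A F" unfolding f dint_eq[OF A f(1)] by (rule integral_mult_right_zero)
  finally show "dint A (c \<odot>\<^bsub>W\<^esub> F) = c * dint A F" .
qed

lemma sob_sum:
  fixes n :: nat
  assumes s: "\<And>j::nat. sob (f j) (g j)"
  shows "sob (\<lambda>x. \<Sum>j<n. c j * f j x) (\<lambda>x. \<Sum>j<n. c j * g j x) \<and>
    (\<Oplus>\<^bsub>W\<^esub>j\<in>{..<n}. c j \<odot>\<^bsub>W\<^esub> cls (f j)) = cls (\<lambda>x. \<Sum>j<n. c j * f j x)"
proof (induction n)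
  case 0
  show ?case using sob_zero by (simp add: W_zero)
next
  case (Suc n)
  have sn: "sob (\<lambda>x. c n * f n x) (\<lambda>x. c n * g n x)" by (rule sob_smult[OF s])
  have "(\<Oplus>\<^bsub>W\<^esub>j\<in>{..<Suc n}. c j \<odot>\<^bsub>W\<^esub> cls (f j)) = c n \<odot>\<^bsub>W\<^esub> cls (f n) \<oplus>\<^bsub>W\<^esub> (\<Oplus>\<^bsub>W\<^esub>j\<in>{..<n}. c j \<odot>\<^bsub>W\<^esub> cls (f j))"
    unfolding lessThan_Suc using W_I[OF s] by (intro W.M.finsum_insert) auto
  also have "\<dots> = cls (\<lambda>x. c n * f n x + (\<Sum>j<n. c j * f j x))"
    using Suc sob_measurable[OF s] sob_measurable[OF sn] sob_measurable by (simp add: W_smult W_add)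
  finally show ?case using sob_add[OF conjunct1[OF Suc] sn] by (simp add: add.commute)
qed

definition ramp :: "real \<Rightarrow> real \<Rightarrow> real \<Rightarrow> real \<Rightarrow> complex" where
  "ramp a b s x = of_real (s * (min (max x a) b - a))"

definition block :: "real \<Rightarrow> real \<Rightarrow> real \<Rightarrow> real \<Rightarrow> complex" where
  "block a b s x = of_real (s * indicator {a<..<b} x)"

lemma bounded_in_L:
  assumes "f \<in> borel_measurable M" "\<And>x. cmod (f x) \<le> m" shows "f \<in> L"
proof -
  obtain C where C: "C > 0" "\<And>f m. f \<in> borel_measurable M \<Longrightarrow> m > 0 \<Longrightarrow> (\<And>x. cmod (f x) \<le> m) \<Longrightarrow> lball (C * m) f"
    by (rule bounded_lball) blast
  have "cmod (f x) \<le> \<bar>m\<bar> + 1" for x using assms(2)[of x] by linarith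
  then show ?thesis using lball_in_L[OF C(2)[OF assms(1), of "\<bar>m\<bar> + 1"]] by simp
qed

text \<open>
  The fundamental theorem of calculus for the product with a test function, whose two end values
  vanish; the two kinks are exceptional points.\<close>
lemma sob_ramp:
  assumes ab: "\<alpha> \<le> a" "a < b" "b \<le> \<beta>" and s: "s \<ge> 0"
  shows "sob (ramp a b s) (block a b s)" "cmod (ramp a b s x) \<le> s * (b - a)"
proof -
  show bnd: "cmod (ramp a b s x) \<le> s * (b - a)" for x
  proof -
    have "0 \<le> min (max x a) b - a" "min (max x a) b - a \<le> b - a" using ab by auto
    then show ?thesis using s by (simp add: ramp_def abs_mult mult_left_mono del: of_real_mult of_real_diff)
  qed
  have cont: "continuous_on UNIV (ramp a b s)" unfolding ramp_def[abs_def] by (intro continuous_intros)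
  have tm: "ramp a b s \<in> borel_measurable M"
    using borel_measurable_continuous_onI[OF cont] by (intro measurable_restrict_space1 measurable_completion) simp
  have bm: "block a b s \<in> borel_measurable M"
  proof -
    have "block a b s \<in> borel_measurable borel" unfolding block_def[abs_def] by measurable
    then show ?thesis by (intro measurable_restrict_space1 measurable_completion) simp
  qed
  have tL: "ramp a b s \<in> L" by (rule bounded_in_L[OF tm bnd])
  have bL: "block a b s \<in> L" by (rule bounded_in_L[OF bm, of s]) (use s in \<open>auto simp: block_def indicator_def\<close>)
  have lt: "locally_integrable \<Omega> (ramp a b s)" "locally_integrable \<Omega> (block a b s)"
    using locally_integrable_integrable L_integrable tL bL by blast+
  have "wd (ramp a b s) (block a b s)" unfolding weak_derivative_def
  proof (intro conjI ballI lt)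
    fix \<eta> assume e: "\<eta> \<in> test_functions \<Omega>"
    obtain K where K: "K \<subseteq> \<Omega>" "\<And>x. x \<notin> K \<Longrightarrow> \<eta> x = 0" "continuous_on UNIV \<eta>"
      "\<And>x. (\<eta> has_real_derivative deriv \<eta> x) (at x)"
    proof -
      note * = that
      show thesis by (rule test_functionE[OF e]) (rule *)
    qed
    have ends: "\<eta> \<alpha> = 0" "\<eta> \<beta> = 0" using K(1) by (auto intro!: K(2))
    define P where "P x = \<eta> x *\<^sub>R ramp a b s x" for x
    have tder: "(ramp a b s has_vector_derivative block a b s x) (at x)" if x: "x \<notin> {a, b}" for x
    proof -
      consider "x < a" | "a < x" "x < b" | "x > b" using x by fastforce
      then show ?thesis
      proof cases
        case 1
        have "((\<lambda>x. 0) has_vector_derivative (0::complex)) (at x)" by simp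
        then have "(ramp a b s has_vector_derivative 0) (at x)"
          by (rule has_vector_derivative_transform_within_open[of _ _ _ "{..<a}"]) (use 1 ab in \<open>auto simp: ramp_def\<close>)
        then show ?thesis using 1 by (simp add: block_def)
      next
        case 2
        have "((\<lambda>x. of_real (s * (x - a))) has_vector_derivative (of_real s :: complex)) (at x)"
          by (rule has_vector_derivative_of_real[of "\<lambda>x. s * (x - a)"]) (auto intro!: derivative_eq_intros simp: has_real_derivative_iff_has_vector_derivative[symmetric])
        then have "(ramp a b s has_vector_derivative of_real s) (at x)"
          by (rule has_vector_derivative_transform_within_open[of _ _ _ "{a<..<b}"]) (use 2 in \<open>auto simp: ramp_def\<close>)
        then show ?thesis using 2 by (simp add: block_def)
      next
        case 3
        have "((\<lambda>x. of_real (s * (b - a))) has_vector_derivative (0::complex)) (at x)" by simp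
        then have "(ramp a b s has_vector_derivative 0) (at x)"
          by (rule has_vector_derivative_transform_within_open[of _ _ _ "{b<..}"]) (use 3 ab in \<open>auto simp: ramp_def\<close>)
        then show ?thesis using 3 by (simp add: block_def)
      qed
    qed
    have "((\<lambda>x. \<eta> x *\<^sub>R block a b s x + deriv \<eta> x *\<^sub>R ramp a b s x) has_integral (P \<beta> - P \<alpha>)) {\<alpha>..\<beta>}"
    proof (rule fundamental_theorem_of_calculus_strong[of "{a, b}"])
      fix x assume "x \<in> {\<alpha>..\<beta>} - {a, b}"
      then show "(P has_vector_derivative \<eta> x *\<^sub>R block a b s x + deriv \<eta> x *\<^sub>R ramp a b s x) (at x)"
        unfolding P_def[abs_def] by (intro has_vector_derivative_scaleR K(4) tder) auto
    next
      show "continuous_on {\<alpha>..\<beta>} P" unfolding P_def[abs_def]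
        by (intro continuous_on_scaleR continuous_on_subset[OF K(3)] continuous_on_subset[OF cont]) auto
    qed (use interval in auto)
    then have 0: "((\<lambda>x. \<eta> x *\<^sub>R block a b s x + deriv \<eta> x *\<^sub>R ramp a b s x) has_integral 0) \<Omega>"
      by (simp add: P_def ends has_integral_Icc_iff_Ioo)
    have i: "integrable M (\<lambda>x. \<eta> x *\<^sub>R block a b s x)" "integrable M (\<lambda>x. deriv \<eta> x *\<^sub>R ramp a b s x)"
      by (rule test_integrable[OF e lt(2)] test_integrable[OF e lt(1)])+
    have "((\<lambda>x. \<eta> x *\<^sub>R block a b s x + deriv \<eta> x *\<^sub>R ramp a b s x) has_integral
       (LINT x|M. \<eta> x *\<^sub>R block a b s x + deriv \<eta> x *\<^sub>R ramp a b s x)) \<Omega>"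
      by (rule has_integral_integral_lebesgue_on[OF Bochner_Integration.integrable_add[OF i]]) simp
    from has_integral_unique[OF this 0]
    have "(LINT x|M. \<eta> x *\<^sub>R block a b s x) + (LINT x|M. deriv \<eta> x *\<^sub>R ramp a b s x) = 0"
      using i by simp
    then show "(LINT x|M. deriv \<eta> x *\<^sub>R ramp a b s x) = - (LINT x|M. \<eta> x *\<^sub>R block a b s x)"
      by (simp add: add_eq_0_iff)
  qed
  then show "sob (ramp a b s) (block a b s)" using tL bL by (simp add: sob_def)
qed

end

text \<open>
  The number \<open>c j\<close> is an upper bound for \<open>\<phi>\<^sup>*(t j)\<close>. The
  lower bound on \<open>s j * t j\<close> makes room for disjoint intervals of the lengths
  needed.\<close>
locale orlicz_blocks = orlicz_interval +
  fixes s t c :: "nat \<Rightarrow> real"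
  assumes st: "s j > 0" "t j > 0" "s j * t j \<ge> 2 ^ j / (\<beta> - \<alpha>)"
    and c: "c j \<ge> 0" "x \<ge> 0 \<Longrightarrow> x * t j - \<phi> x \<le> c j"
begin

text \<open>
  The intervals \<open>A j\<close> have length \<open>w j\<close>, chosen to make
  \<open>s j * t j * w j = 1/2\<close>; they start at points that divide the remaining
  distance to \<open>\<beta>\<close> in half.\<close>
definition "w j = 1 / (2 * (s j * t j))"
definition "p j = \<beta> - (\<beta> - \<alpha>) / 2 ^ j"
definition "A j = {p j<..<p j + w j}"
definition "f j = ramp (p j) (p j + w j) (s j)"
definition "g j = block (p j) (p j + w j) (s j)"
definition "e j = cls (f j)"
definition "h j F = of_real (t j) * dint (A j) F"

lemma w_pos: "w j > 0" using st by (simp add: w_def)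

lemma w_le: "w j \<le> (\<beta> - \<alpha>) / 2 ^ Suc j"
proof -
  have "2 * (2 ^ j / (\<beta> - \<alpha>)) \<le> 2 * (s j * t j)" using st(3)[of j] by simp
  then have "1 / (2 * (s j * t j)) \<le> 1 / (2 * (2 ^ j / (\<beta> - \<alpha>)))" using interval st(1,2)[of j]
    by (intro divide_left_mono mult_pos_pos divide_pos_pos) auto
  then show ?thesis using interval by (simp add: w_def field_simps)
qed

lemma stw: "s j * t j * w j = 1 / 2"
  using st(1,2)[of j] by (simp add: w_def)

lemma p_ge: "\<alpha> \<le> p j"
proof -
  have "(\<beta> - \<alpha>) / 2 ^ j \<le> (\<beta> - \<alpha>) / 1" using interval by (intro divide_left_mono) auto
  then show ?thesis by (simp add: p_def)
qed

lemma p_next: "p j + w j \<le> p (Suc j)"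
proof -
  have "(\<beta> - \<alpha>) / 2 ^ j = 2 * ((\<beta> - \<alpha>) / 2 ^ Suc j)" by (simp add: field_simps)
  then show ?thesis using w_le[of j] unfolding p_def by linarith
qed

lemma p_le: "p j + w j \<le> \<beta>"
proof -
  have "p (Suc j) \<le> \<beta>" using interval by (simp add: p_def)
  then show ?thesis using p_next[of j] by linarith
qed

lemma p_mono: "i < j \<Longrightarrow> p i + w i \<le> p j"
proof (induction j)
  case (Suc j)
  then show ?case using p_next[of j] p_next[of i] w_pos[of j] by (cases "i = j") auto
qed simp

lemma A_disjoint: "x \<in> A i \<Longrightarrow> x \<in> A j \<Longrightarrow> i = j"
  using p_mono[of i j] p_mono[of j i] by (cases i j rule: linorder_cases) (auto simp: A_def)

lemma A_sub: "A j \<subseteq> \<Omega>"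
  using p_ge[of j] p_le[of j] by (auto simp: A_def)

lemma A_meas [simp, measurable]: "A j \<in> sets M"
  using A_sub[of j] by (auto simp: sets_restrict_space_iff A_def)

lemma measure_A: "measure M (A j) = w j" "emeasure M (A j) = ennreal (w j)"
proof -
  show "emeasure M (A j) = ennreal (w j)"
    using A_sub[of j] w_pos[of j] by (subst emeasure_restrict_space) (auto simp: A_def)
  then show "measure M (A j) = w j" using w_pos[of j] by (simp add: measure_def)
qed

lemma sum_w: "(\<Sum>j<n. w j) \<le> \<beta> - \<alpha>"
proof -
  have "(\<Sum>j<n. w j) \<le> p n - \<alpha>"
  proof (induction n)
    case (Suc n)
    then show ?case using p_next[of n] by simp
  qed (simp add: p_def)
  also have "\<dots> \<le> \<beta> - \<alpha>" using interval by (simp add: p_def)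
  finally show ?thesis .
qed

lemma sob_fg: "sob (f j) (g j)" "cmod (f j x) \<le> s j * w j"
  using sob_ramp[of "p j" "p j + w j" "s j"] p_ge[of j] p_le[of j] w_pos[of j] st(1)[of j]
  by (auto simp: f_def g_def)

lemma g_eq: "g j x = indicator (A j) x *\<^sub>R of_real (s j)"
  by (simp add: g_def block_def A_def scaleR_conv_of_real)

lemma e_carrier: "e j \<in> carrier W"
  unfolding e_def by (rule W_I[OF sob_fg(1)])

lemma h_e: "h i (e j) = (if i = j then of_real (1 / 2) else 0)"
proof -
  have "dint (A i) (e j) = (LINT x|M. indicator (A i) x *\<^sub>R g j x)"
    unfolding e_def by (rule dint_eq[OF A_meas sob_fg(1)])
  also have "\<dots> = (LINT x|M. indicator (A i) x *\<^sub>R (if i = j then of_real (s i) else 0))"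
    using A_disjoint by (intro Bochner_Integration.integral_cong) (auto simp: g_eq indicator_def)
  also have "\<dots> = measure M (A i) *\<^sub>R (if i = j then of_real (s i) else 0)"
    using A_sub[of i] by (subst Bochner_Integration.integral_scaleR_left) (auto simp: Int_absorb2 measure_A)
  finally have "h i (e j) = (if i = j then of_real (s i * t i * w i) else 0)"
    by (simp add: h_def measure_A scaleR_conv_of_real mult_ac)
  then show ?thesis unfolding stw by simp
qed

lemma h_lin: "W.lin (h j)"
  using dint_lin[OF A_meas[of j]] unfolding W.lin_def by (auto simp: h_def algebra_simps)

text \<open>
  The derivatives have disjoint supports, so the modular is additive on them.\<close>
lemma I_blocks:
  assumes sg: "\<And>j. \<sigma> j \<in> {1, -1 :: complex}"
  shows "I (\<lambda>x. \<Sum>j\<in>J \<inter> {..<n}. \<sigma> j * g j x) \<le> (\<Sum>j\<in>J \<inter> {..<n}. ennreal (\<phi> (s j) * w j))"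
proof -
  have "I (\<lambda>x. \<Sum>j\<in>J \<inter> {..<n}. \<sigma> j * g j x) \<le> (\<integral>\<^sup>+x. (\<Sum>j\<in>J \<inter> {..<n}. ennreal (\<phi> (s j)) * indicator (A j) x) \<partial>M)"
    unfolding modular_def
  proof (rule nn_integral_mono)
    fix x
    show "ennreal (\<phi> (cmod (\<Sum>j\<in>J \<inter> {..<n}. \<sigma> j * g j x))) \<le> (\<Sum>j\<in>J \<inter> {..<n}. ennreal (\<phi> (s j)) * indicator (A j) x)"
    proof (cases "\<exists>k\<in>J \<inter> {..<n}. x \<in> A k")
      case True
      then obtain k where k: "k \<in> J \<inter> {..<n}" "x \<in> A k" by blast
      have "(\<Sum>j\<in>J \<inter> {..<n}. \<sigma> j * g j x) = (\<Sum>j\<in>J \<inter> {..<n}. if j = k then \<sigma> k * of_real (s k) else 0)"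
        using k(2) A_disjoint by (intro sum.cong) (auto simp: g_eq indicator_def)
      also have "\<dots> = \<sigma> k * of_real (s k)" using k(1) by simp
      finally have "cmod (\<Sum>j\<in>J \<inter> {..<n}. \<sigma> j * g j x) = s k"
        using sg[of k] st(1)[of k] by (auto simp: norm_mult)
      moreover have "ennreal (\<phi> (s k)) * indicator (A k) x \<le> (\<Sum>j\<in>J \<inter> {..<n}. ennreal (\<phi> (s j)) * indicator (A j) x)"
        using k(1) by (intro member_le_sum) auto
      ultimately show ?thesis using k(2) by simp
    next
      case False
      then have "(\<Sum>j\<in>J \<inter> {..<n}. \<sigma> j * g j x) = 0" by (intro sum.neutral) (auto simp: g_eq)
      then show ?thesis by simp
    qed
  qed
  also have "\<dots> = (\<Sum>j\<in>J \<inter> {..<n}. ennreal (\<phi> (s j)) * emeasure M (A j))"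
    by (subst nn_integral_sum) (auto simp: nn_integral_cmult)
  also have "\<dots> = (\<Sum>j\<in>J \<inter> {..<n}. ennreal (\<phi> (s j) * w j))"
    using phi_nonneg st(1) by (intro sum.cong) (auto simp: measure_A ennreal_mult' less_imp_le)
  finally show ?thesis .
qed

text \<open>
  The index set \<open>J\<close> allows two uses: all indices, when the numbers
  \<open>\<phi>(s j) w j\<close> are summable, and a single index, when they are only bounded.\<close>
lemma sums_bounded:
  "\<exists>C>0. \<forall>J n \<sigma>. (\<forall>j. \<sigma> j \<in> {1, -1 :: complex}) \<longrightarrow> (\<Sum>j\<in>J \<inter> {..<n}. \<phi> (s j) * w j) \<le> 1 \<longrightarrow>
    nrm W (\<Oplus>\<^bsub>W\<^esub>j\<in>{..<n}. (if j \<in> J then \<sigma> j else 0) \<odot>\<^bsub>W\<^esub> e j) \<le> C"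
proof -
  obtain C0 where C0: "C0 > 0" "\<And>u. u \<ge> 0 \<Longrightarrow> u \<le> C0 * (\<phi> u + 1)" by (rule phi_linear_lower) blast
  obtain C1 where C1: "C1 > 0" "\<And>f m. f \<in> borel_measurable M \<Longrightarrow> m > 0 \<Longrightarrow> (\<And>x. cmod (f x) \<le> m) \<Longrightarrow> lball (C1 * m) f"
    by (rule bounded_lball) blast
  define m where "m = C0 * (1 + (\<beta> - \<alpha>))"
  have m: "m > 0" using C0 interval by (simp add: m_def)
  show ?thesis
  proof (intro exI[of _ "C1 * m + 1"] conjI allI impI)
    show "C1 * m + 1 > 0" using C1 m by (simp add: add_pos_pos)
    fix J n and \<sigma> :: "nat \<Rightarrow> complex" assume "\<forall>j. \<sigma> j \<in> {1, -1}" and le1: "(\<Sum>j\<in>J \<inter> {..<n}. \<phi> (s j) * w j) \<le> 1"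
    then have sg: "\<sigma> j \<in> {1, -1}" for j by blast
    define d where "d j = (if j \<in> J then \<sigma> j else 0)" for j
    note ss = sob_sum[where f = f and g = g and n = n and c = d, OF sob_fg(1)]
    let ?f = "\<lambda>x. \<Sum>j<n. d j * f j x" and ?g = "\<lambda>x. \<Sum>j<n. d j * g j x"
    have restr: "(\<Sum>j<n. d j * v j) = (\<Sum>j\<in>J \<inter> {..<n}. \<sigma> j * v j)" for v
    proof -
      have "(\<Sum>j\<in>J \<inter> {..<n}. \<sigma> j * v j) = (\<Sum>j\<in>J \<inter> {..<n}. d j * v j)" by (intro sum.cong) (auto simp: d_def)
      also have "\<dots> = (\<Sum>j<n. d j * v j)" by (intro sum.mono_neutral_left) (auto simp: d_def)
      finally show ?thesis by simp
    qed
    have "I (\<lambda>x. ?g x / of_real 1) \<le> (\<Sum>j\<in>J \<inter> {..<n}. ennreal (\<phi> (s j) * w j))"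
      using I_blocks[of \<sigma> J n, OF sg] by (simp add: restr)
    also have "\<dots> = ennreal (\<Sum>j\<in>J \<inter> {..<n}. \<phi> (s j) * w j)"
      using phi_nonneg st(1) w_pos by (intro sum_ennreal) (auto simp: less_imp_le)
    also have "\<dots> \<le> 1" using le1 by (simp add: ennreal_le_1)
    finally have "lball 1 ?g" unfolding lball_def using L_measurable[OF sobD(2)[OF conjunct1[OF ss]]] by simp
    then have lg: "lux ?g \<le> 1" by (rule lux_le)
    have "cmod (?f x) \<le> m" for x
    proof -
      have "cmod (?f x) \<le> (\<Sum>j\<in>J \<inter> {..<n}. cmod (\<sigma> j * f j x))" unfolding restr by (rule norm_sum)
      also have "\<dots> \<le> (\<Sum>j\<in>J \<inter> {..<n}. C0 * (\<phi> (s j) * w j + w j))"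
      proof (rule sum_mono)
        fix j
        have "cmod (\<sigma> j) = 1" using sg[of j] by auto
        then have "cmod (\<sigma> j * f j x) \<le> s j * w j" using sob_fg(2)[of j x] by (simp add: norm_mult)
        also have "\<dots> \<le> C0 * (\<phi> (s j) + 1) * w j" using C0(2)[of "s j"] st(1)[of j] w_pos[of j] by (intro mult_right_mono) auto
        finally show "cmod (\<sigma> j * f j x) \<le> C0 * (\<phi> (s j) * w j + w j)" by (simp add: algebra_simps)
      qed
      also have "\<dots> = C0 * ((\<Sum>j\<in>J \<inter> {..<n}. \<phi> (s j) * w j) + (\<Sum>j\<in>J \<inter> {..<n}. w j))"
        by (simp only: sum_distrib_left[symmetric] sum.distrib)
      also have "\<dots> \<le> m" unfolding m_def
      proof (intro mult_left_mono add_mono le1)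
        have "(\<Sum>j\<in>J \<inter> {..<n}. w j) \<le> (\<Sum>j<n. w j)" using w_pos by (intro sum_mono2) (auto simp: less_imp_le)
        then show "(\<Sum>j\<in>J \<inter> {..<n}. w j) \<le> \<beta> - \<alpha>" using sum_w[of n] by simp
      qed (use C0 in auto)
      finally show ?thesis .
    qed
    then have "lux ?f \<le> C1 * m" using sob_measurable[OF conjunct1[OF ss]] m by (intro lux_le C1)
    then show "nrm W (\<Oplus>\<^bsub>W\<^esub>j\<in>{..<n}. (if j \<in> J then \<sigma> j else 0) \<odot>\<^bsub>W\<^esub> e j) \<le> C1 * m + 1"
      using lg W_nrm[OF conjunct1[OF ss]] ss by (simp add: e_def d_def)
  qed
qed

text \<open>
  Young's inequality \<open>|f'| t j \<le> \<phi>(|f'|) + \<phi>\<^sup>*(t j)\<close>,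
  integrated over the disjoint intervals after \<open>f'\<close> has been divided by a bound for its
  norm. Again \<open>J\<close> is either everything or a single index.\<close>
lemma h_sum_le:
  assumes F: "F \<in> carrier W" and le1: "(\<Sum>j\<in>J \<inter> {..<n}. c j * w j) \<le> 1"
  shows "(\<Sum>j\<in>J \<inter> {..<n}. cmod (h j F)) \<le> 2 * nrm W F"
proof -
  obtain u v where uv: "sob u v" "F = cls u" using W_ex[OF F] by blast
  note vL = sobD(2)[OF uv(1)]
  have ball: "(\<Sum>j\<in>J \<inter> {..<n}. cmod (h j F)) \<le> 2 * l" if lb: "lball l v" for l
  proof -
    note l = lballD(2)[OF lb]
    note [measurable] = lballD(1)[OF lb]
    have fin: "(\<integral>\<^sup>+x. ennreal (\<phi> (cmod (v x / of_real l))) \<partial>M) \<le> 1" using lballD(3)[OF lb] by (simp add: modular_def)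
    have ip: "integrable M (\<lambda>x. \<phi> (cmod (v x / of_real l)))"
      using fin phi_nonneg by (intro integrableI_nonneg) (auto intro: le_less_trans)
    have "ennreal (LINT x|M. \<phi> (cmod (v x / of_real l))) \<le> 1"
      using nn_integral_eq_integral[OF ip] fin phi_nonneg by simp
    then have phi1: "(LINT x|M. \<phi> (cmod (v x / of_real l))) \<le> 1" by (simp add: ennreal_le_1)
    have iv: "integrable M (\<lambda>x. indicator (A j) x * (t j * cmod (v x / of_real l)))" for j
    proof -
      have "integrable M (\<lambda>x. (t j / l) * cmod (indicator (A j) x *\<^sub>R v x))"
        using ind_integrable[OF A_meas vL] by (intro integrable_mult_right integrable_norm)
      then show ?thesis using l by (simp add: norm_divide mult_ac)
    qed
    have ic: "integrable M (\<lambda>x. indicator (A j) x * c j)" for j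
      using A_sub[of j] by (intro integrable_mult_left integrable_real_indicator) (auto simp: measure_A)
    have h1: "cmod (h j F) \<le> l * (LINT x|M. indicator (A j) x * (t j * cmod (v x / of_real l)))" for j
    proof -
      have "cmod (h j F) = t j * cmod (LINT x|M. indicator (A j) x *\<^sub>R v x)"
        unfolding h_def uv(2) dint_eq[OF A_meas uv(1)] using st(2)[of j] by (simp add: norm_mult)
      also have "\<dots> \<le> t j * (LINT x|M. cmod (indicator (A j) x *\<^sub>R v x))"
        using st(2)[of j] by (intro mult_left_mono integral_norm_bound) auto
      also have "\<dots> = (LINT x|M. t j * cmod (indicator (A j) x *\<^sub>R v x))" by simp
      also have "\<dots> = (LINT x|M. l * (indicator (A j) x * (t j * cmod (v x / of_real l))))"
        using l by (intro Bochner_Integration.integral_cong) (auto simp: norm_divide)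
      finally show ?thesis by simp
    qed
    have pt: "(\<Sum>j\<in>J \<inter> {..<n}. indicator (A j) x * (t j * y)) \<le> \<phi> y + (\<Sum>j\<in>J \<inter> {..<n}. indicator (A j) x * c j)"
      if y: "y \<ge> 0" for x y
    proof (cases "\<exists>k\<in>J \<inter> {..<n}. x \<in> A k")
      case True
      then obtain k where k: "k \<in> J \<inter> {..<n}" "x \<in> A k" by blast
      have one: "(\<Sum>j\<in>J \<inter> {..<n}. indicator (A j) x * v j) = v k" for v :: "nat \<Rightarrow> real"
      proof -
        have "(\<Sum>j\<in>J \<inter> {..<n}. indicator (A j) x * v j) = (\<Sum>j\<in>J \<inter> {..<n}. if j = k then v k else 0)"
          using k(2) A_disjoint by (intro sum.cong) (auto simp: indicator_def)
        then show ?thesis using k(1) by simp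
      qed
      show ?thesis unfolding one using c(2)[OF y, of k] by (simp add: mult.commute)
    next
      case False
      then have "(\<Sum>j\<in>J \<inter> {..<n}. indicator (A j) x * (t j * y)) = 0" by (intro sum.neutral) auto
      moreover have "0 \<le> (\<Sum>j\<in>J \<inter> {..<n}. indicator (A j) x * c j)" using c(1) by (intro sum_nonneg) auto
      ultimately show ?thesis using phi_nonneg[OF y] by simp
    qed
    have "(\<Sum>j\<in>J \<inter> {..<n}. LINT x|M. indicator (A j) x * (t j * cmod (v x / of_real l))) =
      (LINT x|M. (\<Sum>j\<in>J \<inter> {..<n}. indicator (A j) x * (t j * cmod (v x / of_real l))))"
      by (intro Bochner_Integration.integral_sum[symmetric] iv)
    also have "\<dots> \<le> (LINT x|M. \<phi> (cmod (v x / of_real l)) + (\<Sum>j\<in>J \<inter> {..<n}. indicator (A j) x * c j))"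
      by (intro integral_mono Bochner_Integration.integrable_sum iv Bochner_Integration.integrable_add ip ic pt) simp
    also have "\<dots> = (LINT x|M. \<phi> (cmod (v x / of_real l))) + (LINT x|M. (\<Sum>j\<in>J \<inter> {..<n}. indicator (A j) x * c j))"
      by (intro Bochner_Integration.integral_add ip Bochner_Integration.integrable_sum ic)
    also have "(LINT x|M. (\<Sum>j\<in>J \<inter> {..<n}. indicator (A j) x * c j)) = (\<Sum>j\<in>J \<inter> {..<n}. LINT x|M. indicator (A j) x * c j)"
      by (intro Bochner_Integration.integral_sum ic)
    also have "\<dots> = (\<Sum>j\<in>J \<inter> {..<n}. c j * w j)"
      using A_sub by (intro sum.cong) (auto simp: measure_A Int_absorb2)
    finally have tot: "(\<Sum>j\<in>J \<inter> {..<n}. LINT x|M. indicator (A j) x * (t j * cmod (v x / of_real l))) \<le> 1 + 1"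
      using phi1 le1 by linarith
    have "(\<Sum>j\<in>J \<inter> {..<n}. cmod (h j F)) \<le> (\<Sum>j\<in>J \<inter> {..<n}. l * (LINT x|M. indicator (A j) x * (t j * cmod (v x / of_real l))))"
      by (intro sum_mono h1)
    also have "\<dots> = l * (\<Sum>j\<in>J \<inter> {..<n}. LINT x|M. indicator (A j) x * (t j * cmod (v x / of_real l)))"
      by (simp add: sum_distrib_left)
    also have "\<dots> \<le> l * (1 + 1)" using tot l by (intro mult_left_mono) auto
    finally show ?thesis by simp
  qed
  have "(\<Sum>j\<in>J \<inter> {..<n}. cmod (h j F)) / 2 \<le> lux v"
  proof (rule lux_leI[OF vL])
    fix l assume "lball l v"
    then show "(\<Sum>j\<in>J \<inter> {..<n}. cmod (h j F)) / 2 \<le> l" using ball[of l] by simp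
  qed
  moreover have "nrm W F = lux u + lux v" unfolding uv(2) by (rule W_nrm[OF uv(1)])
  ultimately show ?thesis using lux_nonneg[OF sobD(1)[OF uv(1)]] by simp
qed

lemma geometric_le: "(\<Sum>j<n. (1/2 :: real) ^ Suc j) \<le> 1"
proof -
  have "(\<Sum>j<n. (1/2 :: real) ^ Suc j) = 1 - (1/2) ^ n" by (induction n) auto
  then show ?thesis by simp
qed

text \<open>
  The modulars of the derivatives are summable, so all signed sums are bounded.\<close>
lemma linfty_blocks:
  assumes small: "\<And>j. 2 ^ j * \<phi> (s j) \<le> s j * t j" and cj: "\<And>j. c j = 2 * (s j * t j)"
  shows "\<not> reflexive W" "\<not> B_convex W"
proof -
  have phiw: "\<phi> (s j) * w j \<le> (1/2) ^ Suc j" for j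
  proof -
    have "2 ^ j * \<phi> (s j) * w j \<le> s j * t j * w j" using small w_pos[of j] by (intro mult_right_mono) (auto simp: less_imp_le)
    then show ?thesis unfolding stw by (simp add: field_simps power_divide)
  qed
  have sum1: "(\<Sum>j\<in>UNIV \<inter> {..<n}. \<phi> (s j) * w j) \<le> 1" for n
    using sum_mono[of "{..<n}" "\<lambda>j. \<phi> (s j) * w j" "\<lambda>j. (1/2) ^ Suc j", OF phiw] geometric_le[of n] by simp
  obtain C where C: "C > 0" "\<forall>J n \<sigma>. (\<forall>j. \<sigma> j \<in> {1, -1 :: complex}) \<longrightarrow> (\<Sum>j\<in>J \<inter> {..<n}. \<phi> (s j) * w j) \<le> 1 \<longrightarrow>
    nrm W (\<Oplus>\<^bsub>W\<^esub>j\<in>{..<n}. (if j \<in> J then \<sigma> j else 0) \<odot>\<^bsub>W\<^esub> e j) \<le> C"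
    using sums_bounded by blast
  have esum: "nrm W (\<Oplus>\<^bsub>W\<^esub>j\<in>{..<n}. \<sigma> j \<odot>\<^bsub>W\<^esub> e j) \<le> C" if "\<And>j. \<sigma> j \<in> {1, -1}" for n \<sigma>
    using C(2)[THEN spec, of UNIV, THEN spec, of n, THEN spec, of \<sigma>] that sum1[of n] by simp
  have hbl: "W.bl 2 (h i)" for i unfolding W.bl_def
  proof (intro conjI ballI h_lin)
    fix F assume F: "F \<in> carrier W"
    have "c i * w i = 1" using stw[of i] by (simp add: cj mult.assoc)
    then have "(\<Sum>j\<in>{i} \<inter> {..<Suc i}. c j * w j) \<le> 1" by simp
    from h_sum_le[OF F this] show "cmod (h i F) \<le> 2 * nrm W F" by simp
  qed
  show "\<not> reflexive W" by (rule W.linfty_not_reflexive[OF e_carrier esum hbl h_e]) auto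
  show "\<not> B_convex W" by (rule W.linfty_not_B_convex[OF e_carrier esum hbl h_e _ C(1)]) auto
qed

text \<open>
  The bounds for \<open>\<phi>\<^sup>*\<close> are summable, so the sum of all coordinates is
  bounded by the norm.\<close>
lemma l1_blocks:
  assumes small: "\<And>j. \<phi> (s j) \<le> 2 * (s j * t j)" and cj: "\<And>j. c j = s j * t j / 2 ^ j"
  shows "\<not> reflexive W" "\<not> B_convex W"
proof -
  have phiw: "\<phi> (s j) * w j \<le> 1" for j
  proof -
    have "\<phi> (s j) * w j \<le> 2 * (s j * t j) * w j" using small w_pos[of j] by (intro mult_right_mono) (auto simp: less_imp_le)
    then show ?thesis using stw[of j] by (simp add: mult.assoc)
  qed
  obtain C where C: "C > 0" "\<forall>J n \<sigma>. (\<forall>j. \<sigma> j \<in> {1, -1 :: complex}) \<longrightarrow> (\<Sum>j\<in>J \<inter> {..<n}. \<phi> (s j) * w j) \<le> 1 \<longrightarrow>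
    nrm W (\<Oplus>\<^bsub>W\<^esub>j\<in>{..<n}. (if j \<in> J then \<sigma> j else 0) \<odot>\<^bsub>W\<^esub> e j) \<le> C"
    using sums_bounded by blast
  have en: "nrm W (e i) \<le> C" for i
  proof -
    have "(\<Oplus>\<^bsub>W\<^esub>j\<in>{..<Suc i}. (if j \<in> {i} then 1 else 0) \<odot>\<^bsub>W\<^esub> e j) = (\<Oplus>\<^bsub>W\<^esub>j\<in>{..<Suc i}. if i = j then e j else \<zero>\<^bsub>W\<^esub>)"
      using e_carrier by (intro W.M.finsum_cong') auto
    also have "\<dots> = e i" using e_carrier by (intro W.M.finsum_singleton) auto
    finally show ?thesis using C(2)[THEN spec, of "{i}", THEN spec, of "Suc i", THEN spec, of "\<lambda>_. 1"] phiw[of i] by simp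
  qed
  have cw: "c j * w j = (1/2) ^ Suc j" for j
  proof -
    have "c j * w j = (s j * t j * w j) / 2 ^ j" by (simp add: cj)
    then show ?thesis unfolding stw by (simp add: power_divide)
  qed
  have hs: "(\<Sum>i<n. cmod (h i F)) \<le> 2 * nrm W F" if F: "F \<in> carrier W" for n F
    using h_sum_le[OF F, of UNIV n] geometric_le[of n] by (simp add: cw)
  show "\<not> reflexive W" by (rule W.l1_not_reflexive[OF e_carrier en h_lin hs h_e]) auto
  show "\<not> B_convex W" by (rule W.l1_not_B_convex[OF e_carrier en h_lin hs h_e _ C(1)]) auto
qed

end

context orlicz_interval
begin

lemma not_Delta2_not_reflexive_not_B_convex:
  assumes nd: "\<not> Delta2_infty (\<lambda>u. ereal (\<phi> u))" shows "\<not> reflexive W" "\<not> B_convex W"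
proof -
  have "\<exists>s t. s > 0 \<and> t > 0 \<and> s * t \<ge> 2 ^ j / (\<beta> - \<alpha>) \<and> 2 ^ j * \<phi> s \<le> s * t \<and> (\<forall>x\<ge>0. x * t - \<phi> x \<le> 2 * (s * t))" for j :: nat
    by (rule not_Delta2_pairs[OF nd, of "2 ^ j" "2 ^ j / (\<beta> - \<alpha>)"]) (simp, blast)
  then obtain s t where seq: "\<And>j. s j > 0" "\<And>j. t j > 0" "\<And>j. s j * t j \<ge> 2 ^ j / (\<beta> - \<alpha>)"
    "\<And>j::nat. 2 ^ j * \<phi> (s j) \<le> s j * t j" "\<And>j x. x \<ge> 0 \<Longrightarrow> x * t j - \<phi> x \<le> 2 * (s j * t j)" by metis
  interpret orlicz_blocks \<phi> \<alpha> \<beta> s t "\<lambda>j. 2 * (s j * t j)"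
    by unfold_locales (use seq in \<open>auto intro: less_imp_le mult_pos_pos\<close>)
  show "\<not> reflexive W" "\<not> B_convex W" by (rule linfty_blocks[OF seq(4) refl])+
qed

lemma not_Delta2_complementary_not_reflexive_not_B_convex:
  assumes nd: "\<not> Delta2_infty (complementary \<phi>)" shows "\<not> reflexive W" "\<not> B_convex W"
proof -
  have "\<exists>s t. s > 0 \<and> t > 0 \<and> s * t \<ge> 2 ^ j / (\<beta> - \<alpha>) \<and> \<phi> s \<le> 2 * (s * t) \<and> (\<forall>x\<ge>0. 2 ^ j * (x * t - \<phi> x) \<le> s * t)" for j :: nat
    by (rule not_Delta2_complementary_pairs[OF nd, of "2 ^ j" "2 ^ j / (\<beta> - \<alpha>)"]) (simp, blast)
  then obtain s t where seq: "\<And>j. s j > 0" "\<And>j. t j > 0" "\<And>j. s j * t j \<ge> 2 ^ j / (\<beta> - \<alpha>)"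
    "\<And>j::nat. \<phi> (s j) \<le> 2 * (s j * t j)" "\<And>j x. x \<ge> 0 \<Longrightarrow> 2 ^ j * (x * t j - \<phi> x) \<le> s j * t j" by metis
  interpret orlicz_blocks \<phi> \<alpha> \<beta> s t "\<lambda>j. s j * t j / 2 ^ j"
  proof unfold_locales
    fix j and x :: real assume "x \<ge> 0"
    then show "x * t j - \<phi> x \<le> s j * t j / 2 ^ j" using seq(5)[of x j] by (simp add: field_simps)
  qed (use seq in \<open>auto intro: less_imp_le mult_pos_pos\<close>)
  show "\<not> reflexive W" "\<not> B_convex W" by (rule l1_blocks[OF seq(4) refl])+
qed

end

section \<open>The uniformly convex modular and the equivalence\<close>

locale orlicz_growth_interval = orlicz_interval \<phi> \<alpha> \<beta> + orlicz_growth \<phi> a s0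
  for \<phi> \<alpha> \<beta> a s0
begin

text \<open>
  By condition \<open>\<Delta>\<^sub>2\<close> for \<open>\<phi>\<close> (\<open>Psi_upper\<close>)
  this modular is finite on the whole Orlicz class, so a real integral suffices.\<close>
definition P :: "(real \<Rightarrow> complex) \<Rightarrow> real" where "P f = (LINT x|M. \<Psi> (cmod (f x)))"

definition \<rho> :: "(real \<Rightarrow> complex) set \<Rightarrow> real" where "\<rho> F = P (fst (rep F)) + P (snd (rep F))"

lemma Psi_measurable [measurable]:
  assumes [measurable]: "f \<in> borel_measurable N"
  shows "(\<lambda>x. \<Psi> (cmod (f x))) \<in> borel_measurable N"
proof -
  have [measurable]: "\<Psi> \<in> borel_measurable borel" by (intro borel_measurable_mono monoI Psi_mono)
  show ?thesis by measurable
qed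

lemma phi_ball_integral:
  assumes lb: "lball l f"
  shows "integrable M (\<lambda>x. \<phi> (cmod (f x / of_real l)))" "(LINT x|M. \<phi> (cmod (f x / of_real l))) \<le> 1"
proof -
  note [measurable] = lballD(1)[OF lb]
  have fin: "(\<integral>\<^sup>+x. ennreal (\<phi> (cmod (f x / of_real l))) \<partial>M) \<le> 1" using lballD(3)[OF lb] by (simp add: modular_def)
  show ip: "integrable M (\<lambda>x. \<phi> (cmod (f x / of_real l)))"
    using fin phi_nonneg by (intro integrableI_nonneg) (auto intro: le_less_trans)
  have "ennreal (LINT x|M. \<phi> (cmod (f x / of_real l))) \<le> 1"
    using nn_integral_eq_integral[OF ip] fin phi_nonneg by simp
  then show "(LINT x|M. \<phi> (cmod (f x / of_real l))) \<le> 1" by (simp add: ennreal_le_1)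
qed

lemma const_integral: "integrable M (\<lambda>x. k :: real)" "(LINT x|M. k) = k * (\<beta> - \<alpha>)"
proof -
  interpret finite_measure M by (rule finite_measure_M)
  show "integrable M (\<lambda>x. k)" by simp
  have "measure M (space M) = \<beta> - \<alpha>" using emeasure_M interval by (simp add: measure_def)
  then show "(LINT x|M. k) = k * (\<beta> - \<alpha>)" by (simp add: mult.commute)
qed

lemma P_ball:
  assumes l: "l > 0"
  obtains R where "\<And>f. lball l f \<Longrightarrow> integrable M (\<lambda>x. \<Psi> (cmod (f x)))" "\<And>f. lball l f \<Longrightarrow> P f \<le> R"
proof -
  obtain C where C: "C > 0" "\<And>u. u \<ge> 0 \<Longrightarrow> \<Psi> u \<le> C * (\<phi> ((1 / l) * u) + 1)"
    using Psi_upper[of "1 / l"] l by auto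
  have pt: "\<Psi> (cmod (f x)) \<le> C * (\<phi> (cmod (f x / of_real l)) + 1)" for f :: "real \<Rightarrow> complex" and x
    using C(2)[of "cmod (f x)"] l by (simp add: norm_divide)
  have int: "integrable M (\<lambda>x. C * (\<phi> (cmod (f x / of_real l)) + 1))" if "lball l f" for f
    by (intro integrable_mult_right Bochner_Integration.integrable_add phi_ball_integral(1)[OF that] const_integral(1))
  have i: "integrable M (\<lambda>x. \<Psi> (cmod (f x)))" if f: "lball l f" for f
  proof (rule Bochner_Integration.integrable_bound[OF int[OF f]])
    show "(\<lambda>x. \<Psi> (cmod (f x))) \<in> borel_measurable M" using lballD(1)[OF f] by (rule Psi_measurable)
    show "AE x in M. norm (\<Psi> (cmod (f x))) \<le> norm (C * (\<phi> (cmod (f x / of_real l)) + 1))"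
    proof (rule AE_I2)
      fix x
      show "norm (\<Psi> (cmod (f x))) \<le> norm (C * (\<phi> (cmod (f x / of_real l)) + 1))"
        unfolding real_norm_def using pt[of f x] Psi_nonneg[of "cmod (f x)"] by linarith
    qed
  qed
  show thesis
  proof (rule that[of "C * (1 + (\<beta> - \<alpha>))"])
    fix f assume f: "lball l f"
    show "integrable M (\<lambda>x. \<Psi> (cmod (f x)))" by (rule i[OF f])
    have "P f \<le> (LINT x|M. C * (\<phi> (cmod (f x / of_real l)) + 1))"
      unfolding P_def by (intro integral_mono i[OF f] int[OF f] pt)
    also have "\<dots> = C * ((LINT x|M. \<phi> (cmod (f x / of_real l))) + 1 * (\<beta> - \<alpha>))"
      using phi_ball_integral(1)[OF f] const_integral[of 1] by simp
    also have "\<dots> \<le> C * (1 + (\<beta> - \<alpha>))" using phi_ball_integral(2)[OF f] C(1) by simp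
    finally show "P f \<le> C * (1 + (\<beta> - \<alpha>))" .
  qed
qed

lemma Psi_integrable: assumes "f \<in> L" shows "integrable M (\<lambda>x. \<Psi> (cmod (f x)))"
proof -
  obtain l where l: "lball l f" using ex_lball[OF assms] .
  show ?thesis by (rule P_ball[OF lballD(2)[OF l]]) (use l in blast)
qed

lemma P_nonneg: "P f \<ge> 0" unfolding P_def by (intro Bochner_Integration.integral_nonneg Psi_nonneg)

lemma P_cong:
  assumes "AE x in M. f x = g x" "f \<in> L" "g \<in> L" shows "P f = P g"
  unfolding P_def
proof (rule integral_cong_AE)
  show "AE x in M. \<Psi> (cmod (f x)) = \<Psi> (cmod (g x))" using assms(1) by eventually_elim simp
qed (auto intro!: Psi_measurable L_measurable assms)

lemma rho_eq: assumes s: "sob f g" shows "\<rho> (cls f) = P f + P g"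
proof -
  note r = rep(1)[OF W_I[OF s]]
  show ?thesis unfolding \<rho>_def
    using P_cong[OF rep_ae(1)[OF s] sobD(1)[OF r] sobD(1)[OF s]] P_cong[OF rep_ae(2)[OF s] sobD(2)[OF r] sobD(2)[OF s]] by simp
qed

lemma P_defect:
  assumes t: "t > 0"
  obtains K where "K \<ge> 0" "\<And>f g. f \<in> L \<Longrightarrow> g \<in> L \<Longrightarrow> P (\<lambda>x. (1/2) * (f x - g x)) \<le>
     t * (P f + P g) + K * ((P f + P g) / 2 - P (\<lambda>x. (1/2) * (f x + g x)))"
proof -
  obtain K where K: "K \<ge> 0" "\<And>x y :: complex. \<Psi> (cmod ((x - y) / 2)) \<le>
     t * (\<Psi> (cmod x) + \<Psi> (cmod y)) + K * ((\<Psi> (cmod x) + \<Psi> (cmod y)) / 2 - \<Psi> (cmod ((x + y) / 2)))"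
    by (rule Psi_defect[OF t]) blast
  show thesis
  proof (rule that[OF K(1)])
    fix f g assume f: "f \<in> L" and g: "g \<in> L"
    let ?d = "\<lambda>x. (1/2) * (f x - g x)" and ?s = "\<lambda>x. (1/2) * (f x + g x)"
    have dL: "?d \<in> L" and sL: "?s \<in> L" by (intro L_smult L_diff L_add f g)+
    note i = Psi_integrable[OF f] Psi_integrable[OF g] Psi_integrable[OF sL] Psi_integrable[OF dL]
    let ?u = "\<lambda>x. \<Psi> (cmod (f x))" and ?v = "\<lambda>x. \<Psi> (cmod (g x))" and ?m = "\<lambda>x. \<Psi> (cmod (?s x))"
    have ib: "integrable M (\<lambda>x. t * (?u x + ?v x) + K * ((?u x + ?v x) / 2 - ?m x))"
      by (intro Bochner_Integration.integrable_add integrable_mult_right Bochner_Integration.integrable_diff integrable_divide i)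
    have "P ?d \<le> (LINT x|M. t * (?u x + ?v x) + K * ((?u x + ?v x) / 2 - ?m x))"
      unfolding P_def
    proof (rule integral_mono[OF i(4) ib])
      fix x
      show "\<Psi> (cmod (?d x)) \<le> t * (?u x + ?v x) + K * ((?u x + ?v x) / 2 - ?m x)"
        using K(2)[of "f x" "g x"] by simp
    qed
    also have "\<dots> = t * (P f + P g) + K * ((P f + P g) / 2 - P ?s)"
      unfolding P_def using i by simp
    finally show "P ?d \<le> t * (P f + P g) + K * ((P f + P g) / 2 - P ?s)" .
  qed
qed

text \<open>
  The term \<open>\<sigma>\<close> of \<open>Psi_lower\<close> is chosen so that its integral is
  \<open>1/2\<close>; the modular of \<open>\<Psi>\<close> contributes the other half.\<close>
lemma P_small:
  assumes e: "e > 0"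
  obtains k where "k > 0" "\<And>f. f \<in> L \<Longrightarrow> P f \<le> k \<Longrightarrow> lux f \<le> e"
proof -
  obtain K where K: "K > 0" "\<And>u. u \<ge> 0 \<Longrightarrow> \<phi> (u / e) \<le> K * \<Psi> u + 1 / (2 * (\<beta> - \<alpha>))"
    using Psi_lower[OF e, of "1 / (2 * (\<beta> - \<alpha>))"] interval by auto
  show thesis
  proof (rule that[of "1 / (2 * K)"])
    show "1 / (2 * K) > 0" using K by simp
    fix f assume f: "f \<in> L" and P: "P f \<le> 1 / (2 * K)"
    have i: "integrable M (\<lambda>x. K * \<Psi> (cmod (f x)) + 1 / (2 * (\<beta> - \<alpha>)))"
      by (intro Bochner_Integration.integrable_add integrable_mult_right Psi_integrable[OF f] const_integral(1))
    have "I (\<lambda>x. f x / of_real e) \<le> (\<integral>\<^sup>+x. ennreal (K * \<Psi> (cmod (f x)) + 1 / (2 * (\<beta> - \<alpha>))) \<partial>M)"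
      unfolding modular_def
    proof (intro nn_integral_mono ennreal_leI)
      fix x show "\<phi> (cmod (f x / of_real e)) \<le> K * \<Psi> (cmod (f x)) + 1 / (2 * (\<beta> - \<alpha>))"
        using K(2)[of "cmod (f x)"] e by (simp add: norm_divide)
    qed
    also have "\<dots> = ennreal (LINT x|M. K * \<Psi> (cmod (f x)) + 1 / (2 * (\<beta> - \<alpha>)))"
      using K(1) Psi_nonneg interval by (intro nn_integral_eq_integral i) auto
    also have "\<dots> \<le> ennreal 1"
    proof (rule ennreal_leI)
      have "(LINT x|M. K * \<Psi> (cmod (f x)) + 1 / (2 * (\<beta> - \<alpha>))) = K * P f + 1 / (2 * (\<beta> - \<alpha>)) * (\<beta> - \<alpha>)"
        unfolding P_def using Psi_integrable[OF f] const_integral[of "1 / (2 * (\<beta> - \<alpha>))"]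
        by (subst Bochner_Integration.integral_add) auto
      moreover have "K * P f \<le> K * (1 / (2 * K))" using P K(1) by (intro mult_left_mono) auto
      then have "K * P f \<le> 1 / 2" using K(1) by simp
      moreover have "1 / (2 * (\<beta> - \<alpha>)) * (\<beta> - \<alpha>) = 1 / 2" using interval by simp
      ultimately show "(LINT x|M. K * \<Psi> (cmod (f x)) + 1 / (2 * (\<beta> - \<alpha>))) \<le> 1" by linarith
    qed
    finally have "lball e f" unfolding lball_def using L_measurable[OF f] e by simp
    then show "lux f \<le> e" by (rule lux_le)
  qed
qed

lemma W_uniformly_convex_modular: "uniformly_convex_modular W \<rho>"
proof (intro uniformly_convex_modular.intro W_normed uniformly_convex_modular_axioms.intro)
  fix F assume "F \<in> carrier W"
  show "0 \<le> \<rho> F" unfolding \<rho>_def using P_nonneg by (simp add: add_nonneg_nonneg)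
next
  fix t :: real assume t: "t > 0"
  obtain K where K: "K \<ge> 0" "\<And>f g. f \<in> L \<Longrightarrow> g \<in> L \<Longrightarrow> P (\<lambda>x. (1/2) * (f x - g x)) \<le>
     t * (P f + P g) + K * ((P f + P g) / 2 - P (\<lambda>x. (1/2) * (f x + g x)))"
    by (rule P_defect[OF t]) blast
  have "\<rho> ((1/2) \<odot>\<^bsub>W\<^esub> (F \<ominus>\<^bsub>W\<^esub> G)) \<le> t * (\<rho> F + \<rho> G) + K * ((\<rho> F + \<rho> G) / 2 - \<rho> ((1/2) \<odot>\<^bsub>W\<^esub> (F \<oplus>\<^bsub>W\<^esub> G)))"
    if F: "F \<in> carrier W" and G: "G \<in> carrier W" for F G
  proof -
    obtain f f' where f: "sob f f'" "F = cls f" using W_ex[OF F] by blast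
    obtain g g' where g: "sob g g'" "G = cls g" using W_ex[OF G] by blast
    have 1: "(1/2) \<odot>\<^bsub>W\<^esub> (F \<ominus>\<^bsub>W\<^esub> G) = cls (\<lambda>x. (1/2) * (f x - g x))"
      unfolding f g W_minus[OF f(1) g(1)] by (rule W_smult[OF sob_measurable[OF sob_diff[OF f(1) g(1)]]])
    have 2: "(1/2) \<odot>\<^bsub>W\<^esub> (F \<oplus>\<^bsub>W\<^esub> G) = cls (\<lambda>x. (1/2) * (f x + g x))"
      unfolding f g W_add[OF sob_measurable[OF f(1)] sob_measurable[OF g(1)]]
      by (rule W_smult[OF sob_measurable[OF sob_add[OF f(1) g(1)]]])
    have 3: "\<rho> F = P f + P f'" "\<rho> G = P g + P g'" unfolding f g by (rule rho_eq[OF f(1)], rule rho_eq[OF g(1)])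
    show ?thesis
      unfolding 1 2 3 rho_eq[OF sob_smult[OF sob_diff[OF f(1) g(1)]]] rho_eq[OF sob_smult[OF sob_add[OF f(1) g(1)]]]
      using add_mono[OF K(2)[OF sobD(1)[OF f(1)] sobD(1)[OF g(1)]] K(2)[OF sobD(2)[OF f(1)] sobD(2)[OF g(1)]]]
      by (simp add: algebra_simps add_divide_distrib)
  qed
  then show "\<exists>K\<ge>0. \<forall>F\<in>carrier W. \<forall>G\<in>carrier W. \<rho> ((1/2) \<odot>\<^bsub>W\<^esub> (F \<ominus>\<^bsub>W\<^esub> G)) \<le>
      t * (\<rho> F + \<rho> G) + K * ((\<rho> F + \<rho> G) / 2 - \<rho> ((1/2) \<odot>\<^bsub>W\<^esub> (F \<oplus>\<^bsub>W\<^esub> G)))"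
    using K(1) by blast
next
  fix m :: real
  have m: "\<bar>m\<bar> + 1 > 0" by simp
  obtain R where R: "\<And>f. lball (\<bar>m\<bar> + 1) f \<Longrightarrow> P f \<le> R" by (rule P_ball[OF m]) blast
  have "\<rho> F \<le> R + R" if F: "F \<in> carrier W" "nrm W F \<le> m" for F
  proof -
    obtain f g where f: "sob f g" "F = cls f" using W_ex[OF F(1)] by blast
    have "lux f + lux g \<le> m" using F(2) W_nrm[OF f(1)] by (simp add: f(2))
    then have "lux f < \<bar>m\<bar> + 1" "lux g < \<bar>m\<bar> + 1"
      using lux_nonneg[OF sobD(1)[OF f(1)]] lux_nonneg[OF sobD(2)[OF f(1)]] by linarith+
    then show ?thesis unfolding f(2) rho_eq[OF f(1)]
      by (intro add_mono R lux_lball sobD(1)[OF f(1)] sobD(2)[OF f(1)])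
  qed
  then show "\<exists>R. \<forall>F\<in>carrier W. nrm W F \<le> m \<longrightarrow> \<rho> F \<le> R" by blast
next
  fix e :: real assume "e > 0"
  then have e: "e / 2 > 0" by simp
  obtain k where k: "k > 0" "\<And>f. f \<in> L \<Longrightarrow> P f \<le> k \<Longrightarrow> lux f \<le> e / 2" by (rule P_small[OF e]) blast
  have "nrm W F \<le> e" if F: "F \<in> carrier W" "\<rho> F \<le> k" for F
  proof -
    obtain f g where f: "sob f g" "F = cls f" using W_ex[OF F(1)] by blast
    have "P f \<le> k" "P g \<le> k" using F(2) P_nonneg[of f] P_nonneg[of g] unfolding f(2) rho_eq[OF f(1)] by linarith+
    then show ?thesis
      using k(2)[OF sobD(1)[OF f(1)]] k(2)[OF sobD(2)[OF f(1)]] W_nrm[OF f(1)] by (simp add: f(2))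
  qed
  then show "\<exists>k>0. \<forall>F\<in>carrier W. \<rho> F \<le> k \<longrightarrow> nrm W F \<le> e" using k(1) by blast
qed

end

lemma (in orlicz_interval) Delta2_superreflexive_B_convex:
  assumes d: "Delta2_infty (\<lambda>u. ereal (\<phi> u))" and dc: "Delta2_infty (complementary \<phi>)"
  shows "superreflexive TYPE('b) W" "B_convex W"
proof -
  obtain a s0 where as: "a \<ge> 2" "s0 > 0" "\<And>s. s \<ge> s0 \<Longrightarrow> 2 * a * \<phi> s \<le> \<phi> (a * s)" "\<phi> s0 > 0"
    by (rule Delta2_complementary_growth[OF dc]) blast
  interpret orlicz_growth_interval \<phi> \<alpha> \<beta> a s0
    by unfold_locales (use as d in auto)
  interpret U: uniformly_convex_modular "W1 \<Omega> \<phi>" \<rho> by (rule W_uniformly_convex_modular)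
  show "superreflexive TYPE('b) W" by (rule U.superreflexive)
  show "B_convex W" by (rule U.B_convex)
qed

theorem corollary7p3:
  fixes \<alpha> \<beta> :: real and \<phi> :: "real \<Rightarrow> real"
  assumes interval: "\<alpha> < \<beta>"
    and orlicz: "orlicz_function \<phi>"
    and universe: "\<exists>h :: real \<Rightarrow> 'y. inj h"
  defines "W \<equiv> W1 {\<alpha><..<\<beta>} \<phi>"
  shows "(reflexive W \<longleftrightarrow> superreflexive TYPE('y) W) \<and>
         (reflexive W \<longleftrightarrow> B_convex W) \<and>
         (reflexive W \<longleftrightarrow>
            Delta2_infty (\<lambda>u. ereal (\<phi> u)) \<and> Delta2_infty (complementary \<phi>))"
proof -
  interpret S: orlicz_interval \<phi> \<alpha> \<beta> by unfold_locales (use orlicz interval in auto)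
  let ?D = "Delta2_infty (\<lambda>u. ereal (\<phi> u)) \<and> Delta2_infty (complementary \<phi>)"
  have 1: "?D" if "reflexive W"
    using that[unfolded W_def] S.not_Delta2_not_reflexive_not_B_convex(1) S.not_Delta2_complementary_not_reflexive_not_B_convex(1) by argo
  have 2: "?D" if "B_convex W"
    using that[unfolded W_def] S.not_Delta2_not_reflexive_not_B_convex(2) S.not_Delta2_complementary_not_reflexive_not_B_convex(2) by argo
  have 3: "superreflexive TYPE('y) W" if ?D
    unfolding W_def by (rule S.Delta2_superreflexive_B_convex(1)[OF conjunct1[OF that] conjunct2[OF that]])
  have 4: "B_convex W" if ?D
    unfolding W_def by (rule S.Delta2_superreflexive_B_convex(2)[OF conjunct1[OF that] conjunct2[OF that]])
  have 5: "reflexive W" if s: "superreflexive TYPE('y) W"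
  proof -
    obtain h :: "real \<Rightarrow> 'y" where h: "inj h" using universe by blast
    obtain k :: "(real \<Rightarrow> complex) set \<Rightarrow> real" where k: "inj_on k (carrier W)"
      using S.W_inj_real unfolding W_def by auto
    have ik: "inj_on (h \<circ> k) (carrier W)" by (rule comp_inj_on[OF k inj_on_subset[OF h subset_UNIV]])
    have bW: "complex_banach_space W" unfolding W_def by (rule S.W_banach)
    show ?thesis by (rule superreflexive_imp_reflexive[OF bW ik s])
  qed
  show ?thesis using 1 2 3 4 5 by argo
qed

end
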